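(* Let $(P,A,\mathcal T)$ be an extendable poset, $\underline{\mathcal R}$ the admissible system of the extended poset $\underline P^m$, and $\Lambda=\Lambda(\underline{\mathcal R})$. Let $\mathcal U$ be the full subcategory of $\mathrm{Mod}\text{-}\Lambda$ of right socle-projective $\Lambda$-modules which do not have $e_0\Lambda$ as a direct summand, and $\mathcal V$ the full subcategory of $\mathrm{Mod}\text{-}\Lambda$ of right $\Lambda$-modules which have injective top and do not have $e_0\Lambda$ as a direct summand. Then there exists an equivalence $F:\mathcal U\to\mathcal V$, where $F$ is an exact functor.
   Context: $K$ is a field, $A$ a finite-dimensional $K$-algebra, $P$ a finite poset. A $P$-multiplicative system over $A$ is a family $\mathcal R=\{\mathcal R_{i,j}\subseteq A\mid i\le j\}$ of $K$-subspaces with (M.1) $\mathcal R_{i,j}\mathcal R_{j,l}\subseteq\mathcal R_{i,l}$ for $i\le j\le l$; (M.2) each $\mathcal R_i=\mathcal R_{i,i}$ is a $K$-algebra with unit $1_i$ such that $1_ir=r=r1_j$ for $r\in\mathcal R_{i,j}$. Its incidence algebra is $\Lambda(\mathcal R)=\bigoplus_{i\le j}e_{i,j}\mathcal R_{i,j}$ ($e_{i,j}$ matrix units, matrix operations), and $e_i=e_{i,i}1_i$. For a poset with greatest element $m$, a multiplicative system is admissible if (A.1) each $\mathcal R_i$ is a division ring; (A.2) if $j<m$ and $0\ne x\in\mathcal R_{i,j}$, there is $y\in\mathcal R_{j,l}$, $l\ne j$, with $xy\ne0$. $P^m$ is $P$ with a greatest element $m$ added, and $\mathcal T^m$ is the $P^m$-multiplicative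 system with $\mathcal T_{i,j}$ for $i\le j$ in $P$ and $\mathcal T_{i,m}=A$ for all $i\in P^m$. $(P,A,\mathcal T)$ is extendable if $A$ is semisimple with exactly one simple module $\varepsilon_mA$ up to isomorphism, each $\mathcal T_i$ ($i\in P$) is a (unital) subalgebra of $A$, and there are idempotents $\varepsilon_i\in\mathcal T_i$ ($i\in P^m$) such that $\{\varepsilon_i\mathcal T_{i,j}\varepsilon_j\mid i\le j\in P^m\}$ is an admissible system whose incidence algebra is Morita equivalent to $\Lambda(\mathcal T^m)$. Extended system: $\underline P^m=P^m\cup\{0\}$ with $0$ a least element, $\mathcal T_{0,i}=A$ for all $i\in\underline P^m$, $\varepsilon_0=\varepsilon_m$, and $\underline{\mathcal R}=\{\varepsilon_i\mathcal T_{i,j}\varepsilon_j\mid i\le j\in\underline P^m\}$, which is an admissible system. The module $e_0\Lambda$ is projective and injective. A module is socle-projective if its socle is projective; the top of $N$ is $N/\mathrm{rad}\,N$. Exactness of $F$ means: for every short exact sequence $0\to M_1\to M_2\to M_3\to0$ of $\Lambda$-modules with all $M_i\in\mathcal U$, the sequence $0\to F(M_1)\to F(M_2)\to F(M_3)\to0$ is exact in $\mathrm{Mod}\text{-}\Lambda$. *)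

theory Defs
  imports Complex_Main "HOL-Algebra.Module" "HOL-Algebra.AbelCoset" "HOL-Library.Extended"
begin

text \<open>Hom-sets of different pairs of objects may overlap, so composition and the action of a
  functor on arrows carry the objects as arguments. In \<open>Cmp C X Y Z g f\<close> the arrow \<open>f : X \<rightarrow> Y\<close>
  comes first.\<close>

record ('o, 'm) cat =
  Obj :: "'o set"
  Hom :: "'o \<Rightarrow> 'o \<Rightarrow> 'm set"
  Idn :: "'o \<Rightarrow> 'm"
  Cmp :: "'o \<Rightarrow> 'o \<Rightarrow> 'o \<Rightarrow> 'm \<Rightarrow> 'm \<Rightarrow> 'm"

definition full_subcat :: "('o, 'm) cat \<Rightarrow> ('o \<Rightarrow> bool) \<Rightarrow> ('o, 'm) cat" where
  "full_subcat C Q = C\<lparr>Obj := {X \<in> Obj C. Q X}\<rparr>"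

definition is_functor ::
  "('o, 'm) cat \<Rightarrow> ('p, 'n) cat \<Rightarrow> ('o \<Rightarrow> 'p) \<Rightarrow> ('o \<Rightarrow> 'o \<Rightarrow> 'm \<Rightarrow> 'n) \<Rightarrow> bool" where
  "is_functor C D Fo Fa \<longleftrightarrow>
     (\<forall>X\<in>Obj C. Fo X \<in> Obj D) \<and>
     (\<forall>X\<in>Obj C. \<forall>Y\<in>Obj C. \<forall>f\<in>Hom C X Y. Fa X Y f \<in> Hom D (Fo X) (Fo Y)) \<and>
     (\<forall>X\<in>Obj C. Fa X X (Idn C X) = Idn D (Fo X)) \<and>
     (\<forall>X\<in>Obj C. \<forall>Y\<in>Obj C. \<forall>Z\<in>Obj C. \<forall>f\<in>Hom C X Y. \<forall>g\<in>Hom C Y Z.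
        Fa X Z (Cmp C X Y Z g f) = Cmp D (Fo X) (Fo Y) (Fo Z) (Fa Y Z g) (Fa X Y f))"

definition iso_arrow :: "('o, 'm) cat \<Rightarrow> 'o \<Rightarrow> 'o \<Rightarrow> 'm \<Rightarrow> bool" where
  "iso_arrow C X Y f \<longleftrightarrow> f \<in> Hom C X Y \<and>
     (\<exists>g\<in>Hom C Y X. Cmp C X Y X g f = Idn C X \<and> Cmp C Y X Y f g = Idn C Y)"

definition naturally_isomorphic ::
  "('o, 'm) cat \<Rightarrow> ('p, 'n) cat \<Rightarrow> ('o \<Rightarrow> 'p) \<Rightarrow> ('o \<Rightarrow> 'o \<Rightarrow> 'm \<Rightarrow> 'n) \<Rightarrow>
   ('o \<Rightarrow> 'p) \<Rightarrow> ('o \<Rightarrow> 'o \<Rightarrow> 'm \<Rightarrow> 'n) \<Rightarrow> bool" where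
  "naturally_isomorphic C D Fo Fa Go Ga \<longleftrightarrow>
     (\<exists>\<eta>. (\<forall>X\<in>Obj C. iso_arrow D (Fo X) (Go X) (\<eta> X)) \<and>
       (\<forall>X\<in>Obj C. \<forall>Y\<in>Obj C. \<forall>f\<in>Hom C X Y.
          Cmp D (Fo X) (Fo Y) (Go Y) (\<eta> Y) (Fa X Y f) =
          Cmp D (Fo X) (Go X) (Go Y) (Ga X Y f) (\<eta> X)))"

definition is_equivalence ::
  "('o, 'm) cat \<Rightarrow> ('p, 'n) cat \<Rightarrow> ('o \<Rightarrow> 'p) \<Rightarrow> ('o \<Rightarrow> 'o \<Rightarrow> 'm \<Rightarrow> 'n) \<Rightarrow> bool" where
  "is_equivalence C D Fo Fa \<longleftrightarrow> is_functor C D Fo Fa \<and>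
     (\<exists>Go Ga. is_functor D C Go Ga \<and>
        naturally_isomorphic C C (\<lambda>X. Go (Fo X)) (\<lambda>X Y f. Ga (Fo X) (Fo Y) (Fa X Y f))
          (\<lambda>X. X) (\<lambda>X Y f. f) \<and>
        naturally_isomorphic D D (\<lambda>X. Fo (Go X)) (\<lambda>X Y f. Fa (Go X) (Go Y) (Ga X Y f))
          (\<lambda>X. X) (\<lambda>X Y f. f))"

text \<open>The record type of \<open>HOL-Algebra.Module\<close> is reused, but \<open>r \<odot>\<^bsub>M\<^esub> x\<close> stands for the right action
  \<open>x r\<close>; this is visible in \<open>smult_assoc\<close>. As in the library, the fields \<open>mult\<close> and \<open>one\<close> of a
  module are irrelevant.\<close>

locale right_module = R?: ring R + M?: abelian_group M
  for R (structure) and M (structure) +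
  assumes smult_closed:
      "\<lbrakk> r \<in> carrier R; x \<in> carrier M \<rbrakk> \<Longrightarrow> r \<odot>\<^bsub>M\<^esub> x \<in> carrier M"
    and smult_l_distr:
      "\<lbrakk> r \<in> carrier R; s \<in> carrier R; x \<in> carrier M \<rbrakk> \<Longrightarrow>
       (r \<oplus> s) \<odot>\<^bsub>M\<^esub> x = r \<odot>\<^bsub>M\<^esub> x \<oplus>\<^bsub>M\<^esub> s \<odot>\<^bsub>M\<^esub> x"
    and smult_r_distr:
      "\<lbrakk> r \<in> carrier R; x \<in> carrier M; y \<in> carrier M \<rbrakk> \<Longrightarrow>
       r \<odot>\<^bsub>M\<^esub> (x \<oplus>\<^bsub>M\<^esub> y) = r \<odot>\<^bsub>M\<^esub> x \<oplus>\<^bsub>M\<^esub> r \<odot>\<^bsub>M\<^esub> y"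
    and smult_assoc:
      "\<lbrakk> r \<in> carrier R; s \<in> carrier R; x \<in> carrier M \<rbrakk> \<Longrightarrow>
       (r \<otimes> s) \<odot>\<^bsub>M\<^esub> x = s \<odot>\<^bsub>M\<^esub> (r \<odot>\<^bsub>M\<^esub> x)"
    and smult_one: "x \<in> carrier M \<Longrightarrow> \<one> \<odot>\<^bsub>M\<^esub> x = x"

definition rmod_hom ::
  "('r, 's) ring_scheme \<Rightarrow> ('r, 'm, 'x) module_scheme \<Rightarrow> ('r, 'n, 'y) module_scheme \<Rightarrow> ('m \<Rightarrow> 'n) set"
  where
  "rmod_hom R M N = {f \<in> carrier M \<rightarrow>\<^sub>E carrier N.
     (\<forall>x\<in>carrier M. \<forall>y\<in>carrier M. f (x \<oplus>\<^bsub>M\<^esub> y) = f x \<oplus>\<^bsub>N\<^esub> f y) \<and>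
     (\<forall>r\<in>carrier R. \<forall>x\<in>carrier M. f (r \<odot>\<^bsub>M\<^esub> x) = r \<odot>\<^bsub>N\<^esub> f x)}"

definition rmod_iso ::
  "('r, 's) ring_scheme \<Rightarrow> ('r, 'm, 'x) module_scheme \<Rightarrow> ('r, 'n, 'y) module_scheme \<Rightarrow> bool" where
  "rmod_iso R M N \<longleftrightarrow> (\<exists>f\<in>rmod_hom R M N. bij_betw f (carrier M) (carrier N))"

text \<open>The category of right \<open>R\<close>-modules whose carrier is a subset of the type \<open>'u\<close>.\<close>

definition rmod_cat :: "('r, 's) ring_scheme \<Rightarrow> (('r, 'u) module, 'u \<Rightarrow> 'u) cat" where
  "rmod_cat R = \<lparr> Obj = {M. right_module R M}, Hom = rmod_hom R,
     Idn = (\<lambda>M. restrict (\<lambda>x. x) (carrier M)),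
     Cmp = (\<lambda>L M N g f. compose (carrier L) g f) \<rparr>"

definition morita_equivalent ::
  "'u itself \<Rightarrow> ('r, 's) ring_scheme \<Rightarrow> ('q, 't) ring_scheme \<Rightarrow> bool" where
  "morita_equivalent U R S \<longleftrightarrow>
     (\<exists>Fo Fa. is_equivalence (rmod_cat R :: (('r, 'u) module, 'u \<Rightarrow> 'u) cat)
                (rmod_cat S :: (('q, 'u) module, 'u \<Rightarrow> 'u) cat) Fo Fa)"

definition short_exact ::
  "('r, 's) ring_scheme \<Rightarrow> ('r, 'l, 'x) module_scheme \<Rightarrow> ('r, 'm, 'y) module_scheme \<Rightarrow>
   ('r, 'n, 'z) module_scheme \<Rightarrow> ('l \<Rightarrow> 'm) \<Rightarrow> ('m \<Rightarrow> 'n) \<Rightarrow> bool" where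
  "short_exact R L M N f g \<longleftrightarrow> f \<in> rmod_hom R L M \<and> g \<in> rmod_hom R M N \<and>
     inj_on f (carrier L) \<and> f ` carrier L = {x \<in> carrier M. g x = \<zero>\<^bsub>N\<^esub>} \<and>
     g ` carrier M = carrier N"

definition exact_functor ::
  "('r, 's) ring_scheme \<Rightarrow> (('r, 'u) module, 'u \<Rightarrow> 'u) cat \<Rightarrow>
   (('r, 'u) module \<Rightarrow> ('r, 'u) module) \<Rightarrow>
   (('r, 'u) module \<Rightarrow> ('r, 'u) module \<Rightarrow> ('u \<Rightarrow> 'u) \<Rightarrow> ('u \<Rightarrow> 'u)) \<Rightarrow> bool" where
  "exact_functor R C Fo Fa \<longleftrightarrow>
     (\<forall>L\<in>Obj C. \<forall>M\<in>Obj C. \<forall>N\<in>Obj C. \<forall>f g. short_exact R L M N f g \<longrightarrow>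
        short_exact R (Fo L) (Fo M) (Fo N) (Fa L M f) (Fa M N g))"

definition simple_rmod :: "('r, 's) ring_scheme \<Rightarrow> ('r, 'm) module \<Rightarrow> bool" where
  "simple_rmod R M \<longleftrightarrow> right_module R M \<and> carrier M \<noteq> {\<zero>\<^bsub>M\<^esub>} \<and>
     (\<forall>N. submodule N R M \<longrightarrow> N = {\<zero>\<^bsub>M\<^esub>} \<or> N = carrier M)"

text \<open>The sum of all simple submodules, i.e. the least submodule containing them.\<close>

definition socle :: "('r, 's) ring_scheme \<Rightarrow> ('r, 'm) module \<Rightarrow> 'm set" where
  "socle R M = \<Inter>{N. submodule N R M \<and>
     (\<forall>S. submodule S R M \<and> simple_rmod R (M\<lparr>carrier := S\<rparr>) \<longrightarrow> S \<subseteq> N)}"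

definition maximal_submodule :: "'m set \<Rightarrow> ('r, 's) ring_scheme \<Rightarrow> ('r, 'm) module \<Rightarrow> bool" where
  "maximal_submodule N R M \<longleftrightarrow> submodule N R M \<and> N \<noteq> carrier M \<and>
     (\<forall>L. submodule L R M \<and> N \<subseteq> L \<longrightarrow> L = N \<or> L = carrier M)"

definition radical :: "('r, 's) ring_scheme \<Rightarrow> ('r, 'm) module \<Rightarrow> 'm set" where
  "radical R M = carrier M \<inter> \<Inter>{N. maximal_submodule N R M}"

definition rmod_quotient :: "('r, 'm) module \<Rightarrow> 'm set \<Rightarrow> ('r, 'm set) module" where
  "rmod_quotient M N = \<lparr> carrier = a_rcosets\<^bsub>M\<^esub> N, mult = undefined, one = undefined,
     zero = N, add = set_add M, smult = (\<lambda>r X. \<Union>x\<in>X. N +>\<^bsub>M\<^esub> (r \<odot>\<^bsub>M\<^esub> x)) \<rparr>"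

definition rmod_top :: "('r, 's) ring_scheme \<Rightarrow> ('r, 'm) module \<Rightarrow> ('r, 'm set) module" where
  "rmod_top R M = rmod_quotient M (radical R M)"

text \<open>Injectivity and projectivity with respect to the modules carried by the type \<open>'u\<close>. The module
  itself may live on another type, since a quotient such as \<^term>\<open>rmod_top R M\<close> has cosets as
  elements.\<close>

definition injective_rmod ::
  "'u itself \<Rightarrow> ('r, 's) ring_scheme \<Rightarrow> ('r, 'q) module \<Rightarrow> bool" where
  "injective_rmod U R Q \<longleftrightarrow> right_module R Q \<and>
     (\<forall>(X :: ('r, 'u) module) (Y :: ('r, 'u) module) f g.
        right_module R X \<and> right_module R Y \<and> f \<in> rmod_hom R X Y \<and> inj_on f (carrier X) \<and>
        g \<in> rmod_hom R X Q \<longrightarrow>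
        (\<exists>h\<in>rmod_hom R Y Q. \<forall>x\<in>carrier X. h (f x) = g x))"

definition projective_rmod ::
  "'u itself \<Rightarrow> ('r, 's) ring_scheme \<Rightarrow> ('r, 'q) module \<Rightarrow> bool" where
  "projective_rmod U R Q \<longleftrightarrow> right_module R Q \<and>
     (\<forall>(X :: ('r, 'u) module) (Y :: ('r, 'u) module) f g.
        right_module R X \<and> right_module R Y \<and> f \<in> rmod_hom R X Y \<and>
        f ` carrier X = carrier Y \<and> g \<in> rmod_hom R Q Y \<longrightarrow>
        (\<exists>h\<in>rmod_hom R Q X. \<forall>x\<in>carrier Q. f (h x) = g x))"

definition has_direct_summand ::
  "('r, 's) ring_scheme \<Rightarrow> ('r, 'm) module \<Rightarrow> ('r, 'n) module \<Rightarrow> bool" where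
  "has_direct_summand R M X \<longleftrightarrow>
     (\<exists>N L. submodule N R M \<and> submodule L R M \<and> N \<inter> L = {\<zero>\<^bsub>M\<^esub>} \<and> N <+>\<^bsub>M\<^esub> L = carrier M \<and>
        rmod_iso R (M\<lparr>carrier := N\<rparr>) X)"

definition regular_rmod :: "('r, 's) ring_scheme \<Rightarrow> ('r, 'r) module" where
  "regular_rmod R = \<lparr> carrier = carrier R, mult = mult R, one = one R, zero = zero R,
     add = add R, smult = (\<lambda>r x. x \<otimes>\<^bsub>R\<^esub> r) \<rparr>"

definition principal_rmod :: "('r, 's) ring_scheme \<Rightarrow> 'r \<Rightarrow> ('r, 'r) module" where
  "principal_rmod R e = (regular_rmod R)\<lparr>carrier := (\<lambda>x. e \<otimes>\<^bsub>R\<^esub> x) ` carrier R\<rparr>"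

definition semisimple_ring :: "('r, 's) ring_scheme \<Rightarrow> bool" where
  "semisimple_ring R \<longleftrightarrow> ring R \<and> socle R (regular_rmod R) = carrier R"

locale fin_dim_algebra = vector_space scale
  for scale :: "'k::field \<Rightarrow> 'a::ring_1 \<Rightarrow> 'a" +
  assumes scale_mult_left: "scale c x * y = scale c (x * y)"
    and scale_mult_right: "x * scale c y = scale c (x * y)"
    and finite_span: "\<exists>B. finite B \<and> span B = UNIV"

definition unital_subalgebra :: "('k::field \<Rightarrow> 'a::ring_1 \<Rightarrow> 'a) \<Rightarrow> 'a set \<Rightarrow> bool" where
  "unital_subalgebra scale S \<longleftrightarrow>
     module.subspace scale S \<and> 1 \<in> S \<and> (\<forall>x\<in>S. \<forall>y\<in>S. x * y \<in> S)"

text \<open>The poset is a subset \<open>I\<close> of an ordered type; values \<open>R i j\<close> with \<open>i \<le> j\<close> failing are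
  irrelevant. The unit of \<open>R i i\<close> need not be the unit of the ambient algebra.\<close>

definition mult_system ::
  "('k::field \<Rightarrow> 'a::ring_1 \<Rightarrow> 'a) \<Rightarrow> 'i::order set \<Rightarrow> ('i \<Rightarrow> 'i \<Rightarrow> 'a set) \<Rightarrow> bool" where
  "mult_system scale I R \<longleftrightarrow>
     (\<forall>i\<in>I. \<forall>j\<in>I. i \<le> j \<longrightarrow> module.subspace scale (R i j)) \<and>
     (\<forall>i\<in>I. \<forall>j\<in>I. \<forall>l\<in>I. i \<le> j \<and> j \<le> l \<longrightarrow> (\<forall>x\<in>R i j. \<forall>y\<in>R j l. x * y \<in> R i l)) \<and>
     (\<exists>u. (\<forall>i\<in>I. u i \<in> R i i) \<and>
        (\<forall>i\<in>I. \<forall>j\<in>I. i \<le> j \<longrightarrow> (\<forall>r\<in>R i j. u i * r = r \<and> r * u j = r)))"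

definition local_unit :: "('i \<Rightarrow> 'i \<Rightarrow> 'a::ring_1 set) \<Rightarrow> 'i \<Rightarrow> 'a" where
  "local_unit R i = (THE u. u \<in> R i i \<and> (\<forall>r\<in>R i i. u * r = r \<and> r * u = r))"

definition admissible ::
  "('k::field \<Rightarrow> 'a::ring_1 \<Rightarrow> 'a) \<Rightarrow> 'i::order set \<Rightarrow> 'i \<Rightarrow> ('i \<Rightarrow> 'i \<Rightarrow> 'a set) \<Rightarrow> bool" where
  "admissible scale I m R \<longleftrightarrow> mult_system scale I R \<and> m \<in> I \<and> (\<forall>i\<in>I. i \<le> m) \<and>
     (\<forall>i\<in>I. local_unit R i \<noteq> 0 \<and>
        (\<forall>x\<in>R i i. x \<noteq> 0 \<longrightarrow> (\<exists>y\<in>R i i. x * y = local_unit R i \<and> y * x = local_unit R i))) \<and>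
     (\<forall>i\<in>I. \<forall>j\<in>I. i \<le> j \<and> j < m \<longrightarrow>
        (\<forall>x\<in>R i j. x \<noteq> 0 \<longrightarrow> (\<exists>l\<in>I. j \<le> l \<and> l \<noteq> j \<and> (\<exists>y\<in>R j l. x * y \<noteq> 0))))"

text \<open>An element of the incidence algebra is the matrix of its coefficients.\<close>

definition incidence_algebra ::
  "'i::order set \<Rightarrow> ('i \<Rightarrow> 'i \<Rightarrow> 'a::ring_1 set) \<Rightarrow> ('i \<Rightarrow> 'i \<Rightarrow> 'a) ring" where
  "incidence_algebra I R = \<lparr>
     carrier = {f. \<forall>i j. if i \<in> I \<and> j \<in> I \<and> i \<le> j then f i j \<in> R i j else f i j = 0},
     mult = (\<lambda>f g i j. \<Sum>l\<in>I. f i l * g l j),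
     one = (\<lambda>i j. if i \<in> I \<and> j = i then local_unit R i else 0),
     zero = (\<lambda>i j. 0),
     add = (\<lambda>f g i j. f i j + g i j) \<rparr>"

definition diag_idempotent :: "('i \<Rightarrow> 'i \<Rightarrow> 'a::ring_1 set) \<Rightarrow> 'i \<Rightarrow> ('i \<Rightarrow> 'i \<Rightarrow> 'a)" where
  "diag_idempotent R k = (\<lambda>i j. if i = k \<and> j = k then local_unit R k else 0)"

text \<open>The greatest element \<open>m\<close> is \<^term>\<open>Pinf\<close>, the least element \<open>0\<close> is \<^term>\<open>Minf\<close>.\<close>

definition add_top :: "'p set \<Rightarrow> 'p extended set" where
  "add_top P = insert Pinf (Fin ` P)"

definition add_top_bot :: "'p set \<Rightarrow> 'p extended set" where
  "add_top_bot P = insert Minf (add_top P)"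

text \<open>On \<^term>\<open>add_top P\<close> this is the system with \<open>T\<^sub>i\<^sub>m = A\<close>; on \<^term>\<open>add_top_bot P\<close> moreover
  \<open>T\<^sub>0\<^sub>i = A\<close>.\<close>

fun extend_system :: "('p \<Rightarrow> 'p \<Rightarrow> 'a set) \<Rightarrow> 'p extended \<Rightarrow> 'p extended \<Rightarrow> 'a set" where
  "extend_system T (Fin i) (Fin j) = T i j"
| "extend_system T _ _ = UNIV"

definition corner_system ::
  "('i \<Rightarrow> 'a::ring_1) \<Rightarrow> ('i \<Rightarrow> 'i \<Rightarrow> 'a set) \<Rightarrow> 'i \<Rightarrow> 'i \<Rightarrow> 'a set" where
  "corner_system \<epsilon> T i j = (\<lambda>t. \<epsilon> i * t * \<epsilon> j) ` T i j"

definition type_ring :: "'a::ring_1 ring" where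
  "type_ring = \<lparr>carrier = UNIV, mult = (*), one = 1, zero = 0, add = (+)\<rparr>"

text \<open>The family of idempotents \<open>\<epsilon>\<close> is part of the data; its value at \<^term>\<open>Minf\<close> plays no role
  here. The type \<open>'u\<close> carries the modules quantified over.\<close>

definition extendable ::
  "'u itself \<Rightarrow> ('k::field \<Rightarrow> 'a::ring_1 \<Rightarrow> 'a) \<Rightarrow> 'p::order set \<Rightarrow> ('p \<Rightarrow> 'p \<Rightarrow> 'a set) \<Rightarrow>
   ('p extended \<Rightarrow> 'a) \<Rightarrow> bool" where
  "extendable U scale P T \<epsilon> \<longleftrightarrow>
     mult_system scale P T \<and>
     semisimple_ring (type_ring :: 'a ring) \<and>
     simple_rmod (type_ring :: 'a ring) (principal_rmod type_ring (\<epsilon> Pinf)) \<and>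
     (\<forall>S :: ('a, 'u) module. simple_rmod (type_ring :: 'a ring) S \<longrightarrow>
        rmod_iso (type_ring :: 'a ring) S (principal_rmod type_ring (\<epsilon> Pinf))) \<and>
     (\<forall>i\<in>P. unital_subalgebra scale (T i i)) \<and>
     (\<forall>i\<in>add_top P. \<epsilon> i \<in> extend_system T i i \<and> \<epsilon> i * \<epsilon> i = \<epsilon> i) \<and>
     admissible scale (add_top P) Pinf (corner_system \<epsilon> (extend_system T)) \<and>
     morita_equivalent U
       (incidence_algebra (add_top P) (corner_system \<epsilon> (extend_system T)))
       (incidence_algebra (add_top P) (extend_system T))"

definition extended_admissible_system ::
  "('p \<Rightarrow> 'p \<Rightarrow> 'a::ring_1 set) \<Rightarrow> ('p extended \<Rightarrow> 'a) \<Rightarrow> 'p extended \<Rightarrow> 'p extended \<Rightarrow> 'a set" where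
  "extended_admissible_system T \<epsilon> = corner_system (\<epsilon>(Minf := \<epsilon> Pinf)) (extend_system T)"

definition socle_projective_cat ::
  "('r, 's) ring_scheme \<Rightarrow> 'r \<Rightarrow> (('r, 'u) module, 'u \<Rightarrow> 'u) cat" where
  "socle_projective_cat R e = full_subcat (rmod_cat R)
     (\<lambda>M. projective_rmod TYPE('u) R (M\<lparr>carrier := socle R M\<rparr>) \<and>
          \<not> has_direct_summand R M (principal_rmod R e))"

definition injective_top_cat ::
  "('r, 's) ring_scheme \<Rightarrow> 'r \<Rightarrow> (('r, 'u) module, 'u \<Rightarrow> 'u) cat" where
  "injective_top_cat R e = full_subcat (rmod_cat R)
     (\<lambda>M. injective_rmod TYPE('u) R (rmod_top R M) \<and>
          \<not> has_direct_summand R M (principal_rmod R e))"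

end

theory Submission
  imports Defs
begin

text \<open>The functor is the first cosyzygy. Write \<open>D = e\<^sub>m\<Lambda>e\<^sub>m\<close>. A module \<open>M\<close> has a direct summand \<open>e\<^sub>0\<Lambda>\<close>
  if and only if \<open>M e\<^sub>0\<^sub>m \<noteq> 0\<close>; hence \<open>\<U>\<close> consists of the modules with \<open>M e\<^sub>0\<^sub>m = 0\<close> in which no nonzero
  element is annihilated by \<open>\<Lambda>e\<^sub>m\<close>, and \<open>\<V>\<close> of those with \<open>M e\<^sub>0\<^sub>m = 0\<close> that are generated by \<open>M e\<^sub>0\<close>.
  For \<open>M\<close> in \<open>\<U>\<close> the map \<open>x \<mapsto> (c \<mapsto> xc)\<close> embeds \<open>M\<close> into the coinduced module
  \<open>E(M) = Hom\<^sub>D(\<Lambda>e\<^sub>m, M e\<^sub>m)\<close>, and \<open>F(M) = E(M)/M\<close>. Because \<open>A = A\<epsilon>\<^sub>mA\<close>, the modules \<open>\<Lambda>e\<^sub>m\<close> and \<open>e\<^sub>0\<Lambda>\<close> have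
  finite dual bases over \<open>D\<close>; therefore \<open>E(M)\<close> is generated by \<open>E(M) e\<^sub>0\<close>, a copy of \<open>M e\<^sub>m\<close> that is mapped
  isomorphically onto \<open>F(M) e\<^sub>0\<close>, so a homomorphism between cosyzygies comes from a unique one between the
  original modules. Conversely, \<open>N\<close> in \<open>\<V>\<close> is a quotient of \<open>Hom\<^sub>D(\<Lambda>e\<^sub>m, N e\<^sub>0)\<close>, and it is the cosyzygy of
  the kernel. The dual bases also show that elements of \<open>E(M)\<close> are determined by finitely many values, so
  that \<open>F(M)\<close> can be realised on the same infinite type as \<open>M\<close>.\<close>

section \<open>Right modules\<close>

text \<open>The module \<open>e_0 \<Lambda>\<close> is itself coinduced from \<open>D\<close>: the
  dual bases identify it with the \<open>D\<close>-dual of \<open>\<Lambda> e_m\<close>. Its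
  cosyzygy is therefore zero, which is why it has to be excluded on both sides. With
  \<open>\<epsilon> = \<epsilon>_m\<close>, the equation \<open>A = A \<epsilon> A\<close> holds
  because each simple right ideal of \<open>A\<close> is isomorphic to \<open>\<epsilon> A\<close>,
  hence of the form \<open>s \<epsilon> A\<close>, and these ideals sum to \<open>A\<close>; cutting
  the factors in \<open>1 = \<Sum> x_k \<epsilon> y_k\<close> down by the idempotents yields the
  dual bases. Projectivity and injectivity are reduced to vector spaces over the division rings on
  the diagonal. Simple modules and radicals are controlled by triangularity: an extremal index of
  the poset isolates a component on which \<Lambda> acts through one division ring. The obstacle is
  the carrier type. Categories, projectivity and injectivity only see modules on \<open>'u\<close>,
  while coinduced modules consist of functions and right ideals of \<Lambda> of matrices. Each is
  copied to \<open>'u\<close> along an injective code.\<close>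

declare (in right_module) smult_closed [simp, intro] smult_one [simp]

text \<open>Apart from the existence of negatives the module axioms are equations, so they pass
  along a surjection that respects the operations. Nothing is presupposed about the operations of
  \<open>Q\<close>, which suits quotients built from representatives or from cosets.\<close>

lemma right_module_if_surjective:
  fixes E :: "('r, 'v, 'x) module_scheme" and Q :: "('r, 'q, 'y) module_scheme"
  assumes E: "right_module R E"
    and surj: "q ` carrier E = carrier Q"
    and add: "\<And>x y. \<lbrakk>x \<in> carrier E; y \<in> carrier E\<rbrakk> \<Longrightarrow> q (x \<oplus>\<^bsub>E\<^esub> y) = q x \<oplus>\<^bsub>Q\<^esub> q y"
    and smult: "\<And>r x. \<lbrakk>r \<in> carrier R; x \<in> carrier E\<rbrakk> \<Longrightarrow> q (r \<odot>\<^bsub>E\<^esub> x) = r \<odot>\<^bsub>Q\<^esub> q x"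
    and zero: "q \<zero>\<^bsub>E\<^esub> = \<zero>\<^bsub>Q\<^esub>"
  shows "right_module R Q"
proof -
  interpret E: right_module R E by fact
  have cl: "q x \<in> carrier Q" if "x \<in> carrier E" for x using that surj by blast
  have Q: "\<exists>x\<in>carrier E. a = q x" if "a \<in> carrier Q" for a using that surj by blast
  have "abelian_group Q"
  proof (rule abelian_groupI)
    fix a b assume "a \<in> carrier Q" "b \<in> carrier Q"
    then obtain x y where "x \<in> carrier E" "y \<in> carrier E" "a = q x" "b = q y" using Q by meson
    then show "a \<oplus>\<^bsub>Q\<^esub> b \<in> carrier Q" "a \<oplus>\<^bsub>Q\<^esub> b = b \<oplus>\<^bsub>Q\<^esub> a"
      using cl by (auto simp flip: add simp: E.M.a_comm)
  next
    show "\<zero>\<^bsub>Q\<^esub> \<in> carrier Q" using cl[of "\<zero>\<^bsub>E\<^esub>"] zero by simp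
  next
    fix a b c assume "a \<in> carrier Q" "b \<in> carrier Q" "c \<in> carrier Q"
    then obtain x y z where "x \<in> carrier E" "y \<in> carrier E" "z \<in> carrier E"
      "a = q x" "b = q y" "c = q z" using Q by meson
    then show "a \<oplus>\<^bsub>Q\<^esub> b \<oplus>\<^bsub>Q\<^esub> c = a \<oplus>\<^bsub>Q\<^esub> (b \<oplus>\<^bsub>Q\<^esub> c)"
      by (simp flip: add add: E.M.a_assoc)
  next
    fix a assume "a \<in> carrier Q"
    then obtain x where x: "x \<in> carrier E" "a = q x" using Q by meson
    then show "\<zero>\<^bsub>Q\<^esub> \<oplus>\<^bsub>Q\<^esub> a = a" by (simp flip: add zero)
    show "\<exists>y\<in>carrier Q. y \<oplus>\<^bsub>Q\<^esub> a = \<zero>\<^bsub>Q\<^esub>"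
      by (rule bexI[of _ "q (\<ominus>\<^bsub>E\<^esub> x)"]) (use x cl in \<open>auto simp flip: add zero simp: E.M.l_neg\<close>)
  qed
  moreover have "right_module_axioms R Q"
  proof
    fix r a assume "r \<in> carrier R" "a \<in> carrier Q"
    then obtain x where "x \<in> carrier E" "a = q x" using Q by meson
    then show "r \<odot>\<^bsub>Q\<^esub> a \<in> carrier Q" using \<open>r \<in> carrier R\<close> cl by (auto simp flip: smult)
  next
    fix r s a assume rs: "r \<in> carrier R" "s \<in> carrier R" and "a \<in> carrier Q"
    then obtain x where x: "x \<in> carrier E" "a = q x" using Q by meson
    then show "(r \<oplus>\<^bsub>R\<^esub> s) \<odot>\<^bsub>Q\<^esub> a = r \<odot>\<^bsub>Q\<^esub> a \<oplus>\<^bsub>Q\<^esub> s \<odot>\<^bsub>Q\<^esub> a"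
      using rs by (simp flip: smult add add: E.smult_l_distr)
    show "(r \<otimes>\<^bsub>R\<^esub> s) \<odot>\<^bsub>Q\<^esub> a = s \<odot>\<^bsub>Q\<^esub> (r \<odot>\<^bsub>Q\<^esub> a)"
      using rs x by (simp flip: smult add: E.smult_assoc)
  next
    fix r a b assume r: "r \<in> carrier R" and "a \<in> carrier Q" "b \<in> carrier Q"
    then obtain x y where "x \<in> carrier E" "y \<in> carrier E" "a = q x" "b = q y" using Q by meson
    then show "r \<odot>\<^bsub>Q\<^esub> (a \<oplus>\<^bsub>Q\<^esub> b) = r \<odot>\<^bsub>Q\<^esub> a \<oplus>\<^bsub>Q\<^esub> r \<odot>\<^bsub>Q\<^esub> b"
      using r by (simp flip: smult add add: E.smult_r_distr)
  next
    fix a assume "a \<in> carrier Q"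
    then obtain x where "x \<in> carrier E" "a = q x" using Q by meson
    then show "\<one>\<^bsub>R\<^esub> \<odot>\<^bsub>Q\<^esub> a = a" by (simp flip: smult)
  qed
  ultimately show ?thesis
    by (intro right_module.intro E.R.ring_axioms)
qed

lemma (in abelian_group) diff_eq_zero_iff [simp]:
  assumes "x \<in> carrier G" "y \<in> carrier G" shows "x \<ominus> y = \<zero> \<longleftrightarrow> x = y"
proof
  assume "x \<ominus> y = \<zero>"
  then have "x = \<ominus> (\<ominus> y)" using assms by (simp add: a_minus_def minus_equality)
  then show "x = y" using assms by simp
qed (use assms in \<open>simp add: a_minus_def r_neg\<close>)

lemma (in abelian_group) diff_self [simp]: "x \<in> carrier G \<Longrightarrow> x \<ominus> x = \<zero>"
  by simp

lemma (in abelian_group) add_diff_add_left: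
  assumes "a \<in> carrier G" "b \<in> carrier G" "c \<in> carrier G"
  shows "(a \<oplus> b) \<ominus> (a \<oplus> c) = b \<ominus> c"
proof -
  have "(a \<oplus> b) \<ominus> (a \<oplus> c) = a \<oplus> (b \<oplus> (\<ominus> a \<oplus> \<ominus> c))"
    using assms by (simp add: a_minus_def minus_add a_assoc)
  also have "b \<oplus> (\<ominus> a \<oplus> \<ominus> c) = \<ominus> a \<oplus> (b \<oplus> \<ominus> c)" using assms by (simp add: a_lcomm)
  finally show ?thesis using assms by (simp add: a_minus_def r_neg2)
qed

text \<open>Formulated for any record with the same addition and zero, so that one rule serves
  corner rings, columns and the idempotent parts of a module, whose remaining fields differ.\<close>

lemma (in abelian_group) abelian_subgroup_structure:
  assumes "add H = add G" "zero H = \<zero>" "carrier H \<subseteq> carrier G" "\<zero> \<in> carrier H"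
    and "\<And>x y. \<lbrakk>x \<in> carrier H; y \<in> carrier H\<rbrakk> \<Longrightarrow> x \<oplus> y \<in> carrier H"
    and neg: "\<And>x. x \<in> carrier H \<Longrightarrow> \<ominus> x \<in> carrier H"
  shows "abelian_group H"
proof (rule abelian_groupI)
  fix x assume x: "x \<in> carrier H"
  then show "\<exists>y\<in>carrier H. y \<oplus>\<^bsub>H\<^esub> x = \<zero>\<^bsub>H\<^esub>"
    using assms by (intro bexI[OF _ neg[OF x]]) (auto simp: l_neg)
  show "\<zero>\<^bsub>H\<^esub> \<oplus>\<^bsub>H\<^esub> x = x" using x assms by auto
qed (use assms in \<open>auto simp: subset_iff a_ac\<close>)

context right_module
begin

lemma smult_l_null [simp]: "x \<in> carrier M \<Longrightarrow> \<zero> \<odot>\<^bsub>M\<^esub> x = \<zero>\<^bsub>M\<^esub>"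
  using smult_l_distr[of \<zero> \<zero> x] by (metis M.add.r_cancel_one' R.l_zero R.zero_closed smult_closed)

lemma smult_r_null [simp]: "r \<in> carrier R \<Longrightarrow> r \<odot>\<^bsub>M\<^esub> \<zero>\<^bsub>M\<^esub> = \<zero>\<^bsub>M\<^esub>"
  using smult_r_distr[of r "\<zero>\<^bsub>M\<^esub>" "\<zero>\<^bsub>M\<^esub>"]
  by (metis M.add.r_cancel_one' M.l_zero M.zero_closed smult_closed)

lemma smult_l_minus:
  assumes "r \<in> carrier R" "x \<in> carrier M" shows "(\<ominus> r) \<odot>\<^bsub>M\<^esub> x = \<ominus>\<^bsub>M\<^esub> (r \<odot>\<^bsub>M\<^esub> x)"
proof (rule M.minus_equality[symmetric])
  show "(\<ominus> r) \<odot>\<^bsub>M\<^esub> x \<oplus>\<^bsub>M\<^esub> r \<odot>\<^bsub>M\<^esub> x = \<zero>\<^bsub>M\<^esub>"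
    using assms by (simp flip: smult_l_distr add: R.l_neg)
qed (use assms in auto)

lemma smult_r_minus:
  assumes "r \<in> carrier R" "x \<in> carrier M" shows "r \<odot>\<^bsub>M\<^esub> (\<ominus>\<^bsub>M\<^esub> x) = \<ominus>\<^bsub>M\<^esub> (r \<odot>\<^bsub>M\<^esub> x)"
proof (rule M.minus_equality[symmetric])
  show "r \<odot>\<^bsub>M\<^esub> (\<ominus>\<^bsub>M\<^esub> x) \<oplus>\<^bsub>M\<^esub> r \<odot>\<^bsub>M\<^esub> x = \<zero>\<^bsub>M\<^esub>"
    using assms by (simp flip: smult_r_distr add: M.l_neg)
qed (use assms in auto)

lemma smult_r_diff:
  "\<lbrakk>r \<in> carrier R; x \<in> carrier M; y \<in> carrier M\<rbrakk> \<Longrightarrow>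
    r \<odot>\<^bsub>M\<^esub> (x \<ominus>\<^bsub>M\<^esub> y) = r \<odot>\<^bsub>M\<^esub> x \<ominus>\<^bsub>M\<^esub> r \<odot>\<^bsub>M\<^esub> y"
  by (simp add: a_minus_def smult_r_distr smult_r_minus)

lemma finsum_smult:
  "\<lbrakk>finite A; r \<in> carrier R; f \<in> A \<rightarrow> carrier M\<rbrakk> \<Longrightarrow>
    r \<odot>\<^bsub>M\<^esub> (\<Oplus>\<^bsub>M\<^esub>i\<in>A. f i) = (\<Oplus>\<^bsub>M\<^esub>i\<in>A. r \<odot>\<^bsub>M\<^esub> f i)"
  by (induct set: finite) (auto simp: Pi_def smult_r_distr M.finsum_insert)

lemma smult_finsum:
  "\<lbrakk>finite A; x \<in> carrier M; f \<in> A \<rightarrow> carrier R\<rbrakk> \<Longrightarrow>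
    (\<Oplus>i\<in>A. f i) \<odot>\<^bsub>M\<^esub> x = (\<Oplus>\<^bsub>M\<^esub>i\<in>A. f i \<odot>\<^bsub>M\<^esub> x)"
  by (induct set: finite) (auto simp: Pi_def smult_l_distr M.finsum_insert R.finsum_insert)

text \<open>Negation is the action of \<open>\<ominus> \<one>\<close>, so closure under sums and
  scalars already gives the subgroup demanded by the library notion.\<close>

lemma submodule_iff:
  "submodule N R M \<longleftrightarrow> N \<subseteq> carrier M \<and> \<zero>\<^bsub>M\<^esub> \<in> N \<and> (\<forall>x\<in>N. \<forall>y\<in>N. x \<oplus>\<^bsub>M\<^esub> y \<in> N) \<and>
     (\<forall>r\<in>carrier R. \<forall>x\<in>N. r \<odot>\<^bsub>M\<^esub> x \<in> N)" (is "_ \<longleftrightarrow> ?R")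
proof
  assume "submodule N R M"
  then interpret submodule N R M .
  show ?R using subset one_closed m_closed by auto
next
  assume R: ?R
  have "inv\<^bsub>add_monoid M\<^esub> x = (\<ominus> \<one>) \<odot>\<^bsub>M\<^esub> x" if "x \<in> N" for x
    using R that by (auto simp: smult_l_minus a_inv_def[of M, symmetric] subset_iff)
  then show "submodule N R M"
    using R by (auto intro!: submodule.intro subgroup.intro simp: submodule_axioms_def)
qed

lemma submodule_subset: "submodule N R M \<Longrightarrow> N \<subseteq> carrier M" by (simp add: submodule_iff)

lemma submodule_zero: "submodule N R M \<Longrightarrow> \<zero>\<^bsub>M\<^esub> \<in> N" by (simp add: submodule_iff)

lemma submodule_add: "\<lbrakk>submodule N R M; x \<in> N; y \<in> N\<rbrakk> \<Longrightarrow> x \<oplus>\<^bsub>M\<^esub> y \<in> N"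
  by (simp add: submodule_iff)

lemma submodule_smult: "\<lbrakk>submodule N R M; r \<in> carrier R; x \<in> N\<rbrakk> \<Longrightarrow> r \<odot>\<^bsub>M\<^esub> x \<in> N"
  by (simp add: submodule_iff)

lemma submodule_neg: "\<lbrakk>submodule N R M; x \<in> N\<rbrakk> \<Longrightarrow> \<ominus>\<^bsub>M\<^esub> x \<in> N"
  using submodule_smult[of N "\<ominus> \<one>" x] submodule_subset[of N] by (auto simp: smult_l_minus subset_iff)

lemma submodule_diff: "\<lbrakk>submodule N R M; x \<in> N; y \<in> N\<rbrakk> \<Longrightarrow> x \<ominus>\<^bsub>M\<^esub> y \<in> N"
  by (simp add: a_minus_def submodule_add submodule_neg)

lemma submodule_finsum:
  assumes N: "submodule N R M" and "finite A" "f \<in> A \<rightarrow> N"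
  shows "(\<Oplus>\<^bsub>M\<^esub>i\<in>A. f i) \<in> N"
  using assms(2,3)
proof (induct rule: finite_induct)
  case empty then show ?case by (simp add: submodule_zero[OF N])
next
  case (insert x F)
  moreover have "f \<in> insert x F \<rightarrow> carrier M" using insert submodule_subset[OF N] by blast
  ultimately show ?case by (auto simp: M.finsum_insert Pi_def submodule_add[OF N])
qed

lemma diff_mem_cancel:
  assumes "submodule N R M" "x \<in> carrier M" "y \<in> N" "x \<ominus>\<^bsub>M\<^esub> y \<in> N"
  shows "x \<in> N"
proof -
  have "x = (x \<ominus>\<^bsub>M\<^esub> y) \<oplus>\<^bsub>M\<^esub> y"
    using assms submodule_subset[of N] by (simp add: a_minus_def M.a_assoc M.l_neg subset_iff)
  then show ?thesis using assms submodule_add by metis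
qed

lemma carrier_submodule: "submodule (carrier M) R M"
  by (simp add: submodule_iff)

lemma zero_submodule: "submodule {\<zero>\<^bsub>M\<^esub>} R M"
  by (simp add: submodule_iff)

lemma submodule_sum:
  assumes "submodule N R M" "submodule L R M"
  shows "submodule {x \<oplus>\<^bsub>M\<^esub> y |x y. x \<in> N \<and> y \<in> L} R M"
  unfolding submodule_iff
proof (intro conjI ballI)
  note N = assms(1)[unfolded submodule_iff] and L = assms(2)[unfolded submodule_iff]
  show "{x \<oplus>\<^bsub>M\<^esub> y |x y. x \<in> N \<and> y \<in> L} \<subseteq> carrier M" using N L by blast
  have "\<zero>\<^bsub>M\<^esub> = \<zero>\<^bsub>M\<^esub> \<oplus>\<^bsub>M\<^esub> \<zero>\<^bsub>M\<^esub>" by simp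
  then show "\<zero>\<^bsub>M\<^esub> \<in> {x \<oplus>\<^bsub>M\<^esub> y |x y. x \<in> N \<and> y \<in> L}" using N L by blast
  fix a assume "a \<in> {x \<oplus>\<^bsub>M\<^esub> y |x y. x \<in> N \<and> y \<in> L}"
  then obtain x y where a: "a = x \<oplus>\<^bsub>M\<^esub> y" "x \<in> N" "y \<in> L" by blast
  { fix b assume "b \<in> {x \<oplus>\<^bsub>M\<^esub> y |x y. x \<in> N \<and> y \<in> L}"
    then obtain x' y' where b: "b = x' \<oplus>\<^bsub>M\<^esub> y'" "x' \<in> N" "y' \<in> L" by blast
    have "a \<oplus>\<^bsub>M\<^esub> b = (x \<oplus>\<^bsub>M\<^esub> x') \<oplus>\<^bsub>M\<^esub> (y \<oplus>\<^bsub>M\<^esub> y')"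
      using a b N L by (simp add: subset_iff M.a_ac)
    then show "a \<oplus>\<^bsub>M\<^esub> b \<in> {x \<oplus>\<^bsub>M\<^esub> y |x y. x \<in> N \<and> y \<in> L}" using a b N L by blast }
  { fix r assume r: "r \<in> carrier R"
    then have "r \<odot>\<^bsub>M\<^esub> a = r \<odot>\<^bsub>M\<^esub> x \<oplus>\<^bsub>M\<^esub> r \<odot>\<^bsub>M\<^esub> y"
      using a N L by (simp add: subset_iff smult_r_distr)
    then show "r \<odot>\<^bsub>M\<^esub> a \<in> {x \<oplus>\<^bsub>M\<^esub> y |x y. x \<in> N \<and> y \<in> L}" using a N L r by blast }
qed

lemma cyclic_submodule:
  assumes "x \<in> carrier M" shows "submodule ((\<lambda>r. r \<odot>\<^bsub>M\<^esub> x) ` carrier R) R M"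
proof -
  have "\<zero>\<^bsub>M\<^esub> = \<zero> \<odot>\<^bsub>M\<^esub> x" using assms by simp
  then have "\<zero>\<^bsub>M\<^esub> \<in> (\<lambda>r. r \<odot>\<^bsub>M\<^esub> x) ` carrier R" by blast
  then show ?thesis
    using assms by (auto simp: submodule_iff simp flip: smult_l_distr smult_assoc)
qed

lemma mem_cyclic: "x \<in> carrier M \<Longrightarrow> x \<in> (\<lambda>r. r \<odot>\<^bsub>M\<^esub> x) ` carrier R"
  by (metis R.one_closed imageI smult_one)

lemma submodule_right_module:
  assumes "submodule N R M" shows "right_module R (M\<lparr>carrier := N\<rparr>)"
proof -
  note N = assms[unfolded submodule_iff]
  have "abelian_group (M\<lparr>carrier := N\<rparr>)"
  proof (rule abelian_groupI; simp)
    fix x y assume "x \<in> N" "y \<in> N"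
    then show "x \<oplus>\<^bsub>M\<^esub> y \<in> N" "x \<oplus>\<^bsub>M\<^esub> y = y \<oplus>\<^bsub>M\<^esub> x" using N by (auto simp: M.a_comm subset_iff)
  next
    show "\<zero>\<^bsub>M\<^esub> \<in> N" using N by simp
  next
    fix x y z assume "x \<in> N" "y \<in> N" "z \<in> N"
    then show "x \<oplus>\<^bsub>M\<^esub> y \<oplus>\<^bsub>M\<^esub> z = x \<oplus>\<^bsub>M\<^esub> (y \<oplus>\<^bsub>M\<^esub> z)" using N by (auto simp: M.a_assoc subset_iff)
  next
    fix x assume "x \<in> N"
    then show "\<zero>\<^bsub>M\<^esub> \<oplus>\<^bsub>M\<^esub> x = x" "\<exists>y\<in>N. y \<oplus>\<^bsub>M\<^esub> x = \<zero>\<^bsub>M\<^esub>"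
      using N submodule_neg[OF assms] by (auto simp: subset_iff intro!: bexI[of _ "\<ominus>\<^bsub>M\<^esub> x"] M.l_neg)
  qed
  then show ?thesis
    by (rule right_module.intro[OF R.ring_axioms])
      (use N in \<open>auto intro!: right_module_axioms.intro simp: subset_iff smult_l_distr smult_r_distr smult_assoc\<close>)
qed

text \<open>With this, simplicity of a submodule is tested on submodules of the ambient
  module.\<close>

lemma submodule_submodule_iff:
  assumes "submodule N R M"
  shows "submodule L R (M\<lparr>carrier := N\<rparr>) \<longleftrightarrow> submodule L R M \<and> L \<subseteq> N"
  using submodule_right_module[OF assms, THEN right_module.submodule_iff] submodule_subset[OF assms]
  by (auto simp: submodule_iff)

end

section \<open>Homomorphisms and quotients\<close>

lemma rmod_homI:
  "\<lbrakk>f \<in> carrier M \<rightarrow>\<^sub>E carrier N;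
    \<And>x y. \<lbrakk>x \<in> carrier M; y \<in> carrier M\<rbrakk> \<Longrightarrow> f (x \<oplus>\<^bsub>M\<^esub> y) = f x \<oplus>\<^bsub>N\<^esub> f y;
    \<And>r x. \<lbrakk>r \<in> carrier R; x \<in> carrier M\<rbrakk> \<Longrightarrow> f (r \<odot>\<^bsub>M\<^esub> x) = r \<odot>\<^bsub>N\<^esub> f x\<rbrakk> \<Longrightarrow> f \<in> rmod_hom R M N"
  by (simp add: rmod_hom_def)

lemma rmod_hom_restrictI:
  assumes "right_module R M"
    "\<And>x. x \<in> carrier M \<Longrightarrow> f x \<in> carrier N"
    "\<And>x y. \<lbrakk>x \<in> carrier M; y \<in> carrier M\<rbrakk> \<Longrightarrow> f (x \<oplus>\<^bsub>M\<^esub> y) = f x \<oplus>\<^bsub>N\<^esub> f y"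
    "\<And>r x. \<lbrakk>r \<in> carrier R; x \<in> carrier M\<rbrakk> \<Longrightarrow> f (r \<odot>\<^bsub>M\<^esub> x) = r \<odot>\<^bsub>N\<^esub> f x"
  shows "restrict f (carrier M) \<in> rmod_hom R M N"
proof -
  interpret right_module R M by fact
  show ?thesis using assms(2-) by (auto simp: rmod_hom_def)
qed

lemma rmod_homD:
  assumes "f \<in> rmod_hom R M N"
  shows "\<And>x. x \<in> carrier M \<Longrightarrow> f x \<in> carrier N"
    and "\<And>x y. \<lbrakk>x \<in> carrier M; y \<in> carrier M\<rbrakk> \<Longrightarrow> f (x \<oplus>\<^bsub>M\<^esub> y) = f x \<oplus>\<^bsub>N\<^esub> f y"
    and "\<And>r x. \<lbrakk>r \<in> carrier R; x \<in> carrier M\<rbrakk> \<Longrightarrow> f (r \<odot>\<^bsub>M\<^esub> x) = r \<odot>\<^bsub>N\<^esub> f x"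
    and "f \<in> extensional (carrier M)"
  using assms by (auto simp: rmod_hom_def PiE_def)

locale rmod_homomorphism = M: right_module R M + N: right_module R N
  for R (structure) and M (structure) and N (structure) +
  fixes f
  assumes hom: "f \<in> rmod_hom R M N"
begin

lemmas closed [simp, intro] = rmod_homD(1)[OF hom]
lemmas add [simp] = rmod_homD(2)[OF hom]
lemmas smult [simp] = rmod_homD(3)[OF hom]

lemma zero [simp]: "f \<zero>\<^bsub>M\<^esub> = \<zero>\<^bsub>N\<^esub>"
  using smult[of \<zero> "\<zero>\<^bsub>M\<^esub>"] by simp

lemma neg [simp]: "x \<in> carrier M \<Longrightarrow> f (\<ominus>\<^bsub>M\<^esub> x) = \<ominus>\<^bsub>N\<^esub> f x"
  using smult[of "\<ominus> \<one>" x] by (simp add: M.smult_l_minus N.smult_l_minus)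

lemma diff [simp]: "\<lbrakk>x \<in> carrier M; y \<in> carrier M\<rbrakk> \<Longrightarrow> f (x \<ominus>\<^bsub>M\<^esub> y) = f x \<ominus>\<^bsub>N\<^esub> f y"
  by (simp add: a_minus_def)

lemma finsum:
  "\<lbrakk>finite A; g \<in> A \<rightarrow> carrier M\<rbrakk> \<Longrightarrow> f (\<Oplus>\<^bsub>M\<^esub>i\<in>A. g i) = (\<Oplus>\<^bsub>N\<^esub>i\<in>A. f (g i))"
  by (induct set: finite) (auto simp: Pi_def)

lemma kernel_submodule: "submodule {x \<in> carrier M. f x = \<zero>\<^bsub>N\<^esub>} R M"
  by (auto simp: M.submodule_iff)

lemma image_submodule:
  assumes "submodule L R M" shows "submodule (f ` L) R N"
  unfolding N.submodule_iff
proof (intro conjI ballI)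
  note L = assms[unfolded M.submodule_iff]
  show "f ` L \<subseteq> carrier N" using L by auto
  show "\<zero>\<^bsub>N\<^esub> \<in> f ` L" using L zero by (metis imageI)
  show "a \<oplus>\<^bsub>N\<^esub> b \<in> f ` L" if "a \<in> f ` L" "b \<in> f ` L" for a b
    using that L by (auto simp: subset_iff simp flip: add)
  show "r \<odot>\<^bsub>N\<^esub> a \<in> f ` L" if "a \<in> f ` L" "r \<in> carrier R" for a r
    using that L by (auto simp: subset_iff simp flip: smult)
qed

lemma preimage_submodule:
  assumes "submodule L R N" shows "submodule {x \<in> carrier M. f x \<in> L} R M"
  using assms by (auto simp: M.submodule_iff N.submodule_iff)

lemma inj_iff: "inj_on f (carrier M) \<longleftrightarrow> (\<forall>x\<in>carrier M. f x = \<zero>\<^bsub>N\<^esub> \<longrightarrow> x = \<zero>\<^bsub>M\<^esub>)"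
proof
  assume inj: "inj_on f (carrier M)"
  then show "\<forall>x\<in>carrier M. f x = \<zero>\<^bsub>N\<^esub> \<longrightarrow> x = \<zero>\<^bsub>M\<^esub>"
    by (metis inj_onD M.M.zero_closed zero)
next
  assume *: "\<forall>x\<in>carrier M. f x = \<zero>\<^bsub>N\<^esub> \<longrightarrow> x = \<zero>\<^bsub>M\<^esub>"
  show "inj_on f (carrier M)"
  proof (rule inj_onI)
    fix x y assume "x \<in> carrier M" "y \<in> carrier M" "f x = f y"
    then have "x \<ominus>\<^bsub>M\<^esub> y = \<zero>\<^bsub>M\<^esub>" using * by simp
    then show "x = y" using \<open>x \<in> carrier M\<close> \<open>y \<in> carrier M\<close> by simp
  qed
qed

lemma inverse_hom:
  assumes "bij_betw f (carrier M) (carrier N)"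
  shows "restrict (inv_into (carrier M) f) (carrier N) \<in> rmod_hom R N M"
proof (rule rmod_hom_restrictI)
  note surj = bij_betw_imp_surj_on[OF assms] and inj = bij_betw_imp_inj_on[OF assms]
  let ?g = "inv_into (carrier M) f"
  show cl: "?g y \<in> carrier M" if "y \<in> carrier N" for y using that surj by (simp add: inv_into_into)
  have fg: "f (?g y) = y" if "y \<in> carrier N" for y using that surj by (simp add: f_inv_into_f)
  show "?g (x \<oplus>\<^bsub>N\<^esub> y) = ?g x \<oplus>\<^bsub>M\<^esub> ?g y" if "x \<in> carrier N" "y \<in> carrier N" for x y
    by (rule inv_into_f_eq[OF inj]) (use that cl fg in auto)
  show "?g (r \<odot>\<^bsub>N\<^esub> x) = r \<odot>\<^bsub>M\<^esub> ?g x" if "r \<in> carrier R" "x \<in> carrier N" for r x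
    by (rule inv_into_f_eq[OF inj]) (use that cl fg in auto)
qed (rule N.right_module_axioms)

end

lemma rmod_hom_compose:
  assumes "right_module R L" "f \<in> rmod_hom R L M" "g \<in> rmod_hom R M N"
  shows "compose (carrier L) g f \<in> rmod_hom R L N"
proof -
  interpret right_module R L by fact
  show ?thesis
    by (rule rmod_homI) (use rmod_homD[OF assms(2)] rmod_homD[OF assms(3)] in
      \<open>auto simp: compose_eq compose_def\<close>)
qed

section \<open>Quotients and copies with carrier in a prescribed type\<close>

context right_module
begin

text \<open>The representative of a coset is coded in the target type by \<open>c\<close>.\<close>

lemma exists_quotient:
  fixes c :: "_ \<Rightarrow> 'u"
  assumes W: "submodule W R M" and inj: "inj_on c (carrier M)"
  shows "\<exists>(Q :: (_, 'u) module) q. right_module R Q \<and> q \<in> rmod_hom R M Q \<and>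
    q ` carrier M = carrier Q \<and> (\<forall>x\<in>carrier M. q x = \<zero>\<^bsub>Q\<^esub> \<longleftrightarrow> x \<in> W)"
proof -
  note W' = W[unfolded submodule_iff]
  define rep where "rep x = (SOME y. y \<in> carrier M \<and> x \<ominus>\<^bsub>M\<^esub> y \<in> W)" for x
  have rep: "rep x \<in> carrier M \<and> x \<ominus>\<^bsub>M\<^esub> rep x \<in> W" if "x \<in> carrier M" for x
    unfolding rep_def by (rule someI[of _ x]) (use that W' in \<open>simp add: a_minus_def M.r_neg\<close>)
  have diff_sym: "y \<ominus>\<^bsub>M\<^esub> x \<in> W" if "x \<ominus>\<^bsub>M\<^esub> y \<in> W" "x \<in> carrier M" "y \<in> carrier M" for x y
    using submodule_neg[OF W that(1)] that by (simp add: a_minus_def M.minus_add M.a_comm)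
  have diff_trans: "x \<ominus>\<^bsub>M\<^esub> z \<in> W" if "x \<ominus>\<^bsub>M\<^esub> y \<in> W" "y \<ominus>\<^bsub>M\<^esub> z \<in> W" "x \<in> carrier M" "y \<in> carrier M" "z \<in> carrier M" for x y z
  proof -
    have "x \<ominus>\<^bsub>M\<^esub> z = (x \<ominus>\<^bsub>M\<^esub> y) \<oplus>\<^bsub>M\<^esub> (y \<ominus>\<^bsub>M\<^esub> z)"
      using that by (simp add: a_minus_def M.a_ac M.l_neg) (simp flip: M.a_assoc add: M.l_neg M.r_neg)
    then show ?thesis using that W' by simp
  qed
  have rep_eq: "rep x = rep y \<longleftrightarrow> x \<ominus>\<^bsub>M\<^esub> y \<in> W" if x: "x \<in> carrier M" and y: "y \<in> carrier M" for x y
  proof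
    assume "rep x = rep y"
    then show "x \<ominus>\<^bsub>M\<^esub> y \<in> W" using rep[OF x] rep[OF y] diff_sym diff_trans x y by metis
  next
    assume *: "x \<ominus>\<^bsub>M\<^esub> y \<in> W"
    have "(z \<in> carrier M \<and> x \<ominus>\<^bsub>M\<^esub> z \<in> W) \<longleftrightarrow> (z \<in> carrier M \<and> y \<ominus>\<^bsub>M\<^esub> z \<in> W)" for z
      using diff_trans[of x y z] diff_trans[of y x z] diff_sym[of x y] * x y by blast
    then show "rep x = rep y" unfolding rep_def by simp
  qed
  define q where "q = restrict (\<lambda>x. c (rep x)) (carrier M)"
  have q_eq: "q x = q y \<longleftrightarrow> x \<ominus>\<^bsub>M\<^esub> y \<in> W" if "x \<in> carrier M" "y \<in> carrier M" for x y
    using rep that inj_onD[OF inj] rep_eq[OF that] by (auto simp: q_def)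
  \<comment> \<open>A preimage of a code, correct only modulo \<open>W\<close>. For this reason the
    operations of \<open>Q\<close> below apply \<open>q\<close> once more, which absorbs the
    ambiguity.\<close>
  define p where "p = inv_into (carrier M) q"
  have p: "p (q x) \<in> carrier M \<and> p (q x) \<ominus>\<^bsub>M\<^esub> x \<in> W" if "x \<in> carrier M" for x
    using that q_eq[of "p (q x)" x] by (auto simp: p_def inv_into_into f_inv_into_f)
  define Q :: "(_, 'u) module" where "Q = \<lparr>carrier = q ` carrier M, mult = undefined, one = undefined,
    zero = q \<zero>\<^bsub>M\<^esub>, add = (\<lambda>a b. q (p a \<oplus>\<^bsub>M\<^esub> p b)), smult = (\<lambda>r a. q (r \<odot>\<^bsub>M\<^esub> p a))\<rparr>"
  have add: "q (x \<oplus>\<^bsub>M\<^esub> y) = q x \<oplus>\<^bsub>Q\<^esub> q y" if x: "x \<in> carrier M" and y: "y \<in> carrier M" for x y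
  proof -
    have "(p (q x) \<oplus>\<^bsub>M\<^esub> p (q y)) \<ominus>\<^bsub>M\<^esub> (x \<oplus>\<^bsub>M\<^esub> y) = (p (q x) \<ominus>\<^bsub>M\<^esub> x) \<oplus>\<^bsub>M\<^esub> (p (q y) \<ominus>\<^bsub>M\<^esub> y)"
      using p[OF x] p[OF y] x y by (simp add: a_minus_def M.a_ac M.minus_add)
    then show ?thesis using p[OF x] p[OF y] x y W' by (simp add: Q_def q_eq diff_sym)
  qed
  have smult: "q (r \<odot>\<^bsub>M\<^esub> x) = r \<odot>\<^bsub>Q\<^esub> q x" if r: "r \<in> carrier R" and x: "x \<in> carrier M" for r x
  proof -
    have "r \<odot>\<^bsub>M\<^esub> p (q x) \<ominus>\<^bsub>M\<^esub> r \<odot>\<^bsub>M\<^esub> x = r \<odot>\<^bsub>M\<^esub> (p (q x) \<ominus>\<^bsub>M\<^esub> x)"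
      using p[OF x] r x by (simp add: smult_r_diff)
    then show ?thesis using p[OF x] r x W' by (simp add: Q_def q_eq diff_sym)
  qed
  have "right_module R Q"
    by (rule right_module_if_surjective[OF right_module_axioms, of q])
      (use add smult in \<open>auto simp: Q_def\<close>)
  moreover have "q \<in> rmod_hom R M Q"
    by (rule rmod_homI) (use add smult in \<open>auto simp: Q_def q_def\<close>)
  moreover have "q x = \<zero>\<^bsub>Q\<^esub> \<longleftrightarrow> x \<in> W" if "x \<in> carrier M" for x
    using that q_eq[of x "\<zero>\<^bsub>M\<^esub>"] M.minus_equality[of "\<zero>\<^bsub>M\<^esub>" "\<zero>\<^bsub>M\<^esub>"]
    by (simp add: Q_def a_minus_def)
  ultimately show ?thesis by (intro exI[of _ Q] exI[of _ q]) (auto simp: Q_def)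
qed

text \<open>The quotient by the zero submodule. It moves a module onto the type over which the
  category and the tests for projectivity and injectivity range.\<close>

lemma exists_copy:
  fixes c :: "_ \<Rightarrow> 'u"
  assumes "inj_on c (carrier M)"
  shows "\<exists>(Q :: (_, 'u) module) q. right_module R Q \<and> q \<in> rmod_hom R M Q \<and>
    bij_betw q (carrier M) (carrier Q)"
proof -
  obtain Q :: "(_, 'u) module" and q where Q: "right_module R Q" "q \<in> rmod_hom R M Q"
    "q ` carrier M = carrier Q" "\<forall>x\<in>carrier M. q x = \<zero>\<^bsub>Q\<^esub> \<longleftrightarrow> x \<in> {\<zero>\<^bsub>M\<^esub>}"
    using exists_quotient[OF zero_submodule assms] by blast
  then interpret rmod_homomorphism R M Q q
    by (intro rmod_homomorphism.intro rmod_homomorphism_axioms.intro right_module_axioms)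
  show ?thesis using Q inj_iff by (auto simp: bij_betw_def)
qed

end

lemma factor_hom:
  assumes E: "right_module R E" and Q: "right_module R Q" and N: "right_module R N"
    and q: "q \<in> rmod_hom R E Q" and surj: "q ` carrier E = carrier Q" and g: "g \<in> rmod_hom R E N"
    and ker: "\<And>x. \<lbrakk>x \<in> carrier E; q x = \<zero>\<^bsub>Q\<^esub>\<rbrakk> \<Longrightarrow> g x = \<zero>\<^bsub>N\<^esub>"
  shows "\<exists>h\<in>rmod_hom R Q N. \<forall>x\<in>carrier E. h (q x) = g x"
proof -
  interpret q: rmod_homomorphism R E Q q
    using E Q q by (intro rmod_homomorphism.intro rmod_homomorphism_axioms.intro)
  interpret g: rmod_homomorphism R E N g
    using E N g by (intro rmod_homomorphism.intro rmod_homomorphism_axioms.intro)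
  define s where "s = inv_into (carrier E) q"
  have s: "s y \<in> carrier E" "q (s y) = y" if "y \<in> carrier Q" for y
    using that surj by (simp_all add: s_def inv_into_into f_inv_into_f)
  have gs: "g x = g y" if "x \<in> carrier E" "y \<in> carrier E" "q x = q y" for x y
    using ker[of "x \<ominus>\<^bsub>E\<^esub> y"] that by simp
  let ?h = "restrict (\<lambda>y. g (s y)) (carrier Q)"
  have "?h \<in> rmod_hom R Q N"
  proof (rule rmod_hom_restrictI[OF Q])
    fix y assume y: "y \<in> carrier Q"
    then show "g (s y) \<in> carrier N" using s by simp
    show "g (s (r \<odot>\<^bsub>Q\<^esub> y)) = r \<odot>\<^bsub>N\<^esub> g (s y)" if "r \<in> carrier R" for r
      using gs[of "s (r \<odot>\<^bsub>Q\<^esub> y)" "r \<odot>\<^bsub>E\<^esub> s y"] that y s by simp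
    show "g (s (y \<oplus>\<^bsub>Q\<^esub> z)) = g (s y) \<oplus>\<^bsub>N\<^esub> g (s z)" if "z \<in> carrier Q" for z
      using gs[of "s (y \<oplus>\<^bsub>Q\<^esub> z)" "s y \<oplus>\<^bsub>E\<^esub> s z"] that y s by simp
  qed
  moreover have "?h (q x) = g x" if "x \<in> carrier E" for x
    using gs[of "s (q x)" x] that s[of "q x"] by simp
  ultimately show ?thesis by blast
qed

text \<open>Serves density: the cosyzygy and the given module will both be images of one coinduced
  module, with the same kernel.\<close>

lemma iso_of_same_kernel:
  assumes E: "right_module R E" and Q: "right_module R Q" and N: "right_module R N"
    and q: "q \<in> rmod_hom R E Q" "q ` carrier E = carrier Q"
    and g: "g \<in> rmod_hom R E N" "g ` carrier E = carrier N"
    and ker: "\<And>x. x \<in> carrier E \<Longrightarrow> q x = \<zero>\<^bsub>Q\<^esub> \<longleftrightarrow> g x = \<zero>\<^bsub>N\<^esub>"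
  shows "\<exists>h\<in>rmod_hom R Q N. bij_betw h (carrier Q) (carrier N)"
proof -
  obtain h where h: "h \<in> rmod_hom R Q N" and hq: "\<And>x. x \<in> carrier E \<Longrightarrow> h (q x) = g x"
    using factor_hom[OF E Q N q g(1)] ker by blast
  interpret h: rmod_homomorphism R Q N h
    using Q N h by (intro rmod_homomorphism.intro rmod_homomorphism_axioms.intro)
  have "y = \<zero>\<^bsub>Q\<^esub>" if "y \<in> carrier Q" "h y = \<zero>\<^bsub>N\<^esub>" for y
    using that hq ker unfolding q(2)[symmetric] by auto
  then have "inj_on h (carrier Q)" unfolding h.inj_iff by blast
  moreover have "h ` carrier Q = g ` carrier E"
    unfolding q(2)[symmetric] image_image by (rule image_cong) (simp_all add: hq)
  ultimately show ?thesis using h g(2) by (auto simp: bij_betw_def)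
qed

section \<open>Codes for pairs and finite families in an infinite type\<close>

lemma exists_inj_prod:
  assumes "infinite (UNIV :: 'u set)" shows "\<exists>p :: 'u \<times> 'u \<Rightarrow> 'u. inj p"
proof -
  \<comment> \<open>Cardinal arithmetic: an infinite set is equipotent with its square.\<close>
  have "(card_of (UNIV \<times> UNIV :: ('u \<times> 'u) set), card_of (UNIV :: 'u set)) \<in> ordLeq"
    using card_of_Times_same_infinite[OF assms] ordIso_iff_ordLeq by blast
  then show ?thesis using card_of_ordLeq[of "UNIV \<times> UNIV :: ('u \<times> 'u) set" "UNIV :: 'u set"] by auto
qed

text \<open>Induction on \<open>K\<close>, each new coordinate being absorbed by a pairing. Finite
  index sets are enough, because coinduced elements and matrices are determined by finitely many
  values.\<close>

lemma exists_inj_PiE: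
  assumes "infinite (UNIV :: 'u set)" and "finite K"
  shows "\<exists>c :: ('k \<Rightarrow> 'u) \<Rightarrow> 'u. inj_on c (K \<rightarrow>\<^sub>E UNIV)"
  using assms(2)
proof (induct set: finite)
  case empty
  then show ?case by (auto simp: inj_on_def)
next
  case (insert x F)
  then obtain c :: "('k \<Rightarrow> 'u) \<Rightarrow> 'u" where c: "inj_on c (F \<rightarrow>\<^sub>E UNIV)" by blast
  obtain p :: "'u \<times> 'u \<Rightarrow> 'u" where p: "inj p" using exists_inj_prod[OF assms(1)] by blast
  have "inj_on (\<lambda>g. p (g x, c (restrict g F))) (insert x F \<rightarrow>\<^sub>E UNIV)"
  proof (rule inj_onI)
    fix g g' assume g: "g \<in> insert x F \<rightarrow>\<^sub>E UNIV" "g' \<in> insert x F \<rightarrow>\<^sub>E UNIV"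
      and eq: "p (g x, c (restrict g F)) = p (g' x, c (restrict g' F))"
    then have gx: "g x = g' x" and "c (restrict g F) = c (restrict g' F)"
      using p by (auto dest: injD)
    then have "restrict g F = restrict g' F" using inj_onD[OF c] by simp
    then have "g y = g' y" if "y \<in> F" for y using that by (metis restrict_apply')
    then show "g = g'" using g gx by (intro PiE_ext[of g "insert x F" _ g']) auto
  qed
  then show ?case by blast
qed

section \<open>Vector spaces over division rings\<close>

lemma regular_simps [simp]:
  "carrier (regular_rmod S) = carrier S" "add (regular_rmod S) = add S" "zero (regular_rmod S) = zero S"
  "smult (regular_rmod S) = (\<lambda>r x. mult S x r)"
  by (simp_all add: regular_rmod_def)

lemma regular_right_module:
  assumes "ring R" shows "right_module R (regular_rmod R)"
proof -
  interpret ring R by fact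
  have "abelian_group (regular_rmod R)"
    by (rule abelian_groupI) (auto simp: regular_rmod_def a_ac intro: l_neg)
  then show ?thesis
    by (intro right_module.intro right_module_axioms.intro ring_axioms)
      (auto simp: regular_rmod_def r_distr l_distr m_assoc)
qed

text \<open>Right inverses match the right action: acting by \<open>d\<close> and then by
  \<open>d'\<close> is acting by \<open>d \<otimes> d'\<close>, which returns
  \<open>x\<close>.\<close>

locale division_module = right_module +
  assumes right_inverse: "\<lbrakk>d \<in> carrier R; d \<noteq> \<zero>\<rbrakk> \<Longrightarrow> \<exists>d'\<in>carrier R. d \<otimes> d' = \<one>"
begin

lemma smult_eq_zeroD:
  assumes "d \<in> carrier R" "x \<in> carrier M" "d \<odot>\<^bsub>M\<^esub> x = \<zero>\<^bsub>M\<^esub>"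
  shows "d = \<zero> \<or> x = \<zero>\<^bsub>M\<^esub>"
proof (cases "d = \<zero>")
  case False
  then obtain d' where "d' \<in> carrier R" "d \<otimes> d' = \<one>" using right_inverse assms by blast
  then show ?thesis using assms smult_assoc[of d d' x] by simp
qed simp

text \<open>The modules are arbitrary, so dimensions are unbounded and Zorn's lemma is applied to
  the submodules meeting \<open>W\<close> trivially. A vector outside \<open>W + X\<close> could be
  added to a maximal \<open>X\<close>, because nonzero scalars can be cancelled.\<close>

lemma exists_complement:
  assumes W: "submodule W R M"
  shows "\<exists>X. submodule X R M \<and> X \<inter> W = {\<zero>\<^bsub>M\<^esub>} \<and> (\<forall>v\<in>carrier M. \<exists>w\<in>W. \<exists>x\<in>X. v = w \<oplus>\<^bsub>M\<^esub> x)"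
proof -
  note W' = W[unfolded submodule_iff]
  define \<A> where "\<A> = {X. submodule X R M \<and> X \<inter> W = {\<zero>\<^bsub>M\<^esub>}}"
  have "\<exists>X\<in>\<A>. \<forall>Y\<in>\<A>. X \<subseteq> Y \<longrightarrow> Y = X"
  proof (rule subset_Zorn_nonempty)
    have "{\<zero>\<^bsub>M\<^esub>} \<in> \<A>" using W' zero_submodule by (auto simp: \<A>_def)
    then show "\<A> \<noteq> {}" by blast
  next
    fix \<C> assume ne: "\<C> \<noteq> {}" and chain: "subset.chain \<A> \<C>"
    then have sub: "\<And>X. X \<in> \<C> \<Longrightarrow> submodule X R M \<and> X \<inter> W = {\<zero>\<^bsub>M\<^esub>}"
      by (auto simp: subset.chain_def \<A>_def)
    have "x \<oplus>\<^bsub>M\<^esub> y \<in> \<Union>\<C>" if x: "x \<in> X" "X \<in> \<C>" and y: "y \<in> Y" "Y \<in> \<C>" for x y X Y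
    proof -
      from chain x y have "X \<subseteq> Y \<or> Y \<subseteq> X" by (auto simp: subset_chain_def)
      then show ?thesis using x y sub submodule_add by blast
    qed
    then have "submodule (\<Union>\<C>) R M"
      unfolding submodule_iff[of "\<Union>\<C>"]
    proof (intro conjI ballI)
      show "\<Union>\<C> \<subseteq> carrier M" using sub submodule_subset by blast
      show "\<zero>\<^bsub>M\<^esub> \<in> \<Union>\<C>" using ne sub by blast
      show "r \<odot>\<^bsub>M\<^esub> x \<in> \<Union>\<C>" if "x \<in> \<Union>\<C>" "r \<in> carrier R" for r x
        using that sub submodule_smult by blast
    qed blast
    moreover have "\<Union>\<C> \<inter> W = {\<zero>\<^bsub>M\<^esub>}" using sub ne by blast
    ultimately show "\<Union>\<C> \<in> \<A>" by (simp add: \<A>_def)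
  qed
  then obtain X where X: "submodule X R M" "X \<inter> W = {\<zero>\<^bsub>M\<^esub>}"
    and max: "\<And>Y. \<lbrakk>submodule Y R M; Y \<inter> W = {\<zero>\<^bsub>M\<^esub>}; X \<subseteq> Y\<rbrakk> \<Longrightarrow> Y = X"
    by (auto simp: \<A>_def)
  note X' = X(1)[unfolded submodule_iff]
  define S where "S = {w \<oplus>\<^bsub>M\<^esub> x |w x. w \<in> W \<and> x \<in> X}"
  have S: "submodule S R M" unfolding S_def by (rule submodule_sum[OF W X(1)])
  have XS: "x \<in> S" if "x \<in> X" for x
  proof -
    have "x = \<zero>\<^bsub>M\<^esub> \<oplus>\<^bsub>M\<^esub> x" using that X' by auto
    then show ?thesis unfolding S_def using that W' by blast
  qed
  have WS: "w \<in> S" if "w \<in> W" for w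
  proof -
    have "w = w \<oplus>\<^bsub>M\<^esub> \<zero>\<^bsub>M\<^esub>" using that W' by auto
    then show ?thesis unfolding S_def using that X' by blast
  qed
  have "v \<in> S" if v: "v \<in> carrier M" for v
  proof (rule ccontr)
    assume nS: "v \<notin> S"
    define Y where "Y = {x \<oplus>\<^bsub>M\<^esub> y |x y. x \<in> X \<and> y \<in> (\<lambda>d. d \<odot>\<^bsub>M\<^esub> v) ` carrier R}"
    have Y: "submodule Y R M"
      unfolding Y_def by (rule submodule_sum[OF X(1) cyclic_submodule[OF v]])
    have "Y \<inter> W \<subseteq> {\<zero>\<^bsub>M\<^esub>}"
    proof
      fix a assume "a \<in> Y \<inter> W"
      then obtain x d where a: "a = x \<oplus>\<^bsub>M\<^esub> d \<odot>\<^bsub>M\<^esub> v" "x \<in> X" "d \<in> carrier R" "a \<in> W"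
        by (auto simp: Y_def)
      have xc: "x \<in> carrier M" using a X' by auto
      show "a \<in> {\<zero>\<^bsub>M\<^esub>}"
      proof (cases "d = \<zero>")
        case True
        then have "a = x" using a v xc by simp
        then show ?thesis using a X(2) by auto
      next
        case False
        \<comment> \<open>Since \<open>d\<close> is invertible, \<open>x + v d\<close> in
          \<open>W\<close> would put \<open>v\<close> itself into \<open>W + X\<close>, against its
          choice.\<close>
        then obtain d' where d': "d' \<in> carrier R" "d \<otimes> d' = \<one>" using right_inverse a by blast
        have "d \<odot>\<^bsub>M\<^esub> v = a \<ominus>\<^bsub>M\<^esub> x"
          using a v xc M.r_neg1[of x "d \<odot>\<^bsub>M\<^esub> v"] M.a_comm[of a "\<ominus>\<^bsub>M\<^esub> x"]
          by (simp add: a_minus_def)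
        then have "d \<odot>\<^bsub>M\<^esub> v \<in> S" using submodule_diff[OF S WS[OF a(4)] XS[OF a(2)]] by simp
        then have "d' \<odot>\<^bsub>M\<^esub> (d \<odot>\<^bsub>M\<^esub> v) \<in> S" by (rule submodule_smult[OF S d'(1)])
        then show ?thesis using nS v a d' by (simp flip: smult_assoc)
      qed
    qed
    moreover have "X \<subseteq> Y"
    proof
      fix x assume "x \<in> X"
      moreover from this have "x = x \<oplus>\<^bsub>M\<^esub> \<zero> \<odot>\<^bsub>M\<^esub> v" using X' v by auto
      ultimately show "x \<in> Y" unfolding Y_def by blast
    qed
    ultimately have "Y = X" using Y X W' X' by (intro max) auto
    moreover have "v = \<zero>\<^bsub>M\<^esub> \<oplus>\<^bsub>M\<^esub> \<one> \<odot>\<^bsub>M\<^esub> v" using v by simp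
    then have "v \<in> Y" unfolding Y_def using X' by blast
    ultimately show False using nS XS by simp
  qed
  then have "\<forall>v\<in>carrier M. \<exists>w\<in>W. \<exists>x\<in>X. v = w \<oplus>\<^bsub>M\<^esub> x" unfolding S_def by blast
  then show ?thesis using X by blast
qed

text \<open>Vector spaces are injective: project onto \<open>W\<close> along a complement and apply
  \<open>g\<close>.\<close>

lemma extend_hom:
  assumes W: "submodule W R M" and Q: "right_module R Q" and g: "g \<in> rmod_hom R (M\<lparr>carrier := W\<rparr>) Q"
  shows "\<exists>h\<in>rmod_hom R M Q. \<forall>w\<in>W. h w = g w"
proof -
  obtain X where X: "submodule X R M" "X \<inter> W = {\<zero>\<^bsub>M\<^esub>}"
    and sum: "\<forall>v\<in>carrier M. \<exists>w\<in>W. \<exists>x\<in>X. v = w \<oplus>\<^bsub>M\<^esub> x"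
    using exists_complement[OF W] by blast
  note W' = W[unfolded submodule_iff] and X' = X(1)[unfolded submodule_iff]
  interpret g: rmod_homomorphism R "M\<lparr>carrier := W\<rparr>" Q g
    using Q g submodule_right_module[OF W] by (intro rmod_homomorphism.intro rmod_homomorphism_axioms.intro)
  \<comment> \<open>The projection onto \<open>W\<close> along \<open>X\<close>; the choice is
    unique because \<open>X\<close> and \<open>W\<close> meet in zero.\<close>
  define p where "p v = (SOME w. w \<in> W \<and> (\<exists>x\<in>X. v = w \<oplus>\<^bsub>M\<^esub> x))" for v
  have p: "p (w \<oplus>\<^bsub>M\<^esub> x) = w" if w: "w \<in> W" and x: "x \<in> X" for w x
    unfolding p_def
  proof (rule some_equality)
    fix w' assume "w' \<in> W \<and> (\<exists>x'\<in>X. w \<oplus>\<^bsub>M\<^esub> x = w' \<oplus>\<^bsub>M\<^esub> x')"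
    then obtain x' where w': "w' \<in> W" "x' \<in> X" and eq: "w \<oplus>\<^bsub>M\<^esub> x = w' \<oplus>\<^bsub>M\<^esub> x'" by blast
    have c: "w \<in> carrier M" "w' \<in> carrier M" "x \<in> carrier M" "x' \<in> carrier M"
      using w x w' W' X' by auto
    have "w' \<ominus>\<^bsub>M\<^esub> w = (w' \<oplus>\<^bsub>M\<^esub> x') \<ominus>\<^bsub>M\<^esub> (w \<oplus>\<^bsub>M\<^esub> x')"
      using c M.a_comm[of w' x'] M.a_comm[of w x'] M.add_diff_add_left[of x' w' w] by simp
    also have "\<dots> = (w \<oplus>\<^bsub>M\<^esub> x) \<ominus>\<^bsub>M\<^esub> (w \<oplus>\<^bsub>M\<^esub> x')" by (simp add: eq)
    also have "\<dots> = x \<ominus>\<^bsub>M\<^esub> x'"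
      using c by (simp add: M.add_diff_add_left)
    finally have "w' \<ominus>\<^bsub>M\<^esub> w \<in> X \<inter> W"
      using w x w' submodule_diff[OF W, of w' w] submodule_diff[OF X(1), of x x'] by simp
    then show "w' = w" using X(2) c by simp
  qed (use that in blast)
  let ?h = "restrict (\<lambda>v. g (p v)) (carrier M)"
  have "?h \<in> rmod_hom R M Q"
  proof (rule rmod_hom_restrictI[OF right_module_axioms])
    fix v assume v: "v \<in> carrier M"
    then obtain w x where wx: "w \<in> W" "x \<in> X" "v = w \<oplus>\<^bsub>M\<^esub> x" using sum by blast
    then show "g (p v) \<in> carrier Q" using p g.closed[of w] by simp
    show "g (p (r \<odot>\<^bsub>M\<^esub> v)) = r \<odot>\<^bsub>Q\<^esub> g (p v)" if r: "r \<in> carrier R" for r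
    proof -
      have "r \<odot>\<^bsub>M\<^esub> v = r \<odot>\<^bsub>M\<^esub> w \<oplus>\<^bsub>M\<^esub> r \<odot>\<^bsub>M\<^esub> x"
        using wx r W' X' by (auto simp: subset_iff smult_r_distr)
      then show ?thesis using wx r W' X' p g.smult[of r w] by simp
    qed
    fix v' assume v': "v' \<in> carrier M"
    then obtain w' x' where wx': "w' \<in> W" "x' \<in> X" "v' = w' \<oplus>\<^bsub>M\<^esub> x'" using sum by blast
    have "v \<oplus>\<^bsub>M\<^esub> v' = (w \<oplus>\<^bsub>M\<^esub> w') \<oplus>\<^bsub>M\<^esub> (x \<oplus>\<^bsub>M\<^esub> x')"
      using wx wx' W' X' by (simp add: subset_iff M.a_ac)
    then show "g (p (v \<oplus>\<^bsub>M\<^esub> v')) = g (p v) \<oplus>\<^bsub>Q\<^esub> g (p v')"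
      using wx wx' W' X' p g.add[of w w'] by simp
  qed
  moreover have "?h w = g w" if "w \<in> W" for w
    using that p[OF that submodule_zero[OF X(1)]] W' by (auto simp: subset_iff)
  ultimately show ?thesis by blast
qed

text \<open>Reduced to an inclusion by inverting \<open>f\<close> on its image.\<close>

lemma extend_along:
  assumes X: "right_module R X" and Q: "right_module R Q" and f: "f \<in> rmod_hom R X M"
    and inj: "inj_on f (carrier X)" and g: "g \<in> rmod_hom R X Q"
  shows "\<exists>h\<in>rmod_hom R M Q. \<forall>x\<in>carrier X. h (f x) = g x"
proof -
  interpret f: rmod_homomorphism R X M f
    using X f by (intro rmod_homomorphism.intro rmod_homomorphism_axioms.intro right_module_axioms)
  let ?W = "f ` carrier X"
  have W: "submodule ?W R M" by (rule f.image_submodule[OF f.M.carrier_submodule])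
  interpret f': rmod_homomorphism R X "M\<lparr>carrier := ?W\<rparr>" f
    by (intro rmod_homomorphism.intro rmod_homomorphism_axioms.intro f.M.right_module_axioms
        submodule_right_module[OF W] rmod_homI) (use rmod_homD[OF f] in \<open>auto simp: extensional_def\<close>)
  let ?i = "restrict (inv_into (carrier X) f) (carrier (M\<lparr>carrier := ?W\<rparr>))"
  have "?i \<in> rmod_hom R (M\<lparr>carrier := ?W\<rparr>) X"
    by (rule f'.inverse_hom) (use inj in \<open>simp add: bij_betw_def\<close>)
  then have "compose ?W g ?i \<in> rmod_hom R (M\<lparr>carrier := ?W\<rparr>) Q"
    using rmod_hom_compose[OF submodule_right_module[OF W] _ g, of ?i] by simp
  then obtain h where "h \<in> rmod_hom R M Q" "\<forall>w\<in>?W. h w = compose ?W g ?i w"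
    using extend_hom[OF W Q] by blast
  then show ?thesis
    by (intro bexI[of _ h]) (auto simp: compose_eq inv_into_f_f[OF inj])
qed

text \<open>The map \<open>d \<mapsto> x d\<close> embeds the regular module as a line, and the
  identity of the regular module extends along it. This replaces the choice of a basis through
  \<open>x\<close>.\<close>

lemma exists_functional:
  assumes x: "x \<in> carrier M" "x \<noteq> \<zero>\<^bsub>M\<^esub>"
  shows "\<exists>\<phi>\<in>rmod_hom R M (regular_rmod R). \<phi> x = \<one>"
proof -
  let ?f = "restrict (\<lambda>d. d \<odot>\<^bsub>M\<^esub> x) (carrier (regular_rmod R))"
  note rr = regular_right_module[OF R.ring_axioms]
  have f: "?f \<in> rmod_hom R (regular_rmod R) M"
    by (rule rmod_hom_restrictI[OF rr])
      (use x in \<open>auto simp: regular_rmod_def smult_l_distr smult_assoc\<close>)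
  interpret f: rmod_homomorphism R "regular_rmod R" M ?f
    using f by (intro rmod_homomorphism.intro rmod_homomorphism_axioms.intro right_module_axioms rr)
  have "inj_on ?f (carrier (regular_rmod R))"
    unfolding f.inj_iff using x smult_eq_zeroD[of _ x] by (auto simp: regular_rmod_def)
  moreover have "restrict (\<lambda>d. d) (carrier (regular_rmod R)) \<in> rmod_hom R (regular_rmod R) (regular_rmod R)"
    by (rule rmod_hom_restrictI[OF rr]) auto
  ultimately obtain h where "h \<in> rmod_hom R M (regular_rmod R)"
    "\<forall>d\<in>carrier (regular_rmod R). h (?f d) = restrict (\<lambda>d. d) (carrier (regular_rmod R)) d"
    using extend_along[OF rr rr f] by blast
  then show ?thesis using x by (intro bexI[of _ h]) (auto simp: regular_rmod_def dest!: bspec[of _ _ \<one>])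
qed

text \<open>A complement of the kernel is mapped isomorphically onto \<open>N\<close>; its inverse
  is the section.\<close>

lemma exists_section:
  assumes N: "right_module R N" and f: "f \<in> rmod_hom R M N" and surj: "f ` carrier M = carrier N"
  shows "\<exists>s\<in>rmod_hom R N M. \<forall>y\<in>carrier N. f (s y) = y"
proof -
  interpret f: rmod_homomorphism R M N f
    using N f by (intro rmod_homomorphism.intro rmod_homomorphism_axioms.intro right_module_axioms)
  obtain X where X: "submodule X R M" "X \<inter> {x \<in> carrier M. f x = \<zero>\<^bsub>N\<^esub>} = {\<zero>\<^bsub>M\<^esub>}"
    and sum: "\<forall>v\<in>carrier M. \<exists>w\<in>{x \<in> carrier M. f x = \<zero>\<^bsub>N\<^esub>}. \<exists>x\<in>X. v = w \<oplus>\<^bsub>M\<^esub> x"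
    using exists_complement[OF f.kernel_submodule] by blast
  note X' = X(1)[unfolded submodule_iff]
  have r: "rmod_homomorphism R (M\<lparr>carrier := X\<rparr>) N (restrict f (carrier (M\<lparr>carrier := X\<rparr>)))"
    by (intro rmod_homomorphism.intro rmod_homomorphism_axioms.intro submodule_right_module[OF X(1)]
        rmod_hom_restrictI N) (use X' in \<open>auto simp: subset_iff\<close>)
  have "x = \<zero>\<^bsub>M\<^esub>" if "x \<in> X" "f x = \<zero>\<^bsub>N\<^esub>" for x
    using that X(2) submodule_subset[OF X(1)] by blast
  then have "inj_on f X" using rmod_homomorphism.inj_iff[OF r, simplified] by blast
  then have "inj_on (restrict f X) X" by simp
  moreover have "restrict f X ` X = carrier N"
  proof -
    have "y \<in> f ` X" if y: "y \<in> carrier N" for y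
    proof -
      from y surj have "y \<in> f ` carrier M" by simp
      then obtain v where v: "v \<in> carrier M" "f v = y" by (auto simp del: f.closed)
      obtain w x where wx: "w \<in> carrier M" "f w = \<zero>\<^bsub>N\<^esub>" "x \<in> X" "v = w \<oplus>\<^bsub>M\<^esub> x" using sum v by blast
      then have "f x = y" using v X' f.add[of w x] f.closed[of x] by (auto simp: subset_iff)
      then show ?thesis using wx by blast
    qed
    then show ?thesis using X' f.closed by (auto simp: subset_iff)
  qed
  ultimately have bij: "bij_betw (restrict f X) X (carrier N)" by (simp add: bij_betw_def)
  define s where "s = restrict (inv_into X (restrict f X)) (carrier N)"
  have s: "s \<in> rmod_hom R N (M\<lparr>carrier := X\<rparr>)"
    using rmod_homomorphism.inverse_hom[OF r] bij by (simp add: s_def)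
  have "f (s y) = y" if y: "y \<in> carrier N" for y
    using that bij_betw_inv_into_right[OF bij y] rmod_homD(1)[OF s y] by (simp add: s_def)
  moreover have "s \<in> rmod_hom R N M"
    using s X' by (auto simp: rmod_hom_def PiE_def Pi_def)
  ultimately show ?thesis by blast
qed

end

section \<open>Categories and equivalences\<close>

text \<open>The record \<open>cat\<close> carries data only; closure, units and associativity have
  to be stated before isomorphisms can be cancelled.\<close>

definition category :: "('o, 'm) cat \<Rightarrow> bool" where
  "category C \<longleftrightarrow>
     (\<forall>X\<in>Obj C. Idn C X \<in> Hom C X X) \<and>
     (\<forall>X\<in>Obj C. \<forall>Y\<in>Obj C. \<forall>Z\<in>Obj C. \<forall>f\<in>Hom C X Y. \<forall>g\<in>Hom C Y Z. Cmp C X Y Z g f \<in> Hom C X Z) \<and>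
     (\<forall>X\<in>Obj C. \<forall>Y\<in>Obj C. \<forall>f\<in>Hom C X Y. Cmp C X X Y f (Idn C X) = f \<and> Cmp C X Y Y (Idn C Y) f = f) \<and>
     (\<forall>W\<in>Obj C. \<forall>X\<in>Obj C. \<forall>Y\<in>Obj C. \<forall>Z\<in>Obj C. \<forall>f\<in>Hom C W X. \<forall>g\<in>Hom C X Y. \<forall>h\<in>Hom C Y Z.
        Cmp C W Y Z h (Cmp C W X Y g f) = Cmp C W X Z (Cmp C X Y Z h g) f)"

text \<open>Density selects for each \<open>Y\<close> an object \<open>Go Y\<close> and an
  isomorphism \<open>s Y\<close> from its image to \<open>Y\<close>. Conjugation by these, followed
  by lifting along the bijections \<open>Fa X Y\<close>, is the inverse on arrows; identities in
  \<open>C\<close> are checked after applying \<open>Fa\<close>.\<close>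

lemma is_equivalence_if_fully_faithful:
  assumes C: "category C" and D: "category D" and F: "is_functor C D Fo Fa"
    and faithful: "\<And>X Y f g. \<lbrakk>X \<in> Obj C; Y \<in> Obj C; f \<in> Hom C X Y; g \<in> Hom C X Y; Fa X Y f = Fa X Y g\<rbrakk> \<Longrightarrow> f = g"
    and full: "\<And>X Y g. \<lbrakk>X \<in> Obj C; Y \<in> Obj C; g \<in> Hom D (Fo X) (Fo Y)\<rbrakk> \<Longrightarrow> \<exists>f\<in>Hom C X Y. Fa X Y f = g"
    and dense: "\<And>Y. Y \<in> Obj D \<Longrightarrow> \<exists>X\<in>Obj C. \<exists>s. iso_arrow D (Fo X) Y s"
  shows "is_equivalence C D Fo Fa"
proof -
  note Cid = C[unfolded category_def, THEN conjunct1, rule_format]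
    and Ccl = C[unfolded category_def, THEN conjunct2, THEN conjunct1, rule_format]
    and Dcl = D[unfolded category_def, THEN conjunct2, THEN conjunct1, rule_format]
    and Did = D[unfolded category_def, THEN conjunct1, rule_format]
    and Dunit = D[unfolded category_def, THEN conjunct2, THEN conjunct2, THEN conjunct1, rule_format]
    and Dassoc = D[unfolded category_def, THEN conjunct2, THEN conjunct2, THEN conjunct2, rule_format]
  have Fo [simp]: "Fo X \<in> Obj D" if "X \<in> Obj C" for X
    using that F by (simp add: is_functor_def)
  have Fa: "Fa X Y f \<in> Hom D (Fo X) (Fo Y)" if "X \<in> Obj C" "Y \<in> Obj C" "f \<in> Hom C X Y" for X Y f
    using that F by (simp add: is_functor_def)
  have Fid: "Fa X X (Idn C X) = Idn D (Fo X)" if "X \<in> Obj C" for X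
    using that F by (simp add: is_functor_def)
  have Fcmp: "Fa X Z (Cmp C X Y Z g f) = Cmp D (Fo X) (Fo Y) (Fo Z) (Fa Y Z g) (Fa X Y f)"
    if "X \<in> Obj C" "Y \<in> Obj C" "Z \<in> Obj C" "f \<in> Hom C X Y" "g \<in> Hom C Y Z" for X Y Z f g
    using that F by (simp add: is_functor_def)
  obtain Go s where G: "\<And>Y. Y \<in> Obj D \<Longrightarrow> Go Y \<in> Obj C \<and> iso_arrow D (Fo (Go Y)) Y (s Y)"
    using dense by metis
  then obtain t where st: "\<And>Y. Y \<in> Obj D \<Longrightarrow> s Y \<in> Hom D (Fo (Go Y)) Y \<and> t Y \<in> Hom D Y (Fo (Go Y)) \<and>
      Cmp D (Fo (Go Y)) Y (Fo (Go Y)) (t Y) (s Y) = Idn D (Fo (Go Y)) \<and>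
      Cmp D Y (Fo (Go Y)) Y (s Y) (t Y) = Idn D Y"
    unfolding iso_arrow_def by metis
  have Go [simp]: "Go Y \<in> Obj C" if "Y \<in> Obj D" for Y using that G by blast
  \<comment> \<open>The inverse of \<open>Fa X Y\<close> on arrows; fullness makes the choice
    possible and faithfulness makes it unique.\<close>
  define L where "L X Y g = (SOME f. f \<in> Hom C X Y \<and> Fa X Y f = g)" for X Y g
  have L: "L X Y g \<in> Hom C X Y \<and> Fa X Y (L X Y g) = g"
    if "X \<in> Obj C" "Y \<in> Obj C" "g \<in> Hom D (Fo X) (Fo Y)" for X Y g
    unfolding L_def by (rule someI_ex) (use full[OF that] in blast)
  \<comment> \<open>\<open>g\<close> conjugated by the isomorphisms \<open>s\<close>: the only arrow
    for which \<open>s\<close> becomes natural.\<close>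
  define \<gamma> where "\<gamma> Y Z g = Cmp D (Fo (Go Y)) Z (Fo (Go Z)) (t Z) (Cmp D (Fo (Go Y)) Y Z g (s Y))" for Y Z g
  define Ga where "Ga Y Z g = L (Go Y) (Go Z) (\<gamma> Y Z g)" for Y Z g
  have \<gamma>: "\<gamma> Y Z g \<in> Hom D (Fo (Go Y)) (Fo (Go Z))" if "Y \<in> Obj D" "Z \<in> Obj D" "g \<in> Hom D Y Z" for Y Z g
    unfolding \<gamma>_def by (rule Dcl[OF _ that(2)]) (use that st Dcl in auto)
  have Ga: "Ga Y Z g \<in> Hom C (Go Y) (Go Z)" and FGa: "Fa (Go Y) (Go Z) (Ga Y Z g) = \<gamma> Y Z g"
    if "Y \<in> Obj D" "Z \<in> Obj D" "g \<in> Hom D Y Z" for Y Z g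
    using L \<gamma> that by (auto simp: Ga_def)
  have s\<gamma>: "Cmp D (Fo (Go Y)) (Fo (Go Z)) Z (s Z) (\<gamma> Y Z g) = Cmp D (Fo (Go Y)) Y Z g (s Y)"
    if Y: "Y \<in> Obj D" and Z: "Z \<in> Obj D" and g: "g \<in> Hom D Y Z" for Y Z g
  proof -
    have k: "Cmp D (Fo (Go Y)) Y Z g (s Y) \<in> Hom D (Fo (Go Y)) Z"
      using that st by (intro Dcl) auto
    show ?thesis unfolding \<gamma>_def using that st k Dunit
      by (subst Dassoc[of "Fo (Go Y)" Z "Fo (Go Z)" Z]) auto
  qed
  \<comment> \<open>\<open>s Y\<close> is split by \<open>t Y\<close>, so it is a monomorphism, and
    functoriality can be tested after composing with it.\<close>
  have s_cancel: "h = h'" if "Y \<in> Obj D" "Z \<in> Obj D" "h \<in> Hom D Z (Fo (Go Y))" "h' \<in> Hom D Z (Fo (Go Y))"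
    "Cmp D Z (Fo (Go Y)) Y (s Y) h = Cmp D Z (Fo (Go Y)) Y (s Y) h'" for Y Z h h'
  proof -
    have "Cmp D Z Y (Fo (Go Y)) (t Y) (Cmp D Z (Fo (Go Y)) Y (s Y) k) = k" if "k \<in> Hom D Z (Fo (Go Y))" for k
      using that \<open>Y \<in> Obj D\<close> \<open>Z \<in> Obj D\<close> st[of Y] Dunit[of Z "Fo (Go Y)" k]
        Dassoc[of Z "Fo (Go Y)" Y "Fo (Go Y)" k "s Y" "t Y"] by simp
    then show ?thesis using that(3-5) by metis
  qed
  have G_functor: "is_functor D C Go Ga"
    unfolding is_functor_def
  proof (intro conjI ballI)
    fix Y assume Y: "Y \<in> Obj D"
    then show "Go Y \<in> Obj C" by simp
    have "Ga Y Y (Idn D Y) = Idn C (Go Y)"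
    proof (rule faithful)
      have "\<gamma> Y Y (Idn D Y) = Idn D (Fo (Go Y))"
        using Y st Dunit by (auto simp: \<gamma>_def)
      then show "Fa (Go Y) (Go Y) (Ga Y Y (Idn D Y)) = Fa (Go Y) (Go Y) (Idn C (Go Y))"
        using Y FGa Did Fid by simp
    qed (use Y Ga Did Cid in auto)
    then show "Ga Y Y (Idn D Y) = Idn C (Go Y)" .
  next
    fix X Y Z f g assume XYZ: "X \<in> Obj D" "Y \<in> Obj D" "Z \<in> Obj D"
      and f: "f \<in> Hom D X Y" and g: "g \<in> Hom D Y Z"
    show "Ga X Z (Cmp D X Y Z g f) = Cmp C (Go X) (Go Y) (Go Z) (Ga Y Z g) (Ga X Y f)"
    proof (rule faithful)
      have gf: "Cmp D X Y Z g f \<in> Hom D X Z" by (rule Dcl[OF XYZ f g])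
      have "\<gamma> X Z (Cmp D X Y Z g f) = Cmp D (Fo (Go X)) (Fo (Go Y)) (Fo (Go Z)) (\<gamma> Y Z g) (\<gamma> X Y f)"
      proof (rule s_cancel[of Z "Fo (Go X)"])
        have "Cmp D (Fo (Go X)) (Fo (Go Z)) Z (s Z) (Cmp D (Fo (Go X)) (Fo (Go Y)) (Fo (Go Z)) (\<gamma> Y Z g) (\<gamma> X Y f))
            = Cmp D (Fo (Go X)) (Fo (Go Y)) Z (Cmp D (Fo (Go Y)) Y Z g (s Y)) (\<gamma> X Y f)"
          using XYZ f g \<gamma> st by (subst Dassoc[of "Fo (Go X)" "Fo (Go Y)"]) (auto simp: s\<gamma>)
        also have "\<dots> = Cmp D (Fo (Go X)) Y Z g (Cmp D (Fo (Go X)) X Y f (s X))"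
          using XYZ f g \<gamma> st by (subst Dassoc[of "Fo (Go X)" "Fo (Go Y)" Y Z, symmetric]) (auto simp: s\<gamma>)
        also have "\<dots> = Cmp D (Fo (Go X)) X Z (Cmp D X Y Z g f) (s X)"
          using XYZ f g st by (subst Dassoc[of "Fo (Go X)" X Y Z]) auto
        also have "\<dots> = Cmp D (Fo (Go X)) (Fo (Go Z)) Z (s Z) (\<gamma> X Z (Cmp D X Y Z g f))"
          using XYZ gf by (simp add: s\<gamma>)
        finally show "Cmp D (Fo (Go X)) (Fo (Go Z)) Z (s Z) (\<gamma> X Z (Cmp D X Y Z g f)) =
          Cmp D (Fo (Go X)) (Fo (Go Z)) Z (s Z) (Cmp D (Fo (Go X)) (Fo (Go Y)) (Fo (Go Z)) (\<gamma> Y Z g) (\<gamma> X Y f))" ..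
      qed (use XYZ f g gf \<gamma> Dcl in auto)
      then show "Fa (Go X) (Go Z) (Ga X Z (Cmp D X Y Z g f)) =
          Fa (Go X) (Go Z) (Cmp C (Go X) (Go Y) (Go Z) (Ga Y Z g) (Ga X Y f))"
        using XYZ f g gf Ga by (simp add: FGa Fcmp)
    qed (use XYZ f g Ga Ccl Dcl in auto)
  qed (use Ga in auto)
  have nat_D: "naturally_isomorphic D D (\<lambda>Y. Fo (Go Y)) (\<lambda>Y Z g. Fa (Go Y) (Go Z) (Ga Y Z g)) (\<lambda>Y. Y) (\<lambda>Y Z g. g)"
    unfolding naturally_isomorphic_def
    by (rule exI[of _ s]) (use G s\<gamma> FGa in auto)
  have nat_C: "naturally_isomorphic C C (\<lambda>X. Go (Fo X)) (\<lambda>X Y f. Ga (Fo X) (Fo Y) (Fa X Y f)) (\<lambda>X. X) (\<lambda>X Y f. f)"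
    unfolding naturally_isomorphic_def
  proof (intro exI conjI ballI)
    \<comment> \<open>The component at \<open>X\<close> is the lift of \<open>s (Fo X)\<close>; its
      inverse will be the lift of \<open>t (Fo X)\<close>.\<close>
    let ?\<eta> = "\<lambda>X. L (Go (Fo X)) X (s (Fo X))"
    have \<eta>: "?\<eta> X \<in> Hom C (Go (Fo X)) X" "Fa (Go (Fo X)) X (?\<eta> X) = s (Fo X)" if "X \<in> Obj C" for X
      using L that st by auto
    fix X assume X: "X \<in> Obj C"
    let ?\<theta> = "L X (Go (Fo X)) (t (Fo X))"
    have \<theta>: "?\<theta> \<in> Hom C X (Go (Fo X))" "Fa X (Go (Fo X)) ?\<theta> = t (Fo X)"
      using L X st by auto
    have "Cmp C (Go (Fo X)) X (Go (Fo X)) ?\<theta> (?\<eta> X) = Idn C (Go (Fo X))"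
      by (rule faithful[of "Go (Fo X)" "Go (Fo X)"]) (use X \<theta> \<eta> Ccl Cid in \<open>auto simp: Fcmp Fid st\<close>)
    moreover have "Cmp C X (Go (Fo X)) X (?\<eta> X) ?\<theta> = Idn C X"
      by (rule faithful[of X X]) (use X \<theta> \<eta> Ccl Cid in \<open>auto simp: Fcmp Fid st\<close>)
    ultimately show "iso_arrow C (Go (Fo X)) X (?\<eta> X)"
      unfolding iso_arrow_def using \<theta> \<eta> X by blast
    fix Y f assume Y: "Y \<in> Obj C" and f: "f \<in> Hom C X Y"
    show "Cmp C (Go (Fo X)) (Go (Fo Y)) Y (?\<eta> Y) (Ga (Fo X) (Fo Y) (Fa X Y f)) =
      Cmp C (Go (Fo X)) X Y f (?\<eta> X)"
      by (rule faithful[of "Go (Fo X)" Y]) (use X Y f Fa[OF X Y f] Ga \<eta> Ccl in \<open>auto simp: Fcmp FGa s\<gamma>\<close>)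
  qed
  show ?thesis unfolding is_equivalence_def using F G_functor nat_C nat_D by blast
qed

lemma full_subcat_simps [simp]:
  "Hom (full_subcat C Q) = Hom C" "Idn (full_subcat C Q) = Idn C" "Cmp (full_subcat C Q) = Cmp C"
  "Obj (full_subcat C Q) = {X \<in> Obj C. Q X}"
  by (simp_all add: full_subcat_def)

lemma rmod_cat_simps [simp]:
  "Obj (rmod_cat R) = {M. right_module R M}" "Hom (rmod_cat R) = rmod_hom R"
  "Idn (rmod_cat R) M = restrict (\<lambda>x. x) (carrier M)" "Cmp (rmod_cat R) L M N g f = compose (carrier L) g f"
  by (simp_all add: rmod_cat_def)

lemma rmod_hom_id: "right_module R M \<Longrightarrow> restrict (\<lambda>x. x) (carrier M) \<in> rmod_hom R M M"
  by (rule rmod_hom_restrictI) auto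

lemma category_full_subcat_rmod_cat: "category (full_subcat (rmod_cat R) Q)"
  unfolding category_def
proof (intro conjI ballI; simp)
  fix L M N f g h assume f: "f \<in> rmod_hom R L M"
  then show "compose (carrier L) f (restrict (\<lambda>x. x) (carrier L)) = f"
    "compose (carrier L) (restrict (\<lambda>x. x) (carrier M)) f = f"
    by (auto simp: compose_def fun_eq_iff dest: rmod_homD(1) intro: extensional_arb[symmetric] rmod_homD(4))
  show "compose (carrier L) h (compose (carrier L) g f) = compose (carrier L) (compose (carrier M) h g) f"
    using f by (auto simp: compose_def fun_eq_iff dest: rmod_homD(1))
qed (auto simp: rmod_hom_id rmod_hom_compose)

text \<open>The predicate \<open>Q\<close> stays free, since isomorphisms in a full subcategory are
  those of the surrounding category.\<close>

lemma iso_arrow_if_bij: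
  assumes "right_module R M" "right_module R N" "f \<in> rmod_hom R M N" "bij_betw f (carrier M) (carrier N)"
  shows "iso_arrow (full_subcat (rmod_cat R) Q) M N f"
proof -
  interpret f: rmod_homomorphism R M N f
    using assms by (intro rmod_homomorphism.intro rmod_homomorphism_axioms.intro)
  let ?g = "restrict (inv_into (carrier M) f) (carrier N)"
  have "compose (carrier M) ?g f = restrict (\<lambda>x. x) (carrier M)"
    using assms(4) by (auto simp: compose_def fun_eq_iff bij_betw_inv_into_left)
  moreover have "compose (carrier N) f ?g = restrict (\<lambda>x. x) (carrier N)"
    using assms(4) by (auto simp: compose_def fun_eq_iff bij_betw_inv_into_right)
  ultimately show ?thesis
    using f.inverse_hom[OF assms(4)] assms(3) by (auto simp: iso_arrow_def)
qed

section \<open>The cosyzygy functor\<close>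

text \<open>In the application \<open>e\<close>, \<open>f\<close>, \<open>u\<close> are the matrix units \<open>e\<^sub>0\<close>, \<open>e\<^sub>m\<close>, \<open>e\<^sub>0\<^sub>m\<close>. Both \<open>pr\<close> and \<open>tw\<close>
  are identifications through \<open>u\<close>: of \<open>eRf\<close> with \<open>D = fRf\<close>, and of \<open>D\<close> with \<open>eRe\<close>. The families \<open>a\<close> and
  \<open>b\<close> are dual bases of \<open>Rf\<close> and \<open>eR\<close> for the pairing \<open>(x, c) \<mapsto> pr (x c)\<close>.\<close>

locale dual_corner_ring = ring +
  fixes e f u :: 'a and pr tw :: "'a \<Rightarrow> 'a" and K :: "'k set" and a b :: "'k \<Rightarrow> 'a"
  assumes e_closed [simp, intro]: "e \<in> carrier R" and e_idem [simp]: "e \<otimes> e = e"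
    and f_closed [simp, intro]: "f \<in> carrier R" and f_idem [simp]: "f \<otimes> f = f"
    and u_closed [simp, intro]: "u \<in> carrier R" and e_u [simp]: "e \<otimes> u = u" and u_f [simp]: "u \<otimes> f = u"
    \<comment> \<open>Triangularity at the two ends of the poset: \<open>fR = fRf\<close>, because
      nothing leads out of the greatest index, and \<open>Re = eRe\<close>, because nothing leads
      into the least one.\<close>
    and f_row: "x \<in> carrier R \<Longrightarrow> f \<otimes> x \<otimes> f = f \<otimes> x"
    and e_col: "x \<in> carrier R \<Longrightarrow> e \<otimes> x \<otimes> e = x \<otimes> e"
    and pr_closed [simp, intro]: "x \<in> carrier R \<Longrightarrow> pr x \<in> carrier R"
    and f_pr [simp]: "x \<in> carrier R \<Longrightarrow> f \<otimes> pr x = pr x"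
    and u_pr: "x \<in> carrier R \<Longrightarrow> u \<otimes> pr x = e \<otimes> x \<otimes> f"
    and u_cancel: "\<lbrakk>d \<in> carrier R; d' \<in> carrier R; f \<otimes> d = d; f \<otimes> d' = d'; u \<otimes> d = u \<otimes> d'\<rbrakk> \<Longrightarrow> d = d'"
    and tw_closed [simp, intro]: "d \<in> carrier R \<Longrightarrow> tw d \<in> carrier R"
    and tw_e [simp]: "d \<in> carrier R \<Longrightarrow> tw d \<otimes> e = tw d"
    and tw_u: "\<lbrakk>d \<in> carrier R; f \<otimes> d = d\<rbrakk> \<Longrightarrow> tw d \<otimes> u = u \<otimes> d"
    and cancel_u: "\<lbrakk>d \<in> carrier R; d' \<in> carrier R; d \<otimes> e = d; d' \<otimes> e = d'; d \<otimes> u = d' \<otimes> u\<rbrakk> \<Longrightarrow> d = d'"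
    and finite_K [simp, intro]: "finite K"
    and a_closed [simp, intro]: "k \<in> K \<Longrightarrow> a k \<in> carrier R" and a_f [simp]: "k \<in> K \<Longrightarrow> a k \<otimes> f = a k"
    and b_closed [simp, intro]: "k \<in> K \<Longrightarrow> b k \<in> carrier R" and e_b [simp]: "k \<in> K \<Longrightarrow> e \<otimes> b k = b k"
    and column_expand: "\<lbrakk>c \<in> carrier R; c \<otimes> f = c\<rbrakk> \<Longrightarrow> c = (\<Oplus>k\<in>K. a k \<otimes> pr (b k \<otimes> c))"
    and row_expand: "\<lbrakk>x \<in> carrier R; e \<otimes> x = x\<rbrakk> \<Longrightarrow> x = (\<Oplus>k\<in>K. tw (pr (x \<otimes> a k)) \<otimes> b k)"
begin

text \<open>Cut down by \<open>f\<close> on the left only: by \<open>f_row\<close> the condition on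
  the right follows.\<close>

definition D where "D = R\<lparr>carrier := {d \<in> carrier R. f \<otimes> d = d}, one := f\<rparr>"

text \<open>The left ideal \<open>Rf\<close>, that is, the column of the greatest index. Torsion
  below means annihilation by \<open>C\<close>.\<close>

definition C where "C = {c \<in> carrier R. c \<otimes> f = c}"

definition column where "column = (regular_rmod R)\<lparr>carrier := C\<rparr>"

lemma D_simps [simp]:
  "carrier D = {d \<in> carrier R. f \<otimes> d = d}" "mult D = mult R" "add D = add R" "zero D = \<zero>" "one D = f"
  by (simp_all add: D_def)

lemma column_simps [simp]:
  "carrier column = C" "add column = add R" "zero column = \<zero>" "smult column = (\<lambda>r x. x \<otimes> r)"
  by (simp_all add: column_def regular_rmod_def)

lemma D_right_f: "\<lbrakk>d \<in> carrier R; f \<otimes> d = d\<rbrakk> \<Longrightarrow> d \<otimes> f = d"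
  using f_row[of d] by simp

lemma f_mult_D: "x \<in> carrier R \<Longrightarrow> f \<otimes> x \<in> carrier D"
  by (simp flip: m_assoc)

lemma pr_D: "x \<in> carrier R \<Longrightarrow> pr x \<in> carrier D"
  by simp

lemma u_pr_C: "c \<in> C \<Longrightarrow> u \<otimes> pr c = e \<otimes> c"
  by (simp add: C_def u_pr m_assoc)

lemma C_closed: "c \<in> C \<Longrightarrow> c \<in> carrier R" by (simp add: C_def)

lemma C_mult: "\<lbrakk>r \<in> carrier R; c \<in> C\<rbrakk> \<Longrightarrow> r \<otimes> c \<in> C"
  by (simp add: C_def m_assoc)

lemma C_mult_D: "\<lbrakk>c \<in> carrier R; d \<in> carrier D\<rbrakk> \<Longrightarrow> c \<otimes> d \<in> C"
  by (simp add: C_def m_assoc D_right_f)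

lemma C_f [simp]: "f \<in> C" and C_u [simp]: "u \<in> C" and C_a [simp]: "k \<in> K \<Longrightarrow> a k \<in> C"
  by (simp_all add: C_def)

lemma C_zero [simp]: "\<zero> \<in> C" and C_add: "\<lbrakk>c \<in> C; c' \<in> C\<rbrakk> \<Longrightarrow> c \<oplus> c' \<in> C"
  by (simp_all add: C_def l_distr)

lemma e_tw [simp]: "d \<in> carrier R \<Longrightarrow> e \<otimes> tw d = tw d"
  using e_col[of "tw d"] by (simp add: m_assoc)

text \<open>Cancellation of \<open>u\<close>. The remaining laws of \<open>pr\<close> are read off
  from this characterisation instead of being assumed.\<close>

lemma pr_unique: "\<lbrakk>x \<in> carrier R; d \<in> carrier D; u \<otimes> d = e \<otimes> x \<otimes> f\<rbrakk> \<Longrightarrow> pr x = d"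
  by (rule u_cancel) (auto simp: u_pr)

lemma pr_add: "\<lbrakk>x \<in> carrier R; y \<in> carrier R\<rbrakk> \<Longrightarrow> pr (x \<oplus> y) = pr x \<oplus> pr y"
  by (rule pr_unique) (auto simp: r_distr l_distr u_pr)

lemma pr_mult: "\<lbrakk>x \<in> carrier R; d \<in> carrier D\<rbrakk> \<Longrightarrow> pr (x \<otimes> d) = pr x \<otimes> d"
proof (rule pr_unique)
  assume x: "x \<in> carrier R" and d: "d \<in> carrier D"
  have "u \<otimes> (pr x \<otimes> d) = (u \<otimes> pr x) \<otimes> d" using x d by (simp add: m_assoc)
  also have "\<dots> = e \<otimes> x \<otimes> (f \<otimes> d)" using x d by (simp only: u_pr) (simp add: m_assoc)
  also have "f \<otimes> d = d \<otimes> f" using d D_right_f by simp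
  finally show "u \<otimes> (pr x \<otimes> d) = e \<otimes> (x \<otimes> d) \<otimes> f" using x d by (simp add: m_assoc)
  show "pr x \<otimes> d \<in> carrier D" using x d by (simp flip: m_assoc)
qed (auto)

lemma pr_e: "x \<in> carrier R \<Longrightarrow> pr (e \<otimes> x) = pr x"
  by (rule pr_unique) (auto simp: u_pr simp flip: m_assoc)

lemma pr_u [simp]: "pr u = f"
  by (rule pr_unique) auto

text \<open>Left linearity of the pairing over \<open>eRe\<close>, expressed in \<open>D\<close> by
  means of \<open>tw\<close>.\<close>

lemma pr_tw: "\<lbrakk>d \<in> carrier D; x \<in> carrier R\<rbrakk> \<Longrightarrow> pr (tw d \<otimes> x) = d \<otimes> pr x"
proof (rule pr_unique)
  assume d: "d \<in> carrier D" and x: "x \<in> carrier R"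
  have "u \<otimes> (d \<otimes> pr x) = tw d \<otimes> (u \<otimes> pr x)" using d x tw_u[of d] by (simp flip: m_assoc)
  also have "\<dots> = (tw d \<otimes> e) \<otimes> x \<otimes> f" using d x by (simp add: u_pr m_assoc del: tw_e)
  finally show "u \<otimes> (d \<otimes> pr x) = e \<otimes> (tw d \<otimes> x) \<otimes> f" using d x by (simp flip: m_assoc)
  show "d \<otimes> pr x \<in> carrier D" using d x by (simp flip: m_assoc)
qed auto

text \<open>Cancellation of \<open>u\<close> on the other side; it makes \<open>tw\<close> a ring
  homomorphism from \<open>D\<close> into \<open>eRe\<close>.\<close>

lemma tw_unique: "\<lbrakk>d \<in> carrier D; d' \<in> carrier R; d' \<otimes> e = d'; d' \<otimes> u = u \<otimes> d\<rbrakk> \<Longrightarrow> tw d = d'"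
  by (rule cancel_u) (auto simp: tw_u)

lemma tw_add: "\<lbrakk>d \<in> carrier D; d' \<in> carrier D\<rbrakk> \<Longrightarrow> tw (d \<oplus> d') = tw d \<oplus> tw d'"
  by (rule tw_unique) (auto simp: r_distr l_distr tw_u)

lemma tw_mult: "\<lbrakk>d \<in> carrier D; d' \<in> carrier D\<rbrakk> \<Longrightarrow> tw (d \<otimes> d') = tw d \<otimes> tw d'"
proof (rule tw_unique)
  assume d: "d \<in> carrier D" "d' \<in> carrier D"
  have "tw d \<otimes> tw d' \<otimes> u = (tw d \<otimes> u) \<otimes> d'" using d tw_u[of d'] by (simp add: m_assoc)
  then show "tw d \<otimes> tw d' \<otimes> u = u \<otimes> (d \<otimes> d')" using d tw_u[of d] by (simp add: m_assoc)
  show "d \<otimes> d' \<in> carrier D" using d by (simp flip: m_assoc)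
qed (auto simp: m_assoc)

lemma tw_f [simp]: "tw f = e"
  by (rule tw_unique) auto

lemma ring_D: "ring D"
proof -
  have "\<ominus> d \<in> carrier D" if "d \<in> carrier D" for d
    using that by (simp add: r_minus)
  then have "abelian_group D"
    by (intro abelian_subgroup_structure) (auto simp: r_distr)
  moreover have "monoid D"
    by (rule monoidI) (auto simp: m_assoc D_right_f simp flip: m_assoc[of f])
  ultimately show ?thesis
    by (intro ringI) (auto simp: r_distr l_distr abelian_group_def monoid_def)
qed

lemma column_right_module: "right_module D column"
proof -
  have "\<ominus> c \<in> C" if "c \<in> C" for c using that by (simp add: C_def l_minus)
  then have "abelian_group column"
    by (intro abelian_subgroup_structure) (auto simp: C_add C_closed)
  then show ?thesis
    by (intro right_module.intro right_module_axioms.intro ring_D)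
      (auto simp: C_mult_D C_closed r_distr l_distr m_assoc, auto simp: C_def)
qed

subsection \<open>Coinduced modules\<close>

text \<open>The right adjoint of \<open>M \<mapsto> M f\<close>. A right action on homomorphisms
  arises from left multiplication in their argument \<open>Rf\<close>, and extensionality on
  \<open>C\<close> turns equality into pointwise equality.\<close>

definition coinduced :: "('a, 'v) module \<Rightarrow> ('a, 'a \<Rightarrow> 'v) module" where
  "coinduced V = \<lparr>carrier = rmod_hom D column V, mult = undefined, one = undefined,
     zero = (\<lambda>c\<in>C. \<zero>\<^bsub>V\<^esub>), add = (\<lambda>\<phi> \<psi>. \<lambda>c\<in>C. \<phi> c \<oplus>\<^bsub>V\<^esub> \<psi> c), smult = (\<lambda>r \<psi>. \<lambda>c\<in>C. \<psi> (r \<otimes> c))\<rparr>"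

lemma coinduced_simps [simp]:
  "carrier (coinduced V) = rmod_hom D column V" "zero (coinduced V) = (\<lambda>c\<in>C. \<zero>\<^bsub>V\<^esub>)"
  "add (coinduced V) = (\<lambda>\<phi> \<psi>. \<lambda>c\<in>C. \<phi> c \<oplus>\<^bsub>V\<^esub> \<psi> c)" "smult (coinduced V) = (\<lambda>r \<psi>. \<lambda>c\<in>C. \<psi> (r \<otimes> c))"
  by (simp_all add: coinduced_def)

lemma coind_closed: "\<lbrakk>\<psi> \<in> rmod_hom D column V; c \<in> C\<rbrakk> \<Longrightarrow> \<psi> c \<in> carrier V"
  and coind_add: "\<lbrakk>\<psi> \<in> rmod_hom D column V; c \<in> C; c' \<in> C\<rbrakk> \<Longrightarrow> \<psi> (c \<oplus> c') = \<psi> c \<oplus>\<^bsub>V\<^esub> \<psi> c'"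
  and coind_smult: "\<lbrakk>\<psi> \<in> rmod_hom D column V; d \<in> carrier D; c \<in> C\<rbrakk> \<Longrightarrow> \<psi> (c \<otimes> d) = d \<odot>\<^bsub>V\<^esub> \<psi> c"
  and coind_ext: "\<lbrakk>\<psi> \<in> rmod_hom D column V; \<phi> \<in> rmod_hom D column V; \<And>c. c \<in> C \<Longrightarrow> \<psi> c = \<phi> c\<rbrakk> \<Longrightarrow> \<psi> = \<phi>"
  using rmod_homD[of \<psi> D column V] rmod_homD(4)[of \<phi> D column V]
  by (auto intro: extensionalityI)

lemma coindI:
  assumes "\<And>c. c \<in> C \<Longrightarrow> \<psi> c \<in> carrier V"
    and "\<And>c c'. \<lbrakk>c \<in> C; c' \<in> C\<rbrakk> \<Longrightarrow> \<psi> (c \<oplus> c') = \<psi> c \<oplus>\<^bsub>V\<^esub> \<psi> c'"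
    and "\<And>c d. \<lbrakk>c \<in> C; d \<in> carrier R; f \<otimes> d = d\<rbrakk> \<Longrightarrow> \<psi> (c \<otimes> d) = d \<odot>\<^bsub>V\<^esub> \<psi> c"
  shows "(\<lambda>c\<in>C. \<psi> c) \<in> rmod_hom D column V"
  using rmod_hom_restrictI[OF column_right_module, of \<psi> V] assms by simp

lemma coinduced_right_module:
  assumes "right_module D V" shows "right_module R (coinduced V)"
proof -
  interpret V: right_module D V by fact
  have "abelian_group (coinduced V)"
  proof (rule abelian_groupI; simp only: coinduced_simps)
    fix \<phi> \<psi> assume h: "\<phi> \<in> rmod_hom D column V" "\<psi> \<in> rmod_hom D column V"
    show "(\<lambda>c\<in>C. \<phi> c \<oplus>\<^bsub>V\<^esub> \<psi> c) \<in> rmod_hom D column V"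
      by (rule coindI) (use h in \<open>auto simp: coind_closed coind_add coind_smult V.M.a_ac V.smult_r_distr\<close>)
    show "(\<lambda>c\<in>C. \<phi> c \<oplus>\<^bsub>V\<^esub> \<psi> c) = (\<lambda>c\<in>C. \<psi> c \<oplus>\<^bsub>V\<^esub> \<phi> c)"
      using h by (auto simp: coind_closed V.M.a_comm intro!: restrict_ext)
  next
    fix \<phi> \<psi> \<chi> assume "\<phi> \<in> rmod_hom D column V" "\<psi> \<in> rmod_hom D column V" "\<chi> \<in> rmod_hom D column V"
    then show "(\<lambda>c\<in>C. (\<lambda>c\<in>C. \<phi> c \<oplus>\<^bsub>V\<^esub> \<psi> c) c \<oplus>\<^bsub>V\<^esub> \<chi> c) = (\<lambda>c\<in>C. \<phi> c \<oplus>\<^bsub>V\<^esub> (\<lambda>c\<in>C. \<psi> c \<oplus>\<^bsub>V\<^esub> \<chi> c) c)"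
      by (auto simp: coind_closed V.M.a_assoc intro!: restrict_ext)
  next
    show z: "(\<lambda>c\<in>C. \<zero>\<^bsub>V\<^esub>) \<in> rmod_hom D column V"
      by (rule coindI) auto
    fix \<phi> assume h: "\<phi> \<in> rmod_hom D column V"
    show "(\<lambda>c\<in>C. (\<lambda>c\<in>C. \<zero>\<^bsub>V\<^esub>) c \<oplus>\<^bsub>V\<^esub> \<phi> c) = \<phi>"
      using h rmod_homD(4)[OF h] by (intro extensionalityI[of _ C]) (auto simp: coind_closed)
    have "(\<lambda>c\<in>C. \<ominus>\<^bsub>V\<^esub> \<phi> c) \<in> rmod_hom D column V"
      by (rule coindI) (use h in \<open>auto simp: coind_closed coind_add coind_smult V.M.minus_add V.M.a_comm V.smult_r_minus\<close>)
    then show "\<exists>\<psi>\<in>rmod_hom D column V. (\<lambda>c\<in>C. \<psi> c \<oplus>\<^bsub>V\<^esub> \<phi> c) = (\<lambda>c\<in>C. \<zero>\<^bsub>V\<^esub>)"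
      using h by (intro bexI[of _ "\<lambda>c\<in>C. \<ominus>\<^bsub>V\<^esub> \<phi> c"]) (auto simp: coind_closed V.M.l_neg intro!: restrict_ext)
  qed
  moreover have "right_module_axioms R (coinduced V)"
  proof (rule right_module_axioms.intro; simp only: coinduced_simps)
    fix r \<psi> assume r: "r \<in> carrier R" and h: "\<psi> \<in> rmod_hom D column V"
    show "(\<lambda>c\<in>C. \<psi> (r \<otimes> c)) \<in> rmod_hom D column V"
      by (rule coindI)
        (use r h in \<open>auto simp: coind_closed coind_add coind_smult C_mult C_closed r_distr simp flip: m_assoc\<close>)
    { fix s assume s: "s \<in> carrier R"
      show "(\<lambda>c\<in>C. \<psi> ((r \<oplus> s) \<otimes> c)) = (\<lambda>c\<in>C. (\<lambda>c\<in>C. \<psi> (r \<otimes> c)) c \<oplus>\<^bsub>V\<^esub> (\<lambda>c\<in>C. \<psi> (s \<otimes> c)) c)"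
        using r s h by (auto simp: coind_add C_mult C_closed l_distr intro!: restrict_ext)
      show "(\<lambda>c\<in>C. \<psi> (r \<otimes> s \<otimes> c)) = (\<lambda>c\<in>C. (\<lambda>c\<in>C. \<psi> (r \<otimes> c)) (s \<otimes> c))"
        using r s by (auto simp: C_mult C_closed m_assoc intro!: restrict_ext) }
    { fix \<phi> assume "\<phi> \<in> rmod_hom D column V"
      then show "(\<lambda>c\<in>C. (\<lambda>c\<in>C. \<psi> c \<oplus>\<^bsub>V\<^esub> \<phi> c) (r \<otimes> c)) = (\<lambda>c\<in>C. (\<lambda>c\<in>C. \<psi> (r \<otimes> c)) c \<oplus>\<^bsub>V\<^esub> (\<lambda>c\<in>C. \<phi> (r \<otimes> c)) c)"
        using r by (auto simp: C_mult intro!: restrict_ext) }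
  next
    fix \<psi> assume h: "\<psi> \<in> rmod_hom D column V"
    show "(\<lambda>c\<in>C. \<psi> (\<one> \<otimes> c)) = \<psi>"
      using rmod_homD(4)[OF h] by (intro extensionalityI[of _ C]) (auto simp: C_closed)
  qed
  ultimately show ?thesis by (intro right_module.intro ring_axioms)
qed

lemma coind_finsum:
  assumes V: "right_module D V" and "finite A" "\<And>i. i \<in> A \<Longrightarrow> \<psi> i \<in> rmod_hom D column V" and c: "c \<in> C"
  shows "(\<Oplus>\<^bsub>coinduced V\<^esub>i\<in>A. \<psi> i) c = (\<Oplus>\<^bsub>V\<^esub>i\<in>A. \<psi> i c)"
proof -
  interpret V: right_module D V by fact
  interpret E: right_module R "coinduced V" by (rule coinduced_right_module[OF V])
  show ?thesis using assms(2,3)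
    by (induct set: finite)
      (use c in \<open>auto simp: Pi_def coind_closed\<close>)
qed

text \<open>Apply \<open>\<psi>\<close> to the expansion of \<open>c\<close> along the
  \<open>a k\<close> and pull the coefficients, which lie in \<open>D\<close>, out.\<close>

lemma coind_expand:
  assumes V: "right_module D V" and \<psi>: "\<psi> \<in> rmod_hom D column V" and c: "c \<in> C"
  shows "\<psi> c = (\<Oplus>\<^bsub>V\<^esub>k\<in>K. pr (b k \<otimes> c) \<odot>\<^bsub>V\<^esub> \<psi> (a k))"
proof -
  interpret rmod_homomorphism D column V \<psi>
    using V \<psi> by (intro rmod_homomorphism.intro rmod_homomorphism_axioms.intro column_right_module)
  have C: "C \<subseteq> carrier R" by (auto simp: C_def)
  \<comment> \<open>\<open>column_expand\<close> forms its sum in \<open>R\<close>; it has to be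
    read in \<open>column\<close>, where \<open>\<psi>\<close> is a homomorphism.\<close>
  have fs: "finsum column g A = finsum R g A" if "finite A" "g \<in> A \<rightarrow> C" for g and A :: "'k set"
    using that
  proof (induct set: finite)
    case (insert x F)
    then have "g \<in> F \<rightarrow> C" "g x \<in> C" "g \<in> F \<rightarrow> carrier R" using C by auto
    then show ?case using insert M.M.finsum_insert[of F x g] finsum_insert[of F x g] C by auto
  qed (simp add: finsum_empty)
  have ca: "a k \<otimes> pr (b k \<otimes> c) \<in> C" if "k \<in> K" for k
    using that c by (intro C_mult_D pr_D) (auto simp: C_closed)
  have "c = (\<Oplus>\<^bsub>column\<^esub>k\<in>K. a k \<otimes> pr (b k \<otimes> c))"
    using c column_expand[of c] ca by (subst fs) (auto simp: C_def)
  then have "\<psi> c = \<psi> (\<Oplus>\<^bsub>column\<^esub>k\<in>K. a k \<otimes> pr (b k \<otimes> c))" by simp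
  also have "\<dots> = (\<Oplus>\<^bsub>V\<^esub>k\<in>K. \<psi> (a k \<otimes> pr (b k \<otimes> c)))"
    by (rule finsum) (use ca in auto)
  also have "\<dots> = (\<Oplus>\<^bsub>V\<^esub>k\<in>K. pr (b k \<otimes> c) \<odot>\<^bsub>V\<^esub> \<psi> (a k))"
    by (rule N.M.finsum_cong') (use c in \<open>auto simp: coind_smult[OF \<psi>] coind_closed[OF \<psi>] C_closed\<close>)
  finally show ?thesis .
qed

lemma coind_eqI:
  assumes "right_module D V" "\<phi> \<in> rmod_hom D column V" "\<psi> \<in> rmod_hom D column V"
    and "\<And>k. k \<in> K \<Longrightarrow> \<phi> (a k) = \<psi> (a k)"
  shows "\<phi> = \<psi>"
proof (rule coind_ext[OF assms(2,3)])
  interpret V: right_module D V by fact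
  fix c assume "c \<in> C"
  then show "\<phi> c = \<psi> c"
    unfolding coind_expand[OF assms(1,2) \<open>c \<in> C\<close>] coind_expand[OF assms(1,3) \<open>c \<in> C\<close>]
    using assms by (intro V.M.finsum_cong') (auto simp: coind_closed C_closed)
qed

text \<open>The embedding of \<open>V\<close> as the part at \<open>e\<close> of its coinduced
  module, inverse to evaluation at \<open>u\<close> (see \<open>hat_u\<close> and
  \<open>hat_if_e\<close>). These vectors generate everything else.\<close>

definition hat :: "('a, 'v) module \<Rightarrow> 'v \<Rightarrow> 'a \<Rightarrow> 'v" where
  "hat V v = (\<lambda>c\<in>C. pr c \<odot>\<^bsub>V\<^esub> v)"

lemma hat_closed:
  assumes "right_module D V" "v \<in> carrier V" shows "hat V v \<in> rmod_hom D column V"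
proof -
  interpret V: right_module D V by fact
  show ?thesis unfolding hat_def
    by (rule coindI)
      (use assms(2) V.smult_l_distr V.smult_assoc in \<open>auto simp: C_closed pr_add pr_mult\<close>)
qed

lemma hat_u: "\<lbrakk>right_module D V; v \<in> carrier V\<rbrakk> \<Longrightarrow> hat V v u = v"
  using right_module.smult_one[of D V v] by (simp add: hat_def)

lemma hat_mult: "\<lbrakk>r \<in> carrier R; c \<in> C\<rbrakk> \<Longrightarrow> (r \<odot>\<^bsub>coinduced V\<^esub> hat V v) c = pr (r \<otimes> c) \<odot>\<^bsub>V\<^esub> v"
  by (simp add: hat_def C_mult)

lemma e_hat:
  assumes "right_module D V" "v \<in> carrier V"
  shows "e \<odot>\<^bsub>coinduced V\<^esub> hat V v = hat V v"
  by (auto simp: hat_def C_mult C_closed pr_e intro!: restrict_ext)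

text \<open>The part at \<open>e\<close> is acted on by \<open>eRe\<close>, whereas \<open>V\<close>
  is a module over \<open>D\<close>; \<open>tw\<close> translates one action into the other.\<close>

lemma tw_hat:
  assumes V: "right_module D V" and "v \<in> carrier V" "d \<in> carrier D"
  shows "tw d \<odot>\<^bsub>coinduced V\<^esub> hat V v = hat V (d \<odot>\<^bsub>V\<^esub> v)"
proof -
  interpret V: right_module D V by fact
  show ?thesis using assms(2,3) V.smult_assoc[of d]
    by (auto simp: hat_def C_mult C_closed pr_tw intro!: restrict_ext)
qed

text \<open>Being fixed by \<open>e\<close> allows \<open>c\<close> to be replaced by
  \<open>e c = u pr c\<close>, and linearity over \<open>D\<close> then leaves only the value at
  \<open>u\<close>.\<close>

lemma hat_if_e:
  assumes V: "right_module D V" and \<psi>: "\<psi> \<in> rmod_hom D column V" and e: "e \<odot>\<^bsub>coinduced V\<^esub> \<psi> = \<psi>"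
  shows "\<psi> = hat V (\<psi> u)"
proof (rule coind_ext[OF \<psi> hat_closed[OF V]])
  fix c assume c: "c \<in> C"
  have "\<psi> c = \<psi> (e \<otimes> c)" using c fun_cong[OF e, of c] by simp
  also have "\<dots> = \<psi> (u \<otimes> pr c)" using c by (simp add: u_pr_C)
  finally show "\<psi> c = hat V (\<psi> u) c" using c coind_smult[OF \<psi>, of "pr c" u] by (simp add: hat_def C_closed)
qed (rule coind_closed[OF \<psi> C_u])

text \<open>This is \<open>coind_expand\<close> read as an equation between functions:
  \<open>hat\<close> supplies the values and \<open>b k\<close> the coefficients. It proves
  generation by the part at \<open>e\<close>.\<close>

lemma coind_generated:
  assumes V: "right_module D V" and \<psi>: "\<psi> \<in> rmod_hom D column V"
  shows "\<psi> = (\<Oplus>\<^bsub>coinduced V\<^esub>k\<in>K. b k \<odot>\<^bsub>coinduced V\<^esub> hat V (\<psi> (a k)))"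
proof -
  interpret V: right_module D V by fact
  interpret E: right_module R "coinduced V" by (rule coinduced_right_module[OF V])
  have h: "b k \<odot>\<^bsub>coinduced V\<^esub> hat V (\<psi> (a k)) \<in> rmod_hom D column V" if "k \<in> K" for k
    using E.smult_closed[of "b k" "hat V (\<psi> (a k))"] that hat_closed[OF V] coind_closed[OF \<psi>] by simp
  show ?thesis
  proof (rule coind_ext[OF \<psi>])
    show "(\<Oplus>\<^bsub>coinduced V\<^esub>k\<in>K. b k \<odot>\<^bsub>coinduced V\<^esub> hat V (\<psi> (a k))) \<in> rmod_hom D column V"
      using E.M.finsum_closed[of "\<lambda>k. b k \<odot>\<^bsub>coinduced V\<^esub> hat V (\<psi> (a k))" K] h by auto
    fix c assume c: "c \<in> C"
    have "(\<Oplus>\<^bsub>coinduced V\<^esub>k\<in>K. b k \<odot>\<^bsub>coinduced V\<^esub> hat V (\<psi> (a k))) c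
        = (\<Oplus>\<^bsub>V\<^esub>k\<in>K. (b k \<odot>\<^bsub>coinduced V\<^esub> hat V (\<psi> (a k))) c)"
      by (rule coind_finsum[OF V finite_K h c])
    also have "\<dots> = (\<Oplus>\<^bsub>V\<^esub>k\<in>K. pr (b k \<otimes> c) \<odot>\<^bsub>V\<^esub> \<psi> (a k))"
      by (rule V.M.finsum_cong')
        (use c coind_closed[OF \<psi>] in \<open>auto simp: hat_mult C_closed simp del: coinduced_simps\<close>)
    also have "\<dots> = \<psi> c" by (rule coind_expand[OF V \<psi> c, symmetric])
    finally show "\<psi> c = (\<Oplus>\<^bsub>coinduced V\<^esub>k\<in>K. b k \<odot>\<^bsub>coinduced V\<^esub> hat V (\<psi> (a k))) c" ..
  qed
qed

end

context dual_corner_ring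
begin

subsection \<open>Cosyzygies\<close>

definition fpart where "fpart M = M\<lparr>carrier := {x \<in> carrier M. f \<odot>\<^bsub>M\<^esub> x = x}\<rparr>"

lemma fpart_simps [simp]:
  "carrier (fpart M) = {x \<in> carrier M. f \<odot>\<^bsub>M\<^esub> x = x}" "add (fpart M) = add M"
  "zero (fpart M) = zero M" "smult (fpart M) = smult M"
  by (simp_all add: fpart_def)

lemma fpart_right_module:
  assumes "right_module R M" shows "right_module D (fpart M)"
proof -
  interpret M: right_module R M by fact
  have "abelian_group (fpart M)"
    by (rule M.M.abelian_subgroup_structure) (auto simp: M.smult_r_distr M.smult_r_minus)
  then show ?thesis
    by (intro right_module.intro right_module_axioms.intro ring_D)
      (auto simp: M.smult_l_distr M.smult_r_distr M.smult_assoc D_right_f simp flip: M.smult_assoc[of _ f])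
qed

text \<open>The elementary form of membership in \<open>\<U>\<close> on which all constructions
  operate; the link to projective socles is made only in \<open>socle_side_iff\<close>.\<close>

definition socle_side where
  "socle_side M \<longleftrightarrow> right_module R M \<and>
     (\<forall>x\<in>carrier M. (\<forall>c\<in>C. c \<odot>\<^bsub>M\<^esub> x = \<zero>\<^bsub>M\<^esub>) \<longrightarrow> x = \<zero>\<^bsub>M\<^esub>) \<and> (\<forall>x\<in>carrier M. u \<odot>\<^bsub>M\<^esub> x = \<zero>\<^bsub>M\<^esub>)"

text \<open>The corresponding form for \<open>\<V>\<close>, linked to injective tops in
  \<open>top_side_iff\<close>. Generation is phrased by submodules containing the part at
  \<open>e\<close>.\<close>

definition top_side where
  "top_side N \<longleftrightarrow> right_module R N \<and>
     (\<forall>L. submodule L R N \<and> (\<forall>x\<in>carrier N. e \<odot>\<^bsub>N\<^esub> x \<in> L) \<longrightarrow> L = carrier N) \<and>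
     (\<forall>x\<in>carrier N. u \<odot>\<^bsub>N\<^esub> x = \<zero>\<^bsub>N\<^esub>)"

lemma top_sideD:
  assumes "top_side N"
  shows "right_module R N"
    and "\<lbrakk>submodule L R N; \<And>x. x \<in> carrier N \<Longrightarrow> e \<odot>\<^bsub>N\<^esub> x \<in> L\<rbrakk> \<Longrightarrow> L = carrier N"
    and "x \<in> carrier N \<Longrightarrow> u \<odot>\<^bsub>N\<^esub> x = \<zero>\<^bsub>N\<^esub>"
  using assms by (auto simp: top_side_def)

lemma socle_sideD:
  assumes "socle_side M"
  shows "right_module R M"
    and "\<lbrakk>x \<in> carrier M; \<And>c. c \<in> C \<Longrightarrow> c \<odot>\<^bsub>M\<^esub> x = \<zero>\<^bsub>M\<^esub>\<rbrakk> \<Longrightarrow> x = \<zero>\<^bsub>M\<^esub>"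
    and "x \<in> carrier M \<Longrightarrow> u \<odot>\<^bsub>M\<^esub> x = \<zero>\<^bsub>M\<^esub>"
  using assms by (auto simp: socle_side_def)

text \<open>On the part at \<open>e\<close> an element \<open>c\<close> acts through
  \<open>e c = u pr c\<close>, hence through \<open>u\<close>.\<close>

lemma C_e_eq_zero:
  assumes "right_module R M" "x \<in> carrier M" "c \<in> C" "u \<odot>\<^bsub>M\<^esub> x = \<zero>\<^bsub>M\<^esub>"
  shows "c \<odot>\<^bsub>M\<^esub> (e \<odot>\<^bsub>M\<^esub> x) = \<zero>\<^bsub>M\<^esub>"
proof -
  interpret M: right_module R M by fact
  have "c \<odot>\<^bsub>M\<^esub> (e \<odot>\<^bsub>M\<^esub> x) = (u \<otimes> pr c) \<odot>\<^bsub>M\<^esub> x"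
    using assms by (simp add: u_pr_C C_closed flip: M.smult_assoc)
  then show ?thesis using assms by (simp add: M.smult_assoc C_closed)
qed

lemma socle_side_eqI:
  assumes "socle_side M" "x \<in> carrier M" "y \<in> carrier M" "\<And>c. c \<in> C \<Longrightarrow> c \<odot>\<^bsub>M\<^esub> x = c \<odot>\<^bsub>M\<^esub> y"
  shows "x = y"
proof -
  interpret M: right_module R M by (rule socle_sideD(1)[OF assms(1)])
  have "x \<ominus>\<^bsub>M\<^esub> y = \<zero>\<^bsub>M\<^esub>"
    by (rule socle_sideD(2)[OF assms(1)]) (use assms in \<open>auto simp: M.smult_r_diff C_closed\<close>)
  then show ?thesis using assms by simp
qed

text \<open>The element is torsion by \<open>C_e_eq_zero\<close>. So the objects of
  \<open>\<U>\<close> have no component at the least index.\<close>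

lemma socle_side_e: "\<lbrakk>socle_side M; x \<in> carrier M\<rbrakk> \<Longrightarrow> e \<odot>\<^bsub>M\<^esub> x = \<zero>\<^bsub>M\<^esub>"
  by (rule socle_sideD(2))
    (auto simp: C_e_eq_zero socle_sideD intro: right_module.smult_closed[OF socle_sideD(1)])

text \<open>The elements annihilated by \<open>C\<close> form a submodule, \<open>C\<close> being a
  left ideal, and this submodule contains the generating part at \<open>e\<close>. So the objects of
  \<open>\<V>\<close> have no component at the greatest index.\<close>

lemma top_side_C:
  assumes N: "top_side N" and x: "x \<in> carrier N" and c: "c \<in> C"
  shows "c \<odot>\<^bsub>N\<^esub> x = \<zero>\<^bsub>N\<^esub>"
proof -
  interpret N: right_module R N by (rule top_sideD(1)[OF N])
  have "submodule {x \<in> carrier N. \<forall>c\<in>C. c \<odot>\<^bsub>N\<^esub> x = \<zero>\<^bsub>N\<^esub>} R N"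
    by (auto simp: N.submodule_iff N.smult_r_distr C_closed C_mult simp flip: N.smult_assoc)
  from top_sideD(2)[OF N this] have "{x \<in> carrier N. \<forall>c\<in>C. c \<odot>\<^bsub>N\<^esub> x = \<zero>\<^bsub>N\<^esub>} = carrier N"
    using N by (auto simp: C_e_eq_zero top_sideD)
  then show ?thesis using x c by blast
qed

lemma map_coind:
  assumes "h \<in> rmod_hom D V V'" "\<psi> \<in> rmod_hom D column V"
  shows "compose C h \<psi> \<in> rmod_hom D column V'"
  using rmod_hom_compose[OF column_right_module assms(2,1)] by simp

lemma map_coind_hom:
  assumes "right_module D V" "h \<in> rmod_hom D V V'"
  shows "restrict (compose C h) (rmod_hom D column V) \<in> rmod_hom R (coinduced V) (coinduced V')"
proof -
  have "restrict (compose C h) (carrier (coinduced V)) \<in> rmod_hom R (coinduced V) (coinduced V')"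
    by (rule rmod_hom_restrictI[OF coinduced_right_module[OF assms(1)]])
      (use map_coind[OF assms(2)] rmod_homD[OF assms(2)] in
        \<open>auto simp: compose_def C_mult coind_closed fun_eq_iff\<close>)
  then show ?thesis by simp
qed

lemma fpart_hom:
  assumes "right_module R M" "h \<in> rmod_hom R M M'"
  shows "restrict h (carrier (fpart M)) \<in> rmod_hom D (fpart M) (fpart M')"
  by (rule rmod_hom_restrictI[OF fpart_right_module[OF assms(1)]])
    (use rmod_homD[OF assms(2)] in \<open>auto simp flip: rmod_homD(3)[OF assms(2)]\<close>)

text \<open>The unit of the adjunction between \<open>fpart\<close> and coinduction; injective
  exactly when no nonzero element is torsion.\<close>

definition iota :: "('a, 'v) module \<Rightarrow> 'v \<Rightarrow> 'a \<Rightarrow> 'v" where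
  "iota M = (\<lambda>x\<in>carrier M. \<lambda>c\<in>C. c \<odot>\<^bsub>M\<^esub> x)"

lemma iota_hom:
  assumes "right_module R M" shows "iota M \<in> rmod_hom R M (coinduced (fpart M))"
proof -
  interpret M: right_module R M by fact
  show ?thesis unfolding iota_def
  proof (rule rmod_hom_restrictI[OF assms])
    fix x assume x: "x \<in> carrier M"
    have "(\<lambda>c\<in>C. c \<odot>\<^bsub>M\<^esub> x) \<in> rmod_hom D column (fpart M)"
      by (rule coindI)
        (use x in \<open>auto simp: C_closed M.smult_l_distr M.smult_assoc, auto simp: C_def simp flip: M.smult_assoc\<close>)
    then show "(\<lambda>c\<in>C. c \<odot>\<^bsub>M\<^esub> x) \<in> carrier (coinduced (fpart M))" by simp
    show "(\<lambda>c\<in>C. c \<odot>\<^bsub>M\<^esub> (r \<odot>\<^bsub>M\<^esub> x)) = r \<odot>\<^bsub>coinduced (fpart M)\<^esub> (\<lambda>c\<in>C. c \<odot>\<^bsub>M\<^esub> x)" if "r \<in> carrier R" for r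
      using that x by (auto simp: C_mult C_closed M.smult_assoc intro!: restrict_ext)
    show "(\<lambda>c\<in>C. c \<odot>\<^bsub>M\<^esub> (x \<oplus>\<^bsub>M\<^esub> y)) = (\<lambda>c\<in>C. c \<odot>\<^bsub>M\<^esub> x) \<oplus>\<^bsub>coinduced (fpart M)\<^esub> (\<lambda>c\<in>C. c \<odot>\<^bsub>M\<^esub> y)"
      if "y \<in> carrier M" for y
      using that x by (auto simp: C_closed M.smult_r_distr intro!: restrict_ext)
  qed
qed

lemma iota_apply: "\<lbrakk>x \<in> carrier M; c \<in> C\<rbrakk> \<Longrightarrow> iota M x c = c \<odot>\<^bsub>M\<^esub> x"
  by (simp add: iota_def)

lemma exists_coind_code:
  fixes V :: "('a, 'u) module"
  assumes inf: "infinite (UNIV :: 'u set)" and V: "right_module D V"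
  shows "\<exists>c :: ('a \<Rightarrow> 'u) \<Rightarrow> 'u. inj_on c (rmod_hom D column V)"
proof -
  obtain c :: "('k \<Rightarrow> 'u) \<Rightarrow> 'u" where c: "inj_on c (K \<rightarrow>\<^sub>E UNIV)"
    using exists_inj_PiE[OF inf finite_K] by blast
  have "inj_on (\<lambda>\<psi>. c (restrict (\<psi> \<circ> a) K)) (rmod_hom D column V)"
  proof (rule inj_onI)
    fix \<phi> \<psi> assume h: "\<phi> \<in> rmod_hom D column V" "\<psi> \<in> rmod_hom D column V"
      and "c (restrict (\<phi> \<circ> a) K) = c (restrict (\<psi> \<circ> a) K)"
    then have "restrict (\<phi> \<circ> a) K = restrict (\<psi> \<circ> a) K" using inj_onD[OF c] by simp
    then have "\<phi> (a k) = \<psi> (a k)" if "k \<in> K" for k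
      using that by (metis comp_apply restrict_apply')
    then show "\<phi> = \<psi>" by (rule coind_eqI[OF V h])
  qed
  then show ?thesis by blast
qed

text \<open>A relation, because the cokernel is determined only up to isomorphism and a carrier
  inside the module type must still be chosen.\<close>

definition cosyzygy :: "('a, 'v) module \<Rightarrow> ('a, 'v) module \<Rightarrow> (('a \<Rightarrow> 'v) \<Rightarrow> 'v) \<Rightarrow> bool" where
  "cosyzygy M Q q \<longleftrightarrow> right_module R Q \<and> q \<in> rmod_hom R (coinduced (fpart M)) Q \<and>
     q ` rmod_hom D column (fpart M) = carrier Q \<and>
     (\<forall>\<psi>\<in>rmod_hom D column (fpart M). q \<psi> = \<zero>\<^bsub>Q\<^esub> \<longleftrightarrow> \<psi> \<in> iota M ` carrier M)"

lemma exists_cosyzygy: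
  fixes M :: "('a, 'u) module"
  assumes inf: "infinite (UNIV :: 'u set)" and M: "right_module R M"
  shows "\<exists>Q q. cosyzygy M Q q"
proof -
  interpret M: right_module R M by fact
  note V = fpart_right_module[OF M]
  interpret E: right_module R "coinduced (fpart M)" by (rule coinduced_right_module[OF V])
  interpret i: rmod_homomorphism R M "coinduced (fpart M)" "iota M"
    by (intro rmod_homomorphism.intro rmod_homomorphism_axioms.intro M E.right_module_axioms iota_hom)
  obtain c :: "('a \<Rightarrow> 'u) \<Rightarrow> 'u" where "inj_on c (carrier (coinduced (fpart M)))"
    using exists_coind_code[OF inf V] by auto
  from E.exists_quotient[OF i.image_submodule[OF M.carrier_submodule] this]
  show ?thesis unfolding cosyzygy_def by (simp del: coinduced_simps(2-4))
qed

end

text \<open>\<open>Fo\<close> and \<open>q\<close> fix one cosyzygy for each object; the action on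
  arrows is then forced.\<close>

locale cosyzygy_functor = dual_corner_ring +
  fixes Fo :: "('a, 'u) module \<Rightarrow> ('a, 'u) module" and q :: "('a, 'u) module \<Rightarrow> ('a \<Rightarrow> 'u) \<Rightarrow> 'u"
  assumes infinite_universe: "infinite (UNIV :: 'u set)"
    and cosyz: "socle_side M \<Longrightarrow> cosyzygy M (Fo M) (q M)"
begin

abbreviation E where "E M \<equiv> rmod_hom D column (fpart M)"

lemma V_module: "socle_side M \<Longrightarrow> right_module D (fpart M)"
  by (rule fpart_right_module[OF socle_sideD(1)])

lemma E_module: "socle_side M \<Longrightarrow> right_module R (coinduced (fpart M))"
  by (rule coinduced_right_module[OF V_module])

lemma Fo_module: "socle_side M \<Longrightarrow> right_module R (Fo M)"
  using cosyz by (simp add: cosyzygy_def)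

lemma q_hom: "socle_side M \<Longrightarrow> q M \<in> rmod_hom R (coinduced (fpart M)) (Fo M)"
  using cosyz by (simp add: cosyzygy_def)

lemma q_homomorphism: "socle_side M \<Longrightarrow> rmod_homomorphism R (coinduced (fpart M)) (Fo M) (q M)"
  by (intro rmod_homomorphism.intro rmod_homomorphism_axioms.intro q_hom E_module Fo_module)

lemma q_surj: "socle_side M \<Longrightarrow> q M ` E M = carrier (Fo M)"
  using cosyz by (simp add: cosyzygy_def)

lemma q_closed: "\<lbrakk>socle_side M; \<psi> \<in> E M\<rbrakk> \<Longrightarrow> q M \<psi> \<in> carrier (Fo M)"
  using q_surj by blast

lemma q_cases:
  assumes "socle_side M" "y \<in> carrier (Fo M)" obtains \<psi> where "\<psi> \<in> E M" "y = q M \<psi>"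
  using assms q_surj by blast

lemma q_zero_iff: "\<lbrakk>socle_side M; \<psi> \<in> E M\<rbrakk> \<Longrightarrow> q M \<psi> = \<zero>\<^bsub>Fo M\<^esub> \<longleftrightarrow> (\<exists>x\<in>carrier M. \<psi> = iota M x)"
  using cosyz by (auto simp: cosyzygy_def)

lemma iota_closed: "\<lbrakk>socle_side M; x \<in> carrier M\<rbrakk> \<Longrightarrow> iota M x \<in> E M"
  using rmod_homD(1)[OF iota_hom[OF socle_sideD(1)]] by simp

lemma compose_fpart: "\<psi> \<in> E M \<Longrightarrow> compose C (restrict h (carrier (fpart M))) \<psi> = compose C h \<psi>"
  using coind_closed[of \<psi> "fpart M"] by (auto simp: compose_def fun_eq_iff)

lemma compose_closed:
  "\<lbrakk>right_module R M; h \<in> rmod_hom R M M'; \<psi> \<in> E M\<rbrakk> \<Longrightarrow> compose C h \<psi> \<in> E M'"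
  using map_coind[OF fpart_hom, of M h M' \<psi>] by (simp only: compose_fpart)

lemma compose_hom:
  assumes "right_module R M" "h \<in> rmod_hom R M M'"
  shows "restrict (compose C h) (E M) \<in> rmod_hom R (coinduced (fpart M)) (coinduced (fpart M'))"
proof -
  have "restrict (compose C (restrict h (carrier (fpart M)))) (E M) = restrict (compose C h) (E M)"
    by (rule restrict_ext) (rule compose_fpart)
  then show ?thesis
    using map_coind_hom[OF fpart_right_module[OF assms(1)] fpart_hom[OF assms]] by (simp only:)
qed

lemma compose_iota:
  assumes "right_module R M" "h \<in> rmod_hom R M M'" "x \<in> carrier M"
  shows "compose C h (iota M x) = iota M' (h x)"
  using assms rmod_homD[OF assms(2)] by (auto simp: compose_def iota_def C_closed fun_eq_iff)

text \<open>The induced map on cokernels, unique because \<open>q M\<close> is onto (see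
  \<open>Fo_hom_eqI\<close>).\<close>

definition Fa :: "('a, 'u) module \<Rightarrow> ('a, 'u) module \<Rightarrow> ('u \<Rightarrow> 'u) \<Rightarrow> 'u \<Rightarrow> 'u" where
  "Fa M M' h = (SOME g. g \<in> rmod_hom R (Fo M) (Fo M') \<and> (\<forall>\<psi>\<in>E M. g (q M \<psi>) = q M' (compose C h \<psi>)))"

text \<open>By naturality of \<open>iota\<close>, composition with \<open>h\<close> sends the kernel
  of \<open>q M\<close> into that of \<open>q M'\<close>, so the composite factors.\<close>

lemma Fa_spec:
  assumes M: "socle_side M" and M': "socle_side M'" and h: "h \<in> rmod_hom R M M'"
  shows "Fa M M' h \<in> rmod_hom R (Fo M) (Fo M') \<and> (\<forall>\<psi>\<in>E M. Fa M M' h (q M \<psi>) = q M' (compose C h \<psi>))"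
proof -
  note MR = socle_sideD(1)[OF M]
  let ?g = "compose (E M) (q M') (restrict (compose C h) (E M))"
  have g: "?g \<in> rmod_hom R (coinduced (fpart M)) (Fo M')"
    using rmod_hom_compose[OF E_module[OF M] compose_hom[OF MR h] q_hom[OF M']] by simp
  have "\<exists>k\<in>rmod_hom R (Fo M) (Fo M'). \<forall>\<psi>\<in>carrier (coinduced (fpart M)). k (q M \<psi>) = ?g \<psi>"
  proof (rule factor_hom[OF E_module[OF M] Fo_module[OF M] Fo_module[OF M'] q_hom[OF M] _ g])
    fix \<psi> assume "\<psi> \<in> carrier (coinduced (fpart M))" and "q M \<psi> = \<zero>\<^bsub>Fo M\<^esub>"
    then obtain x where \<psi>: "\<psi> \<in> E M" and x: "x \<in> carrier M" "\<psi> = iota M x"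
      using q_zero_iff[OF M] by auto
    have hx: "h x \<in> carrier M'" using x rmod_homD(1)[OF h] by simp
    then have "q M' (iota M' (h x)) = \<zero>\<^bsub>Fo M'\<^esub>"
      using q_zero_iff[OF M'] iota_closed[OF M'] by blast
    then show "?g \<psi> = \<zero>\<^bsub>Fo M'\<^esub>"
      using \<psi> x compose_iota[OF MR h] by (simp add: compose_eq)
  qed (use q_surj[OF M] in simp)
  then have "\<exists>k. k \<in> rmod_hom R (Fo M) (Fo M') \<and> (\<forall>\<psi>\<in>E M. k (q M \<psi>) = q M' (compose C h \<psi>))"
    by (auto simp: compose_eq)
  from someI_ex[OF this] show ?thesis unfolding Fa_def .
qed

lemmas Fa_hom = Fa_spec[THEN conjunct1]

lemma Fa_q:
  "\<lbrakk>socle_side M; socle_side M'; h \<in> rmod_hom R M M'; \<psi> \<in> E M\<rbrakk> \<Longrightarrow> Fa M M' h (q M \<psi>) = q M' (compose C h \<psi>)"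
  using Fa_spec by blast

lemma Fo_hom_eqI:
  assumes M: "socle_side M" and "g \<in> rmod_hom R (Fo M) N" "g' \<in> rmod_hom R (Fo M) N"
    and eq: "\<And>\<psi>. \<psi> \<in> E M \<Longrightarrow> g (q M \<psi>) = g' (q M \<psi>)"
  shows "g = g'"
proof (rule extensionalityI[of _ "carrier (Fo M)"])
  fix y assume "y \<in> carrier (Fo M)"
  then show "g y = g' y" using q_cases[OF M] eq by metis
qed (use assms rmod_homD(4) in blast)+

lemma Fa_id:
  assumes M: "socle_side M"
  shows "Fa M M (restrict (\<lambda>x. x) (carrier M)) = restrict (\<lambda>x. x) (carrier (Fo M))"
proof (rule Fo_hom_eqI[OF M Fa_hom[OF M M rmod_hom_id[OF socle_sideD(1)[OF M]]] rmod_hom_id[OF Fo_module[OF M]]])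
  fix \<psi> assume \<psi>: "\<psi> \<in> E M"
  have "compose C (restrict (\<lambda>x. x) (carrier M)) \<psi> = \<psi>"
    by (rule coind_ext[OF compose_closed[OF socle_sideD(1)[OF M] rmod_hom_id[OF socle_sideD(1)[OF M]] \<psi>] \<psi>])
      (use coind_closed[OF \<psi>] in \<open>auto simp: compose_eq\<close>)
  then show "Fa M M (restrict (\<lambda>x. x) (carrier M)) (q M \<psi>) = restrict (\<lambda>x. x) (carrier (Fo M)) (q M \<psi>)"
    using Fa_q[OF M M rmod_hom_id[OF socle_sideD(1)[OF M]] \<psi>] q_closed[OF M \<psi>] by simp
qed

lemma Fa_compose:
  assumes L: "socle_side L" and M: "socle_side M" and N: "socle_side N"
    and g: "g \<in> rmod_hom R L M" and h: "h \<in> rmod_hom R M N"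
  shows "Fa L N (compose (carrier L) h g) = compose (carrier (Fo L)) (Fa M N h) (Fa L M g)"
proof (rule Fo_hom_eqI[OF L])
  note LR = socle_sideD(1)[OF L] and MR = socle_sideD(1)[OF M]
  have hg: "compose (carrier L) h g \<in> rmod_hom R L N" by (rule rmod_hom_compose[OF LR g h])
  show "Fa L N (compose (carrier L) h g) \<in> rmod_hom R (Fo L) (Fo N)" by (rule Fa_hom[OF L N hg])
  show "compose (carrier (Fo L)) (Fa M N h) (Fa L M g) \<in> rmod_hom R (Fo L) (Fo N)"
    by (rule rmod_hom_compose[OF Fo_module[OF L] Fa_hom[OF L M g] Fa_hom[OF M N h]])
  fix \<psi> assume \<psi>: "\<psi> \<in> E L"
  have "compose C (compose (carrier L) h g) \<psi> = compose C h (compose C g \<psi>)"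
    using coind_closed[OF \<psi>] by (auto simp: compose_def fun_eq_iff)
  then show "Fa L N (compose (carrier L) h g) (q L \<psi>) = compose (carrier (Fo L)) (Fa M N h) (Fa L M g) (q L \<psi>)"
    using q_closed[OF L \<psi>] \<psi> compose_closed[OF LR g \<psi>]
    by (simp add: compose_eq Fa_q L M N g h hg)
qed

lemma hat_closed_E: "\<lbrakk>socle_side M; v \<in> carrier (fpart M)\<rbrakk> \<Longrightarrow> hat (fpart M) v \<in> E M"
  by (rule hat_closed[OF V_module])

text \<open>If a \<open>hat\<close> vector is \<open>iota x\<close>, applying \<open>e\<close> shows
  that it is also \<open>iota\<close> of the part of \<open>x\<close> at \<open>e\<close>, which
  vanishes on the socle side. Thus the part at \<open>e\<close> survives in the cokernel.\<close>

lemma q_hat_zero: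
  assumes M: "socle_side M" and v: "v \<in> carrier (fpart M)" and "q M (hat (fpart M) v) = \<zero>\<^bsub>Fo M\<^esub>"
  shows "v = \<zero>\<^bsub>M\<^esub>"
proof -
  interpret M: right_module R M by (rule socle_sideD(1)[OF M])
  obtain x where x: "x \<in> carrier M" "hat (fpart M) v = iota M x"
    using assms q_zero_iff[OF M hat_closed_E[OF M v]] by blast
  have "hat (fpart M) v = e \<odot>\<^bsub>coinduced (fpart M)\<^esub> iota M x"
    using e_hat[OF V_module[OF M] v] x(2) by simp
  also have "\<dots> = iota M (e \<odot>\<^bsub>M\<^esub> x)"
    using rmod_homD(3)[OF iota_hom[OF socle_sideD(1)[OF M]] e_closed x(1)] ..
  also have "\<dots> = iota M \<zero>\<^bsub>M\<^esub>" using socle_side_e[OF M x(1)] by simp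
  finally have "hat (fpart M) v u = u \<odot>\<^bsub>M\<^esub> \<zero>\<^bsub>M\<^esub>" by (simp add: iota_apply)
  then show ?thesis using hat_u[OF V_module[OF M] v] by simp
qed

lemma hat_diff:
  assumes V: "right_module D V" and v: "v \<in> carrier V" and w: "w \<in> carrier V"
  shows "hat V (v \<oplus>\<^bsub>V\<^esub> w) = hat V v \<oplus>\<^bsub>coinduced V\<^esub> hat V w"
    "hat V (v \<ominus>\<^bsub>V\<^esub> w) = hat V v \<ominus>\<^bsub>coinduced V\<^esub> hat V w"
proof -
  interpret V: right_module D V by fact
  interpret E: right_module R "coinduced V" by (rule coinduced_right_module[OF V])
  have add: "hat V (x \<oplus>\<^bsub>V\<^esub> y) = hat V x \<oplus>\<^bsub>coinduced V\<^esub> hat V y" if "x \<in> carrier V" "y \<in> carrier V" for x y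
    using that by (auto simp: hat_def V.smult_r_distr C_closed intro!: restrict_ext)
  then show "hat V (v \<oplus>\<^bsub>V\<^esub> w) = hat V v \<oplus>\<^bsub>coinduced V\<^esub> hat V w" using v w .
  have c: "hat V x \<in> carrier (coinduced V)" if "x \<in> carrier V" for x using hat_closed[OF V that] by simp
  have "hat V v = hat V (v \<ominus>\<^bsub>V\<^esub> w) \<oplus>\<^bsub>coinduced V\<^esub> hat V w"
    using add[of "v \<ominus>\<^bsub>V\<^esub> w" w] v w by (simp add: a_minus_def V.M.a_assoc V.M.l_neg)
  then show "hat V (v \<ominus>\<^bsub>V\<^esub> w) = hat V v \<ominus>\<^bsub>coinduced V\<^esub> hat V w"
    using c v w by (simp add: a_minus_def E.M.a_assoc E.M.r_neg del: coinduced_simps)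
qed

lemma q_hat_inj:
  assumes M: "socle_side M" and v: "v \<in> carrier (fpart M)" and w: "w \<in> carrier (fpart M)"
    and "q M (hat (fpart M) v) = q M (hat (fpart M) w)"
  shows "v = w"
proof -
  note VM = V_module[OF M]
  interpret V: right_module D "fpart M" by (rule VM)
  interpret q: rmod_homomorphism R "coinduced (fpart M)" "Fo M" "q M" by (rule q_homomorphism[OF M])
  have c: "hat (fpart M) x \<in> carrier (coinduced (fpart M))" if "x \<in> carrier (fpart M)" for x
    using hat_closed[OF VM that] by simp
  have "q M (hat (fpart M) (v \<ominus>\<^bsub>fpart M\<^esub> w)) = \<zero>\<^bsub>Fo M\<^esub>"
    unfolding hat_diff(2)[OF VM v w] using assms c by (simp del: coinduced_simps fpart_simps)
  then have "v \<ominus>\<^bsub>fpart M\<^esub> w = \<zero>\<^bsub>fpart M\<^esub>" using q_hat_zero[OF M V.M.minus_closed[OF v w]] by simp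
  then show ?thesis using v w V.M.diff_eq_zero_iff by blast
qed

text \<open>Generation by the part at \<open>e\<close> holds in the coinduced module and passes to
  quotients. That \<open>u\<close> acts as zero is the effect of dividing by the image of
  \<open>iota\<close>.\<close>

lemma top_side_Fo:
  assumes M: "socle_side M" shows "top_side (Fo M)"
  unfolding top_side_def
proof (intro conjI allI impI ballI)
  note MR = socle_sideD(1)[OF M]
  note VM = V_module[OF M]
  interpret M: right_module R M by (rule MR)
  interpret q: rmod_homomorphism R "coinduced (fpart M)" "Fo M" "q M" by (rule q_homomorphism[OF M])
  show "right_module R (Fo M)" by (rule Fo_module[OF M])
  fix L assume L: "submodule L R (Fo M) \<and> (\<forall>x\<in>carrier (Fo M). e \<odot>\<^bsub>Fo M\<^esub> x \<in> L)"
  have "y \<in> L" if y: "y \<in> carrier (Fo M)" for y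
  proof -
    obtain \<psi> where \<psi>: "\<psi> \<in> E M" "y = q M \<psi>" by (rule q_cases[OF M y])
    have hc: "hat (fpart M) (\<psi> (a k)) \<in> carrier (coinduced (fpart M))" if "k \<in> K" for k
      using hat_closed[OF VM coind_closed[OF \<psi>(1) C_a[OF that]]] by simp
    have hL: "q M (hat (fpart M) (\<psi> (a k))) \<in> L" if k: "k \<in> K" for k
    proof -
      have "q M (hat (fpart M) (\<psi> (a k))) = q M (e \<odot>\<^bsub>coinduced (fpart M)\<^esub> hat (fpart M) (\<psi> (a k)))"
        by (simp only: e_hat[OF VM coind_closed[OF \<psi>(1) C_a[OF k]]])
      also have "\<dots> = e \<odot>\<^bsub>Fo M\<^esub> q M (hat (fpart M) (\<psi> (a k)))" by (rule q.smult[OF e_closed hc[OF k]])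
      finally show ?thesis using L q.closed[OF hc[OF k]] by metis
    qed
    have "y = q M (\<Oplus>\<^bsub>coinduced (fpart M)\<^esub>k\<in>K. b k \<odot>\<^bsub>coinduced (fpart M)\<^esub> hat (fpart M) (\<psi> (a k)))"
      unfolding \<psi>(2) by (rule arg_cong[OF coind_generated[OF VM \<psi>(1)]])
    also have "\<dots> = (\<Oplus>\<^bsub>Fo M\<^esub>k\<in>K. q M (b k \<odot>\<^bsub>coinduced (fpart M)\<^esub> hat (fpart M) (\<psi> (a k))))"
      by (rule q.finsum) (use hc in \<open>auto simp del: coinduced_simps\<close>)
    also have "\<dots> = (\<Oplus>\<^bsub>Fo M\<^esub>k\<in>K. b k \<odot>\<^bsub>Fo M\<^esub> q M (hat (fpart M) (\<psi> (a k))))"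
      by (rule q.N.M.finsum_cong') (use hc in \<open>auto simp del: coinduced_simps\<close>)
    also have "\<dots> \<in> L"
      by (rule q.N.submodule_finsum) (use L hL q.N.submodule_smult in auto)
    finally show ?thesis .
  qed
  then show "L = carrier (Fo M)" using L q.N.submodule_subset by blast
next
  fix y assume y: "y \<in> carrier (Fo M)"
  note MR = socle_sideD(1)[OF M]
  interpret M: right_module R M by (rule MR)
  interpret q: rmod_homomorphism R "coinduced (fpart M)" "Fo M" "q M" by (rule q_homomorphism[OF M])
  obtain \<psi> where \<psi>: "\<psi> \<in> E M" "y = q M \<psi>" by (rule q_cases[OF M y])
  have \<psi>u: "\<psi> u \<in> carrier M" using coind_closed[OF \<psi>(1) C_u] by simp
  have uE: "u \<odot>\<^bsub>coinduced (fpart M)\<^esub> \<psi> \<in> E M" using q.M.smult_closed[OF u_closed, of \<psi>] \<psi> by simp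
  have "u \<odot>\<^bsub>coinduced (fpart M)\<^esub> \<psi> = iota M (\<psi> u)"
  proof (rule coind_ext[OF uE iota_closed[OF M \<psi>u]])
    fix c assume c: "c \<in> C"
    \<comment> \<open>As \<open>u = u f\<close> and \<open>f c\<close> lies in \<open>D\<close>,
      linearity turns this value into the action of \<open>c\<close> on \<open>\<psi> u\<close>. So
      acting by \<open>u\<close> always produces an element of the image of
      \<open>iota\<close>.\<close>
    have "\<psi> (u \<otimes> c) = \<psi> (u \<otimes> (f \<otimes> c))" using c by (simp add: C_closed flip: m_assoc)
    also have "\<dots> = (f \<otimes> c) \<odot>\<^bsub>M\<^esub> \<psi> u"
      using coind_smult[OF \<psi>(1) f_mult_D[OF C_closed[OF c]] C_u] by simp
    also have "\<dots> = c \<odot>\<^bsub>M\<^esub> \<psi> u"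
      using c coind_closed[OF \<psi>(1) C_u] M.smult_assoc[of f c "\<psi> u"] by (simp add: C_closed)
    finally show "(u \<odot>\<^bsub>coinduced (fpart M)\<^esub> \<psi>) c = iota M (\<psi> u) c" using c \<psi>u by (simp add: iota_apply)
  qed
  then have "q M (u \<odot>\<^bsub>coinduced (fpart M)\<^esub> \<psi>) = \<zero>\<^bsub>Fo M\<^esub>"
    using q_zero_iff[OF M uE] \<psi>u by blast
  then show "u \<odot>\<^bsub>Fo M\<^esub> y = \<zero>\<^bsub>Fo M\<^esub>" using q.smult[OF u_closed, of \<psi>] \<psi> by simp
qed

end

context cosyzygy_functor
begin

subsection \<open>Full faithfulness and exactness\<close>

lemma hom_fpart_apply:
  assumes M: "right_module R M" and M': "right_module R M'"
    and h: "h \<in> rmod_hom R M M'" and x: "x \<in> carrier M" and c: "c \<in> C"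
  shows "c \<odot>\<^bsub>M\<^esub> x \<in> carrier (fpart M)" "h (c \<odot>\<^bsub>M\<^esub> x) = c \<odot>\<^bsub>M'\<^esub> h x"
proof -
  interpret M: right_module R M by fact
  show "c \<odot>\<^bsub>M\<^esub> x \<in> carrier (fpart M)"
    using x c by (simp add: C_closed flip: M.smult_assoc) (simp add: C_def)
  show "h (c \<odot>\<^bsub>M\<^esub> x) = c \<odot>\<^bsub>M'\<^esub> h x" using rmod_homD(3)[OF h] x c by (simp add: C_closed)
qed

text \<open>On \<open>hat\<close> vectors \<open>Fa M M' h\<close> remembers \<open>h\<close> on the
  part at \<open>f\<close>, and a map into the torsion free \<open>M'\<close> is determined by its
  restriction to that part.\<close>

lemma Fa_faithful:
  assumes M: "socle_side M" and M': "socle_side M'"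
    and h: "h \<in> rmod_hom R M M'" and k: "k \<in> rmod_hom R M M'" and eq: "Fa M M' h = Fa M M' k"
  shows "h = k"
proof (rule extensionalityI[OF rmod_homD(4)[OF h] rmod_homD(4)[OF k]])
  note MR = socle_sideD(1)[OF M] and MR' = socle_sideD(1)[OF M']
  have ch: "g v \<in> carrier (fpart M')" and hh: "compose C g (hat (fpart M) v) = hat (fpart M') (g v)"
    if g: "g \<in> rmod_hom R M M'" and v: "v \<in> carrier (fpart M)" for g v
  proof -
    show gv: "g v \<in> carrier (fpart M')"
      using v rmod_homD(1)[OF g, of v] rmod_homD(3)[OF g f_closed, of v] by simp
    show "compose C g (hat (fpart M) v) = hat (fpart M') (g v)"
      by (rule coind_ext[OF compose_closed[OF MR g hat_closed_E[OF M v]] hat_closed_E[OF M' gv]])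
        (use v rmod_homD(3)[OF g] in \<open>simp add: compose_eq hat_def C_closed\<close>)
  qed
  have hk: "h v = k v" if v: "v \<in> carrier (fpart M)" for v
  proof (rule q_hat_inj[OF M' ch[OF h v] ch[OF k v]])
    show "q M' (hat (fpart M') (h v)) = q M' (hat (fpart M') (k v))"
      using eq Fa_q[OF M M' h hat_closed_E[OF M v]] Fa_q[OF M M' k hat_closed_E[OF M v]]
      by (simp only: hh[OF h v] hh[OF k v])
  qed
  fix x assume x: "x \<in> carrier M"
  show "h x = k x"
  proof (rule socle_side_eqI[OF M'])
    fix c assume c: "c \<in> C"
    show "c \<odot>\<^bsub>M'\<^esub> h x = c \<odot>\<^bsub>M'\<^esub> k x"
      using hk[OF hom_fpart_apply(1)[OF MR MR' h x c]] hom_fpart_apply(2)[OF MR MR' h x c]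
        hom_fpart_apply(2)[OF MR MR' k x c] by simp
  qed (use x rmod_homD(1)[OF h] rmod_homD(1)[OF k] in auto)
qed

text \<open>Acting by \<open>e\<close> on any preimage under \<open>q M\<close> produces a preimage
  fixed by \<open>e\<close>, and such elements are \<open>hat\<close> vectors.\<close>

lemma e_fixed_is_hat:
  assumes M: "socle_side M" and y: "y \<in> carrier (Fo M)" "e \<odot>\<^bsub>Fo M\<^esub> y = y"
  shows "\<exists>w\<in>carrier (fpart M). q M (hat (fpart M) w) = y"
proof -
  note VM = V_module[OF M]
  interpret q: rmod_homomorphism R "coinduced (fpart M)" "Fo M" "q M" by (rule q_homomorphism[OF M])
  obtain \<psi> where \<psi>: "\<psi> \<in> E M" "y = q M \<psi>" by (rule q_cases[OF M y(1)])
  let ?\<phi> = "e \<odot>\<^bsub>coinduced (fpart M)\<^esub> \<psi>"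
  have \<psi>c: "\<psi> \<in> carrier (coinduced (fpart M))" using \<psi>(1) by simp
  have \<phi>: "?\<phi> \<in> E M" using q.M.smult_closed[OF e_closed \<psi>c] by simp
  have "e \<odot>\<^bsub>coinduced (fpart M)\<^esub> ?\<phi> = ?\<phi>" using q.M.smult_assoc[OF e_closed e_closed \<psi>c] by (simp del: coinduced_simps)
  then have "?\<phi> = hat (fpart M) (?\<phi> u)" by (rule hat_if_e[OF VM \<phi>])
  moreover have "q M ?\<phi> = y" using q.smult[OF e_closed \<psi>c] \<psi>(2) y(2) by simp
  ultimately show ?thesis using coind_closed[OF \<phi> C_u] by metis
qed

text \<open>The given map restricts to the parts at \<open>e\<close>, which are copies of
  \<open>fpart M\<close> and \<open>fpart M'\<close>. The resulting \<open>D\<close>-linear map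
  \<open>k\<close> induces \<open>g\<close>, and its compatibility with the kernels extends
  \<open>k\<close> to all of \<open>M\<close>.\<close>

lemma Fa_full:
  assumes M: "socle_side M" and M': "socle_side M'" and g: "g \<in> rmod_hom R (Fo M) (Fo M')"
  shows "\<exists>h\<in>rmod_hom R M M'. Fa M M' h = g"
proof -
  note MR = socle_sideD(1)[OF M] and MR' = socle_sideD(1)[OF M']
  note VM = V_module[OF M] and VM' = V_module[OF M']
  interpret M: right_module R M by (rule MR)
  interpret M': right_module R M' by (rule MR')
  interpret V: right_module D "fpart M" by (rule VM)
  interpret V': right_module D "fpart M'" by (rule VM')
  interpret q: rmod_homomorphism R "coinduced (fpart M)" "Fo M" "q M" by (rule q_homomorphism[OF M])
  interpret q': rmod_homomorphism R "coinduced (fpart M')" "Fo M'" "q M'" by (rule q_homomorphism[OF M'])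
  interpret g: rmod_homomorphism R "Fo M" "Fo M'" g
    by (intro rmod_homomorphism.intro rmod_homomorphism_axioms.intro Fo_module M M' g)
  let ?h = "hat (fpart M)" and ?h' = "hat (fpart M')"
  let ?EM = "coinduced (fpart M)" and ?EM' = "coinduced (fpart M')"
  have hc: "?h v \<in> carrier ?EM" if "v \<in> carrier (fpart M)" for v using hat_closed_E[OF M that] by simp
  have hc': "?h' v \<in> carrier ?EM'" if "v \<in> carrier (fpart M')" for v using hat_closed_E[OF M' that] by simp
  \<comment> \<open>\<open>g\<close> commutes with \<open>e\<close>, so it sends \<open>hat\<close>
    vectors to classes of \<open>hat\<close> vectors.\<close>
  have "\<exists>w\<in>carrier (fpart M'). q M' (?h' w) = g (q M (?h v))" if v: "v \<in> carrier (fpart M)" for v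
  proof (rule e_fixed_is_hat[OF M'])
    show "g (q M (?h v)) \<in> carrier (Fo M')" using hc[OF v] by blast
    have "e \<odot>\<^bsub>Fo M'\<^esub> g (q M (?h v)) = g (q M (e \<odot>\<^bsub>?EM\<^esub> ?h v))"
      using g.smult[OF e_closed q.closed[OF hc[OF v]]] q.smult[OF e_closed hc[OF v]] by simp
    then show "e \<odot>\<^bsub>Fo M'\<^esub> g (q M (?h v)) = g (q M (?h v))" by (simp only: e_hat[OF VM v])
  qed
  then obtain k0 where k0: "\<And>v. v \<in> carrier (fpart M) \<Longrightarrow>
      k0 v \<in> carrier (fpart M') \<and> q M' (?h' (k0 v)) = g (q M (?h v))" by metis
  have k0c: "k0 v \<in> carrier (fpart M')" and k0q: "q M' (?h' (k0 v)) = g (q M (?h v))"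
    if "v \<in> carrier (fpart M)" for v using k0[OF that] by blast+
  define k where "k = restrict k0 (carrier (fpart M))"
  have kc: "k v \<in> carrier (fpart M')" if "v \<in> carrier (fpart M)" for v
    using k0c[OF that] that by (simp add: k_def del: fpart_simps)
  have kq: "q M' (?h' (k v)) = g (q M (?h v))" if "v \<in> carrier (fpart M)" for v
    using k0q[OF that] that by (simp add: k_def del: fpart_simps)
  \<comment> \<open>Each law for \<open>k\<close> is tested after \<open>hat\<close> and
    \<open>q M'\<close>, where it becomes a law for \<open>g\<close>, and is then cancelled by
    \<open>q_hat_inj\<close>. Scalars of \<open>D\<close> pass through \<open>tw\<close>.\<close>
  have k: "k \<in> rmod_hom D (fpart M) (fpart M')"
    unfolding k_def
  proof (rule rmod_hom_restrictI[OF VM k0c])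
    fix v w assume v: "v \<in> carrier (fpart M)" and w: "w \<in> carrier (fpart M)"
    note vw = V.M.add.m_closed[OF v w]
    have "q M' (?h' (k0 (v \<oplus>\<^bsub>fpart M\<^esub> w))) = q M' (?h' (k0 v \<oplus>\<^bsub>fpart M'\<^esub> k0 w))"
      unfolding hat_diff(1)[OF VM' k0c[OF v] k0c[OF w]] q'.add[OF hc'[OF k0c[OF v]] hc'[OF k0c[OF w]]]
        k0q[OF v] k0q[OF w] k0q[OF vw] hat_diff(1)[OF VM v w] q.add[OF hc[OF v] hc[OF w]]
      by (rule g.add) (use hc[OF v] hc[OF w] in blast)+
    then show "k0 (v \<oplus>\<^bsub>fpart M\<^esub> w) = k0 v \<oplus>\<^bsub>fpart M'\<^esub> k0 w"
      by (rule q_hat_inj[OF M' k0c[OF vw] V'.M.add.m_closed[OF k0c[OF v] k0c[OF w]]])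
  next
    fix d v assume d: "d \<in> carrier D" and v: "v \<in> carrier (fpart M)"
    have twd: "tw d \<in> carrier R" using d by simp
    note dv = V.smult_closed[OF d v]
    have "q M' (?h' (k0 (d \<odot>\<^bsub>fpart M\<^esub> v))) = q M' (?h' (d \<odot>\<^bsub>fpart M'\<^esub> k0 v))"
      unfolding tw_hat[OF VM' k0c[OF v] d, symmetric] q'.smult[OF twd hc'[OF k0c[OF v]]]
        k0q[OF v] k0q[OF dv] tw_hat[OF VM v d, symmetric] q.smult[OF twd hc[OF v]]
      by (rule g.smult[OF twd]) (use hc[OF v] in blast)
    then show "k0 (d \<odot>\<^bsub>fpart M\<^esub> v) = d \<odot>\<^bsub>fpart M'\<^esub> k0 v"
      by (rule q_hat_inj[OF M' k0c[OF dv] V'.smult_closed[OF d k0c[OF v]]])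
  qed
  \<comment> \<open>Both sides are \<open>R\<close>-linear and agree on \<open>hat\<close> vectors,
    which generate by \<open>coind_generated\<close>.\<close>
  have gq: "g (q M \<psi>) = q M' (compose C k \<psi>)" if \<psi>: "\<psi> \<in> E M" for \<psi>
  proof -
    have kE: "compose C k \<psi> \<in> E M'" by (rule map_coind[OF k \<psi>])
    note \<psi>a = coind_closed[OF \<psi> C_a]
    note k\<psi>a = coind_closed[OF kE C_a]
    have "g (q M \<psi>) = g (q M (\<Oplus>\<^bsub>?EM\<^esub>i\<in>K. b i \<odot>\<^bsub>?EM\<^esub> ?h (\<psi> (a i))))"
      by (rule arg_cong[OF coind_generated[OF VM \<psi>]])
    also have "\<dots> = g (\<Oplus>\<^bsub>Fo M\<^esub>i\<in>K. q M (b i \<odot>\<^bsub>?EM\<^esub> ?h (\<psi> (a i))))"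
      by (subst q.finsum) (use hc[OF \<psi>a] in \<open>auto simp del: coinduced_simps fpart_simps\<close>)
    also have "\<dots> = (\<Oplus>\<^bsub>Fo M'\<^esub>i\<in>K. g (q M (b i \<odot>\<^bsub>?EM\<^esub> ?h (\<psi> (a i)))))"
      by (rule g.finsum) (use hc[OF \<psi>a] in \<open>auto simp del: coinduced_simps fpart_simps\<close>)
    also have "\<dots> = (\<Oplus>\<^bsub>Fo M'\<^esub>i\<in>K. q M' (b i \<odot>\<^bsub>?EM'\<^esub> ?h' (compose C k \<psi> (a i))))"
    proof (rule q'.N.M.finsum_cong'[OF refl])
      show "(\<lambda>i. q M' (b i \<odot>\<^bsub>?EM'\<^esub> ?h' (compose C k \<psi> (a i)))) \<in> K \<rightarrow> carrier (Fo M')"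
        using hc'[OF k\<psi>a] by (auto simp del: coinduced_simps fpart_simps)
      fix i assume i: "i \<in> K"
      have "g (q M (b i \<odot>\<^bsub>?EM\<^esub> ?h (\<psi> (a i)))) = b i \<odot>\<^bsub>Fo M'\<^esub> g (q M (?h (\<psi> (a i))))"
        using i hc[OF \<psi>a[OF i]] by (simp del: coinduced_simps fpart_simps)
      also have "\<dots> = b i \<odot>\<^bsub>Fo M'\<^esub> q M' (?h' (compose C k \<psi> (a i)))"
        using i kq[OF \<psi>a[OF i]] by (simp add: compose_eq del: coinduced_simps fpart_simps)
      also have "\<dots> = q M' (b i \<odot>\<^bsub>?EM'\<^esub> ?h' (compose C k \<psi> (a i)))"
        using i hc'[OF k\<psi>a[OF i]] by (simp del: coinduced_simps fpart_simps)
      finally show "g (q M (b i \<odot>\<^bsub>?EM\<^esub> ?h (\<psi> (a i)))) = q M' (b i \<odot>\<^bsub>?EM'\<^esub> ?h' (compose C k \<psi> (a i)))" .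
    qed
    also have "\<dots> = q M' (\<Oplus>\<^bsub>?EM'\<^esub>i\<in>K. b i \<odot>\<^bsub>?EM'\<^esub> ?h' (compose C k \<psi> (a i)))"
      by (rule q'.finsum[symmetric]) (use hc'[OF k\<psi>a] in \<open>auto simp del: coinduced_simps fpart_simps\<close>)
    also have "\<dots> = q M' (compose C k \<psi>)"
      by (rule arg_cong[OF coind_generated[OF VM' kE], symmetric])
    finally show ?thesis .
  qed
  \<comment> \<open>\<open>iota M x\<close> is killed by \<open>q M\<close>, hence its image under
    \<open>k\<close> is killed by \<open>q M'\<close> and comes from some \<open>y\<close>. Torsion
    freeness of \<open>M'\<close> makes \<open>y\<close> unique, so that the choice
    \<open>h0\<close> is linear.\<close>
  have "\<exists>y\<in>carrier M'. \<forall>c\<in>C. c \<odot>\<^bsub>M'\<^esub> y = k (c \<odot>\<^bsub>M\<^esub> x)" if x: "x \<in> carrier M" for x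
  proof -
    have ix: "iota M x \<in> E M" by (rule iota_closed[OF M x])
    have "q M (iota M x) = \<zero>\<^bsub>Fo M\<^esub>" using q_zero_iff[OF M ix] x by blast
    then have "q M' (compose C k (iota M x)) = \<zero>\<^bsub>Fo M'\<^esub>" using gq[OF ix] by simp
    then obtain y where y: "y \<in> carrier M'" "compose C k (iota M x) = iota M' y"
      using q_zero_iff[OF M' map_coind[OF k ix]] by blast
    have "c \<odot>\<^bsub>M'\<^esub> y = k (c \<odot>\<^bsub>M\<^esub> x)" if c: "c \<in> C" for c
      using fun_cong[OF y(2), of c] c x y(1) by (simp add: compose_eq iota_apply)
    then show ?thesis using y by blast
  qed
  then obtain h0 where h0c: "\<And>x. x \<in> carrier M \<Longrightarrow> h0 x \<in> carrier M'"
    and h0: "\<And>x c. \<lbrakk>x \<in> carrier M; c \<in> C\<rbrakk> \<Longrightarrow> c \<odot>\<^bsub>M'\<^esub> h0 x = k (c \<odot>\<^bsub>M\<^esub> x)"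
    by metis
  note fp = hom_fpart_apply(1)[OF MR MR rmod_hom_id[OF MR]]
  define h where "h = restrict h0 (carrier M)"
  have h: "h \<in> rmod_hom R M M'"
    unfolding h_def
  proof (rule rmod_hom_restrictI[OF MR h0c])
    fix x y assume x: "x \<in> carrier M" and y: "y \<in> carrier M"
    show "h0 (x \<oplus>\<^bsub>M\<^esub> y) = h0 x \<oplus>\<^bsub>M'\<^esub> h0 y"
    proof (rule socle_side_eqI[OF M'])
      fix c assume c: "c \<in> C"
      have "c \<odot>\<^bsub>M'\<^esub> h0 (x \<oplus>\<^bsub>M\<^esub> y) = k (c \<odot>\<^bsub>M\<^esub> x \<oplus>\<^bsub>M\<^esub> c \<odot>\<^bsub>M\<^esub> y)"
        using c x y by (simp add: h0 M.smult_r_distr C_closed)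
      also have "\<dots> = k (c \<odot>\<^bsub>M\<^esub> x) \<oplus>\<^bsub>M'\<^esub> k (c \<odot>\<^bsub>M\<^esub> y)"
        using rmod_homD(2)[OF k fp[OF x c] fp[OF y c]] by simp
      finally show "c \<odot>\<^bsub>M'\<^esub> h0 (x \<oplus>\<^bsub>M\<^esub> y) = c \<odot>\<^bsub>M'\<^esub> (h0 x \<oplus>\<^bsub>M'\<^esub> h0 y)"
        using c x y by (simp add: M'.smult_r_distr C_closed h0 h0c)
    qed (use x y h0c in auto)
  next
    fix r x assume r: "r \<in> carrier R" and x: "x \<in> carrier M"
    show "h0 (r \<odot>\<^bsub>M\<^esub> x) = r \<odot>\<^bsub>M'\<^esub> h0 x"
    proof (rule socle_side_eqI[OF M'])
      fix c assume c: "c \<in> C"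
      have "c \<odot>\<^bsub>M'\<^esub> (r \<odot>\<^bsub>M'\<^esub> h0 x) = k ((r \<otimes> c) \<odot>\<^bsub>M\<^esub> x)"
        using r c x h0[OF x C_mult[OF r c]] by (simp add: M'.smult_assoc C_closed h0c)
      then show "c \<odot>\<^bsub>M'\<^esub> h0 (r \<odot>\<^bsub>M\<^esub> x) = c \<odot>\<^bsub>M'\<^esub> (r \<odot>\<^bsub>M'\<^esub> h0 x)"
        using r c x by (simp add: M.smult_assoc C_closed h0)
    qed (use r x h0c in auto)
  qed
  \<comment> \<open>On the part at \<open>f\<close> an element \<open>c\<close> acts as
    \<open>f c\<close>, which lies in \<open>D\<close>, and for such scalars \<open>k\<close> is
    linear.\<close>
  have hv: "h v = k v" if v: "v \<in> carrier (fpart M)" for v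
  proof (rule socle_side_eqI[OF M'])
    have vM: "v \<in> carrier M" and fv: "f \<odot>\<^bsub>M\<^esub> v = v" using v by auto
    show "h v \<in> carrier M'" using rmod_homD(1)[OF h vM] .
    show "k v \<in> carrier M'" using kc[OF v] by simp
    fix c assume c: "c \<in> C"
    have fc: "f \<otimes> c \<in> carrier D" by (rule f_mult_D[OF C_closed[OF c]])
    have eq: "(f \<otimes> c) \<odot>\<^bsub>M\<^esub> v = c \<odot>\<^bsub>M\<^esub> v" using c vM fv by (simp add: M.smult_assoc C_closed)
    have "c \<odot>\<^bsub>M'\<^esub> h v = k ((f \<otimes> c) \<odot>\<^bsub>M\<^esub> v)" using h0[OF vM c] vM eq by (simp add: h_def)
    also have "\<dots> = (f \<otimes> c) \<odot>\<^bsub>M'\<^esub> k v" using rmod_homD(3)[OF k fc v] by simp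
    also have "\<dots> = c \<odot>\<^bsub>M'\<^esub> k v" using kc[OF v] c by (simp add: M'.smult_assoc C_closed)
    finally show "c \<odot>\<^bsub>M'\<^esub> h v = c \<odot>\<^bsub>M'\<^esub> k v" .
  qed
  have "Fa M M' h = g"
  proof (rule Fo_hom_eqI[OF M Fa_hom[OF M M' h] g])
    fix \<psi> assume \<psi>: "\<psi> \<in> E M"
    have "compose C h \<psi> = compose C k \<psi>"
      unfolding compose_def by (rule restrict_ext) (rule hv[OF coind_closed[OF \<psi>]])
    then show "Fa M M' h (q M \<psi>) = g (q M \<psi>)" using Fa_q[OF M M' h \<psi>] gq[OF \<psi>] by simp
  qed
  then show ?thesis using h by blast
qed

text \<open>The column has a finite dual basis over \<open>D\<close>, so \<open>Hom\<close> out of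
  it preserves surjections: it suffices to lift the values at the \<open>a k\<close>.\<close>

lemma coind_lift:
  fixes V :: "('a, 'v) module" and V' :: "('a, 'w) module"
  assumes V: "right_module D V" and V': "right_module D V'" and g: "g \<in> rmod_hom D V V'"
    and surj: "g ` carrier V = carrier V'" and \<psi>: "\<psi> \<in> rmod_hom D column V'"
  shows "\<exists>\<phi>\<in>rmod_hom D column V. compose C g \<phi> = \<psi>"
proof -
  interpret E: right_module R "coinduced V" by (rule coinduced_right_module[OF V])
  interpret V: right_module D V by (rule V)
  interpret g: rmod_homomorphism D V V' g
    by (intro rmod_homomorphism.intro rmod_homomorphism_axioms.intro V V' g)
  have "\<exists>v\<in>carrier V. g v = \<psi> (a i)" if "i \<in> K" for i
    using coind_closed[OF \<psi> C_a[OF that]] surj by (metis imageE)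
  then obtain v where v: "\<And>i. i \<in> K \<Longrightarrow> v i \<in> carrier V" and gv: "\<And>i. i \<in> K \<Longrightarrow> g (v i) = \<psi> (a i)"
    by metis
  let ?t = "\<lambda>i. b i \<odot>\<^bsub>coinduced V\<^esub> hat V (v i)"
  let ?\<phi> = "\<Oplus>\<^bsub>coinduced V\<^esub>i\<in>K. ?t i"
  have t: "?t i \<in> rmod_hom D column V" if "i \<in> K" for i
    using E.smult_closed[of "b i" "hat V (v i)"] hat_closed[OF V v[OF that]] that by simp
  have \<phi>: "?\<phi> \<in> rmod_hom D column V"
    using E.M.finsum_closed[of ?t K] t by auto
  have "compose C g ?\<phi> = \<psi>"
  proof (rule coind_ext[OF map_coind[OF g \<phi>] \<psi>])
    fix c assume c: "c \<in> C"
    have "?\<phi> c = (\<Oplus>\<^bsub>V\<^esub>i\<in>K. ?t i c)" by (rule coind_finsum[OF V finite_K t c])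
    also have "\<dots> = (\<Oplus>\<^bsub>V\<^esub>i\<in>K. pr (b i \<otimes> c) \<odot>\<^bsub>V\<^esub> v i)"
      by (rule V.M.finsum_cong') (use c v in \<open>auto simp: hat_mult C_closed simp del: coinduced_simps\<close>)
    finally have "g (?\<phi> c) = (\<Oplus>\<^bsub>V'\<^esub>i\<in>K. g (pr (b i \<otimes> c) \<odot>\<^bsub>V\<^esub> v i))"
      using v c by (simp only:) (rule g.finsum, auto simp: C_closed)
    also have "\<dots> = (\<Oplus>\<^bsub>V'\<^esub>i\<in>K. pr (b i \<otimes> c) \<odot>\<^bsub>V'\<^esub> \<psi> (a i))"
      by (rule g.N.M.finsum_cong') (use c v gv coind_closed[OF \<psi>] in \<open>auto simp: C_closed\<close>)
    also have "\<dots> = \<psi> c" by (rule coind_expand[OF V' \<psi> c, symmetric])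
    finally show "compose C g ?\<phi> c = \<psi> c" using c by (simp only: compose_eq)
  qed
  then show ?thesis using \<phi> by blast
qed

text \<open>The nine lemma for the rows formed by the modules, their coinduced modules and the
  cokernels: coinduction is exact and \<open>iota\<close> is natural and injective.\<close>

lemma Fa_exact:
  assumes L: "socle_side L" and M: "socle_side M" and N: "socle_side N"
    and ex: "short_exact R L M N i p"
  shows "short_exact R (Fo L) (Fo M) (Fo N) (Fa L M i) (Fa M N p)"
proof -
  note LR = socle_sideD(1)[OF L] and MR = socle_sideD(1)[OF M] and NR = socle_sideD(1)[OF N]
  have i: "i \<in> rmod_hom R L M" and p: "p \<in> rmod_hom R M N" and inj: "inj_on i (carrier L)"
    and mid: "i ` carrier L = {x \<in> carrier M. p x = \<zero>\<^bsub>N\<^esub>}" and surj: "p ` carrier M = carrier N"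
    using ex by (auto simp: short_exact_def)
  interpret i: rmod_homomorphism R L M i
    by (intro rmod_homomorphism.intro rmod_homomorphism_axioms.intro LR MR i)
  interpret p: rmod_homomorphism R M N p
    by (intro rmod_homomorphism.intro rmod_homomorphism_axioms.intro NR MR p)
  have Fi: "Fa L M i \<in> rmod_hom R (Fo L) (Fo M)" and Fp: "Fa M N p \<in> rmod_hom R (Fo M) (Fo N)"
    by (rule Fa_hom; fact)+
  interpret Fi: rmod_homomorphism R "Fo L" "Fo M" "Fa L M i"
    by (intro rmod_homomorphism.intro rmod_homomorphism_axioms.intro Fo_module L M Fi)
  interpret Fp: rmod_homomorphism R "Fo M" "Fo N" "Fa M N p"
    by (intro rmod_homomorphism.intro rmod_homomorphism_axioms.intro Fo_module M N Fp)
  note FiE = Fa_q[OF L M i] and FpE = Fa_q[OF M N p]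
  have pi: "p (i x) = \<zero>\<^bsub>N\<^esub>" if "x \<in> carrier L" for x using mid that by blast
  \<comment> \<open>Left exactness of \<open>Hom\<close> out of the column: values in the kernel of
    \<open>p\<close> are pulled back through \<open>i\<close>.\<close>
  have lift_ker: "\<exists>\<phi>\<in>E L. compose C i \<phi> = \<psi>" if \<psi>: "\<psi> \<in> E M" and z: "\<And>c. c \<in> C \<Longrightarrow> p (\<psi> c) = \<zero>\<^bsub>N\<^esub>" for \<psi>
  proof -
    have \<psi>c: "\<psi> c \<in> i ` carrier L" if "c \<in> C" for c
      using coind_closed[OF \<psi> that] z[OF that] mid by simp
    define \<phi> where "\<phi> = (\<lambda>c\<in>C. inv_into (carrier L) i (\<psi> c))"
    have \<phi>c: "\<phi> c \<in> carrier L" and i\<phi>: "i (\<phi> c) = \<psi> c" if "c \<in> C" for c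
      using \<psi>c[OF that] that by (simp_all add: \<phi>_def inv_into_into f_inv_into_f)
    have "\<phi> \<in> E L"
      unfolding \<phi>_def
    proof (rule coindI)
      fix c assume c: "c \<in> C"
      have "f \<odot>\<^bsub>L\<^esub> \<phi> c = \<phi> c"
        by (rule inj_onD[OF inj]) (use \<phi>c[OF c] i\<phi>[OF c] coind_closed[OF \<psi> c] in auto)
      then show "inv_into (carrier L) i (\<psi> c) \<in> carrier (fpart L)"
        using \<phi>c[OF c] c by (simp add: \<phi>_def)
      show "inv_into (carrier L) i (\<psi> (c \<oplus> c')) = inv_into (carrier L) i (\<psi> c) \<oplus>\<^bsub>fpart L\<^esub> inv_into (carrier L) i (\<psi> c')"
        if c': "c' \<in> C" for c'
        using \<phi>c[OF c] \<phi>c[OF c'] i\<phi>[OF c] i\<phi>[OF c'] c c' coind_add[OF \<psi> c c']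
        by (intro inv_into_f_eq[OF inj]) (auto simp: \<phi>_def)
      show "inv_into (carrier L) i (\<psi> (c \<otimes> d)) = d \<odot>\<^bsub>fpart L\<^esub> inv_into (carrier L) i (\<psi> c)"
        if d: "d \<in> carrier R" "f \<otimes> d = d" for d
        using \<phi>c[OF c] i\<phi>[OF c] c d coind_smult[OF \<psi> _ c, of d]
        by (intro inv_into_f_eq[OF inj]) (auto simp: \<phi>_def)
    qed
    moreover have "compose C i \<phi> = \<psi>"
      using rmod_homD(4)[OF \<psi>] i\<phi> by (intro extensionalityI[of _ C]) (auto simp: compose_eq compose_def)
    ultimately show ?thesis by blast
  qed
  have "y = \<zero>\<^bsub>Fo L\<^esub>" if y: "y \<in> carrier (Fo L)" and z: "Fa L M i y = \<zero>\<^bsub>Fo M\<^esub>" for y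
  proof -
    obtain \<psi> where \<psi>: "\<psi> \<in> E L" "y = q L \<psi>" by (rule q_cases[OF L y])
    obtain x where x: "x \<in> carrier M" "compose C i \<psi> = iota M x"
      using z FiE[OF \<psi>(1)] q_zero_iff[OF M compose_closed[OF LR i \<psi>(1)]] \<psi>(2) by auto
    have ic: "i (\<psi> c) = c \<odot>\<^bsub>M\<^esub> x" if "c \<in> C" for c
      using fun_cong[OF x(2), of c] that x(1) by (simp add: compose_eq iota_apply)
    \<comment> \<open>\<open>C\<close> annihilates \<open>p x\<close>, because the elements
      \<open>x c\<close> come from \<open>L\<close>. Torsion freeness of \<open>N\<close> then moves
      \<open>x\<close> itself into the image of \<open>i\<close>.\<close>
    have "p x = \<zero>\<^bsub>N\<^esub>"
    proof (rule socle_sideD(2)[OF N])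
      fix c assume c: "c \<in> C"
      have "c \<odot>\<^bsub>N\<^esub> p x = p (i (\<psi> c))" using c x(1) by (simp add: ic C_closed)
      then show "c \<odot>\<^bsub>N\<^esub> p x = \<zero>\<^bsub>N\<^esub>" using pi coind_closed[OF \<psi>(1) c] by simp
    qed (use x in simp)
    then have "x \<in> i ` carrier L" using mid x(1) by simp
    then obtain l where l: "l \<in> carrier L" "x = i l" by (rule imageE)
    have "\<psi> = iota L l"
    proof (rule coind_ext[OF \<psi>(1) iota_closed[OF L l(1)]])
      fix c assume c: "c \<in> C"
      have "\<psi> c = c \<odot>\<^bsub>L\<^esub> l"
        by (rule inj_onD[OF inj]) (use c l ic coind_closed[OF \<psi>(1) c] in \<open>auto simp: C_closed\<close>)
      then show "\<psi> c = iota L l c" using c l by (simp add: iota_apply)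
    qed
    then show ?thesis using q_zero_iff[OF L \<psi>(1)] l(1) \<psi>(2) by blast
  qed
  then have "inj_on (Fa L M i) (carrier (Fo L))" unfolding Fi.inj_iff by blast
  moreover have "Fa L M i ` carrier (Fo L) = {y \<in> carrier (Fo M). Fa M N p y = \<zero>\<^bsub>Fo N\<^esub>}"
  proof (intro subset_antisym subsetI)
    fix y assume "y \<in> Fa L M i ` carrier (Fo L)"
    then obtain z where z: "z \<in> carrier (Fo L)" "y = Fa L M i z" by (rule imageE)
    obtain \<psi> where \<psi>: "\<psi> \<in> E L" "z = q L \<psi>" by (rule q_cases[OF L z(1)])
    note i\<psi> = compose_closed[OF LR i \<psi>(1)]
    have "compose C p (compose C i \<psi>) = iota N \<zero>\<^bsub>N\<^esub>"
    proof (rule coind_ext[OF compose_closed[OF MR p i\<psi>] iota_closed[OF N]])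
      show "compose C p (compose C i \<psi>) c = iota N \<zero>\<^bsub>N\<^esub> c" if "c \<in> C" for c
        using that pi coind_closed[OF \<psi>(1) that] by (simp add: compose_eq iota_apply C_closed)
    qed simp
    then have "q N (compose C p (compose C i \<psi>)) = \<zero>\<^bsub>Fo N\<^esub>"
      using q_zero_iff[OF N compose_closed[OF MR p i\<psi>]] p.N.M.zero_closed by blast
    then show "y \<in> {y \<in> carrier (Fo M). Fa M N p y = \<zero>\<^bsub>Fo N\<^esub>}"
      using z \<psi> FiE[OF \<psi>(1)] FpE[OF i\<psi>] q_closed[OF M i\<psi>] by simp
  next
    fix y assume y: "y \<in> {y \<in> carrier (Fo M). Fa M N p y = \<zero>\<^bsub>Fo N\<^esub>}"
    then have yM: "y \<in> carrier (Fo M)" by simp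
    interpret q: rmod_homomorphism R "coinduced (fpart M)" "Fo M" "q M" by (rule q_homomorphism[OF M])
    obtain \<psi> where \<psi>: "\<psi> \<in> E M" "y = q M \<psi>" by (rule q_cases[OF M yM])
    note p\<psi> = compose_closed[OF MR p \<psi>(1)]
    obtain n where n: "n \<in> carrier N" "compose C p \<psi> = iota N n"
      using y FpE[OF \<psi>(1)] \<psi>(2) q_zero_iff[OF N p\<psi>] by auto
    have "n \<in> p ` carrier M" using n(1) surj by simp
    then obtain x where x: "x \<in> carrier M" "n = p x" by (auto simp del: p.closed)
    have ix: "iota M x \<in> carrier (coinduced (fpart M))" using iota_closed[OF M x(1)] by simp
    have \<psi>c: "\<psi> \<in> carrier (coinduced (fpart M))" using \<psi>(1) by simp
    \<comment> \<open>Subtracting \<open>iota M x\<close> does not change the class in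
      \<open>Fo M\<close>, but makes the image under \<open>p\<close> vanish on the nose instead of
      modulo \<open>iota\<close>.\<close>
    define \<chi> where "\<chi> = \<psi> \<ominus>\<^bsub>coinduced (fpart M)\<^esub> iota M x"
    have \<chi>c: "\<chi> \<in> carrier (coinduced (fpart M))" unfolding \<chi>_def by (rule q.M.M.minus_closed[OF \<psi>c ix])
    have "\<psi> = \<chi> \<oplus>\<^bsub>coinduced (fpart M)\<^esub> iota M x"
      unfolding \<chi>_def a_minus_def
      using q.M.M.a_assoc[OF \<psi>c q.M.M.a_inv_closed[OF ix] ix] q.M.M.l_neg[OF ix] q.M.M.r_zero[OF \<psi>c]
      by (simp del: coinduced_simps)
    then have split: "\<psi> c = \<chi> c \<oplus>\<^bsub>M\<^esub> c \<odot>\<^bsub>M\<^esub> x" if "c \<in> C" for c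
      using that x(1) by (simp add: iota_apply fun_eq_iff)
    have p\<chi>: "p (\<chi> c) = \<zero>\<^bsub>N\<^esub>" if c: "c \<in> C" for c
    proof -
      have \<chi>M: "\<chi> c \<in> carrier M" using coind_closed[of \<chi> "fpart M" c] \<chi>c c by simp
      have "p (\<psi> c) = c \<odot>\<^bsub>N\<^esub> p x"
        using fun_cong[OF n(2), of c] c x by (simp add: compose_eq iota_apply)
      moreover have "p (\<psi> c) = p (\<chi> c) \<oplus>\<^bsub>N\<^esub> c \<odot>\<^bsub>N\<^esub> p x"
        using split[OF c] \<chi>M x(1) c by (simp add: C_closed)
      ultimately show ?thesis
        using \<chi>M x(1) c p.N.M.add.r_cancel_one'[of "c \<odot>\<^bsub>N\<^esub> p x" "p (\<chi> c)"] by (simp add: C_closed)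
    qed
    obtain \<phi> where \<phi>: "\<phi> \<in> E L" "compose C i \<phi> = \<chi>" using lift_ker[of \<chi>] p\<chi> \<chi>c by auto
    have "q M (iota M x) = \<zero>\<^bsub>Fo M\<^esub>" using q_zero_iff[OF M iota_closed[OF M x(1)]] x(1) by blast
    then have "q M \<chi> = y"
      unfolding \<chi>_def q.diff[OF \<psi>c ix] \<psi>(2) using q.closed[OF \<psi>c] Fi.N.M.minus_equality[of "\<zero>\<^bsub>Fo M\<^esub>" "\<zero>\<^bsub>Fo M\<^esub>"]
      by (simp add: a_minus_def)
    then have "y = Fa L M i (q L \<phi>)" using FiE[OF \<phi>(1)] \<phi>(2) by simp
    then show "y \<in> Fa L M i ` carrier (Fo L)" using q_closed[OF L \<phi>(1)] by blast
  qed
  moreover have "Fa M N p ` carrier (Fo M) = carrier (Fo N)"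
  proof (intro subset_antisym subsetI)
    fix y assume y: "y \<in> carrier (Fo N)"
    obtain \<psi> where \<psi>: "\<psi> \<in> E N" "y = q N \<psi>" by (rule q_cases[OF N y])
    have "restrict p (carrier (fpart M)) ` carrier (fpart M) = carrier (fpart N)"
    proof (intro subset_antisym subsetI)
      fix n assume "n \<in> carrier (fpart N)"
      then have n: "n \<in> carrier N" "f \<odot>\<^bsub>N\<^esub> n = n" by auto
      have "n \<in> p ` carrier M" using n(1) surj by simp
      then obtain x where x: "x \<in> carrier M" "n = p x" by (auto simp del: p.closed)
      have fx: "f \<odot>\<^bsub>M\<^esub> x \<in> carrier (fpart M)" using x(1) by (simp flip: i.N.smult_assoc)
      have "n = restrict p (carrier (fpart M)) (f \<odot>\<^bsub>M\<^esub> x)" using n x fx by simp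
      then show "n \<in> restrict p (carrier (fpart M)) ` carrier (fpart M)" using fx by (rule image_eqI)
    qed (use rmod_homD(1)[OF fpart_hom[OF MR p]] in blast)
    from coind_lift[OF V_module[OF M] V_module[OF N] fpart_hom[OF MR p] this \<psi>(1)]
    obtain \<phi> where \<phi>: "\<phi> \<in> E M" "compose C (restrict p (carrier (fpart M))) \<phi> = \<psi>" by blast
    then have "y = Fa M N p (q M \<phi>)" using FpE[OF \<phi>(1)] \<psi>(2) by (simp only: compose_fpart)
    then show "y \<in> Fa M N p ` carrier (Fo M)" using q_closed[OF M \<phi>(1)] by blast
  qed (use rmod_homD(1)[OF Fp] in blast)
  ultimately show ?thesis using Fi Fp by (simp add: short_exact_def)
qed

end

context dual_corner_ring
begin

subsection \<open>Density\<close>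

text \<open>The part at \<open>e\<close> regarded as a right \<open>D\<close>-module through
  \<open>tw\<close>, so that it can be coinduced.\<close>

definition epart :: "('a, 'v) module \<Rightarrow> ('a, 'v) module" where
  "epart N = N\<lparr>carrier := {x \<in> carrier N. e \<odot>\<^bsub>N\<^esub> x = x}, smult := (\<lambda>d x. tw d \<odot>\<^bsub>N\<^esub> x)\<rparr>"

lemma epart_simps [simp]:
  "carrier (epart N) = {x \<in> carrier N. e \<odot>\<^bsub>N\<^esub> x = x}" "add (epart N) = add N"
  "zero (epart N) = zero N" "smult (epart N) = (\<lambda>d x. tw d \<odot>\<^bsub>N\<^esub> x)"
  by (simp_all add: epart_def)

lemma epart_right_module:
  assumes "right_module R N" shows "right_module D (epart N)"
proof -
  interpret N: right_module R N by fact
  have "abelian_group (epart N)"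
    by (rule N.M.abelian_subgroup_structure) (auto simp: N.smult_r_distr N.smult_r_minus)
  then show ?thesis
    by (intro right_module.intro right_module_axioms.intro ring_D)
      (auto simp: tw_add tw_mult N.smult_l_distr N.smult_r_distr N.smult_assoc simp flip: N.smult_assoc[of _ e])
qed

text \<open>Under the dual bases, coinduction of \<open>N e\<close> becomes the tensor product
  \<open>N e \<otimes> eR\<close>, and this is the multiplication map
  \<open>v \<otimes> s \<mapsto> v s\<close>; see \<open>cover_generator\<close>.\<close>

definition cover :: "('a, 'v) module \<Rightarrow> ('a \<Rightarrow> 'v) \<Rightarrow> 'v" where
  "cover N \<psi> = (\<Oplus>\<^bsub>N\<^esub>k\<in>K. b k \<odot>\<^bsub>N\<^esub> \<psi> (a k))"

lemma cover_closed:
  assumes "right_module R N" "\<psi> \<in> rmod_hom D column (epart N)" shows "cover N \<psi> \<in> carrier N"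
proof -
  interpret N: right_module R N by fact
  show ?thesis unfolding cover_def
    by (rule N.M.finsum_closed) (use coind_closed[OF assms(2) C_a] in auto)
qed

lemma cover_add:
  assumes "right_module R N" "\<phi> \<in> rmod_hom D column (epart N)" "\<psi> \<in> rmod_hom D column (epart N)"
  shows "cover N (\<phi> \<oplus>\<^bsub>coinduced (epart N)\<^esub> \<psi>) = cover N \<phi> \<oplus>\<^bsub>N\<^esub> cover N \<psi>"
proof -
  interpret N: right_module R N by fact
  have c: "\<phi> (a k) \<in> carrier N" "\<psi> (a k) \<in> carrier N" if "k \<in> K" for k
    using coind_closed[OF assms(2) C_a[OF that]] coind_closed[OF assms(3) C_a[OF that]] by auto
  have "cover N (\<phi> \<oplus>\<^bsub>coinduced (epart N)\<^esub> \<psi>) = (\<Oplus>\<^bsub>N\<^esub>k\<in>K. b k \<odot>\<^bsub>N\<^esub> \<phi> (a k) \<oplus>\<^bsub>N\<^esub> b k \<odot>\<^bsub>N\<^esub> \<psi> (a k))"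
    unfolding cover_def by (rule N.M.finsum_cong') (use c in \<open>auto simp: N.smult_r_distr\<close>)
  also have "\<dots> = cover N \<phi> \<oplus>\<^bsub>N\<^esub> cover N \<psi>"
    unfolding cover_def by (rule N.M.finsum_addf) (use c in auto)
  finally show ?thesis .
qed

lemma cover_finsum:
  assumes N: "right_module R N" and "finite A" "\<And>i. i \<in> A \<Longrightarrow> \<psi> i \<in> rmod_hom D column (epart N)"
  shows "cover N (\<Oplus>\<^bsub>coinduced (epart N)\<^esub>i\<in>A. \<psi> i) = (\<Oplus>\<^bsub>N\<^esub>i\<in>A. cover N (\<psi> i))"
proof -
  interpret N: right_module R N by fact
  interpret E: right_module R "coinduced (epart N)" by (rule coinduced_right_module[OF epart_right_module[OF N]])
  show ?thesis using assms(2,3)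
  proof (induct set: finite)
    case empty
    have "cover N \<zero>\<^bsub>coinduced (epart N)\<^esub> = (\<Oplus>\<^bsub>N\<^esub>k\<in>K. \<zero>\<^bsub>N\<^esub>)"
      unfolding cover_def by (rule N.M.finsum_cong') auto
    then show ?case by (simp add: N.M.finsum_zero del: coinduced_simps)
  next
    case (insert i F)
    have i: "\<psi> i \<in> carrier (coinduced (epart N))" and F: "\<psi> \<in> F \<rightarrow> carrier (coinduced (epart N))"
      using insert by auto
    have "(\<Oplus>\<^bsub>coinduced (epart N)\<^esub>i\<in>F. \<psi> i) \<in> carrier (coinduced (epart N))" by (rule E.M.finsum_closed[OF F])
    then have "cover N (\<Oplus>\<^bsub>coinduced (epart N)\<^esub>i\<in>insert i F. \<psi> i) = cover N (\<psi> i) \<oplus>\<^bsub>N\<^esub> cover N (\<Oplus>\<^bsub>coinduced (epart N)\<^esub>i\<in>F. \<psi> i)"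
      using E.M.finsum_insert[OF insert(1,2) F i] cover_add[OF N, of "\<psi> i"] i by (simp del: coinduced_simps(2-4))
    also have "\<dots> = cover N (\<psi> i) \<oplus>\<^bsub>N\<^esub> (\<Oplus>\<^bsub>N\<^esub>i\<in>F. cover N (\<psi> i))" using insert by simp
    also have "\<dots> = (\<Oplus>\<^bsub>N\<^esub>i\<in>insert i F. cover N (\<psi> i))"
      by (rule N.M.finsum_insert[symmetric]) (use insert cover_closed[OF N] in auto)
    finally show ?case .
  qed
qed

text \<open>\<open>row_expand\<close> collapses the sum over the dual bases. Linearity over
  \<open>R\<close> is checked on elements of this shape.\<close>

lemma cover_generator:
  assumes N: "right_module R N" and v: "v \<in> carrier (epart N)" and s: "s \<in> carrier R" "e \<otimes> s = s"
  shows "cover N (s \<odot>\<^bsub>coinduced (epart N)\<^esub> hat (epart N) v) = s \<odot>\<^bsub>N\<^esub> v"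
proof -
  interpret N: right_module R N by fact
  have vN: "v \<in> carrier N" using v by simp
  have "cover N (s \<odot>\<^bsub>coinduced (epart N)\<^esub> hat (epart N) v) = (\<Oplus>\<^bsub>N\<^esub>k\<in>K. (tw (pr (s \<otimes> a k)) \<otimes> b k) \<odot>\<^bsub>N\<^esub> v)"
    unfolding cover_def
    by (rule N.M.finsum_cong') (use vN s in \<open>auto simp: hat_mult N.smult_assoc simp del: coinduced_simps\<close>)
  also have "\<dots> = (\<Oplus>k\<in>K. tw (pr (s \<otimes> a k)) \<otimes> b k) \<odot>\<^bsub>N\<^esub> v"
    by (rule N.smult_finsum[symmetric]) (use vN s in auto)
  also have "\<dots> = s \<odot>\<^bsub>N\<^esub> v" using row_expand[OF s] by simp
  finally show ?thesis .
qed

text \<open>Linearity in \<open>r\<close> is invisible in the defining sum. Expanding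
  \<open>\<psi>\<close> by \<open>coind_generated\<close> reduces it to
  \<open>cover_generator\<close> with \<open>s = b k \<otimes> r\<close>.\<close>

lemma cover_hom:
  assumes N: "right_module R N"
  shows "restrict (cover N) (rmod_hom D column (epart N)) \<in> rmod_hom R (coinduced (epart N)) N"
proof -
  interpret N: right_module R N by fact
  note V = epart_right_module[OF N]
  interpret E: right_module R "coinduced (epart N)" by (rule coinduced_right_module[OF V])
  have "restrict (cover N) (carrier (coinduced (epart N))) \<in> rmod_hom R (coinduced (epart N)) N"
  proof (rule rmod_hom_restrictI[OF E.right_module_axioms])
    fix \<psi> assume "\<psi> \<in> carrier (coinduced (epart N))"
    then have \<psi>: "\<psi> \<in> rmod_hom D column (epart N)" by simp
    show "cover N \<psi> \<in> carrier N" by (rule cover_closed[OF N \<psi>])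
    show "cover N (\<psi> \<oplus>\<^bsub>coinduced (epart N)\<^esub> \<phi>) = cover N \<psi> \<oplus>\<^bsub>N\<^esub> cover N \<phi>"
      if "\<phi> \<in> carrier (coinduced (epart N))" for \<phi>
      using cover_add[OF N \<psi>, of \<phi>] that by simp
    fix r assume r: "r \<in> carrier R"
    let ?h = "\<lambda>k. hat (epart N) (\<psi> (a k))"
    have v: "\<psi> (a k) \<in> carrier (epart N)" if "k \<in> K" for k by (rule coind_closed[OF \<psi> C_a[OF that]])
    then have vN: "\<psi> (a k) \<in> carrier N" if "k \<in> K" for k using that by auto
    have h: "?h k \<in> carrier (coinduced (epart N))" if "k \<in> K" for k
      using hat_closed[OF V v[OF that]] by simp
    have "r \<odot>\<^bsub>coinduced (epart N)\<^esub> \<psi> = (\<Oplus>\<^bsub>coinduced (epart N)\<^esub>k\<in>K. r \<odot>\<^bsub>coinduced (epart N)\<^esub> (b k \<odot>\<^bsub>coinduced (epart N)\<^esub> ?h k))"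
      by (subst coind_generated[OF V \<psi>], subst E.finsum_smult) (use r h in \<open>auto simp del: coinduced_simps\<close>)
    also have "\<dots> = (\<Oplus>\<^bsub>coinduced (epart N)\<^esub>k\<in>K. (b k \<otimes> r) \<odot>\<^bsub>coinduced (epart N)\<^esub> ?h k)"
      by (rule E.M.finsum_cong') (use r h in \<open>auto simp: E.smult_assoc simp del: coinduced_simps\<close>)
    finally have "cover N (r \<odot>\<^bsub>coinduced (epart N)\<^esub> \<psi>) = cover N \<dots>" by (rule arg_cong)
    also have "\<dots> = (\<Oplus>\<^bsub>N\<^esub>k\<in>K. cover N ((b k \<otimes> r) \<odot>\<^bsub>coinduced (epart N)\<^esub> ?h k))"
    proof (rule cover_finsum[OF N finite_K])
      fix k assume k: "k \<in> K"
      show "(b k \<otimes> r) \<odot>\<^bsub>coinduced (epart N)\<^esub> ?h k \<in> rmod_hom D column (epart N)"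
        using E.smult_closed[OF _ h[OF k], of "b k \<otimes> r"] k r by simp
    qed
    also have "\<dots> = (\<Oplus>\<^bsub>N\<^esub>k\<in>K. r \<odot>\<^bsub>N\<^esub> (b k \<odot>\<^bsub>N\<^esub> \<psi> (a k)))"
      by (rule N.M.finsum_cong')
        (use r v vN in \<open>auto simp: cover_generator[OF N] N.smult_assoc simp del: coinduced_simps epart_simps simp flip: m_assoc\<close>)
    also have "\<dots> = r \<odot>\<^bsub>N\<^esub> cover N \<psi>"
      unfolding cover_def by (rule N.finsum_smult[symmetric]) (use r vN in auto)
    finally show "cover N (r \<odot>\<^bsub>coinduced (epart N)\<^esub> \<psi>) = r \<odot>\<^bsub>N\<^esub> cover N \<psi>" .
  qed
  then show ?thesis by simp
qed

lemma cover_hat: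
  assumes N: "right_module R N" and v: "v \<in> carrier (epart N)"
  shows "cover N (hat (epart N) v) = v"
  using cover_generator[OF N v e_closed e_idem] v by (simp only: e_hat[OF epart_right_module[OF N] v]) simp

text \<open>The image is a submodule that contains the part at \<open>e\<close>, since
  \<open>cover\<close> inverts \<open>hat\<close>.\<close>

lemma cover_surj:
  fixes N :: "('a, 'v) module"
  assumes N: "top_side N"
  shows "cover N ` rmod_hom D column (epart N) = carrier N"
proof -
  note NR = top_sideD(1)[OF N]
  interpret N: right_module R N by (rule NR)
  note V = epart_right_module[OF NR]
  interpret c: rmod_homomorphism R "coinduced (epart N)" N "restrict (cover N) (rmod_hom D column (epart N))"
    by (intro rmod_homomorphism.intro rmod_homomorphism_axioms.intro coinduced_right_module[OF V] NR cover_hom)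
  have "restrict (cover N) (rmod_hom D column (epart N)) ` carrier (coinduced (epart N)) = carrier N"
  proof (rule top_sideD(2)[OF N c.image_submodule[OF c.M.carrier_submodule]])
    fix x assume "x \<in> carrier N"
    then have ex: "e \<odot>\<^bsub>N\<^esub> x \<in> carrier (epart N)" by (simp flip: N.smult_assoc)
    show "e \<odot>\<^bsub>N\<^esub> x \<in> restrict (cover N) (rmod_hom D column (epart N)) ` carrier (coinduced (epart N))"
      using hat_closed[OF V ex] cover_hat[OF NR ex]
      by (intro image_eqI[of _ _ "hat (epart N) (e \<odot>\<^bsub>N\<^esub> x)"]) (simp_all del: epart_simps)
  qed
  then show ?thesis by simp
qed

text \<open>The kernel is the module whose cosyzygy will be \<open>N\<close>. It is killed by
  \<open>u\<close> because \<open>cover\<close> is injective on the part at \<open>e\<close>, and it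
  contains the whole part at \<open>f\<close> because \<open>N\<close> has no such part.\<close>

lemma cover_kernel:
  fixes N :: "('a, 'v) module"
  assumes N: "top_side N"
  shows "submodule {\<phi> \<in> rmod_hom D column (epart N). cover N \<phi> = \<zero>\<^bsub>N\<^esub>} R (coinduced (epart N))"
    and "\<lbrakk>\<phi> \<in> rmod_hom D column (epart N); cover N \<phi> = \<zero>\<^bsub>N\<^esub>; c \<in> C\<rbrakk> \<Longrightarrow> (u \<odot>\<^bsub>coinduced (epart N)\<^esub> \<phi>) c = \<zero>\<^bsub>N\<^esub>"
    and "\<lbrakk>\<phi> \<in> rmod_hom D column (epart N); f \<odot>\<^bsub>coinduced (epart N)\<^esub> \<phi> = \<phi>\<rbrakk> \<Longrightarrow> cover N \<phi> = \<zero>\<^bsub>N\<^esub>"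
proof -
  note NR = top_sideD(1)[OF N]
  interpret N: right_module R N by (rule NR)
  note V = epart_right_module[OF NR]
  interpret V: right_module D "epart N" by (rule V)
  let ?E = "coinduced (epart N)" and ?c = "restrict (cover N) (rmod_hom D column (epart N))"
  interpret c: rmod_homomorphism R ?E N ?c
    by (intro rmod_homomorphism.intro rmod_homomorphism_axioms.intro coinduced_right_module[OF V] NR cover_hom)
  have "{\<phi> \<in> carrier ?E. ?c \<phi> = \<zero>\<^bsub>N\<^esub>} = {\<phi> \<in> rmod_hom D column (epart N). cover N \<phi> = \<zero>\<^bsub>N\<^esub>}"
    by (rule Collect_cong, rule conj_cong) simp_all
  then show "submodule {\<phi> \<in> rmod_hom D column (epart N). cover N \<phi> = \<zero>\<^bsub>N\<^esub>} R (coinduced (epart N))"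
    using c.kernel_submodule by (simp only:)
  have smult: "cover N (r \<odot>\<^bsub>?E\<^esub> \<phi>) = r \<odot>\<^bsub>N\<^esub> cover N \<phi>" "r \<odot>\<^bsub>?E\<^esub> \<phi> \<in> rmod_hom D column (epart N)"
    if "r \<in> carrier R" "\<phi> \<in> rmod_hom D column (epart N)" for r \<phi>
  proof -
    have \<phi>c: "\<phi> \<in> carrier ?E" using that by simp
    show "r \<odot>\<^bsub>?E\<^esub> \<phi> \<in> rmod_hom D column (epart N)" using c.M.smult_closed[OF that(1) \<phi>c] by simp
    then show "cover N (r \<odot>\<^bsub>?E\<^esub> \<phi>) = r \<odot>\<^bsub>N\<^esub> cover N \<phi>"
      using c.smult[OF that(1) \<phi>c] that(2) by (simp del: coinduced_simps)
  qed
  { assume \<phi>: "\<phi> \<in> rmod_hom D column (epart N)" and z: "cover N \<phi> = \<zero>\<^bsub>N\<^esub>" and c: "c \<in> C"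
    have \<phi>c: "\<phi> \<in> carrier ?E" using \<phi> by simp
    have "e \<odot>\<^bsub>?E\<^esub> (e \<odot>\<^bsub>?E\<^esub> \<phi>) = e \<odot>\<^bsub>?E\<^esub> \<phi>"
      using c.M.smult_assoc[OF e_closed e_closed \<phi>c] by (simp del: coinduced_simps)
    \<comment> \<open>The part of \<open>\<phi>\<close> at \<open>e\<close> is a \<open>hat\<close>
      vector, and on these \<open>cover\<close> is evaluation at \<open>u\<close>; hence
      \<open>\<phi> u = 0\<close>.\<close>
    then have "e \<odot>\<^bsub>?E\<^esub> \<phi> = hat (epart N) ((e \<odot>\<^bsub>?E\<^esub> \<phi>) u)"
      by (rule hat_if_e[OF V smult(2)[OF e_closed \<phi>]])
    also have "(e \<odot>\<^bsub>?E\<^esub> \<phi>) u = \<phi> u" by simp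
    finally have "cover N (e \<odot>\<^bsub>?E\<^esub> \<phi>) = \<phi> u" using cover_hat[OF NR coind_closed[OF \<phi> C_u]] by (simp only:)
    then have \<phi>u: "\<phi> u = \<zero>\<^bsub>N\<^esub>" using smult(1)[OF e_closed \<phi>] z by simp
    have "\<phi> (u \<otimes> c) = \<phi> (u \<otimes> (f \<otimes> c))" using c by (simp add: C_closed flip: m_assoc)
    also have "\<dots> = (f \<otimes> c) \<odot>\<^bsub>epart N\<^esub> \<phi> u"
      by (rule coind_smult[OF \<phi> f_mult_D[OF C_closed[OF c]] C_u])
    also have "\<dots> = \<zero>\<^bsub>N\<^esub>" using \<phi>u c by (simp add: C_closed)
    finally show "(u \<odot>\<^bsub>?E\<^esub> \<phi>) c = \<zero>\<^bsub>N\<^esub>" using c by simp }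
  { assume \<phi>: "\<phi> \<in> rmod_hom D column (epart N)" and f: "f \<odot>\<^bsub>?E\<^esub> \<phi> = \<phi>"
    have "cover N \<phi> = f \<odot>\<^bsub>N\<^esub> cover N \<phi>" using smult(1)[OF f_closed \<phi>] by (simp only: f)
    then show "cover N \<phi> = \<zero>\<^bsub>N\<^esub>" using top_side_C[OF N cover_closed[OF NR \<phi>] C_f] by simp }
qed

end

context cosyzygy_functor
begin

text \<open>\<open>M\<close> is a copy on \<open>'u\<close> of the kernel of \<open>cover\<close>.
  Kernel and coinduced module have the same part at \<open>f\<close>, a copy of
  \<open>epart N\<close>. So coinducing \<open>fpart M\<close> gives the same module again
  (\<open>flat\<close>), with \<open>iota\<close> turned into the inclusion of the kernel.\<close>

lemma Fo_dense:
  fixes N :: "('a, 'u) module"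
  assumes N: "top_side N"
  shows "\<exists>M. socle_side M \<and> (\<exists>h\<in>rmod_hom R (Fo M) N. bij_betw h (carrier (Fo M)) (carrier N))"
proof -
  note NR = top_sideD(1)[OF N]
  interpret N: right_module R N by (rule NR)
  note V = epart_right_module[OF NR]
  interpret V: right_module D "epart N" by (rule V)
  let ?V = "epart N" let ?E = "coinduced (epart N)" and ?X = "rmod_hom D column (epart N)"
  interpret E: right_module R ?E by (rule coinduced_right_module[OF V])
  let ?W = "{\<phi> \<in> ?X. cover N \<phi> = \<zero>\<^bsub>N\<^esub>}"
  let ?M0 = "?E\<lparr>carrier := ?W\<rparr>"
  note W = cover_kernel(1)[OF N]
  have M0: "right_module R ?M0" by (rule E.submodule_right_module[OF W])
  interpret M0: right_module R ?M0 by (rule M0)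
  obtain c :: "('a \<Rightarrow> 'u) \<Rightarrow> 'u" where "inj_on c ?X"
    using exists_coind_code[OF infinite_universe V] by blast
  then have "inj_on c (carrier ?M0)" by (auto intro: inj_on_subset)
  then obtain M :: "('a, 'u) module" and j where M: "right_module R M" and j: "j \<in> rmod_hom R ?M0 M"
    and bij: "bij_betw j (carrier ?M0) (carrier M)"
    using M0.exists_copy by blast
  interpret M: right_module R M by (rule M)
  interpret j: rmod_homomorphism R ?M0 M j
    by (intro rmod_homomorphism.intro rmod_homomorphism_axioms.intro M0 M j)
  define i where "i = restrict (inv_into (carrier ?M0) j) (carrier M)"
  have i: "i \<in> rmod_hom R M ?M0" unfolding i_def by (rule j.inverse_hom[OF bij])
  have iW: "i x \<in> ?W" if "x \<in> carrier M" for x using rmod_homD(1)[OF i that] by simp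
  have iX: "i x \<in> ?X" if "x \<in> carrier M" for x using iW[OF that] by simp
  have ij: "i (j \<phi>) = \<phi>" if "\<phi> \<in> ?W" for \<phi>
    using bij_betw_inv_into_left[OF bij, of \<phi>] j.closed[of \<phi>] that by (simp add: i_def)
  have ji: "j (i x) = x" if "x \<in> carrier M" for x
    using bij_betw_inv_into_right[OF bij that] that by (simp add: i_def)
  have jc: "j \<phi> \<in> carrier M" if "\<phi> \<in> ?W" for \<phi> using j.closed[of \<phi>] that by simp
  have i_smult: "i (r \<odot>\<^bsub>M\<^esub> x) c = i x (r \<otimes> c)" if "r \<in> carrier R" "x \<in> carrier M" "c \<in> C" for r x c
    using rmod_homD(3)[OF i that(1,2)] that(3) by simp
  have i_add: "i (x \<oplus>\<^bsub>M\<^esub> y) c = i x c \<oplus>\<^bsub>N\<^esub> i y c" if "x \<in> carrier M" "y \<in> carrier M" "c \<in> C" for x y c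
    using rmod_homD(2)[OF i that(1,2)] that(3) by simp
  have i_zero: "i \<zero>\<^bsub>M\<^esub> c = \<zero>\<^bsub>N\<^esub>" if "c \<in> C" for c
    using i_smult[of \<zero> "\<zero>\<^bsub>M\<^esub>" c] coind_smult[OF iX[OF M.M.zero_closed], of \<zero> f] that
      coind_closed[OF iX[OF M.M.zero_closed] that]
      V.smult_l_null[OF coind_closed[OF iX[OF M.M.zero_closed] C_f]] by (simp add: C_closed)
  have i_eqI: "x = y" if "x \<in> carrier M" "y \<in> carrier M" "\<And>c. c \<in> C \<Longrightarrow> i x c = i y c" for x y
    using coind_ext[OF iX[OF that(1)] iX[OF that(2)] that(3)] ji that(1,2) by metis
  have M_side: "socle_side M"
    unfolding socle_side_def
  proof (intro conjI ballI impI M)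
    fix x assume x: "x \<in> carrier M"
    { assume z: "\<forall>c\<in>C. c \<odot>\<^bsub>M\<^esub> x = \<zero>\<^bsub>M\<^esub>"
      show "x = \<zero>\<^bsub>M\<^esub>"
      proof (rule i_eqI[OF x M.M.zero_closed])
        fix c assume c: "c \<in> C"
        \<comment> \<open>Evaluating the product of \<open>x\<close> with \<open>c\<close> at
          \<open>f\<close> returns the value of \<open>i x\<close> at \<open>c\<close>, so an
          element annihilated by \<open>C\<close> is the zero function.\<close>
        have "i x c = i (c \<odot>\<^bsub>M\<^esub> x) f" using c x i_smult[of c x f] by (simp add: C_def)
        then show "i x c = i \<zero>\<^bsub>M\<^esub> c" using z c by (simp add: i_zero)
      qed }
    show "u \<odot>\<^bsub>M\<^esub> x = \<zero>\<^bsub>M\<^esub>"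
    proof (rule i_eqI[OF M.smult_closed[OF u_closed x] M.M.zero_closed])
      fix c assume c: "c \<in> C"
      show "i (u \<odot>\<^bsub>M\<^esub> x) c = i \<zero>\<^bsub>M\<^esub> c"
        using cover_kernel(2)[OF N iX[OF x] _ c] iW[OF x] c x by (simp add: i_smult i_zero)
    qed
  qed
  text \<open>A map into \<open>fpart M\<close>, whose values are themselves functions, is determined by evaluating these at \<open>f\<close>.\<close>
  define flat where "flat \<psi> = (\<lambda>c\<in>C. i (\<psi> c) f)" for \<psi>
  note EM = E_module[OF M_side] and VM = V_module[OF M_side]
  have Ec: "\<psi> c \<in> carrier M" "f \<odot>\<^bsub>M\<^esub> \<psi> c = \<psi> c" if "\<psi> \<in> E M" "c \<in> C" for \<psi> c
    using coind_closed[OF that] by auto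
  have flat_closed: "flat \<psi> \<in> ?X" if \<psi>: "\<psi> \<in> E M" for \<psi>
    unfolding flat_def
  proof (rule coindI)
    fix c assume c: "c \<in> C"
    note \<psi>c = Ec[OF \<psi> c]
    show "i (\<psi> c) f \<in> carrier ?V" by (rule coind_closed[OF iX[OF \<psi>c(1)] C_f])
    show "i (\<psi> (c \<oplus> c')) f = i (\<psi> c) f \<oplus>\<^bsub>?V\<^esub> i (\<psi> c') f" if c': "c' \<in> C" for c'
      using coind_add[OF \<psi> c c'] i_add[OF \<psi>c(1) Ec(1)[OF \<psi> c'] C_f] by simp
    show "i (\<psi> (c \<otimes> d)) f = d \<odot>\<^bsub>?V\<^esub> i (\<psi> c) f" if d: "d \<in> carrier R" "f \<otimes> d = d" for d
    proof -
      have "i (\<psi> (c \<otimes> d)) f = i (d \<odot>\<^bsub>M\<^esub> \<psi> c) f" using coind_smult[OF \<psi> _ c, of d] d by simp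
      also have "\<dots> = i (\<psi> c) (f \<otimes> d)" using i_smult[OF d(1) \<psi>c(1) C_f] d D_right_f by simp
      also have "\<dots> = d \<odot>\<^bsub>?V\<^esub> i (\<psi> c) f" using coind_smult[OF iX[OF \<psi>c(1)] _ C_f, of d] d by simp
      finally show ?thesis .
    qed
  qed
  have "restrict flat (carrier (coinduced (fpart M))) \<in> rmod_hom R (coinduced (fpart M)) ?E"
  proof (rule rmod_hom_restrictI[OF EM])
    fix \<psi> assume "\<psi> \<in> carrier (coinduced (fpart M))"
    then have \<psi>: "\<psi> \<in> E M" by simp
    show "flat \<psi> \<in> carrier ?E" using flat_closed[OF \<psi>] by simp
    show "flat (\<psi> \<oplus>\<^bsub>coinduced (fpart M)\<^esub> \<phi>) = flat \<psi> \<oplus>\<^bsub>?E\<^esub> flat \<phi>" if "\<phi> \<in> carrier (coinduced (fpart M))" for \<phi>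
      using that Ec(1)[OF \<psi>] Ec(1)[of \<phi>] i_add by (auto simp: flat_def intro!: restrict_ext)
    show "flat (r \<odot>\<^bsub>coinduced (fpart M)\<^esub> \<psi>) = r \<odot>\<^bsub>?E\<^esub> flat \<psi>" if "r \<in> carrier R" for r
      using that by (auto simp: flat_def C_mult intro!: restrict_ext)
  qed
  then have flat_hom: "restrict flat (E M) \<in> rmod_hom R (coinduced (fpart M)) ?E" by simp
  have flat_inj: "\<phi> = \<psi>" if \<phi>: "\<phi> \<in> E M" and \<psi>: "\<psi> \<in> E M" and eq: "flat \<phi> = flat \<psi>" for \<phi> \<psi>
  proof (rule coind_ext[OF \<phi> \<psi>])
    fix c assume c: "c \<in> C"
    have *: "i (\<chi> c) c' = (f \<otimes> c') \<odot>\<^bsub>?V\<^esub> i (\<chi> c) f" if \<chi>: "\<chi> \<in> E M" and c': "c' \<in> C" for \<chi> c'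
    proof -
      note \<chi>c = Ec[OF \<chi> c]
      have "i (\<chi> c) c' = i (f \<odot>\<^bsub>M\<^esub> \<chi> c) c'" using \<chi>c by simp
      also have "\<dots> = i (f \<odot>\<^bsub>M\<^esub> \<chi> c) (f \<otimes> c')"
        using i_smult[OF f_closed \<chi>c(1)] c' by (simp add: C_mult C_closed flip: m_assoc)
      also have "\<dots> = i (\<chi> c) (f \<otimes> (f \<otimes> c'))"
        using i_smult[OF f_closed \<chi>c(1)] c' by (simp add: C_mult)
      also have "\<dots> = (f \<otimes> c') \<odot>\<^bsub>?V\<^esub> i (\<chi> c) f"
        by (rule coind_smult[OF iX[OF \<chi>c(1)] f_mult_D[OF C_closed[OF c']] C_f])
      finally show ?thesis .
    qed
    show "\<phi> c = \<psi> c"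
    proof (rule i_eqI[OF Ec(1)[OF \<phi> c] Ec(1)[OF \<psi> c]])
      fix c' assume c': "c' \<in> C"
      have "i (\<phi> c) f = i (\<psi> c) f" using fun_cong[OF eq, of c] c by (simp add: flat_def)
      then show "i (\<phi> c) c' = i (\<psi> c) c'" by (simp only: *[OF \<phi> c'] *[OF \<psi> c'])
    qed
  qed
  have flat_surj: "\<exists>\<psi>\<in>E M. flat \<psi> = \<chi>" if \<chi>: "\<chi> \<in> ?X" for \<chi>
  proof -
    \<comment> \<open>The function fixed by \<open>f\<close> whose value at \<open>f\<close> is
      \<open>w\<close>. It lies in the kernel by the third part of \<open>cover_kernel\<close>, and
      inverts the evaluation used in \<open>flat\<close>.\<close>
    define \<beta> where "\<beta> w = (\<lambda>c\<in>C. (f \<otimes> c) \<odot>\<^bsub>?V\<^esub> w)" for w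
    have \<beta>X: "\<beta> w \<in> ?X" if w: "w \<in> carrier ?V" for w
      unfolding \<beta>_def
    proof (rule coindI)
      fix c assume c: "c \<in> C"
      note fc = f_mult_D[OF C_closed[OF c]]
      show "(f \<otimes> c) \<odot>\<^bsub>?V\<^esub> w \<in> carrier ?V" by (rule V.smult_closed[OF fc w])
      show "(f \<otimes> (c \<oplus> c')) \<odot>\<^bsub>?V\<^esub> w = (f \<otimes> c) \<odot>\<^bsub>?V\<^esub> w \<oplus>\<^bsub>?V\<^esub> (f \<otimes> c') \<odot>\<^bsub>?V\<^esub> w" if c': "c' \<in> C" for c'
        using V.smult_l_distr[OF fc f_mult_D[OF C_closed[OF c']] w] c c' by (simp add: r_distr C_closed)
      show "(f \<otimes> (c \<otimes> d)) \<odot>\<^bsub>?V\<^esub> w = d \<odot>\<^bsub>?V\<^esub> ((f \<otimes> c) \<odot>\<^bsub>?V\<^esub> w)" if d: "d \<in> carrier R" "f \<otimes> d = d" for d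
        using V.smult_assoc[OF fc _ w, of d] c d by (simp add: C_closed flip: m_assoc)
    qed
    have f\<beta>: "f \<odot>\<^bsub>?E\<^esub> \<beta> w = \<beta> w" for w
      by (auto simp: \<beta>_def C_mult C_closed simp flip: m_assoc intro!: restrict_ext)
    have \<beta>W: "\<beta> w \<in> ?W" if "w \<in> carrier ?V" for w
      using cover_kernel(3)[OF N \<beta>X[OF that] f\<beta>] \<beta>X[OF that] by simp
    note \<chi>c = coind_closed[OF \<chi>]
    have \<psi>E: "(\<lambda>c\<in>C. j (\<beta> (\<chi> c))) \<in> E M"
    proof (rule coindI)
      fix c assume c: "c \<in> C"
      have "f \<odot>\<^bsub>M\<^esub> j (\<beta> (\<chi> c)) = j (f \<odot>\<^bsub>?M0\<^esub> \<beta> (\<chi> c))"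
        using j.smult[OF f_closed, of "\<beta> (\<chi> c)"] \<beta>W[OF \<chi>c[OF c]] by simp
      also have "\<dots> = j (\<beta> (\<chi> c))" using f\<beta>[of "\<chi> c"] by simp
      finally show "j (\<beta> (\<chi> c)) \<in> carrier (fpart M)" using jc[OF \<beta>W[OF \<chi>c[OF c]]] by simp
      show "j (\<beta> (\<chi> (c \<oplus> c'))) = j (\<beta> (\<chi> c)) \<oplus>\<^bsub>fpart M\<^esub> j (\<beta> (\<chi> c'))" if c': "c' \<in> C" for c'
      proof -
        have "\<beta> (\<chi> (c \<oplus> c')) = \<beta> (\<chi> c) \<oplus>\<^bsub>?M0\<^esub> \<beta> (\<chi> c')"
          using V.smult_r_distr[OF f_mult_D[OF C_closed] \<chi>c[OF c] \<chi>c[OF c']] coind_add[OF \<chi> c c']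
          by (auto simp: \<beta>_def intro!: restrict_ext)
        then show ?thesis using j.add[of "\<beta> (\<chi> c)" "\<beta> (\<chi> c')"] \<beta>W[OF \<chi>c[OF c]] \<beta>W[OF \<chi>c[OF c']] by simp
      qed
      show "j (\<beta> (\<chi> (c \<otimes> d))) = d \<odot>\<^bsub>fpart M\<^esub> j (\<beta> (\<chi> c))" if d: "d \<in> carrier R" "f \<otimes> d = d" for d
      proof -
        have dD: "d \<in> carrier D" using d by simp
        have "\<beta> (\<chi> (c \<otimes> d)) = d \<odot>\<^bsub>?M0\<^esub> \<beta> (\<chi> c)"
        proof -
          have "(f \<otimes> c') \<odot>\<^bsub>?V\<^esub> (d \<odot>\<^bsub>?V\<^esub> \<chi> c) = (f \<otimes> (d \<otimes> c')) \<odot>\<^bsub>?V\<^esub> \<chi> c" if c': "c' \<in> C" for c'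
          proof -
            have "d \<otimes> (f \<otimes> c') = f \<otimes> (d \<otimes> c')"
              using d D_right_f[OF d] c' by (simp add: C_closed flip: m_assoc)
            then show ?thesis using V.smult_assoc[OF dD f_mult_D[OF C_closed[OF c']] \<chi>c[OF c]] by simp
          qed
          then show ?thesis using coind_smult[OF \<chi> dD c] d by (auto simp: \<beta>_def C_mult intro!: restrict_ext)
        qed
        then show ?thesis using j.smult[OF d(1), of "\<beta> (\<chi> c)"] \<beta>W[OF \<chi>c[OF c]] by simp
      qed
    qed
    have "flat (\<lambda>c\<in>C. j (\<beta> (\<chi> c))) = \<chi>"
    proof (rule coind_ext[OF flat_closed[OF \<psi>E] \<chi>])
      fix c assume c: "c \<in> C"
      show "flat (\<lambda>c\<in>C. j (\<beta> (\<chi> c))) c = \<chi> c"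
        using c ij[OF \<beta>W[OF \<chi>c[OF c]]] V.smult_one[OF \<chi>c[OF c]] by (simp add: flat_def \<beta>_def)
    qed
    then show ?thesis using \<psi>E by blast
  qed
  have flat_iota: "flat (iota M x) = i x" if x: "x \<in> carrier M" for x
  proof (rule coind_ext[OF flat_closed[OF iota_closed[OF M_side x]] iX[OF x]])
    fix c assume c: "c \<in> C"
    then show "flat (iota M x) c = i x c"
      using x i_smult[of c x f] by (simp add: flat_def iota_apply) (simp add: C_def)
  qed
  let ?\<theta> = "compose (E M) (restrict (cover N) ?X) (restrict flat (E M))"
  have \<theta>: "?\<theta> \<in> rmod_hom R (coinduced (fpart M)) N"
    using rmod_hom_compose[OF EM flat_hom cover_hom[OF NR]] by simp
  have \<theta>_eq: "?\<theta> \<psi> = cover N (flat \<psi>)" if "\<psi> \<in> E M" for \<psi>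
    using that flat_closed[OF that] by (simp add: compose_eq)
  have "\<exists>h\<in>rmod_hom R (Fo M) N. bij_betw h (carrier (Fo M)) (carrier N)"
  \<comment> \<open>Both \<open>q M\<close> and \<open>?\<theta>\<close> are surjections defined on
    \<open>coinduced (fpart M)\<close> whose kernel is the image of \<open>iota M\<close>.\<close>
  proof (rule iso_of_same_kernel[OF EM Fo_module[OF M_side] NR q_hom[OF M_side] _ \<theta>])
    show "q M ` carrier (coinduced (fpart M)) = carrier (Fo M)" using q_surj[OF M_side] by simp
    have "?\<theta> ` E M = cover N ` flat ` E M" unfolding image_image by (rule image_cong[OF refl \<theta>_eq])
    also have "flat ` E M = ?X" using flat_closed flat_surj by blast
    also have "cover N ` ?X = carrier N" by (rule cover_surj[OF N])
    finally show "?\<theta> ` carrier (coinduced (fpart M)) = carrier N" by (simp only: coinduced_simps)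
    fix \<psi> assume "\<psi> \<in> carrier (coinduced (fpart M))"
    then have \<psi>: "\<psi> \<in> E M" by simp
    show "q M \<psi> = \<zero>\<^bsub>Fo M\<^esub> \<longleftrightarrow> ?\<theta> \<psi> = \<zero>\<^bsub>N\<^esub>"
      unfolding q_zero_iff[OF M_side \<psi>] \<theta>_eq[OF \<psi>]
    proof
      assume "\<exists>x\<in>carrier M. \<psi> = iota M x"
      then show "cover N (flat \<psi>) = \<zero>\<^bsub>N\<^esub>" using flat_iota iW by auto
    next
      assume "cover N (flat \<psi>) = \<zero>\<^bsub>N\<^esub>"
      then have fW: "flat \<psi> \<in> ?W" using flat_closed[OF \<psi>] by simp
      have "\<psi> = iota M (j (flat \<psi>))"
        by (rule flat_inj[OF \<psi> iota_closed[OF M_side jc[OF fW]]]) (simp add: flat_iota[OF jc[OF fW]] ij[OF fW])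
      then show "\<exists>x\<in>carrier M. \<psi> = iota M x" using jc[OF fW] by blast
    qed
  qed
  then show ?thesis using M_side by blast
qed

end

section \<open>Idempotents\<close>

context ring
begin

definition corner where "corner g = R\<lparr>carrier := {d \<in> carrier R. g \<otimes> d = d \<and> d \<otimes> g = d}, one := g\<rparr>"

lemma corner_simps [simp]:
  "carrier (corner g) = {d \<in> carrier R. g \<otimes> d = d \<and> d \<otimes> g = d}" "mult (corner g) = mult R"
  "add (corner g) = add R" "zero (corner g) = \<zero>" "one (corner g) = g"
  by (simp_all add: corner_def)

lemma ring_corner:
  assumes g: "g \<in> carrier R" "g \<otimes> g = g" shows "ring (corner g)"
proof -
  have "abelian_group (corner g)"
    by (rule abelian_subgroup_structure) (use g in \<open>auto simp: r_distr l_distr r_minus l_minus\<close>)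
  moreover have "monoid (corner g)"
  proof (rule monoidI)
    fix x y assume "x \<in> carrier (corner g)" "y \<in> carrier (corner g)"
    then show "x \<otimes>\<^bsub>corner g\<^esub> y \<in> carrier (corner g)"
      using g by (simp add: m_assoc) (simp flip: m_assoc)
  qed (use g in \<open>auto simp: m_assoc\<close>)
  ultimately show ?thesis
    by (intro ringI) (auto simp: r_distr l_distr abelian_group_def monoid_def)
qed

lemma corner_mult:
  "\<lbrakk>g \<in> carrier R; g \<otimes> g = g; x \<in> carrier R\<rbrakk> \<Longrightarrow> g \<otimes> x \<otimes> g \<in> carrier (corner g)"
  by (simp add: m_assoc) (simp flip: m_assoc)

lemma principal_carrier:
  assumes "g \<in> carrier R" "g \<otimes> g = g"
  shows "carrier (principal_rmod R g) = {x \<in> carrier R. g \<otimes> x = x}"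
proof -
  have "x \<in> (\<lambda>x. g \<otimes> x) ` carrier R" if "x \<in> carrier R" "g \<otimes> x = x" for x
    using that by (metis imageI)
  then show ?thesis using assms by (auto simp: principal_rmod_def simp flip: m_assoc)
qed

lemma principal_simps [simp]:
  "add (principal_rmod R g) = add R" "zero (principal_rmod R g) = \<zero>"
  "smult (principal_rmod R g) = (\<lambda>r x. x \<otimes> r)"
  by (simp_all add: principal_rmod_def regular_rmod_def)

lemma principal_right_module:
  assumes "g \<in> carrier R" "g \<otimes> g = g" shows "right_module R (principal_rmod R g)"
proof -
  interpret reg: right_module R "regular_rmod R" by (rule regular_right_module[OF ring_axioms])
  have "submodule {x \<in> carrier R. g \<otimes> x = x} R (regular_rmod R)"
    using assms by (auto simp: reg.submodule_iff r_distr simp flip: m_assoc)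
  from reg.submodule_right_module[OF this] show ?thesis
    using principal_carrier[OF assms] by (simp add: principal_rmod_def)
qed

definition part where "part g M = M\<lparr>carrier := {x \<in> carrier M. g \<odot>\<^bsub>M\<^esub> x = x}\<rparr>"

lemma part_simps [simp]:
  "carrier (part g M) = {x \<in> carrier M. g \<odot>\<^bsub>M\<^esub> x = x}" "add (part g M) = add M"
  "zero (part g M) = zero M" "smult (part g M) = smult M"
  by (simp_all add: part_def)

lemma part_right_module:
  assumes g: "g \<in> carrier R" "g \<otimes> g = g" and M: "right_module R M"
  shows "right_module (corner g) (part g M)"
proof -
  interpret M: right_module R M by fact
  have "abelian_group (part g M)"
    by (rule M.M.abelian_subgroup_structure) (use g in \<open>auto simp: M.smult_r_distr M.smult_r_minus\<close>)
  then show ?thesis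
    by (intro right_module.intro right_module_axioms.intro ring_corner g)
      (use g in \<open>auto simp: M.smult_l_distr M.smult_r_distr M.smult_assoc simp flip: M.smult_assoc[of _ g]\<close>)
qed

lemma part_mem:
  assumes "right_module R M" "g \<in> carrier R" "g \<otimes> g = g" "x \<in> carrier M"
  shows "g \<odot>\<^bsub>M\<^esub> x \<in> carrier (part g M)"
proof -
  interpret M: right_module R M by fact
  show ?thesis using assms by (simp flip: M.smult_assoc)
qed

lemma part_hom:
  assumes "g \<in> carrier R" "g \<otimes> g = g" "right_module R M" "h \<in> rmod_hom R M M'"
  shows "restrict h (carrier (part g M)) \<in> rmod_hom (corner g) (part g M) (part g M')"
  by (rule rmod_hom_restrictI[OF part_right_module[OF assms(1-3)]])
    (use rmod_homD[OF assms(4)] assms(1) in \<open>auto simp flip: rmod_homD(3)[OF assms(4)]\<close>)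

end

text \<open>What is retained of an incidence algebra: a complete family of orthogonal idempotents,
  triangular along the order, with division rings on the diagonal. Simple modules will live at a
  single index.\<close>

locale poset_idempotents = ring +
  fixes I :: "'i::order set" and \<epsilon> :: "'i \<Rightarrow> 'a"
  assumes finite_I [simp]: "finite I"
    and idem_closed [simp, intro]: "i \<in> I \<Longrightarrow> \<epsilon> i \<in> carrier R"
    and idem_idem [simp]: "i \<in> I \<Longrightarrow> \<epsilon> i \<otimes> \<epsilon> i = \<epsilon> i"
    and idem_orth: "\<lbrakk>i \<in> I; j \<in> I; i \<noteq> j\<rbrakk> \<Longrightarrow> \<epsilon> i \<otimes> \<epsilon> j = \<zero>"
    and idem_sum: "(\<Oplus>i\<in>I. \<epsilon> i) = \<one>"
    and idem_order: "\<lbrakk>i \<in> I; j \<in> I; x \<in> carrier R; \<not> i \<le> j\<rbrakk> \<Longrightarrow> \<epsilon> i \<otimes> x \<otimes> \<epsilon> j = \<zero>"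
    and idem_nonzero: "i \<in> I \<Longrightarrow> \<epsilon> i \<noteq> \<zero>"
    and corner_division: "\<lbrakk>i \<in> I; d \<in> carrier (corner (\<epsilon> i)); d \<noteq> \<zero>\<rbrakk> \<Longrightarrow> \<exists>d'\<in>carrier (corner (\<epsilon> i)). d \<otimes> d' = \<epsilon> i"
begin

lemma part_division:
  assumes "i \<in> I" "right_module R M" shows "division_module (corner (\<epsilon> i)) (part (\<epsilon> i) M)"
  by (intro division_module.intro division_module_axioms.intro part_right_module)
    (use assms corner_division in auto)

lemma mem_if_components:
  assumes M: "right_module R M" and L: "submodule L R M" and x: "x \<in> carrier M"
    and "\<And>i. i \<in> I \<Longrightarrow> \<epsilon> i \<odot>\<^bsub>M\<^esub> x \<in> L"
  shows "x \<in> L"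
proof -
  interpret M: right_module R M by fact
  have "x = (\<Oplus>\<^bsub>M\<^esub>i\<in>I. \<epsilon> i \<odot>\<^bsub>M\<^esub> x)"
    using M.smult_finsum[of I x \<epsilon>] x idem_sum by auto
  also have "\<dots> \<in> L" by (rule M.submodule_finsum[OF L]) (use assms in auto)
  finally show ?thesis .
qed

text \<open>Insert 1 as the sum of the idempotents between \<open>y\<close> and \<open>r\<close>: by
  triangularity, component \<open>j\<close> of the product involves only components of
  \<open>y\<close> at indices \<open>k \<le> j\<close>.\<close>

lemma component_mem:
  assumes M: "right_module R M" and L: "submodule L R M" and j: "j \<in> I" and r: "r \<in> carrier R"
    and y: "y \<in> carrier M" and k: "\<And>k. \<lbrakk>k \<in> I; k \<le> j\<rbrakk> \<Longrightarrow> \<epsilon> k \<odot>\<^bsub>M\<^esub> y \<in> L"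
  shows "\<epsilon> j \<odot>\<^bsub>M\<^esub> (r \<odot>\<^bsub>M\<^esub> y) \<in> L"
proof -
  interpret M: right_module R M by fact
  have "\<epsilon> j \<odot>\<^bsub>M\<^esub> (r \<odot>\<^bsub>M\<^esub> y) = ((\<Oplus>k\<in>I. \<epsilon> k) \<otimes> (r \<otimes> \<epsilon> j)) \<odot>\<^bsub>M\<^esub> y"
    using j r y by (simp add: idem_sum M.smult_assoc)
  also have "(\<Oplus>k\<in>I. \<epsilon> k) \<otimes> (r \<otimes> \<epsilon> j) = (\<Oplus>k\<in>I. \<epsilon> k \<otimes> (r \<otimes> \<epsilon> j))"
    by (rule finsum_ldistr) (use j r in auto)
  also have "\<dots> \<odot>\<^bsub>M\<^esub> y = (\<Oplus>\<^bsub>M\<^esub>k\<in>I. (\<epsilon> k \<otimes> (r \<otimes> \<epsilon> j)) \<odot>\<^bsub>M\<^esub> y)"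
    by (rule M.smult_finsum) (use j r y in auto)
  also have "\<dots> \<in> L"
  proof (rule M.submodule_finsum[OF L finite_I], rule Pi_I)
    fix k' assume k': "k' \<in> I"
    show "(\<epsilon> k' \<otimes> (r \<otimes> \<epsilon> j)) \<odot>\<^bsub>M\<^esub> y \<in> L"
    proof (cases "k' \<le> j")
      case True
      have "(\<epsilon> k' \<otimes> (r \<otimes> \<epsilon> j)) \<odot>\<^bsub>M\<^esub> y = (r \<otimes> \<epsilon> j) \<odot>\<^bsub>M\<^esub> (\<epsilon> k' \<odot>\<^bsub>M\<^esub> y)"
        using j r y k' by (simp add: M.smult_assoc)
      then show ?thesis using M.submodule_smult[OF L _ k[OF k' True], of "r \<otimes> \<epsilon> j"] r j by simp
    next
      case False
      then show ?thesis using idem_order[OF k' j r] j r y k' M.submodule_zero[OF L] by (simp flip: m_assoc)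
    qed
  qed
  finally show ?thesis .
qed

lemma component_zero:
  assumes "right_module R M" "j \<in> I" "r \<in> carrier R" "y \<in> carrier M"
    and "\<And>k. \<lbrakk>k \<in> I; k \<le> j\<rbrakk> \<Longrightarrow> \<epsilon> k \<odot>\<^bsub>M\<^esub> y = \<zero>\<^bsub>M\<^esub>"
  shows "\<epsilon> j \<odot>\<^bsub>M\<^esub> (r \<odot>\<^bsub>M\<^esub> y) = \<zero>\<^bsub>M\<^esub>"
  using component_mem[OF assms(1) right_module.zero_submodule[OF assms(1)] assms(2-4)] assms(5) by simp

lemma idem_idem_smult:
  assumes "right_module R M" "i \<in> I" "j \<in> I" "x \<in> carrier M"
  shows "\<epsilon> i \<odot>\<^bsub>M\<^esub> (\<epsilon> j \<odot>\<^bsub>M\<^esub> x) = (if i = j then \<epsilon> j \<odot>\<^bsub>M\<^esub> x else \<zero>\<^bsub>M\<^esub>)"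
proof -
  interpret M: right_module R M by fact
  show ?thesis using assms idem_orth[of j i] by (auto simp flip: M.smult_assoc)
qed

lemma concentrated:
  assumes M: "right_module R M" and i: "i \<in> I" and y: "y \<in> carrier M"
    and z: "\<And>j. \<lbrakk>j \<in> I; j \<noteq> i\<rbrakk> \<Longrightarrow> \<epsilon> j \<odot>\<^bsub>M\<^esub> y = \<zero>\<^bsub>M\<^esub>"
  shows "\<epsilon> i \<odot>\<^bsub>M\<^esub> y = y"
proof -
  interpret M: right_module R M by fact
  have "y \<ominus>\<^bsub>M\<^esub> \<epsilon> i \<odot>\<^bsub>M\<^esub> y \<in> {\<zero>\<^bsub>M\<^esub>}"
  proof (rule mem_if_components[OF M M.zero_submodule])
    fix j assume j: "j \<in> I"
    show "\<epsilon> j \<odot>\<^bsub>M\<^esub> (y \<ominus>\<^bsub>M\<^esub> \<epsilon> i \<odot>\<^bsub>M\<^esub> y) \<in> {\<zero>\<^bsub>M\<^esub>}"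
      using z[OF j] i j y by (cases "j = i") (auto simp: M.smult_r_diff idem_idem_smult[OF M])
  qed (use i y in simp)
  then show ?thesis using i y M.M.diff_eq_zero_iff[of y "\<epsilon> i \<odot>\<^bsub>M\<^esub> y"] by simp
qed

lemma off_order_zero:
  assumes M: "right_module R M" and "i \<in> I" "j \<in> I" "r \<in> carrier R" "y \<in> carrier M" "\<not> i \<le> j"
    and y: "\<epsilon> i \<odot>\<^bsub>M\<^esub> y = y"
  shows "\<epsilon> j \<odot>\<^bsub>M\<^esub> (r \<odot>\<^bsub>M\<^esub> y) = \<zero>\<^bsub>M\<^esub>"
proof (rule component_zero[OF M])
  fix k assume "k \<in> I" "k \<le> j"
  then show "\<epsilon> k \<odot>\<^bsub>M\<^esub> y = \<zero>\<^bsub>M\<^esub>"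
    using idem_idem_smult[OF M, of k i y] assms by auto
qed (use assms in auto)

text \<open>If the cyclic module lives at \<open>i\<close>, then \<open>R\<close> acts on it through
  the division ring at \<open>i\<close>, and any nonzero multiple of \<open>y\<close> can be brought
  back to \<open>y\<close>.\<close>

lemma cyclic_simple:
  assumes M: "right_module R M" and i: "i \<in> I" and y: "y \<in> carrier M" "y \<noteq> \<zero>\<^bsub>M\<^esub>"
    and c: "\<And>s. s \<in> carrier R \<Longrightarrow> \<epsilon> i \<odot>\<^bsub>M\<^esub> (s \<odot>\<^bsub>M\<^esub> y) = s \<odot>\<^bsub>M\<^esub> y"
  shows "simple_rmod R (M\<lparr>carrier := (\<lambda>r. r \<odot>\<^bsub>M\<^esub> y) ` carrier R\<rparr>)"
proof -
  interpret M: right_module R M by fact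
  let ?S = "(\<lambda>r. r \<odot>\<^bsub>M\<^esub> y) ` carrier R"
  note S = M.cyclic_submodule[OF y(1)]
  have iy: "\<epsilon> i \<odot>\<^bsub>M\<^esub> y = y" using c[of \<one>] y by simp
  have "T = {\<zero>\<^bsub>M\<^esub>} \<or> T = ?S" if T: "submodule T R M" "T \<subseteq> ?S" for T
  proof (cases "T = {\<zero>\<^bsub>M\<^esub>}")
    case False
    then obtain z where z: "z \<in> T" "z \<noteq> \<zero>\<^bsub>M\<^esub>" using M.submodule_zero[OF T(1)] by blast
    then obtain s where s: "s \<in> carrier R" "z = s \<odot>\<^bsub>M\<^esub> y" using T by blast
    define d where "d = \<epsilon> i \<otimes> s \<otimes> \<epsilon> i"
    have d: "d \<in> carrier (corner (\<epsilon> i))" unfolding d_def by (rule corner_mult) (use i s in auto)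
    have zd: "z = d \<odot>\<^bsub>M\<^esub> y"
      using i s y iy c[OF s(1)] by (simp add: d_def M.smult_assoc)
    then have "d \<noteq> \<zero>" using z y by auto
    then obtain d' where d': "d' \<in> carrier (corner (\<epsilon> i))" "d \<otimes> d' = \<epsilon> i"
      using corner_division[OF i d] by blast
    have "y = d' \<odot>\<^bsub>M\<^esub> z" using d d' y iy zd M.smult_assoc[of d d' y] by simp
    then have "y \<in> T" using M.submodule_smult[OF T(1) _ z(1)] d' by simp
    then have "?S \<subseteq> T" using M.submodule_smult[OF T(1)] by blast
    then show ?thesis using T by blast
  qed simp
  moreover have "?S \<noteq> {\<zero>\<^bsub>M\<^esub>}" using M.mem_cyclic[OF y(1)] y(2) by blast
  ultimately show ?thesis
    unfolding simple_rmod_def M.submodule_submodule_iff[OF S]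
    using M.submodule_right_module[OF S] by simp
qed

text \<open>Take \<open>i\<close> maximal among the indices at which \<open>S\<close> has a nonzero
  component. The elements of \<open>S\<close> living at \<open>i\<close> form a submodule, since
  multiplication could only push them up to indices where \<open>S\<close> vanishes; by simplicity
  this is all of \<open>S\<close>.\<close>

lemma simple_concentrated:
  assumes M: "right_module R M" and S: "submodule S R M" and simple: "simple_rmod R (M\<lparr>carrier := S\<rparr>)"
  shows "\<exists>i\<in>I. \<forall>x\<in>S. \<epsilon> i \<odot>\<^bsub>M\<^esub> x = x"
proof -
  interpret M: right_module R M by fact
  note S' = M.submodule_subset[OF S]
  define A where "A = {i \<in> I. \<exists>x\<in>S. \<epsilon> i \<odot>\<^bsub>M\<^esub> x \<noteq> \<zero>\<^bsub>M\<^esub>}"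
  have "S \<noteq> {\<zero>\<^bsub>M\<^esub>}" using simple by (simp add: simple_rmod_def)
  then obtain x where "x \<in> S" "x \<noteq> \<zero>\<^bsub>M\<^esub>" using M.submodule_zero[OF S] by blast
  then have "A \<noteq> {}"
    using mem_if_components[OF M M.zero_submodule, of x] S' by (auto simp: A_def)
  then obtain i where i: "i \<in> A" and max: "\<And>j. j \<in> A \<Longrightarrow> i \<le> j \<Longrightarrow> j = i"
    using finite_has_maximal[of A] by (auto simp: A_def)
  have iI: "i \<in> I" using i by (simp add: A_def)
  define L where "L = {x \<in> S. \<epsilon> i \<odot>\<^bsub>M\<^esub> x = x}"
  have "submodule L R M"
    unfolding M.submodule_iff
  proof (intro conjI ballI)
    show "L \<subseteq> carrier M" "\<zero>\<^bsub>M\<^esub> \<in> L" using S' M.submodule_zero[OF S] iI by (auto simp: L_def)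
    show "x \<oplus>\<^bsub>M\<^esub> y \<in> L" if "x \<in> L" "y \<in> L" for x y
      using that M.submodule_add[OF S] S' iI by (auto simp: L_def M.smult_r_distr subset_iff)
    fix r x assume r: "r \<in> carrier R" and x: "x \<in> L"
    have xS: "x \<in> S" and xi: "\<epsilon> i \<odot>\<^bsub>M\<^esub> x = x" using x by (auto simp: L_def)
    have rS: "r \<odot>\<^bsub>M\<^esub> x \<in> S" by (rule M.submodule_smult[OF S r xS])
    have "\<epsilon> i \<odot>\<^bsub>M\<^esub> (r \<odot>\<^bsub>M\<^esub> x) = r \<odot>\<^bsub>M\<^esub> x"
    proof (rule concentrated[OF M iI])
      fix j assume j: "j \<in> I" "j \<noteq> i"
      show "\<epsilon> j \<odot>\<^bsub>M\<^esub> (r \<odot>\<^bsub>M\<^esub> x) = \<zero>\<^bsub>M\<^esub>"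
      proof (cases "i \<le> j")
        case True
        then show ?thesis using max[of j] j rS by (auto simp: A_def)
      next
        case False
        then show ?thesis using off_order_zero[OF M iI j(1) r _ _ xi] xS S' by blast
      qed
    qed (use r xS S' in auto)
    then show "r \<odot>\<^bsub>M\<^esub> x \<in> L" using rS by (simp add: L_def)
  qed
  moreover have "L \<noteq> {\<zero>\<^bsub>M\<^esub>}"
  proof -
    obtain x where x: "x \<in> S" "\<epsilon> i \<odot>\<^bsub>M\<^esub> x \<noteq> \<zero>\<^bsub>M\<^esub>" using i by (auto simp: A_def)
    then have "\<epsilon> i \<odot>\<^bsub>M\<^esub> x \<in> L"
      using iI S' M.submodule_smult[OF S _ x(1)] by (auto simp: L_def idem_idem_smult[OF M])
    then show ?thesis using x(2) by blast
  qed
  moreover have "L \<subseteq> S" by (auto simp: L_def)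
  ultimately have "L = S"
    using simple unfolding simple_rmod_def M.submodule_submodule_iff[OF S] by auto
  then show ?thesis using iI by (auto simp: L_def)
qed

text \<open>The simple module \<open>M/N\<close> lives at one index, shown without forming it. For
  \<open>i\<close> maximal among the components not inside \<open>N\<close>, the submodule
  \<open>Y\<close> of elements supported above \<open>i\<close> is not inside \<open>N\<close>, so
  \<open>N + Y = M\<close>. On \<open>Y\<close>, a component at \<open>k \<noteq> i\<close> vanishes
  or lies in \<open>N\<close> by maximality.\<close>

lemma maximal_concentrated:
  assumes M: "right_module R M" and N: "maximal_submodule N R M"
  shows "\<exists>i\<in>I. \<forall>k\<in>I. k \<noteq> i \<longrightarrow> (\<forall>x\<in>carrier M. \<epsilon> k \<odot>\<^bsub>M\<^esub> x \<in> N)"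
proof -
  interpret M: right_module R M by fact
  have sub: "submodule N R M" and ne: "N \<noteq> carrier M"
    and max: "\<And>L. \<lbrakk>submodule L R M; N \<subseteq> L\<rbrakk> \<Longrightarrow> L = N \<or> L = carrier M"
    using N by (auto simp: maximal_submodule_def)
  note N' = M.submodule_subset[OF sub]
  define A where "A = {i \<in> I. \<exists>x\<in>carrier M. \<epsilon> i \<odot>\<^bsub>M\<^esub> x \<notin> N}"
  have "A \<noteq> {}" using mem_if_components[OF M sub] ne N' by (auto simp: A_def)
  then obtain i where i: "i \<in> A" and mx: "\<And>j. j \<in> A \<Longrightarrow> i \<le> j \<Longrightarrow> j = i"
    using finite_has_maximal[of A] by (auto simp: A_def)
  have iI: "i \<in> I" using i by (simp add: A_def)
  obtain x where x: "x \<in> carrier M" "\<epsilon> i \<odot>\<^bsub>M\<^esub> x \<notin> N" using i by (auto simp: A_def)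
  define Y where "Y = {y \<in> carrier M. \<forall>j\<in>I. \<not> i \<le> j \<longrightarrow> \<epsilon> j \<odot>\<^bsub>M\<^esub> y = \<zero>\<^bsub>M\<^esub>}"
  have Y: "submodule Y R M"
    unfolding M.submodule_iff
  proof (intro conjI ballI)
    fix r y assume r: "r \<in> carrier R" and y: "y \<in> Y"
    have "\<epsilon> j \<odot>\<^bsub>M\<^esub> (r \<odot>\<^bsub>M\<^esub> y) = \<zero>\<^bsub>M\<^esub>" if "j \<in> I" "\<not> i \<le> j" for j
      by (rule component_zero[OF M that(1) r]) (use y that in \<open>auto simp: Y_def\<close>)
    then show "r \<odot>\<^bsub>M\<^esub> y \<in> Y" using r y by (simp add: Y_def)
  qed (auto simp: Y_def M.smult_r_distr)
  define L where "L = {n \<oplus>\<^bsub>M\<^esub> y |n y. n \<in> N \<and> y \<in> Y}"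
  have L: "submodule L R M" unfolding L_def by (rule M.submodule_sum[OF sub Y])
  have zY: "\<zero>\<^bsub>M\<^esub> \<in> Y" and zN: "\<zero>\<^bsub>M\<^esub> \<in> N" using M.submodule_zero Y sub by auto
  have NL: "n \<in> L" if "n \<in> N" for n
  proof -
    have "n = n \<oplus>\<^bsub>M\<^esub> \<zero>\<^bsub>M\<^esub>" using that N' by auto
    then show ?thesis using that zY unfolding L_def by blast
  qed
  have "\<epsilon> i \<odot>\<^bsub>M\<^esub> x \<in> Y" using x iI by (auto simp: Y_def idem_idem_smult[OF M])
  moreover have "\<epsilon> i \<odot>\<^bsub>M\<^esub> x = \<zero>\<^bsub>M\<^esub> \<oplus>\<^bsub>M\<^esub> \<epsilon> i \<odot>\<^bsub>M\<^esub> x" using x iI by simp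
  ultimately have "\<epsilon> i \<odot>\<^bsub>M\<^esub> x \<in> L" using zN unfolding L_def by blast
  then have LM: "L = carrier M" using max[OF L] NL x by blast
  have "\<epsilon> k \<odot>\<^bsub>M\<^esub> w \<in> N" if k: "k \<in> I" "k \<noteq> i" and w: "w \<in> carrier M" for k w
  proof -
    obtain n y where ny: "w = n \<oplus>\<^bsub>M\<^esub> y" "n \<in> N" "y \<in> Y" using w LM unfolding L_def by blast
    have c: "n \<in> carrier M" "y \<in> carrier M" using ny N' by (auto simp: Y_def)
    have "\<epsilon> k \<odot>\<^bsub>M\<^esub> y \<in> N"
    proof (cases "i \<le> k")
      case True
      then show ?thesis using mx[of k] k c by (auto simp: A_def)
    next
      case False
      then show ?thesis using ny k zN by (simp add: Y_def)
    qed
    moreover have "\<epsilon> k \<odot>\<^bsub>M\<^esub> n \<in> N" using M.submodule_smult[OF sub _ ny(2)] k by blast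
    ultimately show ?thesis using M.submodule_add[OF sub] c k ny(1) by (simp add: M.smult_r_distr)
  qed
  then show ?thesis using iI by blast
qed

end

section \<open>Splitting off the module \<open>eR\<close>\<close>

context dual_corner_ring
begin

lemma D_eq_corner: "D = corner f"
proof -
  have "{d \<in> carrier R. f \<otimes> d = d} = {d \<in> carrier R. f \<otimes> d = d \<and> d \<otimes> f = d}"
    using D_right_f by auto
  then show ?thesis by (simp add: D_def corner_def)
qed

lemma fpart_eq_part: "fpart M = part f M"
  by (simp add: fpart_def part_def)

text \<open>\<open>eR\<close> behaves as an injective module because it is coinduced: a functional
  on \<open>fpart M\<close> normalised at the image of \<open>x\<close> under \<open>u\<close>
  extends to \<open>\<rho> : M \<rightarrow> eR\<close> with \<open>\<rho> x = e\<close>. This makes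
  the cyclic module of \<open>x\<close> a complement of the kernel of \<open>\<rho>\<close>.\<close>

lemma principal_summand_if:
  assumes M: "right_module R M" and div: "division_module D (fpart M)"
    and x0: "x0 \<in> carrier M" "u \<odot>\<^bsub>M\<^esub> x0 \<noteq> \<zero>\<^bsub>M\<^esub>"
  shows "has_direct_summand R M (principal_rmod R e)"
proof -
  interpret M: right_module R M by fact
  interpret dv: division_module D "fpart M" by (rule div)
  let ?P = "principal_rmod R e"
  note P = principal_right_module[OF e_closed e_idem]
  note Pc = principal_carrier[OF e_closed e_idem]
  interpret P: right_module R ?P by (rule P)
  note V = epart_right_module[OF P]
  \<comment> \<open>Replacing \<open>x0\<close> by its part at \<open>e\<close> does not affect the
    action of \<open>u\<close>, and gives \<open>x\<close> the same annihilation as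
    \<open>e\<close>.\<close>
  define x where "x = e \<odot>\<^bsub>M\<^esub> x0"
  have x: "x \<in> carrier M" and ex: "e \<odot>\<^bsub>M\<^esub> x = x" and ux: "u \<odot>\<^bsub>M\<^esub> x = u \<odot>\<^bsub>M\<^esub> x0"
    using x0 by (simp_all add: x_def flip: M.smult_assoc)
  have uxf: "u \<odot>\<^bsub>M\<^esub> x \<in> carrier (fpart M)" using x by (simp flip: M.smult_assoc)
  obtain \<phi> where \<phi>: "\<phi> \<in> rmod_hom D (fpart M) (regular_rmod D)" and \<phi>x: "\<phi> (u \<odot>\<^bsub>M\<^esub> x) = f"
    using dv.exists_functional[OF uxf] x0(2) ux by auto
  \<comment> \<open>\<open>tw\<close> carries the values of the functional from \<open>D\<close> to
    the part of \<open>eR\<close> at \<open>e\<close>.\<close>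
  define \<tau> where "\<tau> = restrict (\<lambda>v. tw (\<phi> v)) (carrier (fpart M))"
  have \<tau>: "\<tau> \<in> rmod_hom D (fpart M) (epart ?P)"
    unfolding \<tau>_def
  proof (rule rmod_hom_restrictI[OF dv.right_module_axioms])
    fix v assume v: "v \<in> carrier (fpart M)"
    have \<phi>v: "\<phi> v \<in> carrier D" using rmod_homD(1)[OF \<phi> v] by simp
    then show "tw (\<phi> v) \<in> carrier (epart ?P)" by (simp add: Pc)
    show "tw (\<phi> (v \<oplus>\<^bsub>fpart M\<^esub> w)) = tw (\<phi> v) \<oplus>\<^bsub>epart ?P\<^esub> tw (\<phi> w)" if w: "w \<in> carrier (fpart M)" for w
      using rmod_homD(2)[OF \<phi> v w] tw_add[OF \<phi>v, of "\<phi> w"] rmod_homD(1)[OF \<phi> w] by simp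
    show "tw (\<phi> (d \<odot>\<^bsub>fpart M\<^esub> v)) = d \<odot>\<^bsub>epart ?P\<^esub> tw (\<phi> v)" if d: "d \<in> carrier D" for d
      using rmod_homD(3)[OF \<phi> d v] tw_mult[OF \<phi>v d] by simp
  qed
  \<comment> \<open>The composite of \<open>iota M\<close>, the map induced by \<open>\<tau>\<close>
    on coinduced modules, and \<open>cover\<close> for \<open>eR\<close>.\<close>
  define \<rho> where "\<rho> = compose (carrier M) (restrict (cover ?P) (rmod_hom D column (epart ?P)))
    (compose (carrier M) (restrict (compose C \<tau>) (rmod_hom D column (fpart M))) (iota M))"
  have \<rho>: "\<rho> \<in> rmod_hom R M ?P"
    unfolding \<rho>_def
    by (rule rmod_hom_compose[OF M rmod_hom_compose[OF M iota_hom[OF M] map_coind_hom[OF dv.right_module_axioms \<tau>]] cover_hom[OF P]])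
  interpret \<rho>: rmod_homomorphism R M ?P \<rho>
    by (intro rmod_homomorphism.intro rmod_homomorphism_axioms.intro M P \<rho>)
  have ix: "iota M x \<in> rmod_hom D column (fpart M)" using rmod_homD(1)[OF iota_hom[OF M] x] by simp
  have eP: "e \<in> carrier (epart ?P)" by (simp add: Pc)
  \<comment> \<open>Since \<open>c\<close> acts on \<open>x\<close> as \<open>u\<close> followed by
    \<open>pr c\<close>, the functional reads off \<open>pr c\<close>. The outcome is the
    \<open>hat\<close> vector of \<open>e\<close>, which \<open>cover\<close> returns as
    \<open>e\<close>.\<close>
  have "compose C \<tau> (iota M x) = hat (epart ?P) e"
  proof (rule coind_ext[OF map_coind[OF \<tau> ix] hat_closed[OF V eP]])
    fix c assume c: "c \<in> C"
    have "c \<odot>\<^bsub>M\<^esub> x = c \<odot>\<^bsub>M\<^esub> (e \<odot>\<^bsub>M\<^esub> x)" by (simp only: ex)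
    also have "\<dots> = (u \<otimes> pr c) \<odot>\<^bsub>M\<^esub> x" using c x by (simp add: u_pr_C C_closed flip: M.smult_assoc)
    also have "\<dots> = pr c \<odot>\<^bsub>M\<^esub> (u \<odot>\<^bsub>M\<^esub> x)" using c x by (simp add: M.smult_assoc C_closed)
    finally have cx: "c \<odot>\<^bsub>M\<^esub> x = pr c \<odot>\<^bsub>fpart M\<^esub> (u \<odot>\<^bsub>M\<^esub> x)" by simp
    have pc: "pr c \<in> carrier D" using c by (simp add: C_closed)
    have "\<phi> (c \<odot>\<^bsub>M\<^esub> x) = pr c"
      unfolding cx rmod_homD(3)[OF \<phi> pc uxf] \<phi>x using c by (simp add: C_closed)
    moreover have "c \<odot>\<^bsub>M\<^esub> x \<in> carrier (fpart M)" unfolding cx by (rule dv.smult_closed[OF pc uxf])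
    ultimately show "compose C \<tau> (iota M x) c = hat (epart ?P) e c"
      using c x by (simp add: compose_eq \<tau>_def iota_apply hat_def C_closed)
  qed
  then have \<rho>x: "\<rho> x = e"
    using x ix hat_closed[OF V eP] cover_hat[OF P eP] by (simp add: \<rho>_def compose_eq)
  let ?N = "(\<lambda>r. r \<odot>\<^bsub>M\<^esub> x) ` carrier R" and ?L = "{y \<in> carrier M. \<rho> y = \<zero>\<^bsub>?P\<^esub>}"
  have N: "submodule ?N R M" by (rule M.cyclic_submodule[OF x])
  have L: "submodule ?L R M" by (rule \<rho>.kernel_submodule)
  have \<rho>r: "\<rho> (r \<odot>\<^bsub>M\<^esub> x) = e \<otimes> r" if "r \<in> carrier R" for r using that x \<rho>x by simp
  have erx: "(e \<otimes> r) \<odot>\<^bsub>M\<^esub> x = r \<odot>\<^bsub>M\<^esub> x" if "r \<in> carrier R" for r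
    using that x ex by (simp add: M.smult_assoc)
  have "?N \<inter> ?L \<subseteq> {\<zero>\<^bsub>M\<^esub>}"
  proof
    fix y assume "y \<in> ?N \<inter> ?L"
    then obtain r where r: "r \<in> carrier R" "y = r \<odot>\<^bsub>M\<^esub> x" "\<rho> y = \<zero>" by auto
    then have "e \<otimes> r = \<zero>" using \<rho>r by simp
    then show "y \<in> {\<zero>\<^bsub>M\<^esub>}" using erx[OF r(1)] r(2) x by simp
  qed
  then have NL: "?N \<inter> ?L = {\<zero>\<^bsub>M\<^esub>}" using M.submodule_zero[OF N] M.submodule_zero[OF L] by blast
  have "carrier M \<subseteq> ?N <+>\<^bsub>M\<^esub> ?L"
  proof
    fix y assume y: "y \<in> carrier M"
    have s: "\<rho> y \<in> carrier R" "e \<otimes> \<rho> y = \<rho> y" using \<rho>.closed[OF y] by (auto simp: Pc)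
    have "\<rho> (y \<ominus>\<^bsub>M\<^esub> \<rho> y \<odot>\<^bsub>M\<^esub> x) = \<zero>\<^bsub>?P\<^esub>"
      using y s x \<rho>r[OF s(1)] \<rho>.closed[OF y] \<rho>.diff[OF y, of "\<rho> y \<odot>\<^bsub>M\<^esub> x"] P.M.diff_eq_zero_iff[of "\<rho> y" "\<rho> y"] by simp
    then have "y \<ominus>\<^bsub>M\<^esub> \<rho> y \<odot>\<^bsub>M\<^esub> x \<in> ?L" using y s x by simp
    moreover have "y = \<rho> y \<odot>\<^bsub>M\<^esub> x \<oplus>\<^bsub>M\<^esub> (y \<ominus>\<^bsub>M\<^esub> \<rho> y \<odot>\<^bsub>M\<^esub> x)"
      using y s x by (simp add: a_minus_def M.M.a_lcomm[of _ y] M.M.r_neg)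
    ultimately show "y \<in> ?N <+>\<^bsub>M\<^esub> ?L" using s unfolding set_add_def' by blast
  qed
  moreover have "?N <+>\<^bsub>M\<^esub> ?L \<subseteq> carrier M" using x by (auto simp: set_add_def')
  ultimately have sum: "?N <+>\<^bsub>M\<^esub> ?L = carrier M" by blast
  have iso: "rmod_iso R (M\<lparr>carrier := ?N\<rparr>) ?P"
  proof -
    have \<rho>N: "restrict \<rho> (carrier (M\<lparr>carrier := ?N\<rparr>)) \<in> rmod_hom R (M\<lparr>carrier := ?N\<rparr>) ?P"
      by (rule rmod_hom_restrictI[OF M.submodule_right_module[OF N]]) (use x in auto)
    have "rmod_homomorphism R (M\<lparr>carrier := ?N\<rparr>) ?P (restrict \<rho> (carrier (M\<lparr>carrier := ?N\<rparr>)))"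
      by (intro rmod_homomorphism.intro rmod_homomorphism_axioms.intro M.submodule_right_module[OF N] P \<rho>N)
    note inj = rmod_homomorphism.inj_iff[OF this]
    have "inj_on (restrict \<rho> (carrier (M\<lparr>carrier := ?N\<rparr>))) (carrier (M\<lparr>carrier := ?N\<rparr>))"
      unfolding inj
    proof (intro ballI impI)
      fix y assume "y \<in> carrier (M\<lparr>carrier := ?N\<rparr>)" "restrict \<rho> (carrier (M\<lparr>carrier := ?N\<rparr>)) y = \<zero>\<^bsub>?P\<^esub>"
      then have "y \<in> ?N \<inter> ?L" using x by auto
      then have "y = \<zero>\<^bsub>M\<^esub>" using NL by blast
      then show "y = \<zero>\<^bsub>M\<lparr>carrier := ?N\<rparr>\<^esub>" by simp
    qed
    moreover have "restrict \<rho> ?N ` ?N = carrier ?P"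
    proof -
      have "restrict \<rho> ?N ` ?N = (\<lambda>r. e \<otimes> r) ` carrier R"
        using \<rho>r by (auto simp: image_image)
      then show ?thesis by (simp add: principal_rmod_def)
    qed
    ultimately show ?thesis unfolding rmod_iso_def
      by (intro bexI[OF _ \<rho>N]) (simp add: bij_betw_def)
  qed
  show ?thesis unfolding has_direct_summand_def
    using N L NL sum iso by blast
qed

text \<open>In \<open>eR\<close> the generator \<open>e\<close> is sent by \<open>u\<close> to
  \<open>u\<close>, which is nonzero by cancellation; an isomorphism carries this over to the
  summand.\<close>

lemma u_nonzero_if_principal_summand:
  assumes M: "right_module R M" and f: "f \<noteq> \<zero>" and s: "has_direct_summand R M (principal_rmod R e)"
  shows "\<exists>x\<in>carrier M. u \<odot>\<^bsub>M\<^esub> x \<noteq> \<zero>\<^bsub>M\<^esub>"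
proof -
  interpret M: right_module R M by fact
  obtain N g where N: "submodule N R M" and g: "g \<in> rmod_hom R (M\<lparr>carrier := N\<rparr>) (principal_rmod R e)"
    and bij: "bij_betw g N (carrier (principal_rmod R e))"
    using s by (auto simp: has_direct_summand_def rmod_iso_def)
  interpret g: rmod_homomorphism R "M\<lparr>carrier := N\<rparr>" "principal_rmod R e" g
    by (intro rmod_homomorphism.intro rmod_homomorphism_axioms.intro
        M.submodule_right_module[OF N] principal_right_module g) auto
  have "e \<in> g ` N" using bij principal_carrier[OF e_closed e_idem] by (simp add: bij_betw_def)
  then obtain y where y: "y \<in> N" "g y = e" by auto
  have "u \<noteq> \<zero>" using f u_cancel[of f \<zero>] by auto
  moreover have "g (u \<odot>\<^bsub>M\<^esub> y) = u" using g.smult[of u y] y by simp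
  moreover have "g \<zero>\<^bsub>M\<^esub> = \<zero>" using g.zero by simp
  ultimately have "u \<odot>\<^bsub>M\<^esub> y \<noteq> \<zero>\<^bsub>M\<^esub>" by auto
  then show ?thesis using y M.submodule_subset[OF N] by blast
qed

end

section \<open>Test modules, quotients and socles\<close>

text \<open>\<open>projective_rmod\<close> tests only against modules on \<open>'u\<close>, and a
  copy of \<open>X\<close> there suffices. \<open>Y\<close> stays on \<open>'u\<close>, where the
  quotient to be tested is built directly.\<close>

lemma projective_lift:
  fixes X :: "('r, 'x) module" and Y :: "('r, 'u) module" and c :: "'x \<Rightarrow> 'u"
  assumes Q: "projective_rmod TYPE('u) R Q" and X: "right_module R X" and c: "inj_on c (carrier X)"
    and Y: "right_module R Y" and p: "p \<in> rmod_hom R X Y" "p ` carrier X = carrier Y"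
    and g: "g \<in> rmod_hom R Q Y"
  shows "\<exists>h\<in>rmod_hom R Q X. \<forall>n\<in>carrier Q. p (h n) = g n"
proof -
  interpret X: right_module R X by (rule X)
  obtain X' :: "('r, 'u) module" and j where X': "right_module R X'" and j: "j \<in> rmod_hom R X X'"
    and bij: "bij_betw j (carrier X) (carrier X')"
    using X.exists_copy[OF c] by blast
  interpret j: rmod_homomorphism R X X' j
    by (intro rmod_homomorphism.intro rmod_homomorphism_axioms.intro X X' j)
  define i where "i = restrict (inv_into (carrier X) j) (carrier X')"
  have i: "i \<in> rmod_hom R X' X" unfolding i_def by (rule j.inverse_hom[OF bij])
  have "i ` carrier X' = carrier X"
    unfolding i_def using bij_betw_inv_into[OF bij] by (simp add: bij_betw_def)
  then have surj: "compose (carrier X') p i ` carrier X' = carrier Y"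
    using p(2) by (simp add: compose_def image_image) (metis image_image)
  have QR: "right_module R Q" using Q by (simp add: projective_rmod_def)
  obtain h where h: "h \<in> rmod_hom R Q X'" "\<forall>n\<in>carrier Q. compose (carrier X') p i (h n) = g n"
    using Q[unfolded projective_rmod_def, THEN conjunct2, rule_format,
        of X' Y "compose (carrier X') p i" g] X' Y rmod_hom_compose[OF X' i p(1)] surj g by blast
  show ?thesis
    by (rule bexI[OF _ rmod_hom_compose[OF QR h(1) i]])
      (use h(2) rmod_homD(1)[OF h(1)] in \<open>auto simp: compose_eq\<close>)
qed

text \<open>Copies of both test modules are needed here, as they will be right ideals of the ring
  and thus live on the type of ring elements.\<close>

lemma injective_extension:
  fixes X :: "('r, 'x) module" and Y :: "('r, 'y) module" and c :: "'x \<Rightarrow> 'u" and d :: "'y \<Rightarrow> 'u"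
  assumes Q: "injective_rmod TYPE('u) R Q" and X: "right_module R X" and c: "inj_on c (carrier X)"
    and Y: "right_module R Y" and d: "inj_on d (carrier Y)"
    and f: "f \<in> rmod_hom R X Y" "inj_on f (carrier X)" and g: "g \<in> rmod_hom R X Q"
  shows "\<exists>h\<in>rmod_hom R Y Q. \<forall>x\<in>carrier X. h (f x) = g x"
proof -
  interpret X: right_module R X by (rule X)
  interpret Y: right_module R Y by (rule Y)
  obtain X' :: "('r, 'u) module" and j where X': "right_module R X'" and j: "j \<in> rmod_hom R X X'"
    and bij: "bij_betw j (carrier X) (carrier X')"
    using X.exists_copy[OF c] by blast
  obtain Y' :: "('r, 'u) module" and k where Y': "right_module R Y'" and k: "k \<in> rmod_hom R Y Y'"
    and kbij: "bij_betw k (carrier Y) (carrier Y')"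
    using Y.exists_copy[OF d] by blast
  interpret j: rmod_homomorphism R X X' j
    by (intro rmod_homomorphism.intro rmod_homomorphism_axioms.intro X X' j)
  define i where "i = restrict (inv_into (carrier X) j) (carrier X')"
  have i: "i \<in> rmod_hom R X' X" unfolding i_def by (rule j.inverse_hom[OF bij])
  have ij: "i (j x) = x" if "x \<in> carrier X" for x
    using bij_betw_inv_into_left[OF bij that] that by (simp add: i_def)
  let ?f = "compose (carrier X') (compose (carrier X) k f) i"
  have kf: "compose (carrier X) k f \<in> rmod_hom R X Y'" by (rule rmod_hom_compose[OF X f(1) k])
  have "inj_on ?f (carrier X')"
  proof (rule inj_onI)
    fix x y assume xy: "x \<in> carrier X'" "y \<in> carrier X'" "?f x = ?f y"
    note ic = rmod_homD(1)[OF i xy(1)] rmod_homD(1)[OF i xy(2)]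
    have "f (i x) = f (i y)"
      using xy ic rmod_homD(1)[OF f(1)] inj_onD[OF bij_betw_imp_inj_on[OF kbij]]
      by (simp add: compose_eq)
    then have "i x = i y" using inj_onD[OF f(2)] ic by blast
    then show "x = y"
      using xy bij_betw_inv_into_right[OF bij] by (simp add: i_def) metis
  qed
  then obtain h where h: "h \<in> rmod_hom R Y' Q"
    "\<forall>x\<in>carrier X'. h (?f x) = compose (carrier X') g i x"
    using Q[unfolded injective_rmod_def, THEN conjunct2, rule_format,
        of X' Y' ?f "compose (carrier X') g i"] X' Y' rmod_hom_compose[OF X' i kf] rmod_hom_compose[OF X' i g]
    by blast
  have "compose (carrier Y) h k (f x) = g x" if x: "x \<in> carrier X" for x
    using h(2)[rule_format, of "j x"] x rmod_homD(1)[OF f(1) x] ij[OF x] by (simp add: compose_eq)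
  then show ?thesis by (intro bexI[OF _ rmod_hom_compose[OF Y k h(1)]]) auto
qed

lemma quotient_module:
  fixes M :: "('r, 'm) module"
  assumes M: "right_module R M" and N: "submodule N R M"
  shows "right_module R (rmod_quotient M N)"
    and "restrict (\<lambda>x. N +>\<^bsub>M\<^esub> x) (carrier M) \<in> rmod_hom R M (rmod_quotient M N)"
    and "(\<lambda>x. N +>\<^bsub>M\<^esub> x) ` carrier M = carrier (rmod_quotient M N)"
    and "\<And>x. x \<in> carrier M \<Longrightarrow> N +>\<^bsub>M\<^esub> x = \<zero>\<^bsub>rmod_quotient M N\<^esub> \<longleftrightarrow> x \<in> N"
proof -
  interpret M: right_module R M by (rule M)
  interpret N: abelian_subgroup N M
    by (intro abelian_subgroupI3 additive_subgroup.intro M.abelian_group_axioms submodule.axioms(1)[OF N])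
  let ?Q = "rmod_quotient M N" and ?\<pi> = "\<lambda>x. N +>\<^bsub>M\<^esub> x"
  have Q: "carrier ?Q = a_rcosets\<^bsub>M\<^esub> N" "\<zero>\<^bsub>?Q\<^esub> = N" "add ?Q = set_add M"
    "smult ?Q = (\<lambda>r X. \<Union>x\<in>X. N +>\<^bsub>M\<^esub> (r \<odot>\<^bsub>M\<^esub> x))"
    by (simp_all add: rmod_quotient_def)
  show surj: "?\<pi> ` carrier M = carrier ?Q" by (auto simp: Q A_RCOSETS_def')
  have add: "?\<pi> (x \<oplus>\<^bsub>M\<^esub> y) = ?\<pi> x \<oplus>\<^bsub>?Q\<^esub> ?\<pi> y" if "x \<in> carrier M" "y \<in> carrier M" for x y
    using N.a_rcos_sum[OF that] by (simp add: Q)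
  have smult: "?\<pi> (r \<odot>\<^bsub>M\<^esub> x) = r \<odot>\<^bsub>?Q\<^esub> ?\<pi> x" if r: "r \<in> carrier R" and x: "x \<in> carrier M" for r x
  proof -
    \<comment> \<open>All representatives give the same coset, so the union in the scalar
      multiplication of \<open>rmod_quotient\<close> is that coset.\<close>
    have "?\<pi> (r \<odot>\<^bsub>M\<^esub> y) = ?\<pi> (r \<odot>\<^bsub>M\<^esub> x)" if y: "y \<in> ?\<pi> x" for y
    proof -
      have yc: "y \<in> carrier M" using N.a_elemrcos_carrier[OF x y] .
      have "y \<ominus>\<^bsub>M\<^esub> x \<in> N" using N.a_rcos_module_imp[OF x y] by (simp add: a_minus_def)
      then have "r \<odot>\<^bsub>M\<^esub> y \<ominus>\<^bsub>M\<^esub> r \<odot>\<^bsub>M\<^esub> x \<in> N"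
        using M.submodule_smult[OF N r] r x yc by (simp flip: M.smult_r_diff)
      then have "r \<odot>\<^bsub>M\<^esub> y \<in> ?\<pi> (r \<odot>\<^bsub>M\<^esub> x)"
        using N.a_rcos_module_rev[of "r \<odot>\<^bsub>M\<^esub> x" "r \<odot>\<^bsub>M\<^esub> y"] r x yc by (simp add: a_minus_def)
      then show ?thesis using N.a_repr_independence'[of "r \<odot>\<^bsub>M\<^esub> y" "r \<odot>\<^bsub>M\<^esub> x"] r x by simp
    qed
    then have "(\<Union>y\<in>?\<pi> x. ?\<pi> (r \<odot>\<^bsub>M\<^esub> y)) = (\<Union>y\<in>?\<pi> x. ?\<pi> (r \<odot>\<^bsub>M\<^esub> x))"
      by (intro SUP_cong refl)
    moreover have "?\<pi> x \<noteq> {}" using N.a_rcos_self[OF x] by blast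
    ultimately show ?thesis by (simp add: Q)
  qed
  have zero: "?\<pi> \<zero>\<^bsub>M\<^esub> = \<zero>\<^bsub>?Q\<^esub>"
    using N.a_rcos_const[OF M.submodule_zero[OF N]] by (simp add: Q)
  show Qm: "right_module R ?Q"
    by (rule right_module_if_surjective[OF M surj add smult zero])
  show "restrict ?\<pi> (carrier M) \<in> rmod_hom R M ?Q"
    by (rule rmod_hom_restrictI[OF M]) (use surj add smult in auto)
  show "?\<pi> x = \<zero>\<^bsub>?Q\<^esub> \<longleftrightarrow> x \<in> N" if "x \<in> carrier M" for x
    using N.a_rcos_const[of x] N.a_rcos_self[OF that] by (auto simp: Q)
qed

lemma (in right_module) submodule_Inter:
  assumes "\<F> \<noteq> {}" and sub: "\<And>N. N \<in> \<F> \<Longrightarrow> submodule N R M"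
  shows "submodule (\<Inter>\<F>) R M"
  unfolding submodule_iff
proof (intro conjI ballI)
  show "\<Inter>\<F> \<subseteq> carrier M" using assms submodule_subset by blast
qed (use sub submodule_zero submodule_add submodule_smult in \<open>auto\<close>)

lemma socle_submodule:
  fixes M :: "('r, 'm) module"
  assumes "right_module R M" shows "submodule (socle R M) R M"
proof -
  interpret M: right_module R M by fact
  show ?thesis unfolding socle_def
    by (rule M.submodule_Inter) (use M.carrier_submodule M.submodule_subset in auto)
qed

lemma socle_least:
  "\<lbrakk>submodule N R M; \<And>S. \<lbrakk>submodule S R M; simple_rmod R (M\<lparr>carrier := S\<rparr>)\<rbrakk> \<Longrightarrow> S \<subseteq> N\<rbrakk> \<Longrightarrow> socle R M \<subseteq> N"
  unfolding socle_def by blast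

lemma simple_subset_socle:
  "\<lbrakk>submodule S R M; simple_rmod R (M\<lparr>carrier := S\<rparr>)\<rbrakk> \<Longrightarrow> S \<subseteq> socle R M"
  unfolding socle_def by blast

lemma radical_submodule:
  fixes M :: "('r, 'm) module"
  assumes "right_module R M" shows "submodule (radical R M) R M"
proof -
  interpret M: right_module R M by fact
  show ?thesis unfolding radical_def M.submodule_iff
    by (auto simp: maximal_submodule_def M.submodule_zero M.submodule_add M.submodule_smult)
qed

section \<open>Socle-projective modules and modules with injective top\<close>

text \<open>\<open>to_top\<close> and \<open>from_bottom\<close> say that every index is joined to
  both ends by a nonzero entry. They are what contradicts projectivity of a socle, or injectivity of
  a top, that lives at a wrong index.\<close>

locale socle_top_ring =
  dual_corner_ring R e f u pr tw K a b + poset_idempotents R I \<epsilon>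
  for R (structure) and e f u pr tw and K :: "'k set" and a b and I :: "'i::order set" and \<epsilon> +
  fixes bt tp :: 'i
  assumes bt: "bt \<in> I" "\<epsilon> bt = e" and tp: "tp \<in> I" "\<epsilon> tp = f"
    and to_top: "i \<in> I \<Longrightarrow> \<exists>x\<in>carrier R. \<epsilon> i \<otimes> x \<otimes> f \<noteq> \<zero>"
    and from_bottom: "i \<in> I \<Longrightarrow> \<exists>x\<in>carrier R. e \<otimes> x \<otimes> \<epsilon> i \<noteq> \<zero>"
begin

definition torsion_free where
  "torsion_free M \<longleftrightarrow> (\<forall>x\<in>carrier M. (\<forall>c\<in>C. c \<odot>\<^bsub>M\<^esub> x = \<zero>\<^bsub>M\<^esub>) \<longrightarrow> x = \<zero>\<^bsub>M\<^esub>)"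

lemma fpart_submodule:
  assumes "right_module R M" shows "submodule {x \<in> carrier M. f \<odot>\<^bsub>M\<^esub> x = x} R M"
proof -
  interpret M: right_module R M by fact
  have "f \<odot>\<^bsub>M\<^esub> (r \<odot>\<^bsub>M\<^esub> x) = r \<odot>\<^bsub>M\<^esub> x" if r: "r \<in> carrier R" and x: "x \<in> carrier M" "f \<odot>\<^bsub>M\<^esub> x = x" for r x
  proof -
    have "f \<odot>\<^bsub>M\<^esub> (r \<odot>\<^bsub>M\<^esub> (f \<odot>\<^bsub>M\<^esub> x)) = (f \<otimes> r \<otimes> f) \<odot>\<^bsub>M\<^esub> x" using r x(1) by (simp add: M.smult_assoc)
    also have "\<dots> = r \<odot>\<^bsub>M\<^esub> (f \<odot>\<^bsub>M\<^esub> x)" using r x(1) by (simp add: f_row M.smult_assoc)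
    finally show ?thesis using x by simp
  qed
  then show ?thesis by (auto simp: M.submodule_iff M.smult_r_distr)
qed

text \<open>A simple submodule lives at one index; away from \<open>tp\<close> it would be
  annihilated by \<open>C\<close>. Conversely \<open>R\<close> acts on the part at \<open>f\<close>
  through \<open>D\<close>, so each of its nonzero elements spans a simple module.\<close>

lemma socle_eq_fpart:
  fixes M :: "('a, 'v) module"
  assumes M: "right_module R M" and tf: "torsion_free M"
  shows "socle R M = {x \<in> carrier M. f \<odot>\<^bsub>M\<^esub> x = x}"
proof (intro subset_antisym)
  interpret M: right_module R M by fact
  show "socle R M \<subseteq> {x \<in> carrier M. f \<odot>\<^bsub>M\<^esub> x = x}"
  proof (rule socle_least[OF fpart_submodule[OF M]])
    fix S assume S: "submodule S R M" and simple: "simple_rmod R (M\<lparr>carrier := S\<rparr>)"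
    note S' = M.submodule_subset[OF S]
    obtain i where i: "i \<in> I" "\<And>x. x \<in> S \<Longrightarrow> \<epsilon> i \<odot>\<^bsub>M\<^esub> x = x"
      using simple_concentrated[OF M S simple] by blast
    show "S \<subseteq> {x \<in> carrier M. f \<odot>\<^bsub>M\<^esub> x = x}"
    proof (cases "i = tp")
      case True
      then show ?thesis using i S' tp by auto
    next
      case False
      have "x = \<zero>\<^bsub>M\<^esub>" if x: "x \<in> S" for x
      proof -
        have "c \<odot>\<^bsub>M\<^esub> x = \<zero>\<^bsub>M\<^esub>" if c: "c \<in> C" for c
        proof -
          have xc: "x \<in> carrier M" using x S' by blast
          have "\<epsilon> i \<odot>\<^bsub>M\<^esub> (c \<odot>\<^bsub>M\<^esub> x) = c \<odot>\<^bsub>M\<^esub> x"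
            using i(2)[OF M.submodule_smult[OF S C_closed[OF c] x]] .
          moreover have "\<epsilon> tp \<odot>\<^bsub>M\<^esub> (c \<odot>\<^bsub>M\<^esub> x) = c \<odot>\<^bsub>M\<^esub> x"
            using c xc tp(2) by (simp add: C_def flip: M.smult_assoc)
          moreover have "\<epsilon> i \<odot>\<^bsub>M\<^esub> (\<epsilon> tp \<odot>\<^bsub>M\<^esub> (c \<odot>\<^bsub>M\<^esub> x)) = \<zero>\<^bsub>M\<^esub>"
            using idem_idem_smult[OF M i(1) tp(1), of "c \<odot>\<^bsub>M\<^esub> x"] False c xc by (simp add: C_closed)
          ultimately show ?thesis by simp
        qed
        then show ?thesis using tf x S' by (auto simp: torsion_free_def)
      qed
      then have "S \<subseteq> {\<zero>\<^bsub>M\<^esub>}" by blast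
      then show ?thesis by auto
    qed
  qed
  show "{x \<in> carrier M. f \<odot>\<^bsub>M\<^esub> x = x} \<subseteq> socle R M"
  proof
    fix x assume "x \<in> {x \<in> carrier M. f \<odot>\<^bsub>M\<^esub> x = x}"
    then have x: "x \<in> carrier M" "f \<odot>\<^bsub>M\<^esub> x = x" by auto
    show "x \<in> socle R M"
    proof (cases "x = \<zero>\<^bsub>M\<^esub>")
      case True
      then show ?thesis using M.submodule_zero[OF socle_submodule[OF M]] by simp
    next
      case False
      have "\<epsilon> tp \<odot>\<^bsub>M\<^esub> (s \<odot>\<^bsub>M\<^esub> x) = s \<odot>\<^bsub>M\<^esub> x" if "s \<in> carrier R" for s
        using M.submodule_smult[OF fpart_submodule[OF M] that, of x] x tp(2) by simp
      from simple_subset_socle[OF M.cyclic_submodule[OF x(1)] cyclic_simple[OF M tp(1) x(1) False this]]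
      show ?thesis using M.mem_cyclic[OF x(1)] by blast
    qed
  qed
qed

lemma fpart_division: "right_module R M \<Longrightarrow> division_module D (fpart M)"
  using part_division[OF tp(1), of M] by (simp add: tp(2) D_eq_corner fpart_eq_part)

text \<open>The socle is the part at \<open>f\<close>, where \<open>r\<close> acts as
  \<open>f r\<close> in \<open>D\<close>. Hence a \<open>D\<close>-linear section of
  \<open>X f \<rightarrow> Y f\<close> already provides an \<open>R\<close>-linear lift.\<close>

lemma projective_socle_if_torsion_free:
  fixes M :: "('a, 'u) module"
  assumes M: "right_module R M" and tf: "torsion_free M"
  shows "projective_rmod TYPE('u) R (M\<lparr>carrier := socle R M\<rparr>)"
proof -
  interpret M: right_module R M by fact
  let ?S = "{x \<in> carrier M. f \<odot>\<^bsub>M\<^esub> x = x}"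
  let ?N = "M\<lparr>carrier := ?S\<rparr>"
  note S = fpart_submodule[OF M]
  have N: "right_module R ?N" by (rule M.submodule_right_module[OF S])
  interpret N: right_module R ?N by (rule N)
  have "\<exists>h\<in>rmod_hom R ?N X. \<forall>x\<in>carrier ?N. p (h x) = g x"
    if X: "right_module R X" and Y: "right_module R Y" and p: "p \<in> rmod_hom R X Y"
      and surj: "p ` carrier X = carrier Y" and g: "g \<in> rmod_hom R ?N Y" for X Y :: "('a, 'u) module" and p g
  proof -
    interpret X: right_module R X by (rule X)
    interpret Y: right_module R Y by (rule Y)
    let ?p = "restrict p (carrier (fpart X))"
    have surj': "?p ` carrier (fpart X) = carrier (fpart Y)"
    proof (intro subset_antisym subsetI)
      fix y assume "y \<in> carrier (fpart Y)"
      then have y: "y \<in> carrier Y" "f \<odot>\<^bsub>Y\<^esub> y = y" by auto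
      then have "y \<in> p ` carrier X" using surj by simp
      then obtain x where x: "x \<in> carrier X" "y = p x" by (rule imageE)
      have "f \<odot>\<^bsub>X\<^esub> x \<in> carrier (fpart X)" using x by (simp flip: X.smult_assoc)
      moreover have "y = p (f \<odot>\<^bsub>X\<^esub> x)" using rmod_homD(3)[OF p f_closed x(1)] x y by simp
      ultimately show "y \<in> ?p ` carrier (fpart X)" by (intro image_eqI[of _ _ "f \<odot>\<^bsub>X\<^esub> x"]) simp_all
    qed (use rmod_homD(1)[OF fpart_hom[OF X p]] in blast)
    obtain s where s: "s \<in> rmod_hom D (fpart Y) (fpart X)" "\<And>y. y \<in> carrier (fpart Y) \<Longrightarrow> ?p (s y) = y"
      using division_module.exists_section[OF fpart_division[OF X] fpart_right_module[OF Y] fpart_hom[OF X p] surj'] by blast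
    have gf: "g x \<in> carrier (fpart Y)" if "x \<in> ?S" for x
      using that rmod_homD(1)[OF g, of x] rmod_homD(3)[OF g f_closed, of x] by simp
    have sg: "s (g x) \<in> carrier X" "f \<odot>\<^bsub>X\<^esub> s (g x) = s (g x)" if "x \<in> ?S" for x
      using rmod_homD(1)[OF s(1) gf[OF that]] by auto
    have "restrict (\<lambda>x. s (g x)) (carrier ?N) \<in> rmod_hom R ?N X"
    proof (rule rmod_hom_restrictI[OF N])
      fix x assume "x \<in> carrier ?N"
      then have x: "x \<in> ?S" by simp
      show "s (g x) \<in> carrier X" by (rule sg(1)[OF x])
      show "s (g (x \<oplus>\<^bsub>?N\<^esub> y)) = s (g x) \<oplus>\<^bsub>X\<^esub> s (g y)" if "y \<in> carrier ?N" for y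
        using that x rmod_homD(2)[OF g, of x y] rmod_homD(2)[OF s(1) gf[OF x] gf[of y]] by simp
      fix r assume r: "r \<in> carrier R"
      have fr: "f \<otimes> r \<in> carrier D" by (rule f_mult_D[OF r])
      have "r \<odot>\<^bsub>M\<^esub> x = (f \<otimes> r) \<odot>\<^bsub>M\<^esub> x" using x r by (simp add: M.smult_assoc)
      then have "g (r \<odot>\<^bsub>?N\<^esub> x) = (f \<otimes> r) \<odot>\<^bsub>fpart Y\<^esub> g x"
        using rmod_homD(3)[OF g, of "f \<otimes> r" x] x r by simp
      then have "s (g (r \<odot>\<^bsub>?N\<^esub> x)) = (f \<otimes> r) \<odot>\<^bsub>X\<^esub> s (g x)"
        using rmod_homD(3)[OF s(1) fr gf[OF x]] by simp
      then show "s (g (r \<odot>\<^bsub>?N\<^esub> x)) = r \<odot>\<^bsub>X\<^esub> s (g x)"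
        using sg[OF x] r X.smult_assoc[OF f_closed r sg(1)[OF x]] by simp
    qed
    moreover have "p (s (g x)) = g x" if "x \<in> ?S" for x
      using s(2)[OF gf[OF that]] rmod_homD(1)[OF s(1) gf[OF that]] by simp
    ultimately show ?thesis by (intro bexI[of _ "restrict (\<lambda>x. s (g x)) (carrier ?N)"]) auto
  qed
  then show ?thesis unfolding projective_rmod_def socle_eq_fpart[OF M tf] using N by blast
qed

text \<open>A torsion element yields a simple submodule \<open>y R\<close> at an index
  \<open>i \<noteq> tp\<close>. Projectivity of the socle lifts a map onto the simple top of
  \<open>\<epsilon> i R\<close> to a map with \<open>y \<mapsto> \<epsilon> i\<close>. But
  \<open>y\<close> is annihilated by \<open>R f\<close>, whereas \<open>\<epsilon> i R f\<close> is
  nonzero by \<open>to_top\<close>.\<close>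

lemma torsion_free_if_projective_socle:
  fixes M :: "('a, 'u) module" and c :: "'a \<Rightarrow> 'u"
  assumes M: "right_module R M" and proj: "projective_rmod TYPE('u) R (M\<lparr>carrier := socle R M\<rparr>)"
    and c: "inj_on c (carrier R)"
  shows "torsion_free M"
proof (rule ccontr)
  interpret M: right_module R M by fact
  assume "\<not> torsion_free M"
  then obtain x0 where x0: "x0 \<in> carrier M" "x0 \<noteq> \<zero>\<^bsub>M\<^esub>" and Cx0: "\<And>c. c \<in> C \<Longrightarrow> c \<odot>\<^bsub>M\<^esub> x0 = \<zero>\<^bsub>M\<^esub>"
    by (auto simp: torsion_free_def)
  \<comment> \<open>The indices occurring in the cyclic module of \<open>x0\<close>. At a maximal
    one the component generates a simple module, since anything pushed further up vanishes.\<close>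
  define A where "A = {i \<in> I. \<exists>r\<in>carrier R. \<epsilon> i \<odot>\<^bsub>M\<^esub> (r \<odot>\<^bsub>M\<^esub> x0) \<noteq> \<zero>\<^bsub>M\<^esub>}"
  have "A \<noteq> {}"
  proof
    assume A: "A = {}"
    have "\<epsilon> i \<odot>\<^bsub>M\<^esub> x0 = \<zero>\<^bsub>M\<^esub>" if "i \<in> I" for i
    proof -
      have "\<epsilon> i \<odot>\<^bsub>M\<^esub> (\<one> \<odot>\<^bsub>M\<^esub> x0) = \<zero>\<^bsub>M\<^esub>" using A that by (auto simp: A_def)
      then show ?thesis using x0 by simp
    qed
    then show False using mem_if_components[OF M M.zero_submodule x0(1)] x0(2) by simp
  qed
  then obtain i where i: "i \<in> A" and max: "\<And>j. j \<in> A \<Longrightarrow> i \<le> j \<Longrightarrow> j = i"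
    using finite_has_maximal[of A] by (auto simp: A_def)
  have iI: "i \<in> I" using i by (simp add: A_def)
  obtain r0 where r0: "r0 \<in> carrier R" "\<epsilon> i \<odot>\<^bsub>M\<^esub> (r0 \<odot>\<^bsub>M\<^esub> x0) \<noteq> \<zero>\<^bsub>M\<^esub>" using i by (auto simp: A_def)
  define y where "y = \<epsilon> i \<odot>\<^bsub>M\<^esub> (r0 \<odot>\<^bsub>M\<^esub> x0)"
  have y: "y \<in> carrier M" "y \<noteq> \<zero>\<^bsub>M\<^esub>" "\<epsilon> i \<odot>\<^bsub>M\<^esub> y = y"
    using r0 iI x0 by (simp_all add: y_def idem_idem_smult[OF M])
  have itp: "i \<noteq> tp"
  proof
    assume "i = tp"
    then have "y = (r0 \<otimes> f) \<odot>\<^bsub>M\<^esub> x0" using r0 x0 tp by (simp add: y_def M.smult_assoc)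
    then show False using Cx0[of "r0 \<otimes> f"] y(2) r0 by (simp add: C_def m_assoc)
  qed
  have conc: "\<epsilon> i \<odot>\<^bsub>M\<^esub> (s \<odot>\<^bsub>M\<^esub> y) = s \<odot>\<^bsub>M\<^esub> y" if s: "s \<in> carrier R" for s
  proof (rule concentrated[OF M iI])
    fix j assume j: "j \<in> I" "j \<noteq> i"
    show "\<epsilon> j \<odot>\<^bsub>M\<^esub> (s \<odot>\<^bsub>M\<^esub> y) = \<zero>\<^bsub>M\<^esub>"
    proof (cases "i \<le> j")
      case True
      have "s \<odot>\<^bsub>M\<^esub> y = (r0 \<otimes> \<epsilon> i \<otimes> s) \<odot>\<^bsub>M\<^esub> x0" using s r0 iI x0 by (simp add: y_def M.smult_assoc)
      moreover have "j \<notin> A" using max True j by blast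
      ultimately show ?thesis using j s r0 iI by (auto simp: A_def)
    next
      case False
      then show ?thesis by (intro off_order_zero[OF M iI j(1) s y(1) _ y(3)])
    qed
  qed (use s y in simp)
  let ?N = "socle R M" and ?NM = "M\<lparr>carrier := socle R M\<rparr>"
  have N: "submodule ?N R M" by (rule socle_submodule[OF M])
  note N' = M.submodule_subset[OF N]
  have yN: "y \<in> ?N"
    using simple_subset_socle[OF M.cyclic_submodule[OF y(1)] cyclic_simple[OF M iI y(1,2) conc]]
      M.mem_cyclic[OF y(1)] by blast
  have NM: "right_module R ?NM" by (rule M.submodule_right_module[OF N])
  interpret NM: right_module R ?NM by (rule NM)
  \<comment> \<open>The elements whose multiples admit no nonzero passage between different indices.
    \<open>Z\<close> contains every simple submodule, hence the socle: this is semisimplicity in the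
    form needed below.\<close>
  define Z where "Z = {x \<in> carrier M. \<forall>j\<in>I. \<forall>k\<in>I. j \<noteq> k \<longrightarrow>
    (\<forall>s\<in>carrier R. \<forall>r\<in>carrier R. \<epsilon> k \<odot>\<^bsub>M\<^esub> (r \<odot>\<^bsub>M\<^esub> (\<epsilon> j \<odot>\<^bsub>M\<^esub> (s \<odot>\<^bsub>M\<^esub> x))) = \<zero>\<^bsub>M\<^esub>)}"
  have "?N \<subseteq> Z"
  proof (rule socle_least)
    show "submodule Z R M"
      unfolding M.submodule_iff
    proof (intro conjI ballI)
      fix t x assume t: "t \<in> carrier R" and x: "x \<in> Z"
      have "s \<odot>\<^bsub>M\<^esub> (t \<odot>\<^bsub>M\<^esub> x) = (t \<otimes> s) \<odot>\<^bsub>M\<^esub> x" if "s \<in> carrier R" for s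
        using that t x by (simp add: Z_def M.smult_assoc)
      then show "t \<odot>\<^bsub>M\<^esub> x \<in> Z" using t x by (simp add: Z_def)
    qed (auto simp: Z_def M.smult_r_distr)
    fix S assume S: "submodule S R M" and simple: "simple_rmod R (M\<lparr>carrier := S\<rparr>)"
    note S' = M.submodule_subset[OF S]
    obtain i' where i': "i' \<in> I" "\<And>x. x \<in> S \<Longrightarrow> \<epsilon> i' \<odot>\<^bsub>M\<^esub> x = x"
      using simple_concentrated[OF M S simple] by blast
    have S_zero: "\<epsilon> j \<odot>\<^bsub>M\<^esub> x = \<zero>\<^bsub>M\<^esub>" if "x \<in> S" "j \<in> I" "j \<noteq> i'" for j x
    proof -
      have xc: "x \<in> carrier M" using that S' by blast
      show ?thesis using idem_idem_smult[OF M that(2) i'(1) xc] i'(2)[OF that(1)] that(3) by simp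
    qed
    show "S \<subseteq> Z"
    proof
      fix x assume x: "x \<in> S"
      have "\<epsilon> k \<odot>\<^bsub>M\<^esub> (r \<odot>\<^bsub>M\<^esub> (\<epsilon> j \<odot>\<^bsub>M\<^esub> (s \<odot>\<^bsub>M\<^esub> x))) = \<zero>\<^bsub>M\<^esub>"
        if jk: "j \<in> I" "k \<in> I" "j \<noteq> k" and sr: "s \<in> carrier R" "r \<in> carrier R" for j k s r
      proof (cases "j = i'")
        case True
        have "r \<odot>\<^bsub>M\<^esub> (\<epsilon> j \<odot>\<^bsub>M\<^esub> (s \<odot>\<^bsub>M\<^esub> x)) \<in> S" using x jk sr M.submodule_smult[OF S] by simp
        then show ?thesis using S_zero jk True by simp
      next
        case False
        then show ?thesis using S_zero[OF M.submodule_smult[OF S sr(1) x] jk(1)] jk sr by simp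
      qed
      then show "x \<in> Z" using x S' by (auto simp: Z_def)
    qed
  qed
  then have Z: "\<epsilon> k \<odot>\<^bsub>M\<^esub> (r \<odot>\<^bsub>M\<^esub> (\<epsilon> j \<odot>\<^bsub>M\<^esub> x)) = \<zero>\<^bsub>M\<^esub>"
    if "x \<in> ?N" "j \<in> I" "k \<in> I" "j \<noteq> k" "r \<in> carrier R" for x j k r
  proof -
    have "x \<in> Z" using that \<open>?N \<subseteq> Z\<close> by blast
    then have "\<epsilon> k \<odot>\<^bsub>M\<^esub> (r \<odot>\<^bsub>M\<^esub> (\<epsilon> j \<odot>\<^bsub>M\<^esub> (\<one> \<odot>\<^bsub>M\<^esub> x))) = \<zero>\<^bsub>M\<^esub>"
      using that unfolding Z_def by blast
    then show ?thesis using that N' by (auto simp: subset_iff)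
  qed
  interpret V: division_module "corner (\<epsilon> i)" "part (\<epsilon> i) ?NM" by (rule part_division[OF iI NM])
  have yV: "y \<in> carrier (part (\<epsilon> i) ?NM)" using yN y by simp
  obtain \<phi> where \<phi>: "\<phi> \<in> rmod_hom (corner (\<epsilon> i)) (part (\<epsilon> i) ?NM) (regular_rmod (corner (\<epsilon> i)))"
    and \<phi>y: "\<phi> y = \<epsilon> i"
    using V.exists_functional[OF yV] y(2) by auto
  let ?X = "principal_rmod R (\<epsilon> i)"
  note X = principal_right_module[OF idem_closed[OF iI] idem_idem[OF iI]]
  note Xc = principal_carrier[OF idem_closed[OF iI] idem_idem[OF iI]]
  interpret X: right_module R ?X by (rule X)
  have Xzero: "x \<otimes> \<epsilon> k = \<zero>" if "x \<in> carrier ?X" "k \<in> I" "\<not> i \<le> k" for x k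
    using idem_order[OF iI that(2) _ that(3), of x] that(1) by (simp add: Xc)
  \<comment> \<open>The radical of \<open>\<epsilon> i R\<close>: elements without component at
    \<open>i\<close>. The quotient \<open>Y\<close> is the simple module at
    \<open>i\<close>.\<close>
  define J where "J = {x \<in> carrier ?X. x \<otimes> \<epsilon> i = \<zero>}"
  have J: "submodule J R ?X"
    unfolding X.submodule_iff
  proof (intro conjI ballI)
    fix r x assume r: "r \<in> carrier R" and x: "x \<in> J"
    have "\<epsilon> i \<odot>\<^bsub>?X\<^esub> (r \<odot>\<^bsub>?X\<^esub> x) = \<zero>\<^bsub>?X\<^esub>"
    proof (rule component_zero[OF X iI r])
      fix k assume k: "k \<in> I" "k \<le> i"
      show "\<epsilon> k \<odot>\<^bsub>?X\<^esub> x = \<zero>\<^bsub>?X\<^esub>"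
        using x k Xzero[of x k] by (cases "k = i") (auto simp: J_def)
    qed (use x in \<open>simp add: J_def\<close>)
    then show "r \<odot>\<^bsub>?X\<^esub> x \<in> J" using X.smult_closed[OF r, of x] x by (simp add: J_def)
  next
    show "x \<oplus>\<^bsub>?X\<^esub> z \<in> J" if "x \<in> J" "z \<in> J" for x z
      using that iI X.M.add.m_closed[of x z] by (auto simp: J_def Xc l_distr)
  qed (use iI in \<open>auto simp: J_def Xc\<close>)
  have cX: "inj_on c (carrier ?X)" by (rule inj_on_subset[OF c]) (auto simp: Xc)
  obtain Y :: "('a, 'u) module" and q where Y: "right_module R Y" and q: "q \<in> rmod_hom R ?X Y"
    and qs: "q ` carrier ?X = carrier Y" and qz: "\<And>x. x \<in> carrier ?X \<Longrightarrow> q x = \<zero>\<^bsub>Y\<^esub> \<longleftrightarrow> x \<in> J"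
    using X.exists_quotient[OF J cX] by blast
  interpret q: rmod_homomorphism R ?X Y q
    by (intro rmod_homomorphism.intro rmod_homomorphism_axioms.intro X Y q)
  have comp: "\<epsilon> i \<odot>\<^bsub>M\<^esub> n \<in> carrier (part (\<epsilon> i) ?NM)" if "n \<in> ?N" for n
    using part_mem[OF NM idem_closed[OF iI] idem_idem[OF iI], of n] that by simp
  have \<phi>c: "\<phi> v \<in> carrier ?X" "\<phi> v \<otimes> \<epsilon> i = \<phi> v" "\<phi> v \<in> carrier R" if "v \<in> carrier (part (\<epsilon> i) ?NM)" for v
    using rmod_homD(1)[OF \<phi> that] by (auto simp: Xc)
  \<comment> \<open>The map to be lifted: take the component at \<open>i\<close>, apply the
    functional that sends \<open>y\<close> to \<open>\<epsilon> i\<close>, and pass to the simple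
    quotient.\<close>
  have "restrict (\<lambda>n. q (\<phi> (\<epsilon> i \<odot>\<^bsub>M\<^esub> n))) (carrier ?NM) \<in> rmod_hom R ?NM Y"
  proof (rule rmod_hom_restrictI[OF NM])
    fix n assume "n \<in> carrier ?NM"
    then have n: "n \<in> ?N" and nM: "n \<in> carrier M" using N' by auto
    note v = comp[OF n]
    show "q (\<phi> (\<epsilon> i \<odot>\<^bsub>M\<^esub> n)) \<in> carrier Y" using \<phi>c[OF v] by blast
    show "q (\<phi> (\<epsilon> i \<odot>\<^bsub>M\<^esub> (n \<oplus>\<^bsub>?NM\<^esub> n'))) = q (\<phi> (\<epsilon> i \<odot>\<^bsub>M\<^esub> n)) \<oplus>\<^bsub>Y\<^esub> q (\<phi> (\<epsilon> i \<odot>\<^bsub>M\<^esub> n'))"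
      if "n' \<in> carrier ?NM" for n'
    proof -
      have n': "n' \<in> ?N" "n' \<in> carrier M" using that N' by auto
      note v' = comp[OF n'(1)]
      have "\<phi> (\<epsilon> i \<odot>\<^bsub>M\<^esub> (n \<oplus>\<^bsub>?NM\<^esub> n')) = \<phi> (\<epsilon> i \<odot>\<^bsub>M\<^esub> n) \<oplus>\<^bsub>?X\<^esub> \<phi> (\<epsilon> i \<odot>\<^bsub>M\<^esub> n')"
        using rmod_homD(2)[OF \<phi> v v'] iI nM n' by (simp add: M.smult_r_distr)
      then show ?thesis using q.add[OF \<phi>c(1)[OF v] \<phi>c(1)[OF v']] by simp
    qed
    fix r assume r: "r \<in> carrier R"
    define d where "d = \<epsilon> i \<otimes> r \<otimes> \<epsilon> i"
    have d: "d \<in> carrier (corner (\<epsilon> i))" unfolding d_def by (rule corner_mult) (use iI r in auto)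
    have "\<epsilon> i \<odot>\<^bsub>M\<^esub> (r \<odot>\<^bsub>M\<^esub> n) = d \<odot>\<^bsub>M\<^esub> (\<epsilon> i \<odot>\<^bsub>M\<^esub> n)"
    proof -
      \<comment> \<open>The remainder after removing the component at \<open>i\<close>. Inside the
        socle nothing leads from other indices back to \<open>i\<close>, so \<open>z\<close> does
        not contribute.\<close>
      define z where "z = n \<ominus>\<^bsub>M\<^esub> \<epsilon> i \<odot>\<^bsub>M\<^esub> n"
      have zN: "z \<in> ?N" using M.submodule_diff[OF N n M.submodule_smult[OF N _ n]] iI by (simp add: z_def)
      have zc: "z \<in> carrier M" using zN N' by blast
      have zi: "\<epsilon> i \<odot>\<^bsub>M\<^esub> z = \<zero>\<^bsub>M\<^esub>"
        using nM iI by (simp add: z_def M.smult_r_diff idem_idem_smult[OF M])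
      have "\<epsilon> i \<odot>\<^bsub>M\<^esub> (r \<odot>\<^bsub>M\<^esub> z) \<in> {\<zero>\<^bsub>M\<^esub>}"
      proof -
        have "submodule {w \<in> carrier M. \<forall>s\<in>carrier R. \<epsilon> i \<odot>\<^bsub>M\<^esub> (s \<odot>\<^bsub>M\<^esub> w) = \<zero>\<^bsub>M\<^esub>} R M"
          using iI by (auto simp: M.submodule_iff M.smult_r_distr simp flip: M.smult_assoc)
        then have "z \<in> {w \<in> carrier M. \<forall>s\<in>carrier R. \<epsilon> i \<odot>\<^bsub>M\<^esub> (s \<odot>\<^bsub>M\<^esub> w) = \<zero>\<^bsub>M\<^esub>}"
        proof (rule mem_if_components[OF M _ zc])
          fix j assume j: "j \<in> I"
          show "\<epsilon> j \<odot>\<^bsub>M\<^esub> z \<in> {w \<in> carrier M. \<forall>s\<in>carrier R. \<epsilon> i \<odot>\<^bsub>M\<^esub> (s \<odot>\<^bsub>M\<^esub> w) = \<zero>\<^bsub>M\<^esub>}"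
            using Z[OF zN j iI] zi j zc iI by (cases "j = i") auto
        qed
        then show ?thesis using r by simp
      qed
      moreover have "\<epsilon> i \<odot>\<^bsub>M\<^esub> (r \<odot>\<^bsub>M\<^esub> z) = \<epsilon> i \<odot>\<^bsub>M\<^esub> (r \<odot>\<^bsub>M\<^esub> n) \<ominus>\<^bsub>M\<^esub> d \<odot>\<^bsub>M\<^esub> (\<epsilon> i \<odot>\<^bsub>M\<^esub> n)"
        using r nM iI by (simp add: z_def d_def M.smult_r_diff M.smult_assoc idem_idem_smult[OF M])
      ultimately show ?thesis using r nM iI by (simp add: d_def)
    qed
    then have "\<phi> (\<epsilon> i \<odot>\<^bsub>M\<^esub> (r \<odot>\<^bsub>?NM\<^esub> n)) = \<phi> (\<epsilon> i \<odot>\<^bsub>M\<^esub> n) \<otimes> d"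
      using rmod_homD(3)[OF \<phi> d v] by simp
    moreover have "q (\<phi> (\<epsilon> i \<odot>\<^bsub>M\<^esub> n) \<otimes> d) = q (r \<odot>\<^bsub>?X\<^esub> \<phi> (\<epsilon> i \<odot>\<^bsub>M\<^esub> n))"
    proof -
      let ?w = "\<phi> (\<epsilon> i \<odot>\<^bsub>M\<^esub> n)"
      note w = \<phi>c[OF v]
      have dR: "d \<in> carrier R" using d by simp
      have wd: "?w \<otimes> d = ?w \<otimes> r \<otimes> \<epsilon> i"
        using w r iI by (simp add: d_def flip: m_assoc)
      have c1: "?w \<otimes> d \<in> carrier ?X" using X.smult_closed[OF dR w(1)] by simp
      have c2: "?w \<otimes> r \<in> carrier ?X" using X.smult_closed[OF r w(1)] by simp
      have "(?w \<otimes> d \<ominus>\<^bsub>?X\<^esub> ?w \<otimes> r) \<in> J"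
      proof -
        have eq: "?w \<otimes> d \<ominus>\<^bsub>?X\<^esub> ?w \<otimes> r \<in> carrier ?X" using c1 c2 by simp
        have "\<epsilon> i \<odot>\<^bsub>?X\<^esub> (?w \<otimes> d \<ominus>\<^bsub>?X\<^esub> ?w \<otimes> r) = \<epsilon> i \<odot>\<^bsub>?X\<^esub> (?w \<otimes> d) \<ominus>\<^bsub>?X\<^esub> \<epsilon> i \<odot>\<^bsub>?X\<^esub> (?w \<otimes> r)"
          by (rule X.smult_r_diff) (use c1 c2 iI in auto)
        also have "\<epsilon> i \<odot>\<^bsub>?X\<^esub> (?w \<otimes> d) = \<epsilon> i \<odot>\<^bsub>?X\<^esub> (?w \<otimes> r)"
          using w r iI by (simp add: wd m_assoc)
        finally show ?thesis
          using eq X.smult_closed[OF idem_closed[OF iI] c2] X.M.diff_eq_zero_iff[of "\<epsilon> i \<odot>\<^bsub>?X\<^esub> (?w \<otimes> r)" "\<epsilon> i \<odot>\<^bsub>?X\<^esub> (?w \<otimes> r)"]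
          by (simp add: J_def)
      qed
      then show ?thesis using qz[of "?w \<otimes> d \<ominus>\<^bsub>?X\<^esub> ?w \<otimes> r"] c1 c2 by simp
    qed
    ultimately show "q (\<phi> (\<epsilon> i \<odot>\<^bsub>M\<^esub> (r \<odot>\<^bsub>?NM\<^esub> n))) = r \<odot>\<^bsub>Y\<^esub> q (\<phi> (\<epsilon> i \<odot>\<^bsub>M\<^esub> n))"
      using q.smult[OF r \<phi>c(1)[OF v]] by simp
  qed
  from projective_lift[OF proj X cX Y q qs this]
  obtain h where h: "h \<in> rmod_hom R ?NM ?X"
    and qh: "\<And>n. n \<in> ?N \<Longrightarrow> q (h n) = q (\<phi> (\<epsilon> i \<odot>\<^bsub>M\<^esub> n))" by auto
  have hy: "h y \<in> carrier ?X" using rmod_homD(1)[OF h] yN by simp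
  have eX: "\<epsilon> i \<in> carrier ?X" using iI by (simp add: Xc)
  \<comment> \<open>Modulo \<open>J\<close> the lift sends \<open>y\<close> to
    \<open>\<epsilon> i\<close>, so the components at \<open>i\<close> agree; and \<open>h y\<close>
    lives at \<open>i\<close> because \<open>y\<close> does.\<close>
  have "h y \<ominus>\<^bsub>?X\<^esub> \<epsilon> i \<in> J"
    using qh[OF yN] hy eX qz[of "h y \<ominus>\<^bsub>?X\<^esub> \<epsilon> i"] y(3) \<phi>y by simp
  then have "\<epsilon> i \<odot>\<^bsub>?X\<^esub> (h y \<ominus>\<^bsub>?X\<^esub> \<epsilon> i) = \<zero>\<^bsub>?X\<^esub>" by (simp add: J_def)
  then have "\<epsilon> i \<odot>\<^bsub>?X\<^esub> h y \<ominus>\<^bsub>?X\<^esub> \<epsilon> i \<odot>\<^bsub>?X\<^esub> \<epsilon> i = \<zero>\<^bsub>?X\<^esub>"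
    unfolding X.smult_r_diff[OF idem_closed[OF iI] hy eX] .
  with X.M.diff_eq_zero_iff[OF X.smult_closed[OF idem_closed[OF iI] hy] X.smult_closed[OF idem_closed[OF iI] eX]]
  have "\<epsilon> i \<odot>\<^bsub>?X\<^esub> h y = \<epsilon> i \<odot>\<^bsub>?X\<^esub> \<epsilon> i" by (rule iffD1)
  moreover have "\<epsilon> i \<odot>\<^bsub>?X\<^esub> h y = h y"
    using rmod_homD(3)[OF h idem_closed[OF iI], of y] yN y(3) by simp
  ultimately have hyi: "h y = \<epsilon> i" using iI by simp
  obtain r where r: "r \<in> carrier R" "\<epsilon> i \<otimes> r \<otimes> f \<noteq> \<zero>" using to_top[OF iI] by blast
  have rf: "r \<otimes> f \<in> carrier R" using r by simp
  \<comment> \<open>The contradiction: acting by \<open>r f\<close> kills \<open>y\<close>, which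
    leads from \<open>i\<close> to \<open>tp\<close> inside the socle, but not its image
    \<open>\<epsilon> i\<close>.\<close>
  have "(r \<otimes> f) \<odot>\<^bsub>M\<^esub> y = \<epsilon> tp \<odot>\<^bsub>M\<^esub> (r \<odot>\<^bsub>M\<^esub> (\<epsilon> i \<odot>\<^bsub>M\<^esub> y))"
    using y r tp by (simp add: M.smult_assoc)
  also have "\<dots> = \<zero>\<^bsub>M\<^esub>" by (rule Z[OF yN iI tp(1) itp r(1)])
  finally have "h ((r \<otimes> f) \<odot>\<^bsub>?NM\<^esub> y) = h \<zero>\<^bsub>?NM\<^esub>" by simp
  moreover have "h ((r \<otimes> f) \<odot>\<^bsub>?NM\<^esub> y) = \<epsilon> i \<otimes> (r \<otimes> f)"
    using rmod_homD(3)[OF h rf, of y] yN hyi by simp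
  moreover have "h \<zero>\<^bsub>?NM\<^esub> = \<zero>"
    using rmod_homD(3)[OF h zero_closed NM.M.zero_closed] rmod_homD(1)[OF h NM.M.zero_closed] NM.smult_l_null[OF NM.M.zero_closed]
      X.smult_l_null[of "h \<zero>\<^bsub>?NM\<^esub>"] by simp
  ultimately show False using r iI by (simp add: m_assoc)
qed

lemma no_summand_iff:
  fixes M :: "('a, 'v) module"
  assumes "right_module R M"
  shows "\<not> has_direct_summand R M (principal_rmod R e) \<longleftrightarrow> (\<forall>x\<in>carrier M. u \<odot>\<^bsub>M\<^esub> x = \<zero>\<^bsub>M\<^esub>)"
  using principal_summand_if[OF assms fpart_division[OF assms]] idem_nonzero[OF tp(1)] tp(2)
    u_nonzero_if_principal_summand[OF assms] by auto

lemma socle_side_iff: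
  fixes M :: "('a, 'u) module" and c :: "'a \<Rightarrow> 'u"
  assumes M: "right_module R M" and c: "inj_on c (carrier R)"
  shows "projective_rmod TYPE('u) R (M\<lparr>carrier := socle R M\<rparr>) \<and> \<not> has_direct_summand R M (principal_rmod R e)
    \<longleftrightarrow> socle_side M"
proof -
  have "projective_rmod TYPE('u) R (M\<lparr>carrier := socle R M\<rparr>) \<longleftrightarrow> torsion_free M"
    using projective_socle_if_torsion_free[OF M] torsion_free_if_projective_socle[OF M _ c] by blast
  then show ?thesis
    using no_summand_iff[OF M] M by (simp add: socle_side_def torsion_free_def)
qed

end

section \<open>Tops, radicals and generation from the least index\<close>

context socle_top_ring
begin

definition generated where
  "generated M \<longleftrightarrow> (\<forall>L. submodule L R M \<and> (\<forall>x\<in>carrier M. e \<odot>\<^bsub>M\<^esub> x \<in> L) \<longrightarrow> L = carrier M)"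

definition top_map :: "('a, 'v) module \<Rightarrow> 'v \<Rightarrow> 'v set" where
  "top_map M = restrict (\<lambda>x. radical R M +>\<^bsub>M\<^esub> x) (carrier M)"

lemma top_facts:
  fixes M :: "('a, 'v) module"
  assumes M: "right_module R M"
  shows "right_module R (rmod_top R M)" and "top_map M \<in> rmod_hom R M (rmod_top R M)"
    and "top_map M ` carrier M = carrier (rmod_top R M)"
    and "\<And>x. x \<in> carrier M \<Longrightarrow> top_map M x = \<zero>\<^bsub>rmod_top R M\<^esub> \<longleftrightarrow> x \<in> radical R M"
  using quotient_module[OF M radical_submodule[OF M]]
  by (auto simp: rmod_top_def top_map_def)

lemma radical_iff: "x \<in> radical R M \<longleftrightarrow> x \<in> carrier M \<and> (\<forall>N. maximal_submodule N R M \<longrightarrow> x \<in> N)"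
  by (auto simp: radical_def)

text \<open>A maximal submodule fails to contain the components at only one index, so whatever
  passes from \<open>j\<close> to a different \<open>k\<close> lies in every maximal submodule, that
  is, in the radical.\<close>

lemma top_semisimple:
  fixes M :: "('a, 'v) module"
  assumes M: "right_module R M" and j: "j \<in> I" and k: "k \<in> I" "j \<noteq> k" and r: "r \<in> carrier R"
    and t: "t \<in> carrier (rmod_top R M)"
  shows "\<epsilon> k \<odot>\<^bsub>rmod_top R M\<^esub> (r \<odot>\<^bsub>rmod_top R M\<^esub> (\<epsilon> j \<odot>\<^bsub>rmod_top R M\<^esub> t)) = \<zero>\<^bsub>rmod_top R M\<^esub>"
proof -
  interpret M: right_module R M by (rule M)
  interpret \<pi>: rmod_homomorphism R M "rmod_top R M" "top_map M"
    by (intro rmod_homomorphism.intro rmod_homomorphism_axioms.intro M top_facts)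
  obtain y where y: "y \<in> carrier M" "t = top_map M y"
    using t top_facts(3)[OF M] by (metis imageE)
  have c: "\<epsilon> j \<odot>\<^bsub>M\<^esub> y \<in> carrier M" "r \<odot>\<^bsub>M\<^esub> (\<epsilon> j \<odot>\<^bsub>M\<^esub> y) \<in> carrier M"
    "\<epsilon> k \<odot>\<^bsub>M\<^esub> (r \<odot>\<^bsub>M\<^esub> (\<epsilon> j \<odot>\<^bsub>M\<^esub> y)) \<in> carrier M" using y j k r by auto
  have "\<epsilon> k \<odot>\<^bsub>M\<^esub> (r \<odot>\<^bsub>M\<^esub> (\<epsilon> j \<odot>\<^bsub>M\<^esub> y)) \<in> N" if N: "maximal_submodule N R M" for N
  proof -
    have sub: "submodule N R M" using N by (simp add: maximal_submodule_def)
    obtain i where i: "i \<in> I" "\<And>l x. \<lbrakk>l \<in> I; l \<noteq> i; x \<in> carrier M\<rbrakk> \<Longrightarrow> \<epsilon> l \<odot>\<^bsub>M\<^esub> x \<in> N"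
      using maximal_concentrated[OF M N] by blast
    show ?thesis
    proof (cases "k = i")
      case True
      then have "\<epsilon> j \<odot>\<^bsub>M\<^esub> y \<in> N" using i(2) j k y by blast
      then show ?thesis using M.submodule_smult[OF sub] r k by blast
    next
      case False
      then show ?thesis using i(2) k c(2) by blast
    qed
  qed
  then have "top_map M (\<epsilon> k \<odot>\<^bsub>M\<^esub> (r \<odot>\<^bsub>M\<^esub> (\<epsilon> j \<odot>\<^bsub>M\<^esub> y))) = \<zero>\<^bsub>rmod_top R M\<^esub>"
    using top_facts(4)[OF M c(3)] c(3) by (simp add: radical_iff)
  then show ?thesis
    using y j k r c \<pi>.smult[OF idem_closed[OF k(1)] c(2)] \<pi>.smult[OF r c(1)] \<pi>.smult[OF idem_closed[OF j] y(1)] by simp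
qed

text \<open>If the part at \<open>e\<close> generates, every maximal submodule misses the index
  \<open>bt\<close>, so the top lives there. Extending a map into it is then an extension problem
  over the division ring \<open>eRe\<close>.\<close>

lemma injective_top_if_generated:
  fixes M :: "('a, 'v) module"
  assumes M: "right_module R M" and gen: "generated M"
  shows "injective_rmod TYPE('u) R (rmod_top R M)"
proof -
  interpret M: right_module R M by (rule M)
  let ?T = "rmod_top R M"
  note TM = top_facts(1)[OF M]
  interpret T: right_module R ?T by (rule TM)
  interpret \<pi>: rmod_homomorphism R M ?T "top_map M"
    by (intro rmod_homomorphism.intro rmod_homomorphism_axioms.intro M top_facts)
  have rad: "\<epsilon> j \<odot>\<^bsub>M\<^esub> x \<in> radical R M" if j: "j \<in> I" "j \<noteq> bt" and x: "x \<in> carrier M" for j x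
    unfolding radical_iff
  proof (intro conjI allI impI)
    fix N assume N: "maximal_submodule N R M"
    then have sub: "submodule N R M" and ne: "N \<noteq> carrier M" by (auto simp: maximal_submodule_def)
    obtain i where i: "i \<in> I" "\<And>l x. \<lbrakk>l \<in> I; l \<noteq> i; x \<in> carrier M\<rbrakk> \<Longrightarrow> \<epsilon> l \<odot>\<^bsub>M\<^esub> x \<in> N"
      using maximal_concentrated[OF M N] by blast
    have "i = bt"
    proof (rule ccontr)
      assume "i \<noteq> bt"
      then have "e \<odot>\<^bsub>M\<^esub> x \<in> N" if "x \<in> carrier M" for x using i(2)[of bt x] bt that by auto
      then show False using gen sub ne by (auto simp: generated_def)
    qed
    then show "\<epsilon> j \<odot>\<^bsub>M\<^esub> x \<in> N" using i(2) j x by blast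
  qed (use j x in simp)
  have Te: "e \<odot>\<^bsub>?T\<^esub> t = t" if t: "t \<in> carrier ?T" for t
  proof -
    obtain y where y: "y \<in> carrier M" "t = top_map M y"
      using t top_facts(3)[OF M] by (metis imageE)
    have "\<epsilon> bt \<odot>\<^bsub>?T\<^esub> t = t"
    proof (rule concentrated[OF TM bt(1) t])
      fix j assume j: "j \<in> I" "j \<noteq> bt"
      show "\<epsilon> j \<odot>\<^bsub>?T\<^esub> t = \<zero>\<^bsub>?T\<^esub>"
        using top_facts(4)[OF M, of "\<epsilon> j \<odot>\<^bsub>M\<^esub> y"] rad[OF j y(1)] j y \<pi>.smult[of "\<epsilon> j" y] by simp
    qed
    then show ?thesis by (simp add: bt)
  qed
  have "\<exists>h\<in>rmod_hom R Y ?T. \<forall>x\<in>carrier X. h (p x) = g x"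
    if X: "right_module R X" and Y: "right_module R Y" and p: "p \<in> rmod_hom R X Y"
      and inj: "inj_on p (carrier X)" and g: "g \<in> rmod_hom R X ?T" for X Y :: "('a, 'u) module" and p g
  proof -
    interpret Y: right_module R Y by (rule Y)
    let ?c = "corner e"
    interpret V: division_module ?c "part e Y" using part_division[OF bt(1) Y] by (simp add: bt)
    let ?p = "restrict p (carrier (part e X))" and ?g = "restrict g (carrier (part e X))"
    have inj': "inj_on ?p (carrier (part e X))"
      using inj by (auto simp: inj_on_def)
    obtain h0 where h0: "h0 \<in> rmod_hom ?c (part e Y) (part e ?T)"
      and h0p: "\<And>x. x \<in> carrier (part e X) \<Longrightarrow> h0 (?p x) = ?g x"
      using V.extend_along[OF part_right_module[OF e_closed e_idem X] part_right_module[OF e_closed e_idem TM]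
          part_hom[OF e_closed e_idem X p] inj' part_hom[OF e_closed e_idem X g]] by blast
    note ey = part_mem[OF Y e_closed e_idem]
    note ex = part_mem[OF X e_closed e_idem]
    have h0c: "h0 v \<in> carrier ?T" if "v \<in> carrier (part e Y)" for v using rmod_homD(1)[OF h0 that] by simp
    let ?h = "restrict (\<lambda>y. h0 (e \<odot>\<^bsub>Y\<^esub> y)) (carrier Y)"
    have "?h \<in> rmod_hom R Y ?T"
    proof (rule rmod_hom_restrictI[OF Y])
      fix y assume y: "y \<in> carrier Y"
      show "h0 (e \<odot>\<^bsub>Y\<^esub> y) \<in> carrier ?T" by (rule h0c[OF ey[OF y]])
      show "h0 (e \<odot>\<^bsub>Y\<^esub> (y \<oplus>\<^bsub>Y\<^esub> z)) = h0 (e \<odot>\<^bsub>Y\<^esub> y) \<oplus>\<^bsub>?T\<^esub> h0 (e \<odot>\<^bsub>Y\<^esub> z)" if z: "z \<in> carrier Y" for z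
        using rmod_homD(2)[OF h0 ey[OF y] ey[OF z]] y z by (simp add: Y.smult_r_distr)
      fix r assume r: "r \<in> carrier R"
      \<comment> \<open>By \<open>e_col\<close>, the part at \<open>e\<close> of a product depends
        only on the part of \<open>y\<close> at \<open>e\<close>, on which \<open>r\<close> acts as
        \<open>e r e\<close>.\<close>
      let ?d = "e \<otimes> r \<otimes> e"
      have d: "?d \<in> carrier ?c" by (rule corner_mult) (use r in auto)
      have "e \<odot>\<^bsub>Y\<^esub> (r \<odot>\<^bsub>Y\<^esub> y) = ?d \<odot>\<^bsub>part e Y\<^esub> (e \<odot>\<^bsub>Y\<^esub> y)"
        using y r by (simp add: e_col[OF r] flip: Y.smult_assoc) (simp add: e_col m_assoc[symmetric])
      then have "h0 (e \<odot>\<^bsub>Y\<^esub> (r \<odot>\<^bsub>Y\<^esub> y)) = ?d \<odot>\<^bsub>?T\<^esub> h0 (e \<odot>\<^bsub>Y\<^esub> y)"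
        using rmod_homD(3)[OF h0 d ey[OF y]] by simp
      also have "\<dots> = r \<odot>\<^bsub>?T\<^esub> h0 (e \<odot>\<^bsub>Y\<^esub> y)"
        using r h0c[OF ey[OF y]] by (simp add: T.smult_assoc Te)
      finally show "h0 (e \<odot>\<^bsub>Y\<^esub> (r \<odot>\<^bsub>Y\<^esub> y)) = r \<odot>\<^bsub>?T\<^esub> h0 (e \<odot>\<^bsub>Y\<^esub> y)" .
    qed
    moreover have "?h (p x) = g x" if x: "x \<in> carrier X" for x
    proof -
      have "?h (p x) = h0 (p (e \<odot>\<^bsub>X\<^esub> x))"
        using x rmod_homD(1)[OF p x] rmod_homD(3)[OF p e_closed x] by simp
      also have "\<dots> = g (e \<odot>\<^bsub>X\<^esub> x)" using h0p[OF ex[OF x]] ex[OF x] by simp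
      also have "\<dots> = g x" using rmod_homD(3)[OF g e_closed x] Te[OF rmod_homD(1)[OF g x]] by simp
      finally show ?thesis .
    qed
    ultimately show ?thesis by blast
  qed
  then show ?thesis unfolding injective_rmod_def using TM by blast
qed

text \<open>A proper submodule containing the part at \<open>e\<close> produces a maximal submodule
  whose quotient lives at some \<open>i \<noteq> bt\<close>, and hence a nonzero \<open>t\<close> in
  the top at \<open>i\<close>. A submodule of \<open>eR\<close> maps onto multiples of
  \<open>t\<close> by a map that has no extension to \<open>eR\<close>.\<close>

lemma generated_if_injective_top:
  fixes M :: "('a, 'u) module" and c :: "'a \<Rightarrow> 'u"
  assumes M: "right_module R M" and inj: "injective_rmod TYPE('u) R (rmod_top R M)"
    and c: "inj_on c (carrier R)"
  shows "generated M"
proof (rule ccontr)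
  interpret M: right_module R M by (rule M)
  let ?T = "rmod_top R M"
  note TM = top_facts(1)[OF M]
  interpret T: right_module R ?T by (rule TM)
  interpret \<pi>: rmod_homomorphism R M ?T "top_map M"
    by (intro rmod_homomorphism.intro rmod_homomorphism_axioms.intro M top_facts)
  assume "\<not> generated M"
  then obtain L where L: "submodule L R M" and eL: "\<And>x. x \<in> carrier M \<Longrightarrow> e \<odot>\<^bsub>M\<^esub> x \<in> L" and ne: "L \<noteq> carrier M"
    by (auto simp: generated_def)
  note L' = M.submodule_subset[OF L]
  define A where "A = {i \<in> I. \<exists>x\<in>carrier M. \<epsilon> i \<odot>\<^bsub>M\<^esub> x \<notin> L}"
  have "A \<noteq> {}" using mem_if_components[OF M L] ne L' by (auto simp: A_def)
  \<comment> \<open>Minimality puts all components at indices strictly below \<open>i\<close> into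
    \<open>L\<close>; modulo \<open>L\<close>, nothing reaches the component at \<open>i\<close>
    from another index.\<close>
  then obtain i where i: "i \<in> A" and min: "\<And>j. j \<in> A \<Longrightarrow> j \<le> i \<Longrightarrow> j = i"
    using finite_has_minimal[of A] by (auto simp: A_def)
  have iI: "i \<in> I" using i by (simp add: A_def)
  have below: "\<epsilon> k \<odot>\<^bsub>M\<^esub> x \<in> L" if "k \<in> I" "k \<le> i" "k \<noteq> i" "x \<in> carrier M" for k x
    using min[of k] that by (auto simp: A_def)
  have ibt: "i \<noteq> bt" using i eL bt by (auto simp: A_def)
  obtain x0 where x0: "x0 \<in> carrier M" "\<epsilon> i \<odot>\<^bsub>M\<^esub> x0 \<notin> L" using i by (auto simp: A_def)
  define x where "x = \<epsilon> i \<odot>\<^bsub>M\<^esub> x0"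
  have x: "x \<in> carrier M" "\<epsilon> i \<odot>\<^bsub>M\<^esub> x = x" "x \<notin> L"
    using x0 iI by (simp_all add: x_def idem_idem_smult[OF M])
  let ?c = "corner (\<epsilon> i)" and ?V = "part (\<epsilon> i) M"
  interpret V: division_module ?c ?V by (rule part_division[OF iI M])
  note mem = part_mem[OF M idem_closed[OF iI] idem_idem[OF iI]]
  have W: "submodule (L \<inter> carrier ?V) ?c ?V"
    unfolding V.submodule_iff
  proof (intro conjI ballI)
    show "r \<odot>\<^bsub>?V\<^esub> y \<in> L \<inter> carrier ?V" if "r \<in> carrier ?c" "y \<in> L \<inter> carrier ?V" for r y
      using that V.smult_closed[of r y] M.submodule_smult[OF L, of r y] by auto
    show "y \<oplus>\<^bsub>?V\<^esub> z \<in> L \<inter> carrier ?V" if "y \<in> L \<inter> carrier ?V" "z \<in> L \<inter> carrier ?V" for y z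
      using that V.M.add.m_closed[of y z] M.submodule_add[OF L, of y z] by auto
    show "\<zero>\<^bsub>?V\<^esub> \<in> L \<inter> carrier ?V" using V.M.zero_closed M.submodule_zero[OF L] by auto
  qed auto
  obtain Q :: "('a, 'u) module" and q where Q: "right_module ?c Q" and q: "q \<in> rmod_hom ?c ?V Q"
    and qz: "\<And>y. y \<in> carrier ?V \<Longrightarrow> q y = \<zero>\<^bsub>Q\<^esub> \<longleftrightarrow> y \<in> L \<inter> carrier ?V"
    using V.exists_quotient[OF W inj_on_id] by blast
  interpret Q: division_module ?c Q
    by (intro division_module.intro division_module_axioms.intro Q) (use iI corner_division in auto)
  have xV: "x \<in> carrier ?V" using x by simp
  have "q x \<in> carrier Q" "q x \<noteq> \<zero>\<^bsub>Q\<^esub>" using rmod_homD(1)[OF q xV] qz[OF xV] x(3) by auto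
  then obtain \<phi> where \<phi>: "\<phi> \<in> rmod_hom ?c Q (regular_rmod ?c)" and \<phi>x: "\<phi> (q x) = \<epsilon> i"
    using Q.exists_functional by auto
  \<comment> \<open>A coordinate on the component at \<open>i\<close> modulo \<open>L\<close>,
    normalised to \<open>\<epsilon> i\<close> at \<open>x\<close>. Its kernel \<open>H\<close> will
    be the maximal submodule that avoids \<open>x\<close>.\<close>
  define \<psi> where "\<psi> y = \<phi> (q (\<epsilon> i \<odot>\<^bsub>M\<^esub> y))" for y
  have qc: "q (\<epsilon> i \<odot>\<^bsub>M\<^esub> y) \<in> carrier Q" if "y \<in> carrier M" for y using rmod_homD(1)[OF q mem[OF that]] .
  have \<psi>c: "\<psi> y \<in> carrier ?c" if "y \<in> carrier M" for y
    using rmod_homD(1)[OF \<phi> qc[OF that]] by (simp add: \<psi>_def)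
  have \<psi>_add: "\<psi> (y \<oplus>\<^bsub>M\<^esub> z) = \<psi> y \<oplus> \<psi> z" if y: "y \<in> carrier M" and z: "z \<in> carrier M" for y z
    using rmod_homD(2)[OF q mem[OF y] mem[OF z]] rmod_homD(2)[OF \<phi> qc[OF y] qc[OF z]] iI y z
    by (simp add: \<psi>_def M.smult_r_distr)
  have \<psi>_smult: "\<psi> (d \<odot>\<^bsub>M\<^esub> y) = \<psi> y \<otimes> d" if d: "d \<in> carrier ?c" and y: "y \<in> carrier M" for d y
  proof -
    have "\<epsilon> i \<odot>\<^bsub>M\<^esub> (d \<odot>\<^bsub>M\<^esub> y) = d \<odot>\<^bsub>?V\<^esub> (\<epsilon> i \<odot>\<^bsub>M\<^esub> y)"
      using d y iI by (simp flip: M.smult_assoc)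
    then show ?thesis
      using rmod_homD(3)[OF q d mem[OF y]] rmod_homD(3)[OF \<phi> d qc[OF y]] by (simp add: \<psi>_def)
  qed
  have \<psi>_zero: "\<psi> y = \<zero>" if y: "y \<in> carrier M" "\<epsilon> i \<odot>\<^bsub>M\<^esub> y \<in> L" for y
  proof -
    have "q (\<epsilon> i \<odot>\<^bsub>M\<^esub> y) = \<zero>\<^bsub>Q\<^esub>" using qz[OF mem[OF y(1)]] mem[OF y(1)] y(2) by blast
    moreover have "\<phi> \<zero>\<^bsub>Q\<^esub> = \<zero>"
      using rmod_homD(3)[OF \<phi> V.R.zero_closed Q.M.zero_closed] Q.smult_l_null[OF Q.M.zero_closed]
        rmod_homD(1)[OF \<phi> Q.M.zero_closed] by simp
    ultimately show ?thesis by (simp add: \<psi>_def)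
  qed
  have \<psi>x: "\<psi> x = \<epsilon> i" using x \<phi>x by (simp add: \<psi>_def)
  define H where "H = {y \<in> carrier M. \<psi> y = \<zero>}"
  \<comment> \<open>Only the diagonal entry of \<open>r\<close> at \<open>i\<close> matters, since
    the components that could interfere lie in \<open>L\<close>, where the coordinate
    vanishes.\<close>
  have \<psi>r: "\<psi> (r \<odot>\<^bsub>M\<^esub> y) = \<psi> y \<otimes> (\<epsilon> i \<otimes> r \<otimes> \<epsilon> i)" if r: "r \<in> carrier R" and y: "y \<in> carrier M" for r y
  proof -
    define z where "z = y \<ominus>\<^bsub>M\<^esub> \<epsilon> i \<odot>\<^bsub>M\<^esub> y"
    have zc: "z \<in> carrier M" using y iI by (simp add: z_def)
    have d: "\<epsilon> i \<otimes> r \<otimes> \<epsilon> i \<in> carrier ?c" by (rule corner_mult) (use iI r in auto)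
    have "\<epsilon> i \<odot>\<^bsub>M\<^esub> (r \<odot>\<^bsub>M\<^esub> z) \<in> L"
    proof (rule component_mem[OF M L iI r zc])
      fix k assume k: "k \<in> I" "k \<le> i"
      show "\<epsilon> k \<odot>\<^bsub>M\<^esub> z \<in> L"
      proof (cases "k = i")
        case True
        then show ?thesis
          using y iI M.submodule_zero[OF L]
          by (simp add: z_def M.smult_r_diff idem_idem_smult[OF M])
      next
        case False
        then show ?thesis using below k zc by blast
      qed
    qed
    then have z0: "\<psi> (r \<odot>\<^bsub>M\<^esub> z) = \<zero>" using \<psi>_zero r zc by simp
    have "r \<odot>\<^bsub>M\<^esub> y = r \<odot>\<^bsub>M\<^esub> z \<oplus>\<^bsub>M\<^esub> r \<odot>\<^bsub>M\<^esub> (\<epsilon> i \<odot>\<^bsub>M\<^esub> y)"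
      using r y iI zc by (simp add: z_def a_minus_def M.a_assoc M.l_neg flip: M.smult_r_distr)
    then have "\<psi> (r \<odot>\<^bsub>M\<^esub> y) = \<psi> (r \<odot>\<^bsub>M\<^esub> (\<epsilon> i \<odot>\<^bsub>M\<^esub> y))"
      using \<psi>_add[of "r \<odot>\<^bsub>M\<^esub> z" "r \<odot>\<^bsub>M\<^esub> (\<epsilon> i \<odot>\<^bsub>M\<^esub> y)"] z0 r y zc iI \<psi>c[of "r \<odot>\<^bsub>M\<^esub> (\<epsilon> i \<odot>\<^bsub>M\<^esub> y)"] by simp
    also have "\<dots> = \<psi> ((\<epsilon> i \<otimes> r \<otimes> \<epsilon> i) \<odot>\<^bsub>M\<^esub> y)"
      using r y iI by (simp add: \<psi>_def M.smult_assoc idem_idem_smult[OF M])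
    finally show ?thesis using \<psi>_smult[OF d y] by simp
  qed
  have H: "submodule H R M"
    unfolding M.submodule_iff
  proof (intro conjI ballI)
    show "\<zero>\<^bsub>M\<^esub> \<in> H" using \<psi>_zero[of "\<zero>\<^bsub>M\<^esub>"] M.submodule_zero[OF L] iI by (simp add: H_def)
    show "r \<odot>\<^bsub>M\<^esub> y \<in> H" if "r \<in> carrier R" "y \<in> H" for r y
      using that \<psi>r iI by (simp add: H_def)
  qed (auto simp: H_def \<psi>_add)
  have xH: "x \<notin> H" using \<psi>x idem_nonzero[OF iI] by (simp add: H_def)
  have "maximal_submodule H R M"
    unfolding maximal_submodule_def
  proof (intro conjI allI impI H)
    show "H \<noteq> carrier M" using x xH by blast
    fix N assume N: "submodule N R M \<and> H \<subseteq> N"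
    then have N': "submodule N R M" and HN: "H \<subseteq> N" by auto
    show "N = H \<or> N = carrier M"
    proof (cases "N = H")
      case False
      then obtain y where y: "y \<in> N" "y \<notin> H" using HN by blast
      have yc: "y \<in> carrier M" using y M.submodule_subset[OF N'] by blast
      have "\<psi> y \<noteq> \<zero>" using y yc by (simp add: H_def)
      then obtain d' where d': "d' \<in> carrier ?c" "\<psi> y \<otimes> d' = \<epsilon> i" using corner_division[OF iI \<psi>c[OF yc]] by blast
      have "w \<in> N" if w: "w \<in> carrier M" for w
      proof -
        \<comment> \<open>Chosen so that this multiple of \<open>y\<close> has the same coordinate
          as \<open>w\<close>; the difference then lies in \<open>H\<close>.\<close>
        let ?t = "d' \<otimes> \<psi> w"
        have t: "?t \<in> carrier ?c" using V.R.m_closed[OF d'(1) \<psi>c[OF w]] by simp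
        then have tR: "?t \<in> carrier R" by simp
        have "\<psi> (?t \<odot>\<^bsub>M\<^esub> y) = \<psi> w"
          using \<psi>_smult[OF t yc] d' \<psi>c[OF w] \<psi>c[OF yc] by (simp flip: m_assoc)
        moreover have "w = (w \<ominus>\<^bsub>M\<^esub> ?t \<odot>\<^bsub>M\<^esub> y) \<oplus>\<^bsub>M\<^esub> ?t \<odot>\<^bsub>M\<^esub> y"
          using w yc tR by (simp add: a_minus_def M.a_assoc M.l_neg)
        then have "\<psi> w = \<psi> (w \<ominus>\<^bsub>M\<^esub> ?t \<odot>\<^bsub>M\<^esub> y) \<oplus> \<psi> (?t \<odot>\<^bsub>M\<^esub> y)"
          using \<psi>_add[of "w \<ominus>\<^bsub>M\<^esub> ?t \<odot>\<^bsub>M\<^esub> y" "?t \<odot>\<^bsub>M\<^esub> y"] w yc tR by simp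
        ultimately have "\<psi> (w \<ominus>\<^bsub>M\<^esub> ?t \<odot>\<^bsub>M\<^esub> y) = \<zero>"
          using \<psi>c[OF w] \<psi>c[of "w \<ominus>\<^bsub>M\<^esub> ?t \<odot>\<^bsub>M\<^esub> y"] w yc tR add.l_cancel_one'[of "\<psi> w" "\<psi> (w \<ominus>\<^bsub>M\<^esub> ?t \<odot>\<^bsub>M\<^esub> y)"]
            add.r_cancel_one'[of "\<psi> w" "\<psi> (w \<ominus>\<^bsub>M\<^esub> ?t \<odot>\<^bsub>M\<^esub> y)"] by simp
        then have "w \<ominus>\<^bsub>M\<^esub> ?t \<odot>\<^bsub>M\<^esub> y \<in> N" using HN w yc tR by (auto simp: H_def)
        then show ?thesis
          using M.diff_mem_cancel[OF N' w M.submodule_smult[OF N' tR y(1)]] by blast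
      qed
      then show ?thesis using M.submodule_subset[OF N'] by blast
    qed simp
  qed
  then have xrad: "x \<notin> radical R M" using xH by (auto simp: radical_iff)
  define t where "t = top_map M x"
  have t: "t \<in> carrier ?T" "t \<noteq> \<zero>\<^bsub>?T\<^esub>" "\<epsilon> i \<odot>\<^bsub>?T\<^esub> t = t"
    using x xrad top_facts(4)[OF M x(1)] iI \<pi>.smult[OF idem_closed[OF iI] x(1)] by (auto simp: t_def)
  text \<open>The obstruction: \<open>e\<close> generates the test module and acts on the top through its component at
    \<open>bt\<close>, whereas the map below has its image in the component at \<open>i\<close>.\<close>
  let ?Y = "principal_rmod R e"
  note Y = principal_right_module[OF e_closed e_idem]
  note Yc = principal_carrier[OF e_closed e_idem]
  interpret Y: right_module R ?Y by (rule Y)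
  interpret B: division_module ?c "part (\<epsilon> i) ?Y" by (rule part_division[OF iI Y])
  \<comment> \<open>\<open>from_bottom\<close> provides a nonzero element of \<open>eR\<close> at
    \<open>i\<close>; the functional \<open>\<theta>\<close> normalises it.\<close>
  obtain r where r: "r \<in> carrier R" "e \<otimes> r \<otimes> \<epsilon> i \<noteq> \<zero>" using from_bottom[OF iI] by blast
  define r0 where "r0 = e \<otimes> r \<otimes> \<epsilon> i"
  have r0: "r0 \<in> carrier R" "e \<otimes> r0 = r0" "r0 \<otimes> \<epsilon> i = r0" "r0 \<noteq> \<zero>"
    using r iI by (simp_all add: r0_def m_assoc) (simp flip: m_assoc)
  have r0V: "r0 \<in> carrier (part (\<epsilon> i) ?Y)" using r0 by (simp add: Yc)
  obtain \<theta> where \<theta>: "\<theta> \<in> rmod_hom ?c (part (\<epsilon> i) ?Y) (regular_rmod ?c)" and \<theta>r0: "\<theta> r0 = \<epsilon> i"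
    using B.exists_functional[OF r0V] r0(4) by auto
  \<comment> \<open>The elements of \<open>eR\<close> supported at indices above \<open>i\<close>, a
    submodule by triangularity. On it, though not on all of \<open>eR\<close>, taking the component
    at \<open>i\<close> is compatible with \<open>R\<close>.\<close>
  define X where "X = {l \<in> carrier ?Y. \<forall>k\<in>I. \<not> i \<le> k \<longrightarrow> l \<otimes> \<epsilon> k = \<zero>}"
  have X: "submodule X R ?Y"
    unfolding Y.submodule_iff
  proof (intro conjI ballI)
    fix s l assume s: "s \<in> carrier R" and l: "l \<in> X"
    have "\<epsilon> k \<odot>\<^bsub>?Y\<^esub> (s \<odot>\<^bsub>?Y\<^esub> l) = \<zero>\<^bsub>?Y\<^esub>" if k: "k \<in> I" "\<not> i \<le> k" for k
      by (rule component_zero[OF Y k(1) s]) (use l k in \<open>auto simp: X_def\<close>)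
    then show "s \<odot>\<^bsub>?Y\<^esub> l \<in> X" using Y.smult_closed[OF s, of l] l by (simp add: X_def)
  next
    show "l \<oplus>\<^bsub>?Y\<^esub> l' \<in> X" if "l \<in> X" "l' \<in> X" for l l'
      using that Y.M.add.m_closed[of l l'] by (auto simp: X_def Yc l_distr)
  qed (auto simp: X_def Yc)
  let ?X = "?Y\<lparr>carrier := X\<rparr>"
  have XM: "right_module R ?X" by (rule Y.submodule_right_module[OF X])
  have XR: "l \<in> carrier R" "l \<in> carrier ?Y" if "l \<in> X" for l using that by (auto simp: X_def Yc)
  note memY = part_mem[OF Y idem_closed[OF iI] idem_idem[OF iI]]
  have \<theta>c: "\<theta> (l \<otimes> \<epsilon> i) \<in> carrier ?c" if "l \<in> X" for l
    using rmod_homD(1)[OF \<theta> memY[OF XR(2)[OF that]]] by simp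
  have cl: "\<theta> (l \<otimes> \<epsilon> i) \<odot>\<^bsub>?T\<^esub> t \<in> carrier ?T" if "l \<in> X" for l using \<theta>c[OF that] t by simp
  have Ti: "\<epsilon> i \<odot>\<^bsub>?T\<^esub> (\<theta> (l \<otimes> \<epsilon> i) \<odot>\<^bsub>?T\<^esub> t) = \<theta> (l \<otimes> \<epsilon> i) \<odot>\<^bsub>?T\<^esub> t" if "l \<in> X" for l
    using \<theta>c[OF that] t(1) iI by (simp flip: T.smult_assoc)
  have "restrict (\<lambda>l. \<theta> (l \<otimes> \<epsilon> i) \<odot>\<^bsub>?T\<^esub> t) (carrier ?X) \<in> rmod_hom R ?X ?T"
  proof (rule rmod_hom_restrictI[OF XM])
    fix l assume "l \<in> carrier ?X"
    then have l: "l \<in> X" by simp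
    note lR = XR[OF l]
    show "\<theta> (l \<otimes> \<epsilon> i) \<odot>\<^bsub>?T\<^esub> t \<in> carrier ?T" by (rule cl[OF l])
    show "\<theta> ((l \<oplus>\<^bsub>?X\<^esub> l') \<otimes> \<epsilon> i) \<odot>\<^bsub>?T\<^esub> t = \<theta> (l \<otimes> \<epsilon> i) \<odot>\<^bsub>?T\<^esub> t \<oplus>\<^bsub>?T\<^esub> \<theta> (l' \<otimes> \<epsilon> i) \<odot>\<^bsub>?T\<^esub> t"
      if "l' \<in> carrier ?X" for l'
    proof -
      have l': "l' \<in> X" using that by simp
      have "\<theta> ((l \<oplus> l') \<otimes> \<epsilon> i) = \<theta> (l \<otimes> \<epsilon> i) \<oplus> \<theta> (l' \<otimes> \<epsilon> i)"
        using rmod_homD(2)[OF \<theta> memY[OF lR(2)] memY[OF XR(2)[OF l']]] lR(1) XR(1)[OF l'] iI by (simp add: l_distr)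
      then show ?thesis using \<theta>c[OF l] \<theta>c[OF l'] t(1) by (simp add: T.smult_l_distr)
    qed
    fix s assume s: "s \<in> carrier R"
    let ?d = "\<epsilon> i \<otimes> s \<otimes> \<epsilon> i" and ?w = "\<theta> (l \<otimes> \<epsilon> i) \<odot>\<^bsub>?T\<^esub> t"
    have d: "?d \<in> carrier ?c" by (rule corner_mult) (use iI s in auto)
    \<comment> \<open>Of the indices \<open>k \<le> i\<close>, which alone influence component
      \<open>i\<close>, an element of \<open>X\<close> has a nonzero component only at
      \<open>i\<close> itself.\<close>
    have "l \<otimes> s \<otimes> \<epsilon> i = l \<otimes> \<epsilon> i \<otimes> ?d"
    proof -
      define z where "z = l \<ominus>\<^bsub>?Y\<^esub> l \<otimes> \<epsilon> i"
      have li: "l \<otimes> \<epsilon> i \<in> carrier ?Y" using Y.smult_closed[OF idem_closed[OF iI] lR(2)] by simp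
      have zc: "z \<in> carrier ?Y" unfolding z_def by (rule Y.M.minus_closed[OF lR(2) li])
      have "\<epsilon> i \<odot>\<^bsub>?Y\<^esub> (s \<odot>\<^bsub>?Y\<^esub> z) = \<zero>\<^bsub>?Y\<^esub>"
      proof (rule component_zero[OF Y iI s zc])
        fix k assume k: "k \<in> I" "k \<le> i"
        have "\<epsilon> k \<odot>\<^bsub>?Y\<^esub> z = \<epsilon> k \<odot>\<^bsub>?Y\<^esub> l \<ominus>\<^bsub>?Y\<^esub> \<epsilon> k \<odot>\<^bsub>?Y\<^esub> (\<epsilon> i \<odot>\<^bsub>?Y\<^esub> l)"
          using Y.smult_r_diff[OF idem_closed[OF k(1)] lR(2) li] by (simp add: z_def)
        also have "\<epsilon> k \<odot>\<^bsub>?Y\<^esub> (\<epsilon> i \<odot>\<^bsub>?Y\<^esub> l) = \<epsilon> k \<odot>\<^bsub>?Y\<^esub> l"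
        proof (cases "k = i")
          case False
          then have "\<not> i \<le> k" using k by auto
          then have "l \<otimes> \<epsilon> k = \<zero>" using l k by (simp add: X_def)
          then show ?thesis using idem_idem_smult[OF Y k(1) iI lR(2)] False by simp
        qed (use idem_idem_smult[OF Y k(1) iI lR(2)] in simp)
        finally show "\<epsilon> k \<odot>\<^bsub>?Y\<^esub> z = \<zero>\<^bsub>?Y\<^esub>"
          using Y.M.diff_eq_zero_iff[of "\<epsilon> k \<odot>\<^bsub>?Y\<^esub> l" "\<epsilon> k \<odot>\<^bsub>?Y\<^esub> l"] Y.smult_closed[OF idem_closed[OF k(1)] lR(2)] by simp
      qed
      moreover have "\<epsilon> i \<odot>\<^bsub>?Y\<^esub> (s \<odot>\<^bsub>?Y\<^esub> z) = \<epsilon> i \<odot>\<^bsub>?Y\<^esub> (s \<odot>\<^bsub>?Y\<^esub> l) \<ominus>\<^bsub>?Y\<^esub> \<epsilon> i \<odot>\<^bsub>?Y\<^esub> (s \<odot>\<^bsub>?Y\<^esub> (l \<otimes> \<epsilon> i))"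
        unfolding z_def Y.smult_r_diff[OF s lR(2) li]
        by (rule Y.smult_r_diff[OF idem_closed[OF iI] Y.smult_closed[OF s lR(2)] Y.smult_closed[OF s li]])
      ultimately have "\<epsilon> i \<odot>\<^bsub>?Y\<^esub> (s \<odot>\<^bsub>?Y\<^esub> l) = \<epsilon> i \<odot>\<^bsub>?Y\<^esub> (s \<odot>\<^bsub>?Y\<^esub> (l \<otimes> \<epsilon> i))"
        using Y.M.diff_eq_zero_iff[OF Y.smult_closed[OF idem_closed[OF iI] Y.smult_closed[OF s lR(2)]]
            Y.smult_closed[OF idem_closed[OF iI] Y.smult_closed[OF s li]]] by simp
      then show ?thesis using lR(1) s iI by (simp add: m_assoc) (simp flip: m_assoc)
    qed
    then have "\<theta> (l \<otimes> s \<otimes> \<epsilon> i) = \<theta> (l \<otimes> \<epsilon> i) \<otimes> ?d"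
      using rmod_homD(3)[OF \<theta> d memY[OF lR(2)]] by simp
    then have "\<theta> (l \<otimes> s \<otimes> \<epsilon> i) \<odot>\<^bsub>?T\<^esub> t = ?d \<odot>\<^bsub>?T\<^esub> ?w"
      using \<theta>c[OF l] d t(1) by (simp add: T.smult_assoc)
    also have "\<dots> = \<epsilon> i \<odot>\<^bsub>?T\<^esub> (s \<odot>\<^bsub>?T\<^esub> ?w)"
      using s iI cl[OF l] Ti[OF l] by (simp add: T.smult_assoc)
    also have "\<dots> = s \<odot>\<^bsub>?T\<^esub> ?w"
    proof (rule concentrated[OF TM iI])
      fix j assume j: "j \<in> I" "j \<noteq> i"
      show "\<epsilon> j \<odot>\<^bsub>?T\<^esub> (s \<odot>\<^bsub>?T\<^esub> ?w) = \<zero>\<^bsub>?T\<^esub>"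
        using top_semisimple[OF M iI j(1) _ s cl[OF l]] j(2) Ti[OF l] by simp
    qed (use s cl[OF l] in simp)
    finally show "\<theta> ((s \<odot>\<^bsub>?X\<^esub> l) \<otimes> \<epsilon> i) \<odot>\<^bsub>?T\<^esub> t = s \<odot>\<^bsub>?T\<^esub> ?w" by simp
  qed
  note g = this
  have incl: "restrict (\<lambda>l. l) (carrier ?X) \<in> rmod_hom R ?X ?Y"
    by (rule rmod_hom_restrictI[OF XM]) (use XR in auto)
  have cX: "inj_on c (carrier ?X)" by (rule inj_on_subset[OF c]) (use XR in auto)
  have cY: "inj_on c (carrier ?Y)" by (rule inj_on_subset[OF c]) (auto simp: Yc)
  have "inj_on (restrict (\<lambda>l. l) (carrier ?X)) (carrier ?X)" by (auto simp: inj_on_def)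
  from injective_extension[OF inj XM cX Y cY incl this g]
  obtain h where h: "h \<in> rmod_hom R ?Y ?T" and hX: "\<And>l. l \<in> X \<Longrightarrow> h l = \<theta> (l \<otimes> \<epsilon> i) \<odot>\<^bsub>?T\<^esub> t" by auto
  have "r0 \<otimes> \<epsilon> k = \<zero>" if "k \<in> I" "\<not> i \<le> k" for k
  proof -
    have "r0 \<otimes> \<epsilon> k = r0 \<otimes> (\<epsilon> i \<otimes> \<epsilon> k)" using r0 iI that by (simp flip: m_assoc)
    then show ?thesis using idem_orth[OF iI that(1)] that r0 by auto
  qed
  then have "r0 \<in> X" using r0 by (simp add: X_def Yc)
  then have "h r0 = t" using hX r0(3) \<theta>r0 t(3) by simp
  moreover have eY: "e \<in> carrier ?Y" by (simp add: Yc)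
  have "h r0 = \<zero>\<^bsub>?T\<^esub>"
  proof -
    have he: "h e \<in> carrier ?T" "e \<odot>\<^bsub>?T\<^esub> h e = h e"
      using rmod_homD(1)[OF h eY] rmod_homD(3)[OF h e_closed eY] by simp_all
    have "h r0 = r0 \<odot>\<^bsub>?T\<^esub> h e" using rmod_homD(3)[OF h r0(1) eY] r0 by simp
    also have "\<dots> = (r0 \<otimes> \<epsilon> i) \<odot>\<^bsub>?T\<^esub> h e" by (simp only: r0(3))
    also have "\<dots> = \<epsilon> i \<odot>\<^bsub>?T\<^esub> (r0 \<odot>\<^bsub>?T\<^esub> (\<epsilon> bt \<odot>\<^bsub>?T\<^esub> h e))"
      using r0(1) iI he by (simp add: T.smult_assoc bt)
    also have "\<dots> = \<zero>\<^bsub>?T\<^esub>" by (rule top_semisimple[OF M bt(1) iI _ r0(1) he(1)]) (use ibt in simp)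
    finally show ?thesis .
  qed
  ultimately show False using t(2) by simp
qed

lemma top_side_iff:
  fixes M :: "('a, 'u) module" and c :: "'a \<Rightarrow> 'u"
  assumes M: "right_module R M" and c: "inj_on c (carrier R)"
  shows "injective_rmod TYPE('u) R (rmod_top R M) \<and> \<not> has_direct_summand R M (principal_rmod R e)
    \<longleftrightarrow> top_side M"
proof -
  have "injective_rmod TYPE('u) R (rmod_top R M) \<longleftrightarrow> generated M"
    using injective_top_if_generated[OF M] generated_if_injective_top[OF M _ c] by blast
  then show ?thesis
    using no_summand_iff[OF M] M by (simp add: top_side_def generated_def)
qed

end

text \<open>Two codes are involved: infiniteness of \<open>'u\<close> houses the cosyzygies, while
  \<open>c\<close> houses the test modules cut out of the ring, on which the descriptions of the
  objects rest.\<close>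

lemma (in socle_top_ring) cosyzygy_equivalence:
  fixes c :: "'a \<Rightarrow> 'u"
  assumes inf: "infinite (UNIV :: 'u set)" and c: "inj_on c (carrier R)"
  defines "U \<equiv> socle_projective_cat R e :: (('a, 'u) module, 'u \<Rightarrow> 'u) cat"
    and "V \<equiv> injective_top_cat R e :: (('a, 'u) module, 'u \<Rightarrow> 'u) cat"
  shows "\<exists>Fo Fa. is_equivalence U V Fo Fa \<and> exact_functor R U Fo Fa"
proof -
  have "\<exists>Q q. socle_side M \<longrightarrow> cosyzygy M Q q" for M :: "('a, 'u) module"
    using exists_cosyzygy[OF inf] socle_sideD(1) by blast
  then obtain Fo :: "('a, 'u) module \<Rightarrow> ('a, 'u) module" and q
    where "\<And>M. socle_side M \<Longrightarrow> cosyzygy M (Fo M) (q M)" by metis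
  then interpret F: cosyzygy_functor R e f u pr tw K a b Fo q
    by unfold_locales (use inf in auto)
  have U: "Obj U = {M. socle_side M}" "Hom U = rmod_hom R" "\<And>M. Idn U M = restrict (\<lambda>x. x) (carrier M)"
    "\<And>L M N g h. Cmp U L M N g h = compose (carrier L) g h"
    using socle_side_iff[OF _ c] socle_sideD(1) by (auto simp: U_def socle_projective_cat_def)
  have V: "Obj V = {M. top_side M}" "Hom V = rmod_hom R" "\<And>M. Idn V M = restrict (\<lambda>x. x) (carrier M)"
    "\<And>L M N g h. Cmp V L M N g h = compose (carrier L) g h"
    using top_side_iff[OF _ c] top_sideD(1) by (auto simp: V_def injective_top_cat_def)
  have "is_equivalence U V Fo F.Fa"
  proof (rule is_equivalence_if_fully_faithful)
    show "category U" "category V"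
      by (simp_all add: U_def V_def socle_projective_cat_def injective_top_cat_def category_full_subcat_rmod_cat)
    show "is_functor U V Fo F.Fa"
      unfolding is_functor_def U V
      using F.top_side_Fo F.Fa_hom F.Fa_id F.Fa_compose by simp
    fix M M' assume M: "M \<in> Obj U" "M' \<in> Obj U"
    show "h = k" if "h \<in> Hom U M M'" "k \<in> Hom U M M'" "F.Fa M M' h = F.Fa M M' k" for h k
      using F.Fa_faithful that M by (simp add: U)
    show "\<exists>h\<in>Hom U M M'. F.Fa M M' h = g" if "g \<in> Hom V (Fo M) (Fo M')" for g
      using F.Fa_full that M by (simp add: U V)
  next
    fix N assume "N \<in> Obj V"
    then have N: "top_side N" by (simp add: V)
    obtain M h where M: "socle_side M" and h: "h \<in> rmod_hom R (Fo M) N" "bij_betw h (carrier (Fo M)) (carrier N)"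
      using F.Fo_dense[OF N] by blast
    have "iso_arrow V (Fo M) N h"
      unfolding V_def injective_top_cat_def
      by (rule iso_arrow_if_bij[OF F.Fo_module[OF M] top_sideD(1)[OF N] h])
    then show "\<exists>M\<in>Obj U. \<exists>s. iso_arrow V (Fo M) N s" using M by (auto simp: U)
  qed
  moreover have "exact_functor R U Fo F.Fa"
    unfolding exact_functor_def U using F.Fa_exact by blast
  ultimately show ?thesis by blast
qed

section \<open>Incidence algebras\<close>

definition unit_matrix :: "'i \<Rightarrow> 'i \<Rightarrow> 'a::zero \<Rightarrow> 'i \<Rightarrow> 'i \<Rightarrow> 'a" where
  "unit_matrix p r x = (\<lambda>i j. if i = p \<and> j = r then x else 0)"

lemma unit_matrix_apply: "unit_matrix p r x i j = (if i = p \<and> j = r then x else 0)"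
  by (simp add: unit_matrix_def)

text \<open>\<open>xs\<close> witnesses that the idempotent \<open>g tp\<close> generates the unit ideal.\<close>

locale two_sided_system =
  fixes I :: "'i::order set" and g :: "'i \<Rightarrow> 'a::ring_1" and S :: "'i \<Rightarrow> 'i \<Rightarrow> 'a set" and bt tp :: 'i
    and xs :: "('a \<times> 'a) list"
  assumes finite_I [simp]: "finite I" and bt_I [simp]: "bt \<in> I" and tp_I [simp]: "tp \<in> I"
    and bt_le: "i \<in> I \<Longrightarrow> bt \<le> i" and le_tp: "i \<in> I \<Longrightarrow> i \<le> tp"
    and g_S: "i \<in> I \<Longrightarrow> g i \<in> S i i" and g_bt: "g bt = g tp"
    and S_zero: "\<lbrakk>i \<in> I; j \<in> I; i \<le> j\<rbrakk> \<Longrightarrow> 0 \<in> S i j"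
    and S_add: "\<lbrakk>i \<in> I; j \<in> I; i \<le> j; x \<in> S i j; y \<in> S i j\<rbrakk> \<Longrightarrow> x + y \<in> S i j"
    and S_uminus: "\<lbrakk>i \<in> I; j \<in> I; i \<le> j; x \<in> S i j\<rbrakk> \<Longrightarrow> - x \<in> S i j"
    and S_mult: "\<lbrakk>i \<in> I; j \<in> I; l \<in> I; i \<le> j; j \<le> l; x \<in> S i j; y \<in> S j l\<rbrakk> \<Longrightarrow> x * y \<in> S i l"
    and g_left: "\<lbrakk>i \<in> I; j \<in> I; i \<le> j; x \<in> S i j\<rbrakk> \<Longrightarrow> g i * x = x"
    and g_right: "\<lbrakk>i \<in> I; j \<in> I; i \<le> j; x \<in> S i j\<rbrakk> \<Longrightarrow> x * g j = x"
    and S_bt: "j \<in> I \<Longrightarrow> g bt * x * g j \<in> S bt j" and S_tp: "i \<in> I \<Longrightarrow> g i * x * g tp \<in> S i tp"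
    and g_nonzero: "i \<in> I \<Longrightarrow> g i \<noteq> 0"
    and division: "\<lbrakk>i \<in> I; x \<in> S i i; x \<noteq> 0\<rbrakk> \<Longrightarrow> \<exists>y\<in>S i i. x * y = g i"
    and full: "(\<Sum>(x, y)\<leftarrow>xs. x * g tp * y) = 1"
begin

abbreviation "\<Lambda> \<equiv> incidence_algebra I S"

lemma g_idem [simp]: "i \<in> I \<Longrightarrow> g i * g i = g i"
  using g_left g_S by blast

lemma local_unit_eq: "i \<in> I \<Longrightarrow> local_unit S i = g i"
  unfolding local_unit_def
  by (rule the_equality) (use g_S g_left g_right in \<open>auto, metis order_refl\<close>)

lemma \<Lambda>_simps [simp]:
  "mult \<Lambda> = (\<lambda>p r i j. \<Sum>l\<in>I. p i l * r l j)" "zero \<Lambda> = (\<lambda>i j. 0)" "add \<Lambda> = (\<lambda>p r i j. p i j + r i j)"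
  by (simp_all add: incidence_algebra_def)

lemma \<Lambda>_carrier: "p \<in> carrier \<Lambda> \<longleftrightarrow>
   (\<forall>i\<in>I. \<forall>j\<in>I. i \<le> j \<longrightarrow> p i j \<in> S i j) \<and> (\<forall>i j. \<not> (i \<in> I \<and> j \<in> I \<and> i \<le> j) \<longrightarrow> p i j = 0)"
  by (auto simp: incidence_algebra_def)

lemma \<Lambda>_one: "one \<Lambda> = (\<lambda>i j. if i \<in> I \<and> j = i then g i else 0)"
  by (auto simp: incidence_algebra_def local_unit_eq fun_eq_iff)

lemma \<Lambda>_entry: "\<lbrakk>p \<in> carrier \<Lambda>; i \<in> I; j \<in> I; i \<le> j\<rbrakk> \<Longrightarrow> p i j \<in> S i j"
  and \<Lambda>_zero_entry: "\<lbrakk>p \<in> carrier \<Lambda>; \<not> (i \<in> I \<and> j \<in> I \<and> i \<le> j)\<rbrakk> \<Longrightarrow> p i j = 0"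
  by (auto simp: \<Lambda>_carrier)

lemma g_entry: "\<lbrakk>p \<in> carrier \<Lambda>; i \<in> I\<rbrakk> \<Longrightarrow> g i * p i j = p i j"
  and entry_g: "\<lbrakk>p \<in> carrier \<Lambda>; j \<in> I\<rbrakk> \<Longrightarrow> p i j * g j = p i j"
  using \<Lambda>_entry[of p i j] \<Lambda>_zero_entry[of p i j] g_left[of i j] g_right[of i j] by (metis mult_zero_left mult_zero_right)+

lemma S_sum:
  "\<lbrakk>i \<in> I; j \<in> I; i \<le> j; \<And>l. l \<in> L \<Longrightarrow> h l \<in> S i j\<rbrakk> \<Longrightarrow> sum h L \<in> S i j"
  by (induct L rule: infinite_finite_induct) (auto simp: S_zero S_add)

lemma \<Lambda>_mult_closed:
  assumes p: "p \<in> carrier \<Lambda>" and r: "r \<in> carrier \<Lambda>"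
  shows "(\<lambda>i j. \<Sum>l\<in>I. p i l * r l j) \<in> carrier \<Lambda>"
  unfolding \<Lambda>_carrier
proof (intro conjI allI ballI impI)
  fix i j assume ij: "i \<in> I" "j \<in> I" "i \<le> j"
  show "(\<Sum>l\<in>I. p i l * r l j) \<in> S i j"
  proof (rule S_sum[OF ij])
    fix l assume l: "l \<in> I"
    show "p i l * r l j \<in> S i j"
    proof (cases "i \<le> l \<and> l \<le> j")
      case True
      then show ?thesis using S_mult[of i l j] \<Lambda>_entry[OF p] \<Lambda>_entry[OF r] ij l by blast
    next
      case False
      then have "p i l * r l j = 0" using \<Lambda>_zero_entry[OF p, of i l] \<Lambda>_zero_entry[OF r, of l j] by auto
      then show ?thesis using S_zero[OF ij] by simp
    qed
  qed
next
  fix i j assume ij: "\<not> (i \<in> I \<and> j \<in> I \<and> i \<le> j)"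
  have "p i l * r l j = 0" for l
    using ij \<Lambda>_zero_entry[OF p, of i l] \<Lambda>_zero_entry[OF r, of l j] by (metis mult_zero_left mult_zero_right order_trans)
  then show "(\<Sum>l\<in>I. p i l * r l j) = 0" by simp
qed

lemma unit_matrix_closed:
  "\<lbrakk>p \<in> I; r \<in> I; p \<le> r; x \<in> S p r\<rbrakk> \<Longrightarrow> unit_matrix p r x \<in> carrier \<Lambda>"
  by (auto simp: \<Lambda>_carrier unit_matrix_def S_zero)

lemma unit_matrix_mult: "r \<in> I \<Longrightarrow> unit_matrix p r x \<otimes>\<^bsub>\<Lambda>\<^esub> h = (\<lambda>i j. if i = p then x * h r j else 0)"
  by (auto simp: unit_matrix_def fun_eq_iff if_distrib[of "\<lambda>x. x * _"] sum.If_cases cong: if_cong)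

lemma mult_unit_matrix: "p \<in> I \<Longrightarrow> h \<otimes>\<^bsub>\<Lambda>\<^esub> unit_matrix p r x = (\<lambda>i j. if j = r then h i p * x else 0)"
  by (auto simp: unit_matrix_def fun_eq_iff if_distrib[of "\<lambda>x. _ * x"] sum.If_cases cong: if_cong)

lemma unit_unit_mult:
  "r \<in> I \<Longrightarrow> unit_matrix p r x \<otimes>\<^bsub>\<Lambda>\<^esub> unit_matrix r' s y = (if r = r' then unit_matrix p s (x * y) else (\<lambda>i j. 0))"
  unfolding unit_matrix_mult by (auto simp: unit_matrix_def fun_eq_iff)

lemma ring_\<Lambda>: "ring \<Lambda>"
proof (rule ringI)
  show "abelian_group \<Lambda>"
  proof (rule abelian_groupI)
    fix p assume p: "p \<in> carrier \<Lambda>"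
    then have "(\<lambda>i j. - p i j) \<in> carrier \<Lambda>" by (auto simp: \<Lambda>_carrier S_uminus)
    then show "\<exists>r\<in>carrier \<Lambda>. r \<oplus>\<^bsub>\<Lambda>\<^esub> p = \<zero>\<^bsub>\<Lambda>\<^esub>" by (intro bexI[of _ "\<lambda>i j. - p i j"]) auto
  qed (auto simp: \<Lambda>_carrier S_add S_zero add_ac)
  show "monoid \<Lambda>"
  proof (rule monoidI)
    fix p r s assume p: "p \<in> carrier \<Lambda>" and "r \<in> carrier \<Lambda>" "s \<in> carrier \<Lambda>"
    show "p \<otimes>\<^bsub>\<Lambda>\<^esub> r \<otimes>\<^bsub>\<Lambda>\<^esub> s = p \<otimes>\<^bsub>\<Lambda>\<^esub> (r \<otimes>\<^bsub>\<Lambda>\<^esub> s)"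
    proof (intro ext)
      fix i j
      have "(\<Sum>l\<in>I. \<Sum>k\<in>I. p i k * r k l * s l j) = (\<Sum>k\<in>I. \<Sum>l\<in>I. p i k * r k l * s l j)"
        by (rule sum.swap)
      then show "(p \<otimes>\<^bsub>\<Lambda>\<^esub> r \<otimes>\<^bsub>\<Lambda>\<^esub> s) i j = (p \<otimes>\<^bsub>\<Lambda>\<^esub> (r \<otimes>\<^bsub>\<Lambda>\<^esub> s)) i j"
        by (simp add: sum_distrib_left sum_distrib_right mult.assoc)
    qed
  next
    fix p assume p: "p \<in> carrier \<Lambda>"
    show "\<one>\<^bsub>\<Lambda>\<^esub> \<otimes>\<^bsub>\<Lambda>\<^esub> p = p"
    proof (intro ext)
      fix i j
      show "(\<one>\<^bsub>\<Lambda>\<^esub> \<otimes>\<^bsub>\<Lambda>\<^esub> p) i j = p i j"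
        using g_entry[OF p, of i j] \<Lambda>_zero_entry[OF p, of i j]
        by (cases "i \<in> I") (simp_all add: \<Lambda>_one if_distrib[of "\<lambda>x. x * _"] cong: if_cong)
    qed
    show "p \<otimes>\<^bsub>\<Lambda>\<^esub> \<one>\<^bsub>\<Lambda>\<^esub> = p"
    proof (intro ext)
      fix i j
      have "(p \<otimes>\<^bsub>\<Lambda>\<^esub> \<one>\<^bsub>\<Lambda>\<^esub>) i j = (\<Sum>l\<in>I. if l = j then p i j * g j else 0)"
        unfolding \<Lambda>_simps \<Lambda>_one by (rule sum.cong) auto
      then show "(p \<otimes>\<^bsub>\<Lambda>\<^esub> \<one>\<^bsub>\<Lambda>\<^esub>) i j = p i j"
        using entry_g[OF p, of j i] \<Lambda>_zero_entry[OF p, of i j] by (simp add: sum.delta)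
    qed
  next
    show "\<one>\<^bsub>\<Lambda>\<^esub> \<in> carrier \<Lambda>" by (auto simp: \<Lambda>_one \<Lambda>_carrier g_S S_zero)
  qed (simp add: \<Lambda>_mult_closed)
qed (simp_all add: fun_eq_iff distrib_left distrib_right sum.distrib)

lemma finsum_entry:
  assumes "finite A" "\<And>k. k \<in> A \<Longrightarrow> h k \<in> carrier \<Lambda>"
  shows "finsum \<Lambda> h A i j = (\<Sum>k\<in>A. h k i j)"
proof -
  interpret ring \<Lambda> by (rule ring_\<Lambda>)
  show ?thesis using assms by (induct set: finite) (auto simp: Pi_def)
qed

definition "\<alpha> k = fst (xs ! k)"
definition "\<beta> k = snd (xs ! k)"

lemma sum_\<alpha>\<beta>: "(\<Sum>k<length xs. \<alpha> k * g tp * \<beta> k) = 1"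
  using full by (simp add: \<alpha>_def \<beta>_def sum_list_sum_nth case_prod_unfold lessThan_atLeast0)

text \<open>The factors of \<open>1 = \<Sum> \<alpha> k * g tp * \<beta> k\<close>, cut down by
  \<open>g i\<close> and placed in the column of \<open>tp\<close>, respectively (for
  \<open>b\<close>) in the row of \<open>bt\<close>.\<close>

definition "a = (\<lambda>(i, k). unit_matrix i tp (g i * \<alpha> k * g tp))"
definition "b = (\<lambda>(i, k). unit_matrix bt i (g bt * \<beta> k * g i))"

abbreviation "K \<equiv> I \<times> {..<length xs}"

text \<open>Because \<open>g bt = g tp\<close>, such an entry is fixed by \<open>g tp\<close> on
  both sides, and \<open>S tp tp\<close> contains everything of this kind by
  \<open>S_tp\<close>.\<close>

lemma entry_bt_tp: "x \<in> carrier \<Lambda> \<Longrightarrow> x bt tp \<in> S tp tp"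
  using S_tp[of tp "x bt tp"] g_entry[of x bt tp] entry_g[of x tp bt] by (simp add: g_bt)

lemma entry_tp_tp: "x \<in> carrier \<Lambda> \<Longrightarrow> x tp tp \<in> S bt bt"
  using S_bt[of bt "x tp tp"] g_entry[of x tp tp] entry_g[of x tp tp] by (simp add: g_bt)

lemma tp_row: "\<lbrakk>x \<in> carrier \<Lambda>; j \<noteq> tp\<rbrakk> \<Longrightarrow> x tp j = 0"
  using \<Lambda>_zero_entry[of x tp j] le_tp[of j] antisym[of j tp] by blast

lemma bt_col: "\<lbrakk>x \<in> carrier \<Lambda>; i \<noteq> bt\<rbrakk> \<Longrightarrow> x i bt = 0"
  using \<Lambda>_zero_entry[of x i bt] bt_le[of i] antisym[of i bt] by blast

lemma a_mem: "k \<in> K \<Longrightarrow> a k \<in> carrier \<Lambda>"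
  by (auto simp: a_def le_tp S_tp intro!: unit_matrix_closed)

lemma b_mem: "k \<in> K \<Longrightarrow> b k \<in> carrier \<Lambda>"
  by (auto simp: b_def bt_le S_bt intro!: unit_matrix_closed)

lemma g_tp_S: "g tp \<in> S bt tp"
  using S_bt[of tp "g tp"] by (simp add: g_bt)

text \<open>The decomposition of 1 inserted between \<open>g i\<close> and \<open>x\<close>; the two
  halves are joined by \<open>g tp * g bt = g tp\<close>.\<close>

lemma sandwich:
  assumes "i \<in> I" "g i * x = x"
  shows "(\<Sum>k<length xs. g i * \<alpha> k * g tp * (g bt * \<beta> k * g i * x)) = x"
proof -
  have "(\<Sum>k<length xs. g i * \<alpha> k * g tp * (g bt * \<beta> k * g i * x)) = g i * (\<Sum>k<length xs. \<alpha> k * g tp * \<beta> k) * (g i * x)"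
    by (simp add: sum_distrib_left sum_distrib_right g_bt mult.assoc) (simp flip: mult.assoc)
  then show ?thesis using assms by (simp add: sum_\<alpha>\<beta> flip: mult.assoc)
qed

lemma sandwich':
  assumes "i \<in> I" "x * g i = x"
  shows "(\<Sum>k<length xs. x * (g i * \<alpha> k * g tp) * (g bt * \<beta> k * g i)) = x"
proof -
  have "(\<Sum>k<length xs. x * (g i * \<alpha> k * g tp) * (g bt * \<beta> k * g i)) = (x * g i) * (\<Sum>k<length xs. \<alpha> k * g tp * \<beta> k) * g i"
    by (simp add: sum_distrib_left sum_distrib_right g_bt mult.assoc) (simp flip: mult.assoc)
  then show ?thesis using assms by (simp add: sum_\<alpha>\<beta> flip: mult.assoc)
qed

lemma sum_fst_delta:
  assumes "i \<in> I"
  shows "(\<Sum>k\<in>K. if fst k = i then h (snd k) else 0) = (\<Sum>k<length xs. h k :: 'a)"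
proof -
  have "(\<Sum>k\<in>K. if fst k = i then h (snd k) else 0) = (\<Sum>i'\<in>I. \<Sum>k<length xs. if i' = i then h k else 0)"
    by (simp add: sum.cartesian_product case_prod_unfold)
  also have "\<dots> = (\<Sum>i'\<in>I. if i' = i then \<Sum>k<length xs. h k else 0)" by (rule sum.cong) auto
  finally show ?thesis using assms by (simp add: sum.delta)
qed

text \<open>As \<open>g bt = g tp\<close>, the identifications merely move an entry:
  \<open>pr\<close> from \<open>(bt, tp)\<close> to \<open>(tp, tp)\<close>, and \<open>tw\<close>
  from \<open>(tp, tp)\<close> to \<open>(bt, bt)\<close>. The two expansions are
  \<open>sandwich\<close> in every row and \<open>sandwich'\<close> in every column.\<close>

lemma dual_corner_ring_\<Lambda>:
  "dual_corner_ring \<Lambda> (unit_matrix bt bt (g bt)) (unit_matrix tp tp (g tp)) (unit_matrix bt tp (g tp))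
     (\<lambda>x. unit_matrix tp tp (x bt tp)) (\<lambda>x. unit_matrix bt bt (x tp tp)) K a b"
proof (intro dual_corner_ring.intro dual_corner_ring_axioms.intro ring_\<Lambda>)
  let ?e = "unit_matrix bt bt (g bt)" and ?f = "unit_matrix tp tp (g tp)" and ?u = "unit_matrix bt tp (g tp)"
  have le: "bt \<le> tp" using bt_le by simp
  note um = unit_matrix_mult mult_unit_matrix
  show "?e \<in> carrier \<Lambda>" "?f \<in> carrier \<Lambda>" "?u \<in> carrier \<Lambda>"
    using unit_matrix_closed g_S g_tp_S le by auto
  show "?e \<otimes>\<^bsub>\<Lambda>\<^esub> ?e = ?e" "?f \<otimes>\<^bsub>\<Lambda>\<^esub> ?f = ?f" "?e \<otimes>\<^bsub>\<Lambda>\<^esub> ?u = ?u" "?u \<otimes>\<^bsub>\<Lambda>\<^esub> ?f = ?u"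
    by (simp_all add: unit_unit_mult g_bt del: \<Lambda>_simps)
  show "finite K" by simp
  { fix x assume x: "x \<in> carrier \<Lambda>"
    show "?f \<otimes>\<^bsub>\<Lambda>\<^esub> x \<otimes>\<^bsub>\<Lambda>\<^esub> ?f = ?f \<otimes>\<^bsub>\<Lambda>\<^esub> x"
      using x by (auto simp: um fun_eq_iff tp_row g_entry entry_g simp del: \<Lambda>_simps)
    show "?e \<otimes>\<^bsub>\<Lambda>\<^esub> x \<otimes>\<^bsub>\<Lambda>\<^esub> ?e = x \<otimes>\<^bsub>\<Lambda>\<^esub> ?e"
      using x by (auto simp: um fun_eq_iff bt_col g_entry entry_g simp del: \<Lambda>_simps)
    show "unit_matrix tp tp (x bt tp) \<in> carrier \<Lambda>" "unit_matrix bt bt (x tp tp) \<in> carrier \<Lambda>"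
      using x entry_bt_tp entry_tp_tp unit_matrix_closed by auto
    show "?f \<otimes>\<^bsub>\<Lambda>\<^esub> unit_matrix tp tp (x bt tp) = unit_matrix tp tp (x bt tp)"
      using x g_entry[OF x, of bt tp] by (simp add: unit_unit_mult g_bt del: \<Lambda>_simps)
    show "?u \<otimes>\<^bsub>\<Lambda>\<^esub> unit_matrix tp tp (x bt tp) = ?e \<otimes>\<^bsub>\<Lambda>\<^esub> x \<otimes>\<^bsub>\<Lambda>\<^esub> ?f"
      using x g_entry[OF x, of bt tp] entry_g[OF x, of tp bt]
      by (auto simp: um fun_eq_iff unit_matrix_apply g_bt simp del: \<Lambda>_simps)
    show "unit_matrix bt bt (x tp tp) \<otimes>\<^bsub>\<Lambda>\<^esub> ?e = unit_matrix bt bt (x tp tp)"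
      using x entry_g[OF x, of tp tp] by (simp add: unit_unit_mult g_bt del: \<Lambda>_simps)
    { assume f: "?f \<otimes>\<^bsub>\<Lambda>\<^esub> x = x"
      show "unit_matrix bt bt (x tp tp) \<otimes>\<^bsub>\<Lambda>\<^esub> ?u = ?u \<otimes>\<^bsub>\<Lambda>\<^esub> x"
        using x g_entry[OF x, of tp tp] entry_g[OF x, of tp tp]
        by (auto simp: um fun_eq_iff unit_matrix_apply tp_row simp del: \<Lambda>_simps) }
    { fix y assume y: "y \<in> carrier \<Lambda>" and f: "?f \<otimes>\<^bsub>\<Lambda>\<^esub> x = x" "?f \<otimes>\<^bsub>\<Lambda>\<^esub> y = y"
        and eq: "?u \<otimes>\<^bsub>\<Lambda>\<^esub> x = ?u \<otimes>\<^bsub>\<Lambda>\<^esub> y"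
      have "x tp j = y tp j" for j
        using fun_cong[OF fun_cong[OF eq], of bt j] x y by (simp add: um g_entry del: \<Lambda>_simps)
      moreover have "x i j = 0" "y i j = 0" if "i \<noteq> tp" for i j
        using fun_cong[OF fun_cong[OF f(1)], of i j] fun_cong[OF fun_cong[OF f(2)], of i j] that
        by (simp_all add: um del: \<Lambda>_simps)
      ultimately show "x = y" by (intro ext) metis }
    { fix y assume y: "y \<in> carrier \<Lambda>" and e: "x \<otimes>\<^bsub>\<Lambda>\<^esub> ?e = x" "y \<otimes>\<^bsub>\<Lambda>\<^esub> ?e = y"
        and eq: "x \<otimes>\<^bsub>\<Lambda>\<^esub> ?u = y \<otimes>\<^bsub>\<Lambda>\<^esub> ?u"
      have "x i bt = y i bt" for i
        using fun_cong[OF fun_cong[OF eq], of i tp] entry_g[OF x, of bt i] entry_g[OF y, of bt i]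
        by (simp add: um g_bt del: \<Lambda>_simps)
      moreover have "x i j = 0" "y i j = 0" if "j \<noteq> bt" for i j
        using fun_cong[OF fun_cong[OF e(1)], of i j] fun_cong[OF fun_cong[OF e(2)], of i j] that
        by (simp_all add: um del: \<Lambda>_simps)
      ultimately show "x = y" by (intro ext) metis }
  }
  { fix k assume k: "k \<in> K"
    show "a k \<in> carrier \<Lambda>" "b k \<in> carrier \<Lambda>" using a_mem[OF k] b_mem[OF k] by auto
    show "a k \<otimes>\<^bsub>\<Lambda>\<^esub> ?f = a k" "?e \<otimes>\<^bsub>\<Lambda>\<^esub> b k = b k"
      by (auto simp: a_def b_def case_prod_unfold unit_unit_mult mult.assoc simp del: \<Lambda>_simps)
        (simp flip: mult.assoc) }
  interpret ring \<Lambda> by (rule ring_\<Lambda>)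
  { fix c assume c: "c \<in> carrier \<Lambda>" and f: "c \<otimes>\<^bsub>\<Lambda>\<^esub> ?f = c"
    let ?t = "\<lambda>k. a k \<otimes>\<^bsub>\<Lambda>\<^esub> unit_matrix tp tp ((b k \<otimes>\<^bsub>\<Lambda>\<^esub> c) bt tp)"
    have t: "?t k \<in> carrier \<Lambda>" if "k \<in> K" for k
    proof -
      have "b k \<otimes>\<^bsub>\<Lambda>\<^esub> c \<in> carrier \<Lambda>" by (rule m_closed[OF b_mem[OF that] c])
      then have "unit_matrix tp tp ((b k \<otimes>\<^bsub>\<Lambda>\<^esub> c) bt tp) \<in> carrier \<Lambda>"
        by (intro unit_matrix_closed tp_I order_refl entry_bt_tp)
      then show ?thesis by (rule m_closed[OF a_mem[OF that]])
    qed
    show "c = (\<Oplus>\<^bsub>\<Lambda>\<^esub>k\<in>K. ?t k)"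
    proof (intro ext)
      fix i j
      have tk: "?t k i j = (if fst k = i then (if j = tp then g i * \<alpha> (snd k) * g tp * (g bt * \<beta> (snd k) * g i * c i tp) else 0) else 0)"
        if "k \<in> K" for k
        using that by (auto simp: a_def b_def case_prod_unfold unit_unit_mult unit_matrix_mult unit_matrix_apply simp del: \<Lambda>_simps)
      have "(\<Oplus>\<^bsub>\<Lambda>\<^esub>k\<in>K. ?t k) i j = (\<Sum>k\<in>K. ?t k i j)" by (rule finsum_entry[OF _ t]) auto
      also have "\<dots> = (\<Sum>k\<in>K. if fst k = i then (if j = tp then g i * \<alpha> (snd k) * g tp * (g bt * \<beta> (snd k) * g i * c i tp) else 0) else 0)"
        by (rule sum.cong[OF refl tk])
      also have "\<dots> = c i j"
      proof (cases "i \<in> I")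
        case True
        have "(\<Sum>k\<in>K. if fst k = i then (if j = tp then g i * \<alpha> (snd k) * g tp * (g bt * \<beta> (snd k) * g i * c i tp) else 0) else 0)
            = (\<Sum>k<length xs. if j = tp then g i * \<alpha> k * g tp * (g bt * \<beta> k * g i * c i tp) else 0)"
          by (rule sum_fst_delta[OF True])
        also have "\<dots> = (if j = tp then c i tp else 0)"
          using sandwich[OF True g_entry[OF c True, of tp]] by simp
        also have "\<dots> = c i j"
          using fun_cong[OF fun_cong[OF f], of i j]
          by (cases "j = tp") (simp_all add: mult_unit_matrix del: \<Lambda>_simps)
        finally show ?thesis .
      next
        case False
        then show ?thesis using \<Lambda>_zero_entry[OF c, of i j] by (auto intro!: sum.neutral)
      qed
      finally show "c i j = (\<Oplus>\<^bsub>\<Lambda>\<^esub>k\<in>K. ?t k) i j" ..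
    qed }
  { fix x assume x: "x \<in> carrier \<Lambda>" and e: "?e \<otimes>\<^bsub>\<Lambda>\<^esub> x = x"
    let ?t = "\<lambda>k. unit_matrix bt bt (unit_matrix tp tp ((x \<otimes>\<^bsub>\<Lambda>\<^esub> a k) bt tp) tp tp) \<otimes>\<^bsub>\<Lambda>\<^esub> b k"
    have t: "?t k \<in> carrier \<Lambda>" if "k \<in> K" for k
    proof -
      have "x \<otimes>\<^bsub>\<Lambda>\<^esub> a k \<in> carrier \<Lambda>" by (rule m_closed[OF x a_mem[OF that]])
      then have "unit_matrix tp tp ((x \<otimes>\<^bsub>\<Lambda>\<^esub> a k) bt tp) \<in> carrier \<Lambda>"
        by (intro unit_matrix_closed tp_I order_refl entry_bt_tp)
      note unit_matrix_closed[OF bt_I bt_I order_refl entry_tp_tp[OF this]]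
      then show ?thesis by (rule m_closed[OF _ b_mem[OF that]])
    qed
    show "x = (\<Oplus>\<^bsub>\<Lambda>\<^esub>k\<in>K. ?t k)"
    proof (intro ext)
      fix i j
      have tk: "?t k i j = (if fst k = j then (if i = bt then x bt j * (g j * \<alpha> (snd k) * g tp) * (g bt * \<beta> (snd k) * g j) else 0) else 0)"
        if "k \<in> K" for k
        using that by (auto simp: a_def b_def case_prod_unfold unit_unit_mult mult_unit_matrix unit_matrix_apply simp del: \<Lambda>_simps)
      have "(\<Oplus>\<^bsub>\<Lambda>\<^esub>k\<in>K. ?t k) i j = (\<Sum>k\<in>K. ?t k i j)" by (rule finsum_entry[OF _ t]) auto
      also have "\<dots> = (\<Sum>k\<in>K. if fst k = j then (if i = bt then x bt j * (g j * \<alpha> (snd k) * g tp) * (g bt * \<beta> (snd k) * g j) else 0) else 0)"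
        by (rule sum.cong[OF refl tk])
      also have "\<dots> = x i j"
      proof (cases "j \<in> I")
        case True
        have "(\<Sum>k\<in>K. if fst k = j then (if i = bt then x bt j * (g j * \<alpha> (snd k) * g tp) * (g bt * \<beta> (snd k) * g j) else 0) else 0)
            = (\<Sum>k<length xs. if i = bt then x bt j * (g j * \<alpha> k * g tp) * (g bt * \<beta> k * g j) else 0)"
          by (rule sum_fst_delta[OF True])
        also have "\<dots> = (if i = bt then x bt j else 0)"
          using sandwich'[OF True entry_g[OF x True, of bt]] by simp
        also have "\<dots> = x i j"
          using fun_cong[OF fun_cong[OF e], of i j]
          by (cases "i = bt") (simp_all add: unit_matrix_mult del: \<Lambda>_simps)
        finally show ?thesis .
      next
        case False
        then show ?thesis using \<Lambda>_zero_entry[OF x, of i j] by (auto intro!: sum.neutral)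
      qed
      finally show "x i j = (\<Oplus>\<^bsub>\<Lambda>\<^esub>k\<in>K. ?t k) i j" ..
    qed }
qed

lemma socle_top_ring_\<Lambda>:
  "socle_top_ring \<Lambda> (unit_matrix bt bt (g bt)) (unit_matrix tp tp (g tp)) (unit_matrix bt tp (g tp))
     (\<lambda>x. unit_matrix tp tp (x bt tp)) (\<lambda>x. unit_matrix bt bt (x tp tp)) K a b I (\<lambda>i. unit_matrix i i (g i)) bt tp"
proof (intro socle_top_ring.intro dual_corner_ring_\<Lambda> poset_idempotents.intro ring_\<Lambda>
    poset_idempotents_axioms.intro socle_top_ring_axioms.intro)
  interpret ring \<Lambda> by (rule ring_\<Lambda>)
  let ?\<epsilon> = "\<lambda>i. unit_matrix i i (g i)"
  have \<epsilon>c: "?\<epsilon> i \<in> carrier \<Lambda>" if "i \<in> I" for i using that unit_matrix_closed g_S by auto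
  note um = unit_matrix_mult mult_unit_matrix
  have nz: "unit_matrix i j x \<noteq> \<zero>\<^bsub>\<Lambda>\<^esub>" if "x \<noteq> 0" for i j x
    using that by (auto simp: unit_matrix_apply fun_eq_iff)
  show "finite I" "bt \<in> I" "tp \<in> I" "?\<epsilon> bt = ?\<epsilon> bt" "?\<epsilon> tp = ?\<epsilon> tp" by simp_all
  show "(\<Oplus>\<^bsub>\<Lambda>\<^esub>i\<in>I. ?\<epsilon> i) = \<one>\<^bsub>\<Lambda>\<^esub>"
  proof (intro ext)
    fix i j
    have "(\<Oplus>\<^bsub>\<Lambda>\<^esub>i\<in>I. ?\<epsilon> i) i j = (\<Sum>k\<in>I. ?\<epsilon> k i j)" by (rule finsum_entry[OF _ \<epsilon>c]) auto
    also have "\<dots> = (\<Sum>k\<in>I. if k = i then (if j = i then g i else 0) else 0)"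
      by (rule sum.cong) (auto simp: unit_matrix_apply)
    finally show "(\<Oplus>\<^bsub>\<Lambda>\<^esub>i\<in>I. ?\<epsilon> i) i j = \<one>\<^bsub>\<Lambda>\<^esub> i j" by (auto simp: \<Lambda>_one sum.delta)
  qed
  fix i assume i: "i \<in> I"
  show "?\<epsilon> i \<in> carrier \<Lambda>" by (rule \<epsilon>c[OF i])
  show "?\<epsilon> i \<otimes>\<^bsub>\<Lambda>\<^esub> ?\<epsilon> i = ?\<epsilon> i" using i by (simp add: unit_unit_mult del: \<Lambda>_simps)
  show "?\<epsilon> i \<noteq> \<zero>\<^bsub>\<Lambda>\<^esub>" by (rule nz[OF g_nonzero[OF i]])
  { fix j assume j: "j \<in> I"
    show "?\<epsilon> i \<otimes>\<^bsub>\<Lambda>\<^esub> ?\<epsilon> j = \<zero>\<^bsub>\<Lambda>\<^esub>" if "i \<noteq> j"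
      using that by (simp add: unit_unit_mult[OF i] del: \<Lambda>_simps(1,3))
    show "?\<epsilon> i \<otimes>\<^bsub>\<Lambda>\<^esub> x \<otimes>\<^bsub>\<Lambda>\<^esub> ?\<epsilon> j = \<zero>\<^bsub>\<Lambda>\<^esub>" if "x \<in> carrier \<Lambda>" "\<not> i \<le> j" for x
      using that i j \<Lambda>_zero_entry[OF that(1), of i j] unfolding um[OF i] um[OF j] by (auto simp: fun_eq_iff) }
  { fix d assume d: "d \<in> carrier (corner (?\<epsilon> i))" "d \<noteq> \<zero>\<^bsub>\<Lambda>\<^esub>"
    then have dR: "d \<in> carrier \<Lambda>" and d1: "?\<epsilon> i \<otimes>\<^bsub>\<Lambda>\<^esub> d = d" and d2: "d \<otimes>\<^bsub>\<Lambda>\<^esub> ?\<epsilon> i = d" by auto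
    have eq: "d = unit_matrix i i (d i i)"
    proof (intro ext)
      fix j k
      show "d j k = unit_matrix i i (d i i) j k"
        using fun_cong[OF fun_cong[OF d1], of j k] fun_cong[OF fun_cong[OF d2], of j k]
        unfolding um[OF i] by (auto simp: unit_matrix_apply split: if_splits)
    qed
    have dS: "d i i \<in> S i i" using \<Lambda>_entry[OF dR i i] by simp
    have "d i i \<noteq> 0"
    proof
      assume z: "d i i = 0"
      have "d j k = 0" for j k
        using fun_cong[OF fun_cong[OF eq], of j k] z by (simp add: unit_matrix_apply)
      then show False using d(2) by (simp add: fun_eq_iff)
    qed
    then obtain y where y: "y \<in> S i i" "d i i * y = g i" using division[OF i dS] by blast
    have "unit_matrix i i y \<in> carrier (corner (?\<epsilon> i))"
      using i y unit_matrix_closed[OF i i _ y(1)] g_left[OF i i _ y(1)] g_right[OF i i _ y(1)]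
      by (simp add: unit_unit_mult del: \<Lambda>_simps)
    moreover have "d \<otimes>\<^bsub>\<Lambda>\<^esub> unit_matrix i i y = ?\<epsilon> i"
      by (subst eq) (simp add: unit_unit_mult[OF i] y(2) del: \<Lambda>_simps)
    ultimately show "\<exists>d'\<in>carrier (corner (?\<epsilon> i)). d \<otimes>\<^bsub>\<Lambda>\<^esub> d' = ?\<epsilon> i" by blast }
  \<comment> \<open>Otherwise every term of \<open>sandwich\<close> for \<open>x = g i\<close> would
    vanish, and with it \<open>g i\<close>. The same argument yields the nonzero factor on the side
    of \<open>bt\<close> further below.\<close>
  have "\<exists>k<length xs. g i * \<alpha> k * g tp \<noteq> 0"
  proof (rule ccontr)
    assume "\<not> ?thesis"
    then have "(\<Sum>k<length xs. g i * \<alpha> k * g tp * (g bt * \<beta> k * g i * g i)) = 0" by (intro sum.neutral) auto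
    then show False using sandwich[OF i, of "g i"] g_nonzero[OF i] i by simp
  qed
  then obtain k where k: "g i * \<alpha> k * g tp \<noteq> 0" by blast
  show "\<exists>x\<in>carrier \<Lambda>. ?\<epsilon> i \<otimes>\<^bsub>\<Lambda>\<^esub> x \<otimes>\<^bsub>\<Lambda>\<^esub> unit_matrix tp tp (g tp) \<noteq> \<zero>\<^bsub>\<Lambda>\<^esub>"
  proof (rule bexI)
    show c: "unit_matrix i tp (g i * \<alpha> k * g tp) \<in> carrier \<Lambda>"
      using unit_matrix_closed[OF i tp_I le_tp[OF i] S_tp[OF i]] .
    have "?\<epsilon> i \<otimes>\<^bsub>\<Lambda>\<^esub> unit_matrix i tp (g i * \<alpha> k * g tp) \<otimes>\<^bsub>\<Lambda>\<^esub> unit_matrix tp tp (g tp) = unit_matrix i tp (g i * \<alpha> k * g tp)"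
      using i by (simp add: unit_unit_mult mult.assoc del: \<Lambda>_simps) (simp flip: mult.assoc)
    then show "?\<epsilon> i \<otimes>\<^bsub>\<Lambda>\<^esub> unit_matrix i tp (g i * \<alpha> k * g tp) \<otimes>\<^bsub>\<Lambda>\<^esub> unit_matrix tp tp (g tp) \<noteq> \<zero>\<^bsub>\<Lambda>\<^esub>"
      using nz[OF k] by (simp only: not_False_eq_True)
  qed
  have "\<exists>k<length xs. g bt * \<beta> k * g i \<noteq> 0"
  proof (rule ccontr)
    assume "\<not> ?thesis"
    then have "(\<Sum>k<length xs. g i * \<alpha> k * g tp * (g bt * \<beta> k * g i * g i)) = 0" by (intro sum.neutral) auto
    then show False using sandwich[OF i, of "g i"] g_nonzero[OF i] i by simp
  qed
  then obtain l where l: "g bt * \<beta> l * g i \<noteq> 0" by blast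
  show "\<exists>x\<in>carrier \<Lambda>. unit_matrix bt bt (g bt) \<otimes>\<^bsub>\<Lambda>\<^esub> x \<otimes>\<^bsub>\<Lambda>\<^esub> ?\<epsilon> i \<noteq> \<zero>\<^bsub>\<Lambda>\<^esub>"
  proof (rule bexI)
    show c: "unit_matrix bt i (g bt * \<beta> l * g i) \<in> carrier \<Lambda>"
      using unit_matrix_closed[OF bt_I i bt_le[OF i] S_bt[OF i]] .
    have "unit_matrix bt bt (g bt) \<otimes>\<^bsub>\<Lambda>\<^esub> unit_matrix bt i (g bt * \<beta> l * g i) \<otimes>\<^bsub>\<Lambda>\<^esub> ?\<epsilon> i = unit_matrix bt i (g bt * \<beta> l * g i)"
      using i by (simp add: unit_unit_mult mult.assoc del: \<Lambda>_simps) (simp flip: mult.assoc)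
    then show "unit_matrix bt bt (g bt) \<otimes>\<^bsub>\<Lambda>\<^esub> unit_matrix bt i (g bt * \<beta> l * g i) \<otimes>\<^bsub>\<Lambda>\<^esub> ?\<epsilon> i \<noteq> \<zero>\<^bsub>\<Lambda>\<^esub>"
      using nz[OF l] by (simp only: not_False_eq_True)
  qed
qed

text \<open>A matrix in the algebra is a finite family of entries, each of which is coded by
  \<open>\<iota>\<close>; outside \<open>I \<times> I\<close> all entries are zero.\<close>

lemma exists_code:
  fixes \<iota> :: "'a \<Rightarrow> 'u"
  assumes inf: "infinite (UNIV :: 'u set)" and \<iota>: "inj \<iota>"
  shows "\<exists>c :: ('i \<Rightarrow> 'i \<Rightarrow> 'a) \<Rightarrow> 'u. inj_on c (carrier \<Lambda>)"
proof -
  obtain c :: "('i \<times> 'i \<Rightarrow> 'u) \<Rightarrow> 'u" where c: "inj_on c (I \<times> I \<rightarrow>\<^sub>E UNIV)"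
    using exists_inj_PiE[OF inf, of "I \<times> I"] by auto
  have "inj_on (\<lambda>p. c (restrict (\<lambda>(i, j). \<iota> (p i j)) (I \<times> I))) (carrier \<Lambda>)"
  proof (rule inj_onI)
    fix p r assume p: "p \<in> carrier \<Lambda>" and r: "r \<in> carrier \<Lambda>"
      and "c (restrict (\<lambda>(i, j). \<iota> (p i j)) (I \<times> I)) = c (restrict (\<lambda>(i, j). \<iota> (r i j)) (I \<times> I))"
    then have eq: "restrict (\<lambda>(i, j). \<iota> (p i j)) (I \<times> I) = restrict (\<lambda>(i, j). \<iota> (r i j)) (I \<times> I)"
      using inj_onD[OF c] by simp
    show "p = r"
    proof (intro ext)
      fix i j
      show "p i j = r i j"
        using fun_cong[OF eq, of "(i, j)"] \<Lambda>_zero_entry[OF p, of i j] \<Lambda>_zero_entry[OF r, of i j] injD[OF \<iota>]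
        by (cases "i \<in> I \<and> j \<in> I") auto
    qed
  qed
  then show ?thesis by blast
qed

end

section \<open>Fullness of the idempotent belonging to the simple module\<close>

lemma ring_type_ring: "ring (type_ring :: 'a::ring_1 ring)"
  by (intro ringI abelian_groupI monoidI)
    (auto simp: type_ring_def algebra_simps intro: exI[of _ "- _"] left_minus)

lemma type_ring_simps [simp]:
  "carrier type_ring = UNIV" "mult type_ring = (*)" "one type_ring = 1" "zero type_ring = 0" "add type_ring = (+)"
  by (simp_all add: type_ring_def)

text \<open>Uniqueness of the simple module is known for modules on \<open>'u\<close>, whereas
  simple right ideals of the algebra live on \<open>'a\<close>; simplicity has to survive the
  copying.\<close>

lemma simple_rmod_if_bij:
  fixes M :: "('r, 'm) module" and Q :: "('r, 'q) module"
  assumes M: "simple_rmod R M" and Q: "right_module R Q" and q: "q \<in> rmod_hom R M Q"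
    and bij: "bij_betw q (carrier M) (carrier Q)"
  shows "simple_rmod R Q"
proof -
  have MR: "right_module R M" using M by (simp add: simple_rmod_def)
  interpret q: rmod_homomorphism R M Q q
    by (intro rmod_homomorphism.intro rmod_homomorphism_axioms.intro MR Q q)
  note inj = bij_betw_imp_inj_on[OF bij] and surj = bij_betw_imp_surj_on[OF bij]
  obtain x where x: "x \<in> carrier M" "x \<noteq> \<zero>\<^bsub>M\<^esub>" using M q.M.M.zero_closed by (auto simp: simple_rmod_def)
  then have "q x \<noteq> \<zero>\<^bsub>Q\<^esub>" using inj_onD[OF inj, of x "\<zero>\<^bsub>M\<^esub>"] by auto
  then have ne: "carrier Q \<noteq> {\<zero>\<^bsub>Q\<^esub>}" using q.closed[OF x(1)] by blast
  have "L = {\<zero>\<^bsub>Q\<^esub>} \<or> L = carrier Q" if L: "submodule L R Q" for L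
  proof -
    let ?L = "{x \<in> carrier M. q x \<in> L}"
    have L_eq: "L = q ` ?L" using surj q.N.submodule_subset[OF L] by (auto simp del: q.closed)
    have "?L = {\<zero>\<^bsub>M\<^esub>} \<or> ?L = carrier M"
      using M q.preimage_submodule[OF L] by (simp add: simple_rmod_def)
    then show ?thesis
    proof
      assume "?L = {\<zero>\<^bsub>M\<^esub>}"
      then have "L = q ` {\<zero>\<^bsub>M\<^esub>}" using L_eq by (simp only:)
      then show ?thesis by simp
    next
      assume "?L = carrier M"
      then have "L = q ` carrier M" using L_eq by (simp only:)
      then show ?thesis using surj by simp
    qed
  qed
  then show ?thesis unfolding simple_rmod_def using Q ne by blast
qed

text \<open>In a semisimple ring the two-sided ideal of an idempotent \<open>d\<close> contains every simple right ideal
  isomorphic to \<open>dA\<close>.\<close>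

lemma full_idempotent:
  fixes d :: "'a::ring_1" and \<iota> :: "'a \<Rightarrow> 'u"
  assumes ss: "semisimple_ring (type_ring :: 'a ring)" and d: "d * d = d" and \<iota>: "inj \<iota>"
    and simple: "\<And>S :: ('a, 'u) module. simple_rmod (type_ring :: 'a ring) S \<Longrightarrow>
        rmod_iso (type_ring :: 'a ring) S (principal_rmod type_ring d)"
  shows "\<exists>xs :: ('a \<times> 'a) list. (\<Sum>(x, y)\<leftarrow>xs. x * d * y) = 1"
proof -
  let ?A = "type_ring :: 'a ring"
  interpret A: ring ?A by (rule ring_type_ring)
  let ?M = "regular_rmod ?A"
  have M: "right_module ?A ?M" by (rule regular_right_module[OF ring_type_ring])
  interpret M: right_module ?A ?M by (rule M)
  \<comment> \<open>The two-sided ideal generated by \<open>d\<close>, with finite sums represented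
    by lists of factors.\<close>
  define J where "J = range (\<lambda>xs :: ('a \<times> 'a) list. \<Sum>(x, y)\<leftarrow>xs. x * d * y)"
  have JI: "(\<Sum>(x, y)\<leftarrow>xs. x * d * y) \<in> J" for xs unfolding J_def by (rule rangeI)
  have J: "submodule J ?A ?M"
    unfolding M.submodule_iff
  proof (intro conjI ballI)
    show "\<zero>\<^bsub>?M\<^esub> \<in> J" using JI[of "[]"] by simp
    fix v assume "v \<in> J"
    then obtain xs where v: "v = (\<Sum>(x, y)\<leftarrow>xs. x * d * y)" unfolding J_def by blast
    { fix w assume "w \<in> J"
      then obtain ys where w: "w = (\<Sum>(x, y)\<leftarrow>ys. x * d * y)" unfolding J_def by blast
      show "v \<oplus>\<^bsub>?M\<^esub> w \<in> J" using JI[of "xs @ ys"] by (simp add: v w) }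
    { fix r
      have "v * r = (\<Sum>(x, y)\<leftarrow>map (\<lambda>(x, y). (x, y * r)) xs. x * d * y)"
        unfolding v by (induction xs) (auto simp: distrib_right mult.assoc)
      then have "v * r \<in> J" by (simp only: JI)
      then show "r \<odot>\<^bsub>?M\<^esub> v \<in> J" by simp }
  qed simp
  have "S \<subseteq> J" if S: "submodule S ?A ?M" and Ss: "simple_rmod ?A (?M\<lparr>carrier := S\<rparr>)" for S
  proof
    fix x assume x: "x \<in> S"
    let ?S = "?M\<lparr>carrier := S\<rparr>" and ?P = "principal_rmod ?A d"
    have SR: "right_module ?A ?S" by (rule M.submodule_right_module[OF S])
    interpret S: right_module ?A ?S by (rule SR)
    obtain Q :: "('a, 'u) module" and q where Q: "right_module ?A Q" and q: "q \<in> rmod_hom ?A ?S Q"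
      and qb: "bij_betw q (carrier ?S) (carrier Q)"
      using S.exists_copy[of \<iota>] inj_on_subset[OF \<iota>] by blast
    obtain p where p: "p \<in> rmod_hom ?A Q ?P" and pb: "bij_betw p (carrier Q) (carrier ?P)"
      using simple[OF simple_rmod_if_bij[OF Ss Q q qb]] unfolding rmod_iso_def by blast
    define h where "h = compose (carrier ?S) p q"
    have h: "h \<in> rmod_hom ?A ?S ?P" unfolding h_def by (rule rmod_hom_compose[OF SR q p])
    have hb: "bij_betw h (carrier ?S) (carrier ?P)" unfolding h_def by (rule bij_betw_compose[OF qb pb])
    have hr: "h (s * r) = h s * r" if "s \<in> S" for s r using rmod_homD(3)[OF h, of r s] that by simp
    have dP: "d \<in> carrier ?P" using A.principal_carrier[of d] d by simp
    then have "d \<in> h ` S" using hb by (simp add: bij_betw_def)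
    then obtain s where s: "s \<in> S" "h s = d" by blast
    have closed: "s * r \<in> S" for r using M.submodule_smult[OF S _ s(1), of r] by simp
    have inj: "v = w" if "v \<in> S" "w \<in> S" "h v = h w" for v w
      using inj_onD[OF bij_betw_imp_inj_on[OF hb], of v w] that by simp
    have "h x \<in> carrier ?P" using rmod_homD(1)[OF h, of x] x by simp
    then have "d * h x = h x" using A.principal_carrier[of d] d by simp
    \<comment> \<open>\<open>h\<close> sends \<open>s * (d * h x)\<close> to
      \<open>d * (d * h x) = h x\<close>, so by injectivity every \<open>x\<close> in
      \<open>S\<close> has the form \<open>s * d * h x\<close>.\<close>
    then have "s * (d * h x) = x" using inj[OF closed x] hr[OF s(1)] s(2) by simp
    moreover have "s * (d * h x) \<in> J" using JI[of "[(s, h x)]"] by (simp add: mult.assoc)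
    ultimately show "x \<in> J" by metis
  qed
  then have "socle ?A ?M \<subseteq> J" by (rule socle_least[OF J])
  then have "1 \<in> J" using ss by (auto simp: semisimple_ring_def)
  then obtain xs where "1 = (\<Sum>(x, y)\<leftarrow>xs. x * d * y)" unfolding J_def by (rule rangeE)
  from this[symmetric] show ?thesis by (rule exI)
qed

lemma local_unit_corner_system:
  assumes "\<gamma> i \<in> X i i" "\<gamma> i * \<gamma> i = \<gamma> i"
  shows "local_unit (corner_system \<gamma> X) i = \<gamma> i"
  unfolding local_unit_def
proof (rule the_equality)
  have mem: "\<gamma> i \<in> corner_system \<gamma> X i i"
    unfolding corner_system_def using assms by (intro image_eqI[of _ _ "\<gamma> i"]) simp_all
  have unit: "\<gamma> i * r = r \<and> r * \<gamma> i = r" if "r \<in> corner_system \<gamma> X i i" for r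
    using that assms(2) by (auto simp: corner_system_def mult.assoc) (simp flip: mult.assoc)
  show "\<gamma> i \<in> corner_system \<gamma> X i i \<and> (\<forall>r\<in>corner_system \<gamma> X i i. \<gamma> i * r = r \<and> r * \<gamma> i = r)"
    using mem unit by blast
  fix v assume v: "v \<in> corner_system \<gamma> X i i \<and> (\<forall>r\<in>corner_system \<gamma> X i i. v * r = r \<and> r * v = r)"
  then have "v * \<gamma> i = \<gamma> i" using mem by blast
  then show "v = \<gamma> i" using unit[of v] v by simp
qed

lemma extend_system_UNIV: "i = Minf \<or> i = Pinf \<or> j = Minf \<or> j = Pinf \<Longrightarrow> extend_system T i j = UNIV"
  by (cases i; cases j) auto

lemma add_top_bot_cases:
  assumes "i \<in> add_top_bot P" obtains "i = Minf" | "i = Pinf" | p where "p \<in> P" "i = Fin p"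
  using assms by (auto simp: add_top_bot_def add_top_def)

text \<open>A position involving a new index carries the whole algebra, so closure is trivial or
  inherited from \<open>T\<close>. For products, old indices \<open>i\<close> and \<open>l\<close>
  force any \<open>j\<close> between them to be old.\<close>

lemma extend_system_closed:
  fixes scale :: "'k::field \<Rightarrow> 'a::ring_1 \<Rightarrow> 'a" and P :: "'p::order set"
  assumes sc: "vector_space scale" and T: "mult_system scale P T"
    and i: "i \<in> add_top_bot P" and j: "j \<in> add_top_bot P" and le: "i \<le> j"
  shows "0 \<in> extend_system T i j"
    and "\<And>x y. \<lbrakk>x \<in> extend_system T i j; y \<in> extend_system T i j\<rbrakk> \<Longrightarrow> x + y \<in> extend_system T i j"
    and "\<And>x. x \<in> extend_system T i j \<Longrightarrow> - x \<in> extend_system T i j"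
    and "\<And>l x y. \<lbrakk>l \<in> add_top_bot P; j \<le> l; x \<in> extend_system T i j; y \<in> extend_system T j l\<rbrakk> \<Longrightarrow>
           x * y \<in> extend_system T i l"
proof -
  interpret vector_space scale by (rule sc)
  have sub: "subspace (T p r)" if "p \<in> P" "r \<in> P" "p \<le> r" for p r
    using that T by (simp add: mult_system_def)
  have *: "extend_system T i j = UNIV \<or> subspace (extend_system T i j)"
    by (rule add_top_bot_cases[OF i]; rule add_top_bot_cases[OF j]) (use sub le in \<open>auto simp: extend_system_UNIV\<close>)
  then show "0 \<in> extend_system T i j"
    and "\<And>x y. \<lbrakk>x \<in> extend_system T i j; y \<in> extend_system T i j\<rbrakk> \<Longrightarrow> x + y \<in> extend_system T i j"
    and "\<And>x. x \<in> extend_system T i j \<Longrightarrow> - x \<in> extend_system T i j"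
    using subspace_0 subspace_add subspace_neg by auto
  fix l x y assume l: "l \<in> add_top_bot P" "j \<le> l" and xy: "x \<in> extend_system T i j" "y \<in> extend_system T j l"
  show "x * y \<in> extend_system T i l"
    by (rule add_top_bot_cases[OF i]; rule add_top_bot_cases[OF j]; rule add_top_bot_cases[OF l(1)])
      (use T l xy le in \<open>auto simp: extend_system_UNIV mult_system_def\<close>)
qed

theorem proposition31:
  fixes scale :: "'k::field \<Rightarrow> 'a::ring_1 \<Rightarrow> 'a"
    and P :: "'p::order set"
    and T :: "'p \<Rightarrow> 'p \<Rightarrow> 'a set"
    and \<epsilon> :: "'p extended \<Rightarrow> 'a"
    and \<R> :: "'p extended \<Rightarrow> 'p extended \<Rightarrow> 'a set"
    and \<Lambda> :: "('p extended \<Rightarrow> 'p extended \<Rightarrow> 'a) ring"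
    and \<U> \<V> :: "(('p extended \<Rightarrow> 'p extended \<Rightarrow> 'a, 'u) module, 'u \<Rightarrow> 'u) cat"
  assumes universe: "infinite (UNIV :: 'u set)" "\<exists>\<iota> :: 'a \<Rightarrow> 'u. inj \<iota>"
    and "fin_dim_algebra scale"
    and "finite P"
    and "extendable TYPE('u) scale P T \<epsilon>"
  defines "\<R> \<equiv> extended_admissible_system T \<epsilon>"
    and "\<Lambda> \<equiv> incidence_algebra (add_top_bot P) \<R>"
    and "\<U> \<equiv> socle_projective_cat \<Lambda> (diag_idempotent \<R> Minf)"
    and "\<V> \<equiv> injective_top_cat \<Lambda> (diag_idempotent \<R> Minf)"
  shows "\<exists>Fo Fa. is_equivalence \<U> \<V> Fo Fa \<and> exact_functor \<Lambda> \<U> Fo Fa"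
proof -
  obtain \<iota> :: "'a \<Rightarrow> 'u" where \<iota>: "inj \<iota>" using universe(2) by blast
  have sc: "vector_space scale"
    using assms(3) by (simp add: fin_dim_algebra_def)
  have T: "mult_system scale P T" and ss: "semisimple_ring (type_ring :: 'a ring)"
    and simple: "\<And>S :: ('a, 'u) module. simple_rmod (type_ring :: 'a ring) S \<Longrightarrow>
        rmod_iso (type_ring :: 'a ring) S (principal_rmod type_ring (\<epsilon> Pinf))"
    and idem: "\<And>i. i \<in> add_top P \<Longrightarrow> \<epsilon> i \<in> extend_system T i i \<and> \<epsilon> i * \<epsilon> i = \<epsilon> i"
    and adm: "admissible scale (add_top P) Pinf (corner_system \<epsilon> (extend_system T))"
    using assms(5) by (auto simp: extendable_def)
  let ?g = "\<epsilon>(Minf := \<epsilon> Pinf)" and ?X = "extend_system T" and ?I = "add_top_bot P"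
  have PinfI: "Pinf \<in> add_top P" by (simp add: add_top_def)
  obtain xs :: "('a \<times> 'a) list" where xs: "(\<Sum>(x, y)\<leftarrow>xs. x * \<epsilon> Pinf * y) = 1"
    using full_idempotent[OF ss _ \<iota> simple] idem[OF PinfI] by blast
  have R: "\<R> i j = (\<lambda>t. ?g i * t * ?g j) ` ?X i j" for i j
    by (simp add: \<R>_def extended_admissible_system_def corner_system_def)
  note cl = extend_system_closed[OF sc T]
  have gX: "?g i \<in> ?X i i" and gg: "?g i * ?g i = ?g i" if "i \<in> ?I" for i
    using that idem[of i] idem[OF PinfI] by (auto simp: add_top_bot_def)
  have corner: "local_unit (corner_system \<epsilon> ?X) i \<noteq> 0 \<and> (\<forall>x\<in>corner_system \<epsilon> ?X i i. x \<noteq> 0 \<longrightarrow>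
      (\<exists>y\<in>corner_system \<epsilon> ?X i i. x * y = local_unit (corner_system \<epsilon> ?X) i))" if "i \<in> add_top P" for i
    using adm that unfolding admissible_def by blast
  have corner': "\<epsilon> i \<noteq> 0 \<and> (\<forall>x\<in>corner_system \<epsilon> ?X i i. x \<noteq> 0 \<longrightarrow> (\<exists>y\<in>corner_system \<epsilon> ?X i i. x * y = \<epsilon> i))"
    if "i \<in> add_top P" for i
    using corner[OF that] local_unit_corner_system[of \<epsilon> i ?X] idem[OF that] by simp
  have div: "?g i \<noteq> 0 \<and> (\<forall>x\<in>\<R> i i. x \<noteq> 0 \<longrightarrow> (\<exists>y\<in>\<R> i i. x * y = ?g i))" if i: "i \<in> ?I" for i
  proof (cases "i = Minf")
    case True
    \<comment> \<open>The corner at the new least index is that at the greatest one: same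
      idempotent, same full algebra. So it inherits the division property.\<close>
    have "\<R> Minf Minf = corner_system \<epsilon> ?X Pinf Pinf" by (simp add: R corner_system_def)
    then show ?thesis using corner'[OF PinfI] True by simp
  next
    case False
    then have "i \<in> add_top P" "\<R> i i = corner_system \<epsilon> ?X i i"
      using i by (auto simp: add_top_bot_def R corner_system_def)
    then show ?thesis using corner'[of i] False by simp
  qed
  have left: "?g i * (?g i * t) = ?g i * t" and right: "t * ?g i * ?g i = t * ?g i" if "i \<in> ?I" for i t
    using gg[OF that] by (simp_all only: mult.assoc[symmetric]) (simp only: mult.assoc)
  interpret two_sided_system ?I ?g \<R> Minf Pinf xs
  proof
    show "finite ?I" using assms(4) by (simp add: add_top_bot_def add_top_def)
    show "Minf \<in> ?I" "Pinf \<in> ?I" by (auto simp: add_top_bot_def add_top_def)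
    show "Minf \<le> i" "i \<le> Pinf" for i :: "'p extended" by simp_all
    show "?g Minf = ?g Pinf" by simp
    show "(\<Sum>(x, y)\<leftarrow>xs. x * ?g Pinf * y) = 1" using xs by simp
    fix i assume i: "i \<in> ?I"
    show "?g i \<in> \<R> i i" unfolding R by (rule image_eqI[OF _ gX[OF i]]) (simp only: gg[OF i])
    show "?g i \<noteq> 0" using div[OF i] by blast
    show "\<exists>y\<in>\<R> i i. x * y = ?g i" if "x \<in> \<R> i i" "x \<noteq> 0" for x using div[OF i] that by blast
    show "?g Minf * x * ?g i \<in> \<R> Minf i" for x unfolding R by (rule imageI) (simp add: extend_system_UNIV)
    show "?g i * x * ?g Pinf \<in> \<R> i Pinf" for x unfolding R by (rule imageI) (simp add: extend_system_UNIV)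
    fix j assume j: "j \<in> ?I" and ij: "i \<le> j"
    note c = cl[OF i j ij]
    show "0 \<in> \<R> i j" unfolding R by (rule image_eqI[OF _ c(1)]) simp
    { fix x assume "x \<in> \<R> i j"
      then obtain s where s: "s \<in> ?X i j" "x = ?g i * s * ?g j" unfolding R by blast
      show "- x \<in> \<R> i j" unfolding R by (rule image_eqI[OF _ c(3)[OF s(1)]]) (simp only: s(2) mult_minus_left mult_minus_right)
      show "?g i * x = x" unfolding s(2) mult.assoc by (rule left[OF i])
      show "x * ?g j = x" unfolding s(2) by (rule right[OF j])
      { fix y assume "y \<in> \<R> i j"
        then obtain t where t: "t \<in> ?X i j" "y = ?g i * t * ?g j" unfolding R by blast
        show "x + y \<in> \<R> i j" unfolding R
          by (rule image_eqI[OF _ c(2)[OF s(1) t(1)]]) (simp only: s(2) t(2) distrib_left distrib_right) }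
      fix l y assume l: "l \<in> ?I" and jl: "j \<le> l" and "y \<in> \<R> j l"
      then obtain t where t: "t \<in> ?X j l" "y = ?g j * t * ?g l" unfolding R by blast
      \<comment> \<open>The idempotent in the middle belongs to the system at \<open>j\<close>, so
        the product of the two uncut coefficients still lies in the uncut system.\<close>
      have "s * ?g j \<in> ?X i j" using c(4)[OF j order_refl s(1) gX[OF j]] .
      then have "s * ?g j * t \<in> ?X i l" using c(4)[OF l jl _ t(1)] by blast
      moreover have "x * y = ?g i * (s * ?g j * t) * ?g l"
        unfolding s(2) t(2) by (simp only: mult.assoc left[OF j])
      ultimately show "x * y \<in> \<R> i l" unfolding R by (rule image_eqI[rotated])
    }
  qed
  obtain c where c: "inj_on (c :: _ \<Rightarrow> 'u) (carrier \<Lambda>)"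
    using exists_code[OF universe(1) \<iota>] unfolding \<Lambda>_def by blast
  \<comment> \<open>Makes the summand excluded in \<open>\<U>\<close> and \<open>\<V>\<close> the
    module \<open>eR\<close> of the abstract development.\<close>
  have e: "diag_idempotent \<R> Minf = unit_matrix Minf Minf (?g Minf)"
    using local_unit_eq[OF bt_I] by (auto simp: diag_idempotent_def unit_matrix_def fun_eq_iff)
  show ?thesis
    using socle_top_ring.cosyzygy_equivalence[OF socle_top_ring_\<Lambda> universe(1), of c] c
    unfolding \<U>_def \<V>_def e \<Lambda>_def by blast
qed

end
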